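(* Let $\mathcal G$ be a small groupoid with finite set of objects and let $\mathcal B$ be the groupoid bialgebroid over a field $\mathbb K$ associated to $\mathcal G$, with underlying algebra $B=\mathbb K\mathcal G^1$. Let $M$ be a stable anti Yetter-Drinfel'd $\mathcal B$-module with decomposition $M\cong\bigoplus_{[l]\in\mathcal T(\mathcal G)}M_{[l]}$. Then for all $l\in\mathcal L(\mathcal G)$, $$\mathrm{HH}_\ast(B,M_{[l]})\cong\mathrm{HH}_\ast(B_l,M_l)\qquad\text{and}\qquad\mathrm{HC}_\ast(B,M_{[l]})\cong\mathrm{HC}_\ast(B_l,M_l).$$
   Context: Groupoid bialgebroid: $\mathcal G^0$ is the (finite) set of objects, $\mathcal G^1\supseteq\mathcal G^0$ the set of morphisms (objects identified with identity morphisms), $s,t$ source and target. $B=\mathbb K\mathcal G^1$ has product $gg'=g\circ g'$ if $s(g)=t(g')$ and $0$ otherwise, unit $\sum_{x\in\mathcal G^0}x$; $R=\mathbb K\mathcal G^0\subseteq B$ is a commutative algebra with orthogonal idempotents $x\in\mathcal G^0$. $\mathcal B$ is a right $R$-bialgebroid with $\xi=\zeta$ the inclusion $R\hookrightarrow B$, $\Delta(g)=g\otimes_Rg$, $\epsilon(g)=s(g)$, where $B$ is an $R$-bimodule with both actions given by right multiplication (so $bx\otimes_Rb'=b\otimes_Rb'x$). A right $\mathcal B$-comodule is a right $R$-module $M$ with an $R$-linear coassociative counital coaction $\varrho:M\to M\otimes_RB$, $m\mapsto m^{[0]}\otimes_R m^{[1]}$; it has a left $R$-action $r\cdot m=m^{[0]}\cdot\epsilon(rm^{[1]})$.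 An anti Yetter-Drinfel'd $\mathcal B$-module is a right $\mathcal B$-comodule and left $B$-module $M$ (action $\triangleright$) with $m\cdot r=r\triangleright m=r\cdot m$ for $r\in R$ and $\varrho(h\triangleright m)=h\triangleright m^{[0]}\otimes_Rh\,m^{[1]}h^{-1}$ for $h\in\mathcal G^1$; it is stable if $m^{[1]}\triangleright m^{[0]}=m$ for all $m$. For such $M$ and $g\in\mathcal G^1$ put $M_g=\{m\in M\mid\varrho(m)=m\otimes_Rg,\ m\cdot s(g)=m\}$; then $M=\bigoplus_{g}M_g$. Let $\mathcal L(\mathcal G)=\{g\in\mathcal G^1\mid s(g)=t(g)\}$ be the set of loops, let $[l]=\{g\circ l\circ g^{-1}\mid g\in\mathcal G^1,\ s(g)=s(l)\}$ be the orbit of $l\in\mathcal L(\mathcal G)$ under the adjoint action, and $\mathcal T(\mathcal G)$ the set of orbits. $M_g=0$ unless $g$ is a loop; $M_{[l]}:=\bigoplus_{l'\in[l]}M_{l'}$ is an anti Yetter-Drinfel'd submodule and $M\cong\bigoplus_{[l]\in\mathcal T(\mathcal G)}M_{[l]}$. For $l\in\mathcal L(\mathcal G)$, $\mathcal G^1_l=\{l'\in\mathcal L(\mathcal G)\mid s(l')=s(l),\ l'\circ l\circ l'^{-1}=l\}$ is the centralizer of $l$ in the group of loops at $s(l)$, and $B_l=\mathbb K\mathcal G^1_l$ its group algebra (with unit $s(l)$). $M_l$ is a left $B_l$-module by restriction of $\triangleright$, with $B_l$-coaction $m\mapsto m\otimes_{\mathbb K}l$; it is a stable anti Yetter-Drinfel'd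 module of the group Hopf algebra $B_l$. For a stable anti Yetter-Drinfel'd $\mathcal B$-module $N$, $Z_\ast(B,N)$ is the cyclic $\mathbb K$-module $Z_n(B,N)=B^{\otimes_R\,n+1}\otimes_BN$ ($B$ acting diagonally: $(b_0\otimes_R\dots\otimes_Rb_n)g=b_0g\otimes_R\dots\otimes_Rb_ng$ for $g\in\mathcal G^1$), with faces applying $\epsilon$ to the $k$-th factor, degeneracies applying $\Delta$ to the $k$-th factor ($0\le k\le n$) and cyclic map $w_n:(b_0\otimes_R\dots\otimes_Rb_n)\otimes_Bm\mapsto(b_nm^{[1]}\otimes_Rb_0\otimes_R\dots\otimes_Rb_{n-1})\otimes_Bm^{[0]}$. $Z_\ast(B_l,M_l)$ is defined in the same way for the group $\mathcal G_l^1$ (a groupoid with one object, $R$ replaced by $\mathbb K$): $Z_n(B_l,M_l)=B_l^{\otimes_{\mathbb K}\,n+1}\otimes_{B_l}M_l$. $\mathrm{HH}_\ast(B,N)$, $\mathrm{HC}_\ast(B,N)$ (resp. $\mathrm{HH}_\ast(B_l,M_l)$, $\mathrm{HC}_\ast(B_l,M_l)$) denote the Hochschild and cyclic homologies of the cyclic module $Z_\ast(B,N)$ (resp. $Z_\ast(B_l,M_l)$): $\mathrm{HH}$ is the homology of the complex with differential $\sum_k(-1)^kd_k$, $\mathrm{HC}$ the homology of the total complex of the associated Connes–Tsygan cyclic bicomplex. *)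

theory Defs
  imports Complex_Main "HOL-Algebra.Module" "HOL-Algebra.AbelCoset" "HOL-Library.Poly_Mapping"
begin

section \<open>Vector spaces, quotients, chain complexes\<close>

text \<open>
  The ground field is a type \<open>'k::field\<close>. Vector spaces that arise as quotients are
  \<open>module\<close> records of HOL-Algebra, whose multiplicative fields are left undefined.
\<close>

abbreviation single1 :: "'a \<Rightarrow> 'a \<Rightarrow>\<^sub>0 'k::field"
  where "single1 a \<equiv> Poly_Mapping.single a 1"

definition fscale :: "'k::field \<Rightarrow> ('a \<Rightarrow>\<^sub>0 'k) \<Rightarrow> ('a \<Rightarrow>\<^sub>0 'k)"
  where "fscale c t = Poly_Mapping.map ((*) c) t"

definition lin_ext ::
    "('k::field \<Rightarrow> 'v \<Rightarrow> 'v::ab_group_add) \<Rightarrow> ('a \<Rightarrow> 'v) \<Rightarrow> ('a \<Rightarrow>\<^sub>0 'k) \<Rightarrow> 'v"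
  where "lin_ext sc f t = (\<Sum>a\<in>Poly_Mapping.keys t. sc (Poly_Mapping.lookup t a) (f a))"

definition free_space :: "'a set \<Rightarrow> ('k::field, 'a \<Rightarrow>\<^sub>0 'k) module"
  where "free_space S =
    \<lparr>carrier = {t. Poly_Mapping.keys t \<subseteq> S}, mult = undefined, one = undefined,
     zero = 0, add = (+), smult = fscale\<rparr>"

text \<open>The quotient of \<open>A\<close> by a subspace \<open>U\<close>; scalar multiplication by \<open>c\<close> sends the coset
  of \<open>x\<close> to the coset of \<open>c x\<close> (also for \<open>c = 0\<close>).\<close>

definition quotient_space :: "('k, 'v) module \<Rightarrow> 'v set \<Rightarrow> ('k, 'v set) module"
  where "quotient_space A U =
    \<lparr>carrier = a_rcosets\<^bsub>A\<^esub> U, mult = undefined, one = undefined,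
     zero = U, add = (\<lambda>X Y. X <+>\<^bsub>A\<^esub> Y),
     smult = (\<lambda>c X. \<Union>x\<in>X. U +>\<^bsub>A\<^esub> (c \<odot>\<^bsub>A\<^esub> x))\<rparr>"

definition direct_sum :: "'i set \<Rightarrow> ('i \<Rightarrow> ('k, 'v) module) \<Rightarrow> ('k, 'i \<Rightarrow> 'v) module"
  \<comment> \<open>only used for finite \<open>I\<close>, where the direct sum is the product\<close>
  where "direct_sum I A =
    \<lparr>carrier = (\<Pi>\<^sub>E i\<in>I. carrier (A i)), mult = undefined, one = undefined,
     zero = (\<lambda>i\<in>I. \<zero>\<^bsub>A i\<^esub>), add = (\<lambda>x y. \<lambda>i\<in>I. x i \<oplus>\<^bsub>A i\<^esub> y i),
     smult = (\<lambda>c x. \<lambda>i\<in>I. c \<odot>\<^bsub>A i\<^esub> x i)\<rparr>"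

definition lin_iso :: "('k, 'v) module \<Rightarrow> ('k, 'w) module \<Rightarrow> bool"
  where "lin_iso A C \<longleftrightarrow> (\<exists>f. bij_betw f (carrier A) (carrier C) \<and>
    (\<forall>x\<in>carrier A. \<forall>y\<in>carrier A. f (x \<oplus>\<^bsub>A\<^esub> y) = f x \<oplus>\<^bsub>C\<^esub> f y) \<and>
    (\<forall>c. \<forall>x\<in>carrier A. f (c \<odot>\<^bsub>A\<^esub> x) = c \<odot>\<^bsub>C\<^esub> f x))"

text \<open>Homology of a complex in nonnegative degrees, where \<open>d n\<close> maps \<open>C n\<close> to \<open>C (n - 1)\<close>
  for \<open>n \<ge> 1\<close> and the differential on \<open>C 0\<close> is zero (the value of \<open>d 0\<close> is irrelevant).\<close>

definition homology :: "(nat \<Rightarrow> ('k, 'v) module) \<Rightarrow> (nat \<Rightarrow> 'v \<Rightarrow> 'v) \<Rightarrow> nat \<Rightarrow> ('k, 'v set) module"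
  where "homology C d n = quotient_space
    ((C n)\<lparr>carrier := {x \<in> carrier (C n). n = 0 \<or> d n x = \<zero>\<^bsub>C (n - 1)\<^esub>}\<rparr>)
    (d (Suc n) ` carrier (C (Suc n)))"


section \<open>Cyclic modules\<close>

record ('k, 'v) cyclic_module =
  deg :: "nat \<Rightarrow> ('k, 'v) module"
  face :: "nat \<Rightarrow> nat \<Rightarrow> 'v \<Rightarrow> 'v"    \<comment> \<open>\<open>face Z n k\<close> maps degree \<open>n\<close> to degree \<open>n - 1\<close>\<close>
  degen :: "nat \<Rightarrow> nat \<Rightarrow> 'v \<Rightarrow> 'v"   \<comment> \<open>\<open>degen Z n k\<close> maps degree \<open>n\<close> to degree \<open>n + 1\<close>\<close>
  cyc :: "nat \<Rightarrow> 'v \<Rightarrow> 'v"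

text \<open>The operators of the Connes--Tsygan bicomplex: \<open>hoch_b\<close> is \<open>b\<close>, \<open>hoch_b'\<close> is \<open>b'\<close>
  (the last face omitted), \<open>cyc_t\<close> is the signed cyclic operator, and \<open>cyc_N\<close> is the norm.\<close>

definition hoch_b :: "('k::field, 'v) cyclic_module \<Rightarrow> nat \<Rightarrow> 'v \<Rightarrow> 'v"
  where "hoch_b Z n x =
    (\<Oplus>\<^bsub>deg Z (n - 1)\<^esub>k\<in>{..n}. (-1) ^ k \<odot>\<^bsub>deg Z (n - 1)\<^esub> face Z n k x)"

definition hoch_b' :: "('k::field, 'v) cyclic_module \<Rightarrow> nat \<Rightarrow> 'v \<Rightarrow> 'v"
  where "hoch_b' Z n x =
    (\<Oplus>\<^bsub>deg Z (n - 1)\<^esub>k\<in>{..<n}. (-1) ^ k \<odot>\<^bsub>deg Z (n - 1)\<^esub> face Z n k x)"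

definition cyc_t :: "('k::field, 'v) cyclic_module \<Rightarrow> nat \<Rightarrow> 'v \<Rightarrow> 'v"
  where "cyc_t Z n x = (-1) ^ n \<odot>\<^bsub>deg Z n\<^esub> cyc Z n x"

definition cyc_N :: "('k::field, 'v) cyclic_module \<Rightarrow> nat \<Rightarrow> 'v \<Rightarrow> 'v"
  where "cyc_N Z n x = (\<Oplus>\<^bsub>deg Z n\<^esub>i\<in>{..n}. (cyc_t Z n ^^ i) x)"

text \<open>The bicomplex has \<open>deg Z q\<close> in every bidegree \<open>(p, q)\<close>. Even columns carry \<open>b\<close>, odd
  columns carry \<open>- b'\<close>; the horizontal map out of column \<open>p \<ge> 1\<close> is \<open>1 - t\<close> for odd \<open>p\<close> and
  \<open>N\<close> for even \<open>p\<close>. Below, \<open>p\<close> and \<open>q\<close> are the coordinates of the source.\<close>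

definition bicomplex_vert :: "('k::field, 'v) cyclic_module \<Rightarrow> nat \<Rightarrow> nat \<Rightarrow> 'v \<Rightarrow> 'v"
  where "bicomplex_vert Z p q x =
    (if even p then hoch_b Z q x else (-1) \<odot>\<^bsub>deg Z (q - 1)\<^esub> hoch_b' Z q x)"

definition bicomplex_hor :: "('k::field, 'v) cyclic_module \<Rightarrow> nat \<Rightarrow> nat \<Rightarrow> 'v \<Rightarrow> 'v"
  where "bicomplex_hor Z p q x =
    (if odd p then x \<oplus>\<^bsub>deg Z q\<^esub> ((-1) \<odot>\<^bsub>deg Z q\<^esub> cyc_t Z q x) else cyc_N Z q x)"

text \<open>In total degree \<open>n\<close>, the component with index \<open>q\<close> has bidegree \<open>(n - q, q)\<close>.\<close>

definition tot :: "('k, 'v) cyclic_module \<Rightarrow> nat \<Rightarrow> ('k, nat \<Rightarrow> 'v) module"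
  where "tot Z n = direct_sum {..n} (deg Z)"

definition tot_diff :: "('k::field, 'v) cyclic_module \<Rightarrow> nat \<Rightarrow> (nat \<Rightarrow> 'v) \<Rightarrow> (nat \<Rightarrow> 'v)"
  where "tot_diff Z n x = (\<lambda>q\<in>{..n - 1}.
    bicomplex_vert Z (n - 1 - q) (Suc q) (x (Suc q)) \<oplus>\<^bsub>deg Z q\<^esub> bicomplex_hor Z (n - q) q (x q))"

definition HH :: "('k::field, 'v) cyclic_module \<Rightarrow> nat \<Rightarrow> ('k, 'v set) module"
  where "HH Z = homology (deg Z) (hoch_b Z)"

definition HC :: "('k::field, 'v) cyclic_module \<Rightarrow> nat \<Rightarrow> ('k, (nat \<Rightarrow> 'v) set) module"
  where "HC Z = homology (tot Z) (tot_diff Z)"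


section \<open>Groupoids\<close>

record 'g groupoid =
  Obj :: "'g set"
  Arr :: "'g set"
  src :: "'g \<Rightarrow> 'g"
  tgt :: "'g \<Rightarrow> 'g"
  cmp :: "'g \<Rightarrow> 'g \<Rightarrow> 'g"   \<comment> \<open>\<open>cmp G g h\<close> is \<open>g \<circ> h\<close>, for \<open>src G g = tgt G h\<close>\<close>

locale groupoid =
  fixes G :: "'g groupoid"
  assumes Obj_subset: "Obj G \<subseteq> Arr G"
    and src_closed: "g \<in> Arr G \<Longrightarrow> src G g \<in> Obj G"
    and tgt_closed: "g \<in> Arr G \<Longrightarrow> tgt G g \<in> Obj G"
    and src_Obj: "x \<in> Obj G \<Longrightarrow> src G x = x"
    and tgt_Obj: "x \<in> Obj G \<Longrightarrow> tgt G x = x"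
    and cmp_closed: "\<lbrakk>g \<in> Arr G; h \<in> Arr G; src G g = tgt G h\<rbrakk> \<Longrightarrow> cmp G g h \<in> Arr G"
    and src_cmp: "\<lbrakk>g \<in> Arr G; h \<in> Arr G; src G g = tgt G h\<rbrakk> \<Longrightarrow> src G (cmp G g h) = src G h"
    and tgt_cmp: "\<lbrakk>g \<in> Arr G; h \<in> Arr G; src G g = tgt G h\<rbrakk> \<Longrightarrow> tgt G (cmp G g h) = tgt G g"
    and cmp_assoc: "\<lbrakk>f \<in> Arr G; g \<in> Arr G; h \<in> Arr G; src G f = tgt G g; src G g = tgt G h\<rbrakk>
      \<Longrightarrow> cmp G (cmp G f g) h = cmp G f (cmp G g h)"
    and cmp_src: "g \<in> Arr G \<Longrightarrow> cmp G g (src G g) = g"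
    and tgt_cmp_id: "g \<in> Arr G \<Longrightarrow> cmp G (tgt G g) g = g"
    and inverse_ex: "g \<in> Arr G \<Longrightarrow> \<exists>h\<in>Arr G. src G h = tgt G g \<and> tgt G h = src G g \<and>
      cmp G h g = src G g \<and> cmp G g h = tgt G g"

definition ginv :: "'g groupoid \<Rightarrow> 'g \<Rightarrow> 'g"
  where "ginv G g = (THE h. h \<in> Arr G \<and> src G h = tgt G g \<and> tgt G h = src G g \<and>
    cmp G h g = src G g \<and> cmp G g h = tgt G g)"

definition loops :: "'g groupoid \<Rightarrow> 'g set"
  where "loops G = {g \<in> Arr G. src G g = tgt G g}"

definition adj_orbit :: "'g groupoid \<Rightarrow> 'g \<Rightarrow> 'g set"
  where "adj_orbit G l = {cmp G (cmp G g l) (ginv G g) | g. g \<in> Arr G \<and> src G g = src G l}"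

definition centralizer :: "'g groupoid \<Rightarrow> 'g \<Rightarrow> 'g groupoid"
  where "centralizer G l =
    G\<lparr>Obj := {src G l},
      Arr := {g \<in> loops G. src G g = src G l \<and> cmp G (cmp G g l) (ginv G g) = l}\<rparr>"


section \<open>The groupoid bialgebroid\<close>

definition galg :: "'g groupoid \<Rightarrow> ('g \<Rightarrow>\<^sub>0 'k::field) set"
  where "galg G = {b. Poly_Mapping.keys b \<subseteq> Arr G}"

definition gbase :: "'g groupoid \<Rightarrow> ('g \<Rightarrow>\<^sub>0 'k::field) set"
  where "gbase G = {b. Poly_Mapping.keys b \<subseteq> Obj G}"

definition gmult :: "'g groupoid \<Rightarrow> ('g \<Rightarrow>\<^sub>0 'k::field) \<Rightarrow> ('g \<Rightarrow>\<^sub>0 'k) \<Rightarrow> ('g \<Rightarrow>\<^sub>0 'k)"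
  where "gmult G b c = lin_ext fscale (\<lambda>g.
    lin_ext fscale (\<lambda>h. if src G g = tgt G h then single1 (cmp G g h) else 0) c) b"

definition gunit :: "'g groupoid \<Rightarrow> ('g \<Rightarrow>\<^sub>0 'k::field)"
  where "gunit G = (\<Sum>x\<in>Obj G. single1 x)"

definition gcounit :: "'g groupoid \<Rightarrow> ('g \<Rightarrow>\<^sub>0 'k::field) \<Rightarrow> ('g \<Rightarrow>\<^sub>0 'k)"
  where "gcounit G b = lin_ext fscale (\<lambda>g. single1 (src G g)) b"

text \<open>A formal linear combination of pairs \<open>[b, b']\<close> representing \<open>\<Delta>(b)\<close> in \<open>B \<otimes>\<^sub>R B\<close>.\<close>

definition gcomult :: "('g \<Rightarrow>\<^sub>0 'k::field) \<Rightarrow> (('g \<Rightarrow>\<^sub>0 'k) list \<Rightarrow>\<^sub>0 'k)"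
  where "gcomult b = lin_ext fscale (\<lambda>g. single1 [single1 g, single1 g]) b"


section \<open>Tensor products\<close>

text \<open>
  Iterated tensor products are constructed in one step, as the free vector space on tuples
  modulo multilinearity and the balancing relations. A tuple \<open>(m, [b\<^sub>1, \<dots>, b\<^sub>n])\<close> stands for
  \<open>m \<otimes>\<^sub>R b\<^sub>1 \<otimes>\<^sub>R \<dots> \<otimes>\<^sub>R b\<^sub>n\<close> in \<open>M \<otimes>\<^sub>R B \<otimes>\<^sub>R \<dots> \<otimes>\<^sub>R B\<close>, and a tuple \<open>(m, [b\<^sub>0, \<dots>, b\<^sub>n])\<close> stands for
  \<open>(b\<^sub>0 \<otimes>\<^sub>R \<dots> \<otimes>\<^sub>R b\<^sub>n) \<otimes>\<^sub>B m\<close> in the cyclic module.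
\<close>

type_synonym ('k, 'g, 'm) tuples = "('m \<times> ('g \<Rightarrow>\<^sub>0 'k) list) \<Rightarrow>\<^sub>0 'k"

text \<open>The structure maps of an anti Yetter--Drinfel'd module: a subspace \<open>mcar\<close> of the vector
  space \<open>'m\<close> with a right \<open>R\<close>-action, a left \<open>B\<close>-action and a coaction with values in the
  quotient space \<open>M \<otimes>\<^sub>R B\<close>.\<close>

record (overloaded) ('k, 'g, 'm) ayd_data =
  mcar :: "'m set"
  mscale :: "'k \<Rightarrow> 'm \<Rightarrow> 'm"
  ract :: "'m \<Rightarrow> ('g \<Rightarrow>\<^sub>0 'k) \<Rightarrow> 'm"
  lact :: "('g \<Rightarrow>\<^sub>0 'k) \<Rightarrow> 'm \<Rightarrow> 'm"
  coact :: "'m \<Rightarrow> ('k, 'g, 'm) tuples set"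

definition tuples ::
    "'g groupoid \<Rightarrow> ('k::field, 'g, 'm::ab_group_add) ayd_data \<Rightarrow> nat \<Rightarrow> ('m \<times> ('g \<Rightarrow>\<^sub>0 'k) list) set"
  where "tuples G M n = {(m, bs). m \<in> mcar M \<and> length bs = n \<and> set bs \<subseteq> galg G}"

definition multilinear_rel ::
    "'g groupoid \<Rightarrow> ('k::field, 'g, 'm::ab_group_add) ayd_data \<Rightarrow> nat \<Rightarrow> ('k, 'g, 'm) tuples set"
  where "multilinear_rel G M n =
    {single1 (m + m', bs) - single1 (m, bs) - single1 (m', bs) | m m' bs.
       (m, bs) \<in> tuples G M n \<and> m' \<in> mcar M} \<union>
    {single1 (mscale M c m, bs) - fscale c (single1 (m, bs)) | c m bs. (m, bs) \<in> tuples G M n} \<union>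
    {single1 (m, bs[i := b + b']) - single1 (m, bs[i := b]) - single1 (m, bs[i := b']) | m bs i b b'.
       (m, bs) \<in> tuples G M n \<and> i < n \<and> b \<in> galg G \<and> b' \<in> galg G} \<union>
    {single1 (m, bs[i := fscale c b]) - fscale c (single1 (m, bs[i := b])) | c m bs i b.
       (m, bs) \<in> tuples G M n \<and> i < n \<and> b \<in> galg G}"

text \<open>\<open>R\<close>-balancing between adjacent factors \<open>B\<close>: both \<open>R\<close>-actions on \<open>B\<close> are right
  multiplication, that is, \<open>b r \<otimes>\<^sub>R b' = b \<otimes>\<^sub>R b' r\<close>.\<close>

definition balanced_rel ::
    "'g groupoid \<Rightarrow> ('k::field, 'g, 'm::ab_group_add) ayd_data \<Rightarrow> nat \<Rightarrow> ('k, 'g, 'm) tuples set"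
  where "balanced_rel G M n =
    {single1 (m, bs[i := gmult G (bs ! i) r])
       - single1 (m, bs[Suc i := gmult G (bs ! Suc i) r]) | m bs i r.
       (m, bs) \<in> tuples G M n \<and> Suc i < n \<and> r \<in> gbase G}"

text \<open>The subspace by which one divides to obtain \<open>M \<otimes>\<^sub>R B \<otimes>\<^sub>R \<dots> \<otimes>\<^sub>R B\<close> with \<open>n\<close> factors \<open>B\<close>.\<close>

definition tensor_rel ::
    "'g groupoid \<Rightarrow> ('k::field, 'g, 'm::ab_group_add) ayd_data \<Rightarrow> nat \<Rightarrow> ('k, 'g, 'm) tuples set"
  where "tensor_rel G M n = module.span fscale
    (multilinear_rel G M n \<union> balanced_rel G M n \<union>
     {single1 (ract M m r, bs) - single1 (m, bs[0 := gmult G (bs ! 0) r]) | m bs r.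
        (m, bs) \<in> tuples G M n \<and> 0 < n \<and> r \<in> gbase G})"

definition tensor ::
    "'g groupoid \<Rightarrow> ('k::field, 'g, 'm::ab_group_add) ayd_data \<Rightarrow> nat
      \<Rightarrow> ('k, ('k, 'g, 'm) tuples set) module"
  where "tensor G M n = quotient_space (free_space (tuples G M n)) (tensor_rel G M n)"

definition tensor_class ::
    "'g groupoid \<Rightarrow> ('k::field, 'g, 'm::ab_group_add) ayd_data \<Rightarrow> nat
      \<Rightarrow> ('k, 'g, 'm) tuples \<Rightarrow> ('k, 'g, 'm) tuples set"
  where "tensor_class G M n t = tensor_rel G M n +>\<^bsub>free_space (tuples G M n)\<^esub> t"


section \<open>Stable anti Yetter--Drinfel'd modules\<close>

text \<open>Sweedler notation: for \<open>\<rho>(m) = \<Sum>\<^sub>i m\<^sub>i \<otimes>\<^sub>R b\<^sub>i\<close> this is \<open>\<Sum>\<^sub>i f m\<^sub>i b\<^sub>i\<close>, computed with a chosen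
  representative of \<open>\<rho>(m)\<close>. Wherever it is used below, the value, or its class in the
  tensor product in which it is taken, does not depend on this choice.\<close>

definition sweedler ::
    "('k::field, 'g, 'm::ab_group_add) ayd_data \<Rightarrow> ('k \<Rightarrow> 'v \<Rightarrow> 'v::ab_group_add)
      \<Rightarrow> ('m \<Rightarrow> ('g \<Rightarrow>\<^sub>0 'k) \<Rightarrow> 'v) \<Rightarrow> 'm \<Rightarrow> 'v"
  where "sweedler M sc f m = lin_ext sc (\<lambda>(m0, bs). f m0 (hd bs)) (SOME t. t \<in> coact M m)"

locale right_comodule = groupoid G
  for G :: "'g groupoid" +
  fixes M :: "('k::field, 'g, 'm::ab_group_add) ayd_data"
  assumes scale_vector_space: "vector_space (mscale M)"
    and mcar_subspace: "module.subspace (mscale M) (mcar M)"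
    and ract_closed: "\<lbrakk>m \<in> mcar M; r \<in> gbase G\<rbrakk> \<Longrightarrow> ract M m r \<in> mcar M"
    and ract_add_left: "\<lbrakk>m \<in> mcar M; m' \<in> mcar M; r \<in> gbase G\<rbrakk>
      \<Longrightarrow> ract M (m + m') r = ract M m r + ract M m' r"
    and ract_add_right: "\<lbrakk>m \<in> mcar M; r \<in> gbase G; r' \<in> gbase G\<rbrakk>
      \<Longrightarrow> ract M m (r + r') = ract M m r + ract M m r'"
    and ract_scale_left: "\<lbrakk>m \<in> mcar M; r \<in> gbase G\<rbrakk>
      \<Longrightarrow> ract M (mscale M c m) r = mscale M c (ract M m r)"
    and ract_scale_right: "\<lbrakk>m \<in> mcar M; r \<in> gbase G\<rbrakk>
      \<Longrightarrow> ract M m (fscale c r) = mscale M c (ract M m r)"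
    and ract_mult: "\<lbrakk>m \<in> mcar M; r \<in> gbase G; r' \<in> gbase G\<rbrakk>
      \<Longrightarrow> ract M (ract M m r) r' = ract M m (gmult G r r')"
    and ract_unit: "m \<in> mcar M \<Longrightarrow> ract M m (gunit G) = m"
    and coact_closed: "m \<in> mcar M \<Longrightarrow> coact M m \<in> carrier (tensor G M 1)"
    and coact_add: "\<lbrakk>m \<in> mcar M; m' \<in> mcar M\<rbrakk>
      \<Longrightarrow> coact M (m + m') = coact M m \<oplus>\<^bsub>tensor G M 1\<^esub> coact M m'"
    \<comment> \<open>\<open>R\<close> acts on \<open>M \<otimes>\<^sub>R B\<close> through the right action on \<open>B\<close>\<close>
    and coact_ract: "\<lbrakk>m \<in> mcar M; r \<in> gbase G\<rbrakk>
      \<Longrightarrow> coact M (ract M m r) =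
        tensor_class G M 1 (sweedler M fscale (\<lambda>m0 b. single1 (m0, [gmult G b r])) m)"
    and coassociative: "m \<in> mcar M \<Longrightarrow>
      tensor_class G M 2 (sweedler M fscale (\<lambda>m0 b.
        sweedler M fscale (\<lambda>m00 m01. single1 (m00, [m01, b])) m0) m) =
      tensor_class G M 2 (sweedler M fscale (\<lambda>m0 b.
        lin_ext fscale (\<lambda>bs. single1 (m0, bs)) (gcomult b)) m)"
    and counital: "m \<in> mcar M \<Longrightarrow> sweedler M (mscale M) (\<lambda>m0 b. ract M m0 (gcounit G b)) m = m"

text \<open>The left \<open>R\<close>-action \<open>r \<cdot> m = m\<^bsup>[0]\<^esup> \<cdot> \<epsilon>(r m\<^bsup>[1]\<^esup>)\<close> of a right comodule.\<close>

definition left_base_act ::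
    "'g groupoid \<Rightarrow> ('k::field, 'g, 'm::ab_group_add) ayd_data \<Rightarrow> ('g \<Rightarrow>\<^sub>0 'k) \<Rightarrow> 'm \<Rightarrow> 'm"
  where "left_base_act G M r m =
    sweedler M (mscale M) (\<lambda>m0 b. ract M m0 (gcounit G (gmult G r b))) m"

locale anti_yetter_drinfeld = right_comodule G M
  for G :: "'g groupoid" and M :: "('k::field, 'g, 'm::ab_group_add) ayd_data" +
  assumes lact_closed: "\<lbrakk>b \<in> galg G; m \<in> mcar M\<rbrakk> \<Longrightarrow> lact M b m \<in> mcar M"
    and lact_add_left: "\<lbrakk>b \<in> galg G; b' \<in> galg G; m \<in> mcar M\<rbrakk>
      \<Longrightarrow> lact M (b + b') m = lact M b m + lact M b' m"
    and lact_add_right: "\<lbrakk>b \<in> galg G; m \<in> mcar M; m' \<in> mcar M\<rbrakk>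
      \<Longrightarrow> lact M b (m + m') = lact M b m + lact M b m'"
    and lact_scale_left: "\<lbrakk>b \<in> galg G; m \<in> mcar M\<rbrakk>
      \<Longrightarrow> lact M (fscale c b) m = mscale M c (lact M b m)"
    and lact_scale_right: "\<lbrakk>b \<in> galg G; m \<in> mcar M\<rbrakk>
      \<Longrightarrow> lact M b (mscale M c m) = mscale M c (lact M b m)"
    and lact_mult: "\<lbrakk>b \<in> galg G; b' \<in> galg G; m \<in> mcar M\<rbrakk>
      \<Longrightarrow> lact M (gmult G b b') m = lact M b (lact M b' m)"
    and lact_unit: "m \<in> mcar M \<Longrightarrow> lact M (gunit G) m = m"
    and ract_eq_lact: "\<lbrakk>m \<in> mcar M; r \<in> gbase G\<rbrakk> \<Longrightarrow> ract M m r = lact M r m"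
    and lact_eq_left_base_act: "\<lbrakk>m \<in> mcar M; r \<in> gbase G\<rbrakk> \<Longrightarrow> lact M r m = left_base_act G M r m"
    and coact_lact: "\<lbrakk>h \<in> Arr G; m \<in> mcar M\<rbrakk> \<Longrightarrow>
      coact M (lact M (single1 h) m) =
        tensor_class G M 1 (sweedler M fscale (\<lambda>m0 b. single1
          (lact M (single1 h) m0, [gmult G (gmult G (single1 h) b) (single1 (ginv G h))])) m)"

locale stable_anti_yetter_drinfeld = anti_yetter_drinfeld G M
  for G :: "'g groupoid" and M :: "('k::field, 'g, 'm::ab_group_add) ayd_data" +
  assumes stable: "m \<in> mcar M \<Longrightarrow> sweedler M (mscale M) (\<lambda>m0 b. lact M b m0) m = m"

definition component ::
    "'g groupoid \<Rightarrow> ('k::field, 'g, 'm::ab_group_add) ayd_data \<Rightarrow> 'g \<Rightarrow> 'm set"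
  where "component G M g = {m \<in> mcar M.
    coact M m = tensor_class G M 1 (single1 (m, [single1 g])) \<and> ract M m (single1 (src G g)) = m}"

text \<open>The restriction of \<open>M\<close> to a submodule \<open>N\<close>. Since \<open>R\<close> is semisimple, the map
  \<open>N \<otimes>\<^sub>R B \<rightarrow> M \<otimes>\<^sub>R B\<close> is injective, and the
  element of \<open>N \<otimes>\<^sub>R B\<close> that maps to \<open>\<rho>(m)\<close> consists of those representatives of \<open>\<rho>(m)\<close> that
  involve only elements of \<open>N\<close>.\<close>

definition restrict_module ::
    "'g groupoid \<Rightarrow> ('k::field, 'g, 'm::ab_group_add) ayd_data \<Rightarrow> 'm set \<Rightarrow> ('k, 'g, 'm) ayd_data"
  where "restrict_module G M N = M\<lparr>mcar := N,
    coact := (\<lambda>m. {t \<in> coact M m. Poly_Mapping.keys t \<subseteq> tuples G (M\<lparr>mcar := N\<rparr>) 1})\<rparr>"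

text \<open>The sum of the subspaces \<open>M\<^bsub>l'\<^esub>\<close> for \<open>l'\<close> in the orbit of \<open>l\<close>; it is direct because
  \<open>M\<close> is the direct sum of all \<open>M\<^sub>g\<close>.\<close>

definition orbit_module ::
    "'g groupoid \<Rightarrow> ('k::field, 'g, 'm::ab_group_add) ayd_data \<Rightarrow> 'g \<Rightarrow> ('k, 'g, 'm) ayd_data"
  where "orbit_module G M l =
    restrict_module G M (module.span (mscale M) (\<Union>l'\<in>adj_orbit G l. component G M l'))"

text \<open>\<open>M\<^sub>l\<close> as a module over the group algebra of \<open>centralizer G l\<close>, with coaction \<open>m \<mapsto> m \<otimes> l\<close>.\<close>

definition loop_module ::
    "'g groupoid \<Rightarrow> ('k::field, 'g, 'm::ab_group_add) ayd_data \<Rightarrow> 'g \<Rightarrow> ('k, 'g, 'm) ayd_data"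
  where "loop_module G M l = M\<lparr>mcar := component G M l,
    coact := (\<lambda>m. tensor_class (centralizer G l) (M\<lparr>mcar := component G M l\<rparr>) 1
      (single1 (m, [single1 l])))\<rparr>"


section \<open>The cyclic module of a stable anti Yetter--Drinfel'd module\<close>

definition Z_rel ::
    "'g groupoid \<Rightarrow> ('k::field, 'g, 'm::ab_group_add) ayd_data \<Rightarrow> nat \<Rightarrow> ('k, 'g, 'm) tuples set"
  where "Z_rel G N n = module.span fscale
    (multilinear_rel G N (Suc n) \<union> balanced_rel G N (Suc n) \<union>
     {single1 (m, map (\<lambda>b. gmult G b (single1 g)) bs) - single1 (lact N (single1 g) m, bs) | m bs g.
        (m, bs) \<in> tuples G N (Suc n) \<and> g \<in> Arr G})"

definition Z_deg ::
    "'g groupoid \<Rightarrow> ('k::field, 'g, 'm::ab_group_add) ayd_data \<Rightarrow> nat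
      \<Rightarrow> ('k, ('k, 'g, 'm) tuples set) module"
  where "Z_deg G N n = quotient_space (free_space (tuples G N (Suc n))) (Z_rel G N n)"

text \<open>The map into degree \<open>n\<close> induced by a map \<open>f\<close> on tuples.\<close>

definition Z_map ::
    "'g groupoid \<Rightarrow> ('k::field, 'g, 'm::ab_group_add) ayd_data \<Rightarrow> nat
      \<Rightarrow> ('m \<times> ('g \<Rightarrow>\<^sub>0 'k) list \<Rightarrow> ('k, 'g, 'm) tuples)
      \<Rightarrow> ('k, 'g, 'm) tuples set \<Rightarrow> ('k, 'g, 'm) tuples set"
  where "Z_map G N n f X =
    (\<Union>t\<in>X. Z_rel G N n +>\<^bsub>free_space (tuples G N (Suc n))\<^esub> lin_ext fscale f t)"

text \<open>Applying \<open>\<epsilon>\<close> to \<open>b\<^sub>k\<close> gives an element of \<open>R\<close>, which is absorbed into the next factor,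
  or into the previous one if \<open>b\<^sub>k\<close> is the last, by the isomorphisms \<open>R \<otimes>\<^sub>R B \<cong> B \<cong> B \<otimes>\<^sub>R R\<close>. Both
  actions of \<open>R\<close> on \<open>B\<close> are right multiplication.\<close>

definition tuple_face ::
    "'g groupoid \<Rightarrow> nat \<Rightarrow> 'm \<times> ('g \<Rightarrow>\<^sub>0 'k) list \<Rightarrow> ('k::field, 'g, 'm) tuples"
  where "tuple_face G k = (\<lambda>(m, bs). single1 (m,
    let r = gcounit G (bs ! k) in
    if Suc k < length bs
    then take k bs @ gmult G (bs ! Suc k) r # drop (Suc (Suc k)) bs
    else take (k - 1) bs @ [gmult G (bs ! (k - 1)) r]))"

definition tuple_degen :: "nat \<Rightarrow> 'm \<times> ('g \<Rightarrow>\<^sub>0 'k) list \<Rightarrow> ('k::field, 'g, 'm) tuples"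
  where "tuple_degen k = (\<lambda>(m, bs).
    lin_ext fscale (\<lambda>ds. single1 (m, take k bs @ ds @ drop (Suc k) bs)) (gcomult (bs ! k)))"

definition tuple_cyc ::
    "'g groupoid \<Rightarrow> ('k::field, 'g, 'm::ab_group_add) ayd_data
      \<Rightarrow> 'm \<times> ('g \<Rightarrow>\<^sub>0 'k) list \<Rightarrow> ('k, 'g, 'm) tuples"
  where "tuple_cyc G N = (\<lambda>(m, bs).
    sweedler N fscale (\<lambda>m0 b. single1 (m0, gmult G (last bs) b # butlast bs)) m)"

definition Z_module ::
    "'g groupoid \<Rightarrow> ('k::field, 'g, 'm::ab_group_add) ayd_data
      \<Rightarrow> ('k, ('k, 'g, 'm) tuples set) cyclic_module"
  where "Z_module G N =
    \<lparr>deg = Z_deg G N,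
     face = (\<lambda>n k. Z_map G N (n - 1) (tuple_face G k)),
     degen = (\<lambda>n k. Z_map G N (Suc n) (tuple_degen k)),
     cyc = (\<lambda>n. Z_map G N n (tuple_cyc G N))\<rparr>"

end

theory Submission
  imports Defs
begin

text \<open>
  A tensor \<open>b\<^sub>0 \<otimes>\<^sub>R \<dots> \<otimes>\<^sub>R b\<^sub>n\<close> expands into lists of arrows with a common source. Let \<open>X\<close> be the set of
  arrows with source \<open>s(l)\<close> and \<open>H\<close> the centralizer of \<open>l\<close>. An element of \<open>M\<^bsub>[l]\<^esub>\<close> in degree \<open>g l g\<^sup>-\<^sup>1\<close>
  can be moved to degree \<open>l\<close> across \<open>\<otimes>\<^sub>B\<close>, so that \<open>Z\<^sub>n(B, M\<^bsub>[l]\<^esub>)\<close> is \<open>\<bbbK>[X\<^bsup>n+1\<^esup>] \<otimes>\<^sub>H M\<^sub>l\<close>, with cyclic operator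
  \<open>(x\<^sub>0, \<dots>, x\<^sub>n) \<mapsto> (x\<^sub>n l, x\<^sub>0, \<dots>, x\<^sub>n\<^sub>-\<^sub>1)\<close>; for \<open>X = H\<close> this is \<open>Z\<^sub>n(B\<^sub>l, M\<^sub>l)\<close>. Choosing an arrow \<open>c\<close> with
  \<open>c l c\<^sup>-\<^sup>1 = l'\<close> for every \<open>l' \<in> [l]\<close>, one gets an \<open>H\<close>-equivariant retraction \<open>r\<close> of \<open>X\<close> onto \<open>H\<close>, namely
  \<open>x \<mapsto> c\<^sup>-\<^sup>1 x\<close> where \<open>c\<close> belongs to \<open>x l x\<^sup>-\<^sup>1\<close>. It induces a surjective map from the cyclic module of \<open>X\<close> to
  that of \<open>H\<close>. The prism homotopy between \<open>r\<close> and the identity shows that its kernel is exact for \<open>b\<close>,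
  an extra degeneracy shows the same for \<open>b'\<close>, and hence the map is a quasi-isomorphism on the
  complexes for \<open>HH\<close> and, column by column, for \<open>HC\<close>.
\<close>

section \<open>Linear algebra on records\<close>

text \<open>The difficulty lies less in the homotopy than in reaching a place where it can be
  written down: a chain is a coset of formal sums of arbitrary tuples, and the cyclic operator uses
  an arbitrary representative of the coaction. Both are replaced by finitely supported functions. A
  tensor in \<open>N \<otimes>\<^sub>R B\<close> is determined by its components in the spaces
  \<open>s(g) N\<close>, so a coaction may be traded for the grading that it defines. A class in the
  cyclic module is determined by a function from lists of arrows to \<open>M_l\<close>, supported on
  one list from each orbit of the centralizer.

  The prism does not commute with the cyclic operator, so it is no homotopy of bicomplexes. This is
  why the comparison is a surjection whose kernel is exact in each column separately; the rows then
  enter only through the identities of the bicomplex.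

  The two sides of the theorem are never compared directly. The graded situation is axiomatized with
  the groupoid, the inverse and the set of degrees as parameters, and used twice: with the orbit of
  \<open>l\<close>, and over the centralizer with \<open>{l}\<close>. Both uses end in the same
  model over \<open>H\<close>.\<close>

locale lspace = abelian_group A for A :: "('k::field, 'v) module" (structure) +
  assumes smult_closed [simp, intro]: "x \<in> carrier A \<Longrightarrow> c \<odot> x \<in> carrier A"
    and smult_add_right: "\<lbrakk>x \<in> carrier A; y \<in> carrier A\<rbrakk> \<Longrightarrow> c \<odot> (x \<oplus> y) = c \<odot> x \<oplus> c \<odot> y"
    and smult_add_left: "x \<in> carrier A \<Longrightarrow> (c + d) \<odot> x = c \<odot> x \<oplus> d \<odot> x"
    and smult_smult: "x \<in> carrier A \<Longrightarrow> c \<odot> (d \<odot> x) = (c * d) \<odot> x"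
    and smult_one [simp]: "x \<in> carrier A \<Longrightarrow> 1 \<odot> x = x"
begin

lemma smult_zero_left [simp]: "x \<in> carrier A \<Longrightarrow> 0 \<odot> x = \<zero>"
proof -
  assume x: "x \<in> carrier A"
  have "0 \<odot> x \<oplus> 0 \<odot> x = 0 \<odot> x"
    using smult_add_left[OF x, of 0 0] by simp
  then show ?thesis
    using x by (simp add: add.l_cancel_one)
qed

lemma smult_zero_right [simp]: "c \<odot> \<zero> = \<zero>"
  using smult_smult[of \<zero> c 0] by simp

lemma smult_minus_one: "x \<in> carrier A \<Longrightarrow> (-1) \<odot> x = \<ominus> x"
proof -
  assume x: "x \<in> carrier A"
  have "(-1) \<odot> x \<oplus> x = \<zero>"
    using smult_add_left[OF x, of "-1" 1] x by simp
  then show ?thesis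
    using x by (metis minus_equality smult_closed)
qed

end

definition lsub :: "('k, 'v) module \<Rightarrow> 'v set \<Rightarrow> bool"
  where "lsub A U \<longleftrightarrow> U \<subseteq> carrier A \<and> \<zero>\<^bsub>A\<^esub> \<in> U \<and> (\<forall>x\<in>U. \<forall>y\<in>U. x \<oplus>\<^bsub>A\<^esub> y \<in> U) \<and>
    (\<forall>c. \<forall>x\<in>U. c \<odot>\<^bsub>A\<^esub> x \<in> U)"

definition lmap :: "('k, 'v) module \<Rightarrow> ('k, 'w) module \<Rightarrow> ('v \<Rightarrow> 'w) \<Rightarrow> bool"
  where "lmap A B f \<longleftrightarrow> (\<forall>x\<in>carrier A. f x \<in> carrier B) \<and>
    (\<forall>x\<in>carrier A. \<forall>y\<in>carrier A. f (x \<oplus>\<^bsub>A\<^esub> y) = f x \<oplus>\<^bsub>B\<^esub> f y) \<and>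
    (\<forall>c. \<forall>x\<in>carrier A. f (c \<odot>\<^bsub>A\<^esub> x) = c \<odot>\<^bsub>B\<^esub> f x)"

text \<open>Negation is expressed through \<open>(-1) \<odot> x\<close>, so that no inverse has to
  be named for quotients and direct sums. Only zero, addition and scalars are constrained, as the
  records leave \<open>mult\<close> and \<open>one\<close> undefined.\<close>

lemma lspaceI:
  fixes A :: "('k::field, 'v) module" (structure)
  assumes "\<And>x y. \<lbrakk>x \<in> carrier A; y \<in> carrier A\<rbrakk> \<Longrightarrow> x \<oplus> y \<in> carrier A"
    and "\<zero> \<in> carrier A"
    and "\<And>x y z. \<lbrakk>x \<in> carrier A; y \<in> carrier A; z \<in> carrier A\<rbrakk> \<Longrightarrow> (x \<oplus> y) \<oplus> z = x \<oplus> (y \<oplus> z)"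
    and "\<And>x y. \<lbrakk>x \<in> carrier A; y \<in> carrier A\<rbrakk> \<Longrightarrow> x \<oplus> y = y \<oplus> x"
    and "\<And>x. x \<in> carrier A \<Longrightarrow> \<zero> \<oplus> x = x"
    and "\<And>x. x \<in> carrier A \<Longrightarrow> (-1) \<odot> x \<oplus> x = \<zero>"
    and "\<And>x c. x \<in> carrier A \<Longrightarrow> c \<odot> x \<in> carrier A"
    and "\<And>x y c. \<lbrakk>x \<in> carrier A; y \<in> carrier A\<rbrakk> \<Longrightarrow> c \<odot> (x \<oplus> y) = c \<odot> x \<oplus> c \<odot> y"
    and "\<And>x c d. x \<in> carrier A \<Longrightarrow> (c + d) \<odot> x = c \<odot> x \<oplus> d \<odot> x"
    and "\<And>x c d. x \<in> carrier A \<Longrightarrow> c \<odot> (d \<odot> x) = (c * d) \<odot> x"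
    and "\<And>x. x \<in> carrier A \<Longrightarrow> 1 \<odot> x = x"
  shows "lspace A"
proof -
  have "abelian_group A"
  proof (rule abelian_groupI)
    fix x assume "x \<in> carrier A"
    then show "\<exists>y\<in>carrier A. y \<oplus> x = \<zero>"
      using assms(6,7) by blast
  qed (use assms in auto)
  then show ?thesis
    by (intro lspace.intro lspace_axioms.intro) (use assms in auto)
qed

lemma lmapI:
  assumes "\<And>x. x \<in> carrier A \<Longrightarrow> f x \<in> carrier B"
    and "\<And>x y. \<lbrakk>x \<in> carrier A; y \<in> carrier A\<rbrakk> \<Longrightarrow> f (x \<oplus>\<^bsub>A\<^esub> y) = f x \<oplus>\<^bsub>B\<^esub> f y"
    and "\<And>c x. x \<in> carrier A \<Longrightarrow> f (c \<odot>\<^bsub>A\<^esub> x) = c \<odot>\<^bsub>B\<^esub> f x"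
  shows "lmap A B f"
  using assms by (auto simp: lmap_def)

lemma lmap_closed: "\<lbrakk>lmap A B f; x \<in> carrier A\<rbrakk> \<Longrightarrow> f x \<in> carrier B"
  and lmap_add: "\<lbrakk>lmap A B f; x \<in> carrier A; y \<in> carrier A\<rbrakk> \<Longrightarrow> f (x \<oplus>\<^bsub>A\<^esub> y) = f x \<oplus>\<^bsub>B\<^esub> f y"
  and lmap_smult: "\<lbrakk>lmap A B f; x \<in> carrier A\<rbrakk> \<Longrightarrow> f (c \<odot>\<^bsub>A\<^esub> x) = c \<odot>\<^bsub>B\<^esub> f x"
  by (auto simp: lmap_def)

lemma lmap_zero:
  assumes "lmap A B f" "lspace A" "lspace B"
  shows "f \<zero>\<^bsub>A\<^esub> = \<zero>\<^bsub>B\<^esub>"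
proof -
  interpret A: lspace A by fact
  interpret B: lspace B by fact
  have "f (0 \<odot>\<^bsub>A\<^esub> \<zero>\<^bsub>A\<^esub>) = 0 \<odot>\<^bsub>B\<^esub> f \<zero>\<^bsub>A\<^esub>"
    by (rule lmap_smult[OF assms(1)]) simp
  then show ?thesis
    using lmap_closed[OF assms(1)] by simp
qed

lemma lmap_minus:
  assumes f: "lmap A B f" and A: "lspace A" and B: "lspace B" and x: "x \<in> carrier A" "y \<in> carrier A"
  shows "f (x \<ominus>\<^bsub>A\<^esub> y) = f x \<ominus>\<^bsub>B\<^esub> f y"
proof -
  interpret A: lspace A by fact
  interpret B: lspace B by fact
  show ?thesis
    unfolding a_minus_def A.smult_minus_one[OF x(2), symmetric]
      B.smult_minus_one[OF lmap_closed[OF f x(2)], symmetric]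
    using x by (simp add: lmap_add[OF f] lmap_smult[OF f])
qed

lemma lmap_finsum:
  assumes f: "lmap A B f" and A: "lspace A" and B: "lspace B"
    and "finite I" and "\<And>i. i \<in> I \<Longrightarrow> x i \<in> carrier A"
  shows "f (\<Oplus>\<^bsub>A\<^esub>i\<in>I. x i) = (\<Oplus>\<^bsub>B\<^esub>i\<in>I. f (x i))"
proof -
  interpret A: lspace A by fact
  interpret B: lspace B by fact
  show ?thesis
    using assms(4,5)
  proof (induction I rule: finite_induct)
    case empty
    then show ?case by (simp add: lmap_zero[OF f A B])
  next
    case (insert i I)
    have "x \<in> I \<rightarrow> carrier A" "(\<lambda>i. f (x i)) \<in> I \<rightarrow> carrier B"
      using insert.prems lmap_closed[OF f] by auto
    then show ?case
      using insert lmap_closed[OF f] by (simp add: lmap_add[OF f])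
  qed
qed

lemma lmap_smult_fun:
  assumes f: "lmap A B f" and B: "lspace B"
  shows "lmap A B (\<lambda>x. c \<odot>\<^bsub>B\<^esub> f x)"
proof -
  interpret B: lspace B by fact
  show ?thesis
    by (rule lmapI) (simp_all add: lmap_closed[OF f] lmap_add[OF f] lmap_smult[OF f]
        B.smult_add_right B.smult_smult mult.commute)
qed

lemma lmap_add_fun:
  assumes f: "lmap A B f" and g: "lmap A B g" and B: "lspace B"
  shows "lmap A B (\<lambda>x. f x \<oplus>\<^bsub>B\<^esub> g x)"
proof -
  interpret B: lspace B by fact
  show ?thesis
  proof (rule lmapI)
    fix x y assume xy: "x \<in> carrier A" "y \<in> carrier A"
    have "f x \<in> carrier B" "f y \<in> carrier B" "g x \<in> carrier B" "g y \<in> carrier B"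
      using xy f g by (auto simp: lmap_def)
    then show "f (x \<oplus>\<^bsub>A\<^esub> y) \<oplus>\<^bsub>B\<^esub> g (x \<oplus>\<^bsub>A\<^esub> y) = f x \<oplus>\<^bsub>B\<^esub> g x \<oplus>\<^bsub>B\<^esub> (f y \<oplus>\<^bsub>B\<^esub> g y)"
      unfolding lmap_add[OF f xy] lmap_add[OF g xy] by (simp add: B.a_ac)
  qed (use f g in \<open>auto simp: lmap_def B.smult_add_right\<close>)
qed

lemma lmap_finsum_fun:
  assumes "finite I" and f: "\<And>i. i \<in> I \<Longrightarrow> lmap A B (f i)" and B: "lspace B"
  shows "lmap A B (\<lambda>x. \<Oplus>\<^bsub>B\<^esub>i\<in>I. f i x)"
proof -
  interpret B: lspace B by fact
  have cl: "\<And>i x. i \<in> I \<Longrightarrow> x \<in> carrier A \<Longrightarrow> f i x \<in> carrier B"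
    using f by (auto simp: lmap_def)
  show ?thesis
  proof (rule lmapI)
    fix x assume x: "x \<in> carrier A"
    then show "(\<Oplus>\<^bsub>B\<^esub>i\<in>I. f i x) \<in> carrier B"
      using cl by (intro B.finsum_closed) auto
    fix c
    have "(\<Oplus>\<^bsub>B\<^esub>i\<in>I. f i (c \<odot>\<^bsub>A\<^esub> x)) = (\<Oplus>\<^bsub>B\<^esub>i\<in>I. c \<odot>\<^bsub>B\<^esub> f i x)"
      using f x cl by (intro B.finsum_cong') (auto simp: lmap_def)
    also have "\<dots> = c \<odot>\<^bsub>B\<^esub> (\<Oplus>\<^bsub>B\<^esub>i\<in>I. f i x)"
      by (rule lmap_finsum[symmetric, OF _ B B \<open>finite I\<close>])
        (use cl x in \<open>auto intro!: lmapI simp: B.smult_add_right B.smult_smult mult.commute\<close>)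
    finally show "(\<Oplus>\<^bsub>B\<^esub>i\<in>I. f i (c \<odot>\<^bsub>A\<^esub> x)) = c \<odot>\<^bsub>B\<^esub> (\<Oplus>\<^bsub>B\<^esub>i\<in>I. f i x)" .
  next
    fix x y assume x: "x \<in> carrier A" and y: "y \<in> carrier A"
    have "(\<Oplus>\<^bsub>B\<^esub>i\<in>I. f i (x \<oplus>\<^bsub>A\<^esub> y)) = (\<Oplus>\<^bsub>B\<^esub>i\<in>I. f i x \<oplus>\<^bsub>B\<^esub> f i y)"
      using f x y cl by (intro B.finsum_cong') (auto simp: lmap_def)
    also have "\<dots> = (\<Oplus>\<^bsub>B\<^esub>i\<in>I. f i x) \<oplus>\<^bsub>B\<^esub> (\<Oplus>\<^bsub>B\<^esub>i\<in>I. f i y)"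
      using x y cl by (intro B.finsum_addf) auto
    finally show "(\<Oplus>\<^bsub>B\<^esub>i\<in>I. f i (x \<oplus>\<^bsub>A\<^esub> y)) = (\<Oplus>\<^bsub>B\<^esub>i\<in>I. f i x) \<oplus>\<^bsub>B\<^esub> (\<Oplus>\<^bsub>B\<^esub>i\<in>I. f i y)" .
  qed
qed

lemma lmap_funpow: "lmap A A f \<Longrightarrow> lmap A A (f ^^ i)"
  by (induction i) (simp_all add: lmap_def)

lemma lmap_inv_into:
  assumes f: "lmap A B f" and b: "bij_betw f (carrier A) (carrier B)" and A: "lspace A"
  shows "lmap B A (inv_into (carrier A) f)" (is "lmap B A ?g")
proof -
  interpret A: lspace A by fact
  have g: "\<And>y. y \<in> carrier B \<Longrightarrow> ?g y \<in> carrier A" "\<And>y. y \<in> carrier B \<Longrightarrow> f (?g y) = y"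
    using b by (auto simp: bij_betw_def inv_into_into f_inv_into_f)
  have i: "\<And>x. x \<in> carrier A \<Longrightarrow> ?g (f x) = x"
    using b by (auto simp: bij_betw_def)
  show ?thesis
  proof (rule lmapI)
    fix x y assume "x \<in> carrier B" "y \<in> carrier B"
    then show "?g (x \<oplus>\<^bsub>B\<^esub> y) = ?g x \<oplus>\<^bsub>A\<^esub> ?g y"
      using i[of "?g x \<oplus>\<^bsub>A\<^esub> ?g y"] g by (simp add: lmap_add[OF f])
  next
    fix c x assume "x \<in> carrier B"
    then show "?g (c \<odot>\<^bsub>B\<^esub> x) = c \<odot>\<^bsub>A\<^esub> ?g x"
      using i[of "c \<odot>\<^bsub>A\<^esub> ?g x"] g by (simp add: lmap_smult[OF f])
  qed (use g in auto)
qed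

lemma lin_iso_iff: "lin_iso A C \<longleftrightarrow> (\<exists>f. bij_betw f (carrier A) (carrier C) \<and> lmap A C f)"
  unfolding lin_iso_def lmap_def by (intro ex_cong1) (auto dest: bij_betwE)

lemma lin_iso_sym:
  assumes "lspace A" and "lin_iso A B"
  shows "lin_iso B A"
proof -
  obtain f where f: "bij_betw f (carrier A) (carrier B)" "lmap A B f"
    using assms(2) by (auto simp: lin_iso_iff)
  then have "lmap B A (inv_into (carrier A) f)"
    using lmap_inv_into assms(1) by blast
  then show ?thesis
    using bij_betw_inv_into[OF f(1)] by (auto simp: lin_iso_iff)
qed

lemma lin_iso_trans: "\<lbrakk>lin_iso A B; lin_iso B C\<rbrakk> \<Longrightarrow> lin_iso A C"
  unfolding lin_iso_iff comp_def[symmetric]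
  by (elim exE conjE, rule exI, rule conjI, erule (1) bij_betw_trans) (simp add: lmap_def)

lemma lsub_lspace:
  assumes "lspace A" and "lsub A U"
  shows "lspace (A\<lparr>carrier := U\<rparr>)"
proof -
  interpret A: lspace A by fact
  have U: "\<And>x. x \<in> U \<Longrightarrow> x \<in> carrier A"
    using assms(2) by (auto simp: lsub_def)
  show ?thesis
    by (rule lspaceI) (use assms(2) U in \<open>auto simp: lsub_def A.a_ac A.smult_add_right
      A.smult_add_left A.smult_smult A.smult_minus_one A.r_neg\<close>)
qed

section \<open>Quotients by a subspace and maps between them\<close>

locale quotient = lspace A for A :: "('k::field, 'v) module" (structure) +
  fixes U :: "'v set"
  assumes sub: "lsub A U"
begin

abbreviation cls :: "'v \<Rightarrow> 'v set" where "cls x \<equiv> U +> x"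

lemma subgrp: "subgroup U (add_monoid A)"
proof
  fix x assume "x \<in> U"
  then have "\<ominus> x \<in> U"
    using sub smult_minus_one unfolding lsub_def by (metis subsetD)
  then show "inv\<^bsub>add_monoid A\<^esub> x \<in> U"
    by (simp add: a_inv_def)
qed (use sub in \<open>auto simp: lsub_def\<close>)

lemma sub_carrier: "x \<in> U \<Longrightarrow> x \<in> carrier A"
  using sub by (auto simp: lsub_def)

lemma in_cls_iff: "\<lbrakk>x \<in> carrier A; y \<in> carrier A\<rbrakk> \<Longrightarrow> y \<in> cls x \<longleftrightarrow> y \<ominus> x \<in> U"
proof
  assume x: "x \<in> carrier A" and y: "y \<in> carrier A"
  {
    assume "y \<in> cls x"
    then obtain u where u: "u \<in> U" "y = u \<oplus> x"
      by (auto simp: a_r_coset_def')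
    then have "y \<ominus> x = u"
      using x sub_carrier[of u] by (simp add: a_minus_def a_assoc r_neg)
    then show "y \<ominus> x \<in> U" using u by simp
  }
  assume "y \<ominus> x \<in> U"
  moreover have "y = (y \<ominus> x) \<oplus> x"
    using x y by (simp add: a_minus_def a_assoc l_neg)
  ultimately show "y \<in> cls x"
    by (auto simp: a_r_coset_def')
qed

lemma cls_self: "x \<in> carrier A \<Longrightarrow> x \<in> cls x"
  using sub by (auto simp: in_cls_iff lsub_def a_minus_def r_neg)

lemma cls_carrier: "\<lbrakk>x \<in> carrier A; y \<in> cls x\<rbrakk> \<Longrightarrow> y \<in> carrier A"
  using sub_carrier by (auto simp: a_r_coset_def')

lemma cls_eqI: "\<lbrakk>x \<in> carrier A; y \<in> cls x\<rbrakk> \<Longrightarrow> cls y = cls x"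
  using a_repr_independence'[OF _ _ subgrp, of y x] by (simp add: a_r_coset_def)

lemma cls_eq_iff: "\<lbrakk>x \<in> carrier A; y \<in> carrier A\<rbrakk> \<Longrightarrow> cls y = cls x \<longleftrightarrow> y \<ominus> x \<in> U"
  using cls_eqI in_cls_iff cls_self by metis

lemma quotient_carrier: "carrier (quotient_space A U) = cls ` carrier A"
  by (auto simp: quotient_space_def A_RCOSETS_def')

lemma cls_add:
  assumes "x \<in> carrier A" "y \<in> carrier A"
  shows "cls x \<oplus>\<^bsub>quotient_space A U\<^esub> cls y = cls (x \<oplus> y)"
proof -
  interpret N: normal U "add_monoid A"
    using subgrp a_comm_group comm_group.normal_iff_subgroup by blast
  show ?thesis
    using N.rcos_sum[of x y] assms
    by (simp add: quotient_space_def a_r_coset_def set_add_def)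
qed

lemma diff_smult: "\<lbrakk>x \<in> carrier A; y \<in> carrier A\<rbrakk> \<Longrightarrow> c \<odot> x \<ominus> c \<odot> y = c \<odot> (x \<ominus> y)"
  by (simp add: a_minus_def smult_minus_one[symmetric] smult_add_right smult_smult mult.commute)

lemma cls_smult:
  assumes "x \<in> carrier A"
  shows "c \<odot>\<^bsub>quotient_space A U\<^esub> cls x = cls (c \<odot> x)"
proof -
  have "cls (c \<odot> y) = cls (c \<odot> x)" if "y \<in> cls x" for y
    using that assms sub cls_carrier[OF assms that]
    by (auto simp: cls_eq_iff diff_smult in_cls_iff lsub_def)
  then have "(\<Union>y\<in>cls x. cls (c \<odot> y)) = cls (c \<odot> x)"
    using cls_self[OF assms] by blast
  then show ?thesis
    by (simp only: quotient_space_def module.simps)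
qed

lemma cls_zero: "\<zero>\<^bsub>quotient_space A U\<^esub> = cls \<zero>"
proof -
  have "U = cls \<zero>"
    using in_cls_iff[of \<zero>] sub_carrier cls_carrier[of \<zero>] smult_minus_one[of \<zero>]
    by (auto simp: a_minus_def)
  then show ?thesis
    by (simp add: quotient_space_def)
qed

lemma lspace_quotient: "lspace (quotient_space A U)"
  apply (rule lspaceI; (unfold quotient_carrier)?; (elim imageE)?;
      (simp only: cls_add cls_smult cls_zero a_closed smult_closed zero_closed)?)
  apply (simp_all add: smult_add_left smult_add_right smult_smult smult_minus_one l_neg a_assoc)
  apply (simp add: a_comm)
  done

end

text \<open>The equivalence \<open>ker\<close> does two jobs: \<open>U\<close> goes into
  \<open>V\<close>, which makes the induced map well defined, and nothing else does, which makes it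
  injective. Lifts are needed only modulo \<open>V\<close>.\<close>

lemma quotient_lin_iso:
  assumes A: "lspace A" and U: "lsub A U" and B: "lspace B" and V: "lsub B V"
    and f: "lmap A B f"
    and onto: "\<And>y. y \<in> carrier B \<Longrightarrow> \<exists>x\<in>carrier A. f x \<ominus>\<^bsub>B\<^esub> y \<in> V"
    and ker: "\<And>x. x \<in> carrier A \<Longrightarrow> f x \<in> V \<longleftrightarrow> x \<in> U"
  shows "lin_iso (quotient_space A U) (quotient_space B V)"
proof -
  interpret A: quotient A U by (rule quotient.intro) (use A U quotient_axioms.intro in auto)
  interpret B: quotient B V by (rule quotient.intro) (use B V quotient_axioms.intro in auto)
  \<comment> \<open>All members of a coset of \<open>U\<close> have images in one coset of
    \<open>V\<close>, so the union is that coset and no representative is chosen.\<close>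
  define F where "F X = (\<Union>x\<in>X. B.cls (f x))" for X
  have eq: "B.cls (f x) = B.cls (f y) \<longleftrightarrow> A.cls x = A.cls y"
    if "x \<in> carrier A" "y \<in> carrier A" for x y
    using that by (simp add: A.cls_eq_iff B.cls_eq_iff lmap_closed[OF f] ker
        lmap_minus[OF f A B, symmetric])
  have F: "F (A.cls x) = B.cls (f x)" if "x \<in> carrier A" for x
  proof -
    have "B.cls (f y) = B.cls (f x)" if "y \<in> A.cls x" for y
      using eq[of y x] A.cls_eqI[OF \<open>x \<in> carrier A\<close> that] A.cls_carrier[OF \<open>x \<in> carrier A\<close> that]
        \<open>x \<in> carrier A\<close> by simp
    then show ?thesis
      unfolding F_def using A.cls_self[OF that] by blast
  qed
  have "bij_betw F (carrier (quotient_space A U)) (carrier (quotient_space B V))"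
  proof (rule bij_betw_imageI)
    show "inj_on F (carrier (quotient_space A U))"
      unfolding A.quotient_carrier by (rule inj_onI, elim imageE) (simp only: F eq)
    have "B.cls y \<in> F ` A.cls ` carrier A" if y: "y \<in> carrier B" for y
    proof -
      obtain x where x: "x \<in> carrier A" "f x \<ominus>\<^bsub>B\<^esub> y \<in> V"
        using onto y by blast
      then have "F (A.cls x) = B.cls y"
        using y by (simp add: F B.cls_eq_iff lmap_closed[OF f])
      then show ?thesis using x by (metis imageI)
    qed
    moreover have "F ` A.cls ` carrier A \<subseteq> B.cls ` carrier B"
      using F lmap_closed[OF f] by (simp add: image_subset_iff)
    ultimately show "F ` carrier (quotient_space A U) = carrier (quotient_space B V)"
      unfolding A.quotient_carrier B.quotient_carrier by blast
  qed
  moreover have "lmap (quotient_space A U) (quotient_space B V) F"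
    by (rule lmapI; unfold A.quotient_carrier; elim imageE;
      simp only: F A.cls_add A.cls_smult B.cls_add B.cls_smult A.a_closed A.smult_closed
        lmap_closed[OF f] lmap_add[OF f] lmap_smult[OF f] B.quotient_carrier imageI)
  ultimately show ?thesis
    by (auto simp: lin_iso_iff)
qed

lemma lspace_direct_sum:
  assumes "\<And>i. i \<in> I \<Longrightarrow> lspace (A i)"
  shows "lspace (direct_sum I A)"
proof -
  have "\<And>i. i \<in> I \<Longrightarrow> abelian_group (A i)"
    using assms lspace.axioms(1) by blast
  then have ag: "\<And>i. i \<in> I \<Longrightarrow> abelian_monoid (A i)"
    using abelian_group.axioms(1) by blast
  show ?thesis
  proof (rule lspaceI, goal_cases)
    case (1 x y)
    then show ?case
      using ag by (auto simp: direct_sum_def PiE_iff intro!: abelian_monoid.a_closed)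
  next
    case 2
    then show ?case
      using ag by (auto simp: direct_sum_def intro!: abelian_monoid.zero_closed)
  next
    case (3 x y z)
    then show ?case
      using ag by (auto simp: direct_sum_def PiE_iff abelian_monoid.a_assoc intro!: restrict_ext)
  next
    case (4 x y)
    then show ?case
      using ag by (auto simp: direct_sum_def PiE_iff abelian_monoid.a_comm intro!: restrict_ext)
  next
    case (5 x)
    then show ?case
      using ag by (auto simp: direct_sum_def PiE_iff abelian_monoid.l_zero extensional_def)
  next
    case (6 x)
    have "(-1) \<odot>\<^bsub>A i\<^esub> x i \<oplus>\<^bsub>A i\<^esub> x i = \<zero>\<^bsub>A i\<^esub>" if i: "i \<in> I" for i
    proof -
      interpret lspace "A i" using assms i .
      show ?thesis
        using 6 i by (auto simp: direct_sum_def PiE_iff smult_minus_one l_neg)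
    qed
    then show ?case
      by (auto simp: direct_sum_def intro!: restrict_ext)
  qed (use assms in \<open>auto simp: direct_sum_def PiE_iff extensional_def lspace.smult_closed
      lspace.smult_add_right lspace.smult_add_left lspace.smult_smult lspace.smult_one intro!: restrict_ext\<close>)
qed

section \<open>Homology\<close>

lemma lsub_cycles:
  assumes D: "\<And>n. lspace (D n)" and e: "\<And>n. lmap (D (Suc n)) (D n) (e (Suc n))"
  shows "lsub (D n) {x \<in> carrier (D n). n = 0 \<or> e n x = \<zero>\<^bsub>D (n - 1)\<^esub>}"
proof (cases n)
  case 0
  interpret lspace "D 0" by fact
  show ?thesis using 0 by (auto simp: lsub_def)
next
  case (Suc m)
  interpret lspace "D (Suc m)" by fact
  interpret B: lspace "D m" by fact
  show ?thesis
    using Suc by (auto simp: lsub_def lmap_add[OF e] lmap_smult[OF e] lmap_zero[OF e D D])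
qed

lemma lsub_boundaries:
  assumes D: "\<And>n. lspace (D n)" and e: "\<And>n. lmap (D (Suc n)) (D n) (e (Suc n))"
    and ee: "\<And>n x. x \<in> carrier (D (Suc (Suc n))) \<Longrightarrow> e (Suc n) (e (Suc (Suc n)) x) = \<zero>\<^bsub>D n\<^esub>"
  shows "lsub ((D n)\<lparr>carrier := {x \<in> carrier (D n). n = 0 \<or> e n x = \<zero>\<^bsub>D (n - 1)\<^esub>}\<rparr>)
      (e (Suc n) ` carrier (D (Suc n)))"
proof -
  interpret lspace "D (Suc n)" by fact
  have "e n (e (Suc n) x) = \<zero>\<^bsub>D (n - 1)\<^esub>" if "x \<in> carrier (D (Suc n))" "n \<noteq> 0" for x
    using ee[of x "n - 1"] that by (cases n) auto
  moreover have "\<zero>\<^bsub>D n\<^esub> \<in> e (Suc n) ` carrier (D (Suc n))"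
    using lmap_zero[OF e D D, of n] zero_closed by (metis imageI)
  ultimately show ?thesis
    unfolding lsub_def
    by (auto simp: lmap_closed[OF e] lmap_add[OF e, symmetric] lmap_smult[OF e, symmetric])
qed

text \<open>A surjective chain map whose kernel is exact, degree 0 included, is a quasi-isomorphism.
  In place of a long exact sequence, cycles and bounding chains are lifted along \<open>f\<close>,
  and the error, which lies in the kernel, is corrected by \<open>ex\<close>.\<close>

lemma homology_lin_iso:
  fixes C :: "nat \<Rightarrow> ('k::field, 'v) module" and C' :: "nat \<Rightarrow> ('k, 'w) module"
  assumes C: "\<And>n. lspace (C n)" and C': "\<And>n. lspace (C' n)"
    and d: "\<And>n. lmap (C (Suc n)) (C n) (d (Suc n))"
    and d': "\<And>n. lmap (C' (Suc n)) (C' n) (d' (Suc n))"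
    and dd: "\<And>n x. x \<in> carrier (C (Suc (Suc n))) \<Longrightarrow> d (Suc n) (d (Suc (Suc n)) x) = \<zero>\<^bsub>C n\<^esub>"
    and f: "\<And>n. lmap (C n) (C' n) (f n)"
    and fd: "\<And>n x. x \<in> carrier (C (Suc n)) \<Longrightarrow> f n (d (Suc n) x) = d' (Suc n) (f (Suc n) x)"
    and onto: "\<And>n y. y \<in> carrier (C' n) \<Longrightarrow> \<exists>x\<in>carrier (C n). f n x = y"
    and ex: "\<And>n x. \<lbrakk>x \<in> carrier (C n); f n x = \<zero>\<^bsub>C' n\<^esub>; n = 0 \<or> d n x = \<zero>\<^bsub>C (n - 1)\<^esub>\<rbrakk>
      \<Longrightarrow> \<exists>y\<in>carrier (C (Suc n)). f (Suc n) y = \<zero>\<^bsub>C' (Suc n)\<^esub> \<and> d (Suc n) y = x"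
  shows "lspace (homology C d n) \<and> lin_iso (homology C d n) (homology C' d' n)"
proof -
  \<comment> \<open>Every element of the target lifts to the source, so this identity is inherited
    rather than assumed.\<close>
  have dd': "d' (Suc n) (d' (Suc (Suc n)) y) = \<zero>\<^bsub>C' n\<^esub>" if y: "y \<in> carrier (C' (Suc (Suc n)))" for n y
  proof -
    obtain x where x: "x \<in> carrier (C (Suc (Suc n)))" "f (Suc (Suc n)) x = y"
      using onto[OF y] by blast
    have "d' (Suc n) (d' (Suc (Suc n)) y) = f n (d (Suc n) (d (Suc (Suc n)) x))"
      unfolding x(2)[symmetric] fd[OF x(1), symmetric] by (rule fd[symmetric, OF lmap_closed[OF d x(1)]])
    then show ?thesis
      unfolding dd[OF x(1)] lmap_zero[OF f C C'] .
  qed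
  define A where "A = (C n)\<lparr>carrier := {x \<in> carrier (C n). n = 0 \<or> d n x = \<zero>\<^bsub>C (n - 1)\<^esub>}\<rparr>"
  define B where "B = (C' n)\<lparr>carrier := {x \<in> carrier (C' n). n = 0 \<or> d' n x = \<zero>\<^bsub>C' (n - 1)\<^esub>}\<rparr>"
  have A: "lspace A"
    unfolding A_def by (rule lsub_lspace[OF C lsub_cycles[where D = C and e = d, OF C d]])
  have B: "lspace B"
    unfolding B_def by (rule lsub_lspace[OF C' lsub_cycles[where D = C' and e = d', OF C' d']])
  have U: "lsub A (d (Suc n) ` carrier (C (Suc n)))"
    unfolding A_def by (rule lsub_boundaries[where D = C and e = d, OF C d dd])
  have V: "lsub B (d' (Suc n) ` carrier (C' (Suc n)))"
    unfolding B_def by (rule lsub_boundaries[where D = C' and e = d', OF C' d' dd'])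
  interpret Cn: lspace "C n" by fact
  interpret Cn': lspace "C' n" by fact
  interpret Bl: lspace B by fact
  have lin: "lmap A B (f n)"
  proof -
    have "f n x \<in> carrier B" if x: "x \<in> carrier A" for x
    proof (cases n)
      case (Suc m)
      then show ?thesis
        using x fd[of x m] lmap_closed[OF f, of x n] lmap_zero[OF f C C', of m] by (simp add: A_def B_def)
    qed (use x lmap_closed[OF f, of x n] in \<open>simp add: A_def B_def\<close>)
    then show ?thesis
      by (intro lmapI) (auto simp: A_def B_def lmap_add[OF f] lmap_smult[OF f])
  qed
  have "\<exists>x\<in>carrier A. f n x \<ominus>\<^bsub>B\<^esub> y \<in> d' (Suc n) ` carrier (C' (Suc n))" if y: "y \<in> carrier B" for y
  proof -
    have yC: "y \<in> carrier (C' n)" using y by (simp add: B_def)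
    then obtain x where x: "x \<in> carrier (C n)" "f n x = y"
      using onto[OF yC] by blast
    \<comment> \<open>The lift \<open>x\<close> need not be a cycle, but \<open>d n x\<close> is a
      cycle of the kernel. Exactness gives \<open>k\<close> in the kernel with the same
      differential, and \<open>x - k\<close> is a cycle over \<open>y\<close>.\<close>
    have "\<exists>k\<in>carrier (C n). f n k = \<zero>\<^bsub>C' n\<^esub> \<and> (n = 0 \<or> d n k = d n x)"
    proof (cases n)
      case 0
      then show ?thesis
        using lmap_zero[OF f C C', of 0] Cn.zero_closed by blast
    next
      case (Suc m)
      have "f m (d n x) = \<zero>\<^bsub>C' m\<^esub>"
        using fd[of x m] x y Suc by (simp add: B_def)
      moreover have "m = 0 \<or> d m (d n x) = \<zero>\<^bsub>C (m - 1)\<^esub>"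
        using dd[of x "m - 1"] x Suc by (cases m) auto
      ultimately have "\<exists>k\<in>carrier (C (Suc m)). f (Suc m) k = \<zero>\<^bsub>C' (Suc m)\<^esub> \<and> d (Suc m) k = d n x"
        using ex[of "d n x" m] x lmap_closed[OF d, of x m] Suc by blast
      then show ?thesis using Suc by auto
    qed
    then obtain k where k: "k \<in> carrier (C n)" "f n k = \<zero>\<^bsub>C' n\<^esub>" "n = 0 \<or> d n k = d n x"
      by blast
    have "n = 0 \<or> d n (x \<ominus>\<^bsub>C n\<^esub> k) = \<zero>\<^bsub>C (n - 1)\<^esub>"
    proof (cases n)
      case (Suc m)
      interpret Cm: lspace "C m" by fact
      show ?thesis
        using lmap_minus[OF d C C, of x m k] Suc x k lmap_closed[OF d, of x m]
        by (simp add: Cm.r_neg a_minus_def)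
    qed simp
    moreover have "x \<ominus>\<^bsub>C n\<^esub> k \<in> carrier (C n)"
      using x k by simp
    ultimately have xk: "x \<ominus>\<^bsub>C n\<^esub> k \<in> carrier A"
      unfolding A_def by simp
    have "f n (x \<ominus>\<^bsub>C n\<^esub> k) = f n x \<ominus>\<^bsub>C' n\<^esub> f n k"
      by (rule lmap_minus[OF f C C' x(1) k(1)])
    also have "\<dots> = y"
      using yC Cn'.smult_minus_one[of "\<zero>\<^bsub>C' n\<^esub>"] by (simp add: x(2) k(2) a_minus_def)
    finally have "f n (x \<ominus>\<^bsub>C n\<^esub> k) \<ominus>\<^bsub>B\<^esub> y = \<zero>\<^bsub>B\<^esub>"
      using y by (simp add: a_minus_def Bl.r_neg)
    then show ?thesis
      using V xk unfolding lsub_def by metis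
  qed
  moreover have "f n x \<in> d' (Suc n) ` carrier (C' (Suc n)) \<longleftrightarrow> x \<in> d (Suc n) ` carrier (C (Suc n))"
    if x: "x \<in> carrier A" for x
  proof
    assume "f n x \<in> d' (Suc n) ` carrier (C' (Suc n))"
    then obtain y where y: "y \<in> carrier (C (Suc n))" "f n x = d' (Suc n) (f (Suc n) y)"
      using onto by (metis imageE)
    have xC: "x \<in> carrier (C n)" using x by (simp add: A_def)
    have dy: "d (Suc n) y \<in> carrier (C n)" by (rule lmap_closed[OF d y(1)])
    \<comment> \<open>Lifting the bounding chain leaves a cycle of the kernel as the difference. It
      is the boundary of some \<open>w\<close>, and then \<open>x\<close> is the boundary of
      \<open>w + y\<close>.\<close>
    let ?z = "x \<ominus>\<^bsub>C n\<^esub> d (Suc n) y"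
    have "f n ?z = f n x \<ominus>\<^bsub>C' n\<^esub> f n (d (Suc n) y)"
      by (rule lmap_minus[OF f C C' xC dy])
    also have "\<dots> = \<zero>\<^bsub>C' n\<^esub>"
      using lmap_closed[OF f xC] by (simp add: fd[OF y(1)] y(2)[symmetric] a_minus_def Cn'.r_neg)
    finally have fz: "f n ?z = \<zero>\<^bsub>C' n\<^esub>" .
    have "n = 0 \<or> d n ?z = \<zero>\<^bsub>C (n - 1)\<^esub>"
    proof (cases n)
      case (Suc m)
      interpret Cm: lspace "C m" by fact
      have "d n ?z = d n x \<ominus>\<^bsub>C m\<^esub> d n (d (Suc n) y)"
        using lmap_minus[OF d C C] xC dy unfolding Suc by blast
      moreover have "d n (d (Suc n) y) = \<zero>\<^bsub>C m\<^esub>" "d n x = \<zero>\<^bsub>C m\<^esub>"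
        using Suc dd[of y m] y(1) x unfolding A_def by auto
      ultimately show ?thesis
        using Suc Cm.smult_minus_one[of "\<zero>\<^bsub>C m\<^esub>"] by (simp add: a_minus_def)
    qed simp
    then obtain w where w: "w \<in> carrier (C (Suc n))" "d (Suc n) w = ?z"
      using ex[OF Cn.minus_closed[OF xC dy] fz] by blast
    interpret Cs: lspace "C (Suc n)" by fact
    have "d (Suc n) (w \<oplus>\<^bsub>C (Suc n)\<^esub> y) = x"
      using xC dy by (simp add: lmap_add[OF d w(1) y(1)] w(2) a_minus_def Cn.a_assoc Cn.l_neg)
    then show "x \<in> d (Suc n) ` carrier (C (Suc n))"
      using Cs.a_closed[OF w(1) y(1)] by blast
  next
    assume "x \<in> d (Suc n) ` carrier (C (Suc n))"
    then show "f n x \<in> d' (Suc n) ` carrier (C' (Suc n))"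
    proof
      fix y assume y: "x = d (Suc n) y" "y \<in> carrier (C (Suc n))"
      show ?thesis
        unfolding y(1) fd[OF y(2)] by (rule imageI[OF lmap_closed[OF f y(2)]])
    qed
  qed
  ultimately have "lin_iso (quotient_space A (d (Suc n) ` carrier (C (Suc n))))
      (quotient_space B (d' (Suc n) ` carrier (C' (Suc n))))"
    by (rule quotient_lin_iso[OF A U B V lin])
  moreover have "lspace (quotient_space A (d (Suc n) ` carrier (C (Suc n))))"
    by (intro quotient.lspace_quotient quotient.intro quotient_axioms.intro A U)
  ultimately show ?thesis
    by (simp add: homology_def A_def B_def)
qed

section \<open>The bicomplex of a cyclic module\<close>

text \<open>Only linearity is recorded; the identities of a cyclic module enter as identities of the
  bicomplex in \<open>cyclic_quasi_iso\<close>. Faces start in degree \<open>Suc n\<close>, where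
  the truncated \<open>n - 1\<close> of the operators is a true predecessor.\<close>

locale linear_cyclic =
  fixes Z :: "('k::field, 'v) cyclic_module"
  assumes lspace_deg: "lspace (deg Z n)"
    and lmap_face: "k \<le> Suc n \<Longrightarrow> lmap (deg Z (Suc n)) (deg Z n) (face Z (Suc n) k)"
    and lmap_cyc: "lmap (deg Z n) (deg Z n) (cyc Z n)"
begin

lemma lmap_hoch_b: "lmap (deg Z (Suc n)) (deg Z n) (hoch_b Z (Suc n))"
proof -
  have "lmap (deg Z (Suc n)) (deg Z n)
    (\<lambda>x. \<Oplus>\<^bsub>deg Z n\<^esub>k\<in>{..Suc n}. (-1) ^ k \<odot>\<^bsub>deg Z n\<^esub> face Z (Suc n) k x)"
    by (rule lmap_finsum_fun[OF _ lmap_smult_fun[OF lmap_face lspace_deg] lspace_deg]) auto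
  then show ?thesis
    by (simp add: hoch_b_def[abs_def])
qed

lemma lmap_hoch_b': "lmap (deg Z (Suc n)) (deg Z n) (hoch_b' Z (Suc n))"
proof -
  have "lmap (deg Z (Suc n)) (deg Z n)
    (\<lambda>x. \<Oplus>\<^bsub>deg Z n\<^esub>k\<in>{..<Suc n}. (-1) ^ k \<odot>\<^bsub>deg Z n\<^esub> face Z (Suc n) k x)"
    by (rule lmap_finsum_fun[OF _ lmap_smult_fun[OF lmap_face lspace_deg] lspace_deg]) auto
  then show ?thesis
    by (simp add: hoch_b'_def[abs_def])
qed

lemma lmap_cyc_t: "lmap (deg Z n) (deg Z n) (cyc_t Z n)"
  using lmap_smult_fun[OF lmap_cyc[of n] lspace_deg] by (simp add: cyc_t_def[abs_def])

lemma lmap_cyc_N: "lmap (deg Z n) (deg Z n) (cyc_N Z n)"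
  using lmap_finsum_fun[OF finite_atMost lmap_funpow[OF lmap_cyc_t[of n]] lspace_deg] by (simp add: cyc_N_def[abs_def])

lemma lmap_vert: "lmap (deg Z (Suc q)) (deg Z q) (bicomplex_vert Z p (Suc q))"
  using lmap_hoch_b[of q] lmap_smult_fun[OF lmap_hoch_b'[of q] lspace_deg]
  by (cases "even p") (simp_all add: bicomplex_vert_def[abs_def])

lemma lmap_id: "lmap A A (\<lambda>x. x)"
  by (simp add: lmap_def)

lemma lmap_hor: "lmap (deg Z q) (deg Z q) (bicomplex_hor Z p q)"
  using lmap_cyc_N[of q] lmap_add_fun[OF lmap_id lmap_smult_fun[OF lmap_cyc_t[of q] lspace_deg] lspace_deg]
  by (cases "odd p") (simp_all add: bicomplex_hor_def[abs_def])

lemma lspace_tot: "lspace (tot Z n)"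
  unfolding tot_def by (rule lspace_direct_sum) (rule lspace_deg)

lemma carrier_tot: "carrier (tot Z n) = (\<Pi>\<^sub>E q\<in>{..n}. carrier (deg Z q))"
  by (simp add: tot_def direct_sum_def)

lemma zero_tot: "\<zero>\<^bsub>tot Z n\<^esub> = (\<lambda>q\<in>{..n}. \<zero>\<^bsub>deg Z q\<^esub>)"
  by (simp add: tot_def direct_sum_def)

lemma tot_diff_apply: "q \<le> n \<Longrightarrow> tot_diff Z (Suc n) x q =
    bicomplex_vert Z (n - q) (Suc q) (x (Suc q)) \<oplus>\<^bsub>deg Z q\<^esub> bicomplex_hor Z (Suc n - q) q (x q)"
  by (simp add: tot_diff_def)

lemma tot_carrier_apply: "\<lbrakk>x \<in> carrier (tot Z n); q \<le> n\<rbrakk> \<Longrightarrow> x q \<in> carrier (deg Z q)"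
  by (auto simp: carrier_tot)

lemma lmap_tot_diff: "lmap (tot Z (Suc n)) (tot Z n) (tot_diff Z (Suc n))"
proof (rule lmapI)
  note cl = lmap_closed[OF lmap_vert] lmap_closed[OF lmap_hor] tot_carrier_apply
  fix x assume x: "x \<in> carrier (tot Z (Suc n))"
  have "tot_diff Z (Suc n) x q \<in> carrier (deg Z q)" if q: "q \<le> n" for q
  proof -
    interpret lspace "deg Z q" by (rule lspace_deg)
    show ?thesis
      unfolding tot_diff_apply[OF q] using q by (intro a_closed cl(1,2) cl(3)[OF x]) auto
  qed
  then show "tot_diff Z (Suc n) x \<in> carrier (tot Z n)"
    unfolding carrier_tot by (auto simp: tot_diff_def)
  fix c
  have "tot_diff Z (Suc n) (c \<odot>\<^bsub>tot Z (Suc n)\<^esub> x) q = c \<odot>\<^bsub>deg Z q\<^esub> tot_diff Z (Suc n) x q"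
    if q: "q \<le> n" for q
  proof -
    interpret lspace "deg Z q" by (rule lspace_deg)
    have xc: "x q \<in> carrier (deg Z q)" "x (Suc q) \<in> carrier (deg Z (Suc q))"
      using q by (auto intro: tot_carrier_apply[OF x])
    have cx: "(c \<odot>\<^bsub>tot Z (Suc n)\<^esub> x) q = c \<odot>\<^bsub>deg Z q\<^esub> x q"
      "(c \<odot>\<^bsub>tot Z (Suc n)\<^esub> x) (Suc q) = c \<odot>\<^bsub>deg Z (Suc q)\<^esub> x (Suc q)"
      using q by (auto simp: tot_def direct_sum_def)
    show ?thesis
      unfolding tot_diff_apply[OF q] cx lmap_smult[OF lmap_vert xc(2)] lmap_smult[OF lmap_hor xc(1)]
      by (rule smult_add_right[symmetric, OF lmap_closed[OF lmap_vert xc(2)] lmap_closed[OF lmap_hor xc(1)]])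
  qed
  then show "tot_diff Z (Suc n) (c \<odot>\<^bsub>tot Z (Suc n)\<^esub> x) = c \<odot>\<^bsub>tot Z n\<^esub> tot_diff Z (Suc n) x"
    by (intro ext) (auto simp: tot_diff_def tot_def direct_sum_def)
next
  fix x y assume x: "x \<in> carrier (tot Z (Suc n))" and y: "y \<in> carrier (tot Z (Suc n))"
  have "tot_diff Z (Suc n) (x \<oplus>\<^bsub>tot Z (Suc n)\<^esub> y) q =
      tot_diff Z (Suc n) x q \<oplus>\<^bsub>deg Z q\<^esub> tot_diff Z (Suc n) y q"
    if q: "q \<le> n" for q
  proof -
    interpret lspace "deg Z q" by (rule lspace_deg)
    have xc: "x q \<in> carrier (deg Z q)" "x (Suc q) \<in> carrier (deg Z (Suc q))"
      using q by (auto intro: tot_carrier_apply[OF x])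
    have yc: "y q \<in> carrier (deg Z q)" "y (Suc q) \<in> carrier (deg Z (Suc q))"
      using q by (auto intro: tot_carrier_apply[OF y])
    have cx: "(x \<oplus>\<^bsub>tot Z (Suc n)\<^esub> y) q = x q \<oplus>\<^bsub>deg Z q\<^esub> y q"
      "(x \<oplus>\<^bsub>tot Z (Suc n)\<^esub> y) (Suc q) = x (Suc q) \<oplus>\<^bsub>deg Z (Suc q)\<^esub> y (Suc q)"
      using q by (auto simp: tot_def direct_sum_def)
    show ?thesis
      unfolding tot_diff_apply[OF q] cx lmap_add[OF lmap_vert xc(2) yc(2)] lmap_add[OF lmap_hor xc(1) yc(1)]
      using lmap_closed[OF lmap_vert xc(2)] lmap_closed[OF lmap_hor xc(1)]
        lmap_closed[OF lmap_vert yc(2)] lmap_closed[OF lmap_hor yc(1)]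
      by (simp add: a_ac)
  qed
  then show "tot_diff Z (Suc n) (x \<oplus>\<^bsub>tot Z (Suc n)\<^esub> y) =
      tot_diff Z (Suc n) x \<oplus>\<^bsub>tot Z n\<^esub> tot_diff Z (Suc n) y"
    by (intro ext) (auto simp: tot_diff_def tot_def direct_sum_def)
qed

end

section \<open>Maps of cyclic modules and of their total complexes\<close>

locale cyclic_map = src: linear_cyclic Z + tgt: linear_cyclic Z'
  for Z :: "('k::field, 'v) cyclic_module" and Z' :: "('k, 'w) cyclic_module" +
  fixes F :: "nat \<Rightarrow> 'v \<Rightarrow> 'w"
  assumes lmap_F: "lmap (deg Z n) (deg Z' n) (F n)"
    and F_face: "\<lbrakk>k \<le> Suc n; x \<in> carrier (deg Z (Suc n))\<rbrakk>
      \<Longrightarrow> F n (face Z (Suc n) k x) = face Z' (Suc n) k (F (Suc n) x)"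
    and F_cyc: "x \<in> carrier (deg Z n) \<Longrightarrow> F n (cyc Z n x) = cyc Z' n (F n x)"
begin

text \<open>The index set stays arbitrary to cover both \<open>b\<close> and \<open>b'\<close>,
  which differ only in the last face.\<close>

lemma F_signed_sum:
  assumes I: "finite I" "I \<subseteq> {..Suc n}" and x: "x \<in> carrier (deg Z (Suc n))"
  shows "F n (\<Oplus>\<^bsub>deg Z n\<^esub>k\<in>I. (-1) ^ k \<odot>\<^bsub>deg Z n\<^esub> face Z (Suc n) k x) =
    (\<Oplus>\<^bsub>deg Z' n\<^esub>k\<in>I. (-1) ^ k \<odot>\<^bsub>deg Z' n\<^esub> face Z' (Suc n) k (F (Suc n) x))"
proof -
  interpret A: lspace "deg Z n" by (rule src.lspace_deg)
  interpret B: lspace "deg Z' n" by (rule tgt.lspace_deg)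
  have fx: "face Z (Suc n) k x \<in> carrier (deg Z n)" if "k \<in> I" for k
    using that I by (intro lmap_closed[OF src.lmap_face x]) auto
  have fy: "face Z' (Suc n) k (F (Suc n) x) \<in> carrier (deg Z' n)" if "k \<in> I" for k
    using that I by (intro lmap_closed[OF tgt.lmap_face] lmap_closed[OF lmap_F x]) auto
  have "F n (\<Oplus>\<^bsub>deg Z n\<^esub>k\<in>I. (-1) ^ k \<odot>\<^bsub>deg Z n\<^esub> face Z (Suc n) k x) =
      (\<Oplus>\<^bsub>deg Z' n\<^esub>k\<in>I. F n ((-1) ^ k \<odot>\<^bsub>deg Z n\<^esub> face Z (Suc n) k x))"
    by (rule lmap_finsum[OF lmap_F src.lspace_deg tgt.lspace_deg I(1)]) (use fx in simp)
  also have "\<dots> = (\<Oplus>\<^bsub>deg Z' n\<^esub>k\<in>I. (-1) ^ k \<odot>\<^bsub>deg Z' n\<^esub> face Z' (Suc n) k (F (Suc n) x))"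
  proof (rule B.finsum_cong', goal_cases)
    case (3 k)
    then have "k \<le> Suc n" using I by auto
    show ?case
      unfolding lmap_smult[OF lmap_F fx[OF 3]] F_face[OF \<open>k \<le> Suc n\<close> x] ..
  qed (use fy in auto)
  finally show ?thesis .
qed

lemma F_cyc_t:
  assumes x: "x \<in> carrier (deg Z n)"
  shows "F n (cyc_t Z n x) = cyc_t Z' n (F n x)"
  unfolding cyc_t_def lmap_smult[OF lmap_F lmap_closed[OF src.lmap_cyc x]] F_cyc[OF x] ..

lemma F_funpow:
  assumes x: "x \<in> carrier (deg Z n)"
  shows "F n ((cyc_t Z n ^^ i) x) = (cyc_t Z' n ^^ i) (F n x)"
proof (induction i)
  case (Suc i)
  show ?case
    using F_cyc_t[OF lmap_closed[OF lmap_funpow[OF src.lmap_cyc_t] x]] Suc by simp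
qed simp

lemma F_cyc_N:
  assumes x: "x \<in> carrier (deg Z n)"
  shows "F n (cyc_N Z n x) = cyc_N Z' n (F n x)"
  unfolding cyc_N_def
  using lmap_finsum[OF lmap_F[of n] src.lspace_deg tgt.lspace_deg finite_atMost
      lmap_closed[OF lmap_funpow[OF src.lmap_cyc_t] x]]
  by (simp add: F_funpow[OF x])

lemma F_hoch_b:
  assumes x: "x \<in> carrier (deg Z (Suc n))"
  shows "F n (hoch_b Z (Suc n) x) = hoch_b Z' (Suc n) (F (Suc n) x)"
  unfolding hoch_b_def using F_signed_sum[OF _ _ x, of "{..Suc n}"] by simp

lemma F_vert:
  assumes x: "x \<in> carrier (deg Z (Suc q))"
  shows "F q (bicomplex_vert Z p (Suc q) x) = bicomplex_vert Z' p (Suc q) (F (Suc q) x)"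
  unfolding bicomplex_vert_def
  using F_hoch_b[OF x] lmap_smult[OF lmap_F lmap_closed[OF src.lmap_hoch_b' x]]
    F_signed_sum[OF _ _ x, of "{..<Suc q}"]
  by (simp add: hoch_b'_def lessThan_Suc_atMost)

lemma F_hor:
  assumes x: "x \<in> carrier (deg Z q)"
  shows "F q (bicomplex_hor Z p q x) = bicomplex_hor Z' p q (F q x)"
proof -
  interpret A: lspace "deg Z q" by (rule src.lspace_deg)
  note t = lmap_closed[OF src.lmap_cyc_t x]
  show ?thesis
    unfolding bicomplex_hor_def
    by (simp add: F_cyc_N[OF x] lmap_add[OF lmap_F x A.smult_closed[OF t]] lmap_smult[OF lmap_F t]
        F_cyc_t[OF x])
qed

definition F_tot :: "nat \<Rightarrow> (nat \<Rightarrow> 'v) \<Rightarrow> nat \<Rightarrow> 'w"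
  where "F_tot n x = (\<lambda>q\<in>{..n}. F q (x q))"

lemma lmap_F_tot: "lmap (tot Z n) (tot Z' n) (F_tot n)"
proof (rule lmapI)
  fix x assume x: "x \<in> carrier (tot Z n)"
  then show "F_tot n x \<in> carrier (tot Z' n)"
    unfolding src.carrier_tot tgt.carrier_tot F_tot_def using lmap_closed[OF lmap_F] by auto
  show "F_tot n (c \<odot>\<^bsub>tot Z n\<^esub> x) = c \<odot>\<^bsub>tot Z' n\<^esub> F_tot n x" for c
    using x unfolding F_tot_def
    by (intro ext) (auto simp: tot_def direct_sum_def intro!: lmap_smult[OF lmap_F])
next
  fix x y assume "x \<in> carrier (tot Z n)" "y \<in> carrier (tot Z n)"
  then show "F_tot n (x \<oplus>\<^bsub>tot Z n\<^esub> y) = F_tot n x \<oplus>\<^bsub>tot Z' n\<^esub> F_tot n y"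
    unfolding F_tot_def by (intro ext) (auto simp: tot_def direct_sum_def intro!: lmap_add[OF lmap_F])
qed

lemma F_tot_diff:
  assumes x: "x \<in> carrier (tot Z (Suc n))"
  shows "F_tot n (tot_diff Z (Suc n) x) = tot_diff Z' (Suc n) (F_tot (Suc n) x)"
proof
  fix q
  show "F_tot n (tot_diff Z (Suc n) x) q = tot_diff Z' (Suc n) (F_tot (Suc n) x) q"
  proof (cases "q \<le> n")
    case True
    have xc: "x q \<in> carrier (deg Z q)" "x (Suc q) \<in> carrier (deg Z (Suc q))"
      using True by (auto intro: src.tot_carrier_apply[OF x])
    show ?thesis
      using True unfolding tgt.tot_diff_apply[OF True]
      by (simp add: F_tot_def src.tot_diff_apply[OF True] F_vert[OF xc(2)] F_hor[OF xc(1)]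
          lmap_add[OF lmap_F lmap_closed[OF src.lmap_vert xc(2)] lmap_closed[OF src.lmap_hor xc(1)]])
  qed (simp add: F_tot_def tot_diff_def)
qed

end

text \<open>The identities of the bicomplex are demanded of the source alone; the target inherits
  what the homology argument uses through surjectivity. \<open>kernel_exact\<close> speaks of one
  column at a time and asks for no compatibility with the rows. Squares anticommute because of the
  sign on \<open>b'\<close> in odd columns.\<close>

locale cyclic_quasi_iso = cyclic_map Z Z' F
  for Z :: "('k::field, 'v) cyclic_module" and Z' :: "('k, 'w) cyclic_module" and F +
  assumes vert_vert: "x \<in> carrier (deg Z (Suc (Suc q))) \<Longrightarrow>
      bicomplex_vert Z p (Suc q) (bicomplex_vert Z p (Suc (Suc q)) x) = \<zero>\<^bsub>deg Z q\<^esub>"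
    and hor_hor: "\<lbrakk>x \<in> carrier (deg Z q); p > 0\<rbrakk> \<Longrightarrow>
      bicomplex_hor Z p q (bicomplex_hor Z (Suc p) q x) = \<zero>\<^bsub>deg Z q\<^esub>"
    and vert_hor: "x \<in> carrier (deg Z (Suc q)) \<Longrightarrow>
      bicomplex_vert Z p (Suc q) (bicomplex_hor Z (Suc p) (Suc q) x) \<oplus>\<^bsub>deg Z q\<^esub>
      bicomplex_hor Z (Suc p) q (bicomplex_vert Z (Suc p) (Suc q) x) = \<zero>\<^bsub>deg Z q\<^esub>"
    and F_onto: "y \<in> carrier (deg Z' n) \<Longrightarrow> \<exists>x\<in>carrier (deg Z n). F n x = y"
    and kernel_exact: "\<lbrakk>x \<in> carrier (deg Z q); F q x = \<zero>\<^bsub>deg Z' q\<^esub>;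
        q = 0 \<or> bicomplex_vert Z p q x = \<zero>\<^bsub>deg Z (q - 1)\<^esub>\<rbrakk>
      \<Longrightarrow> \<exists>y\<in>carrier (deg Z (Suc q)). F (Suc q) y = \<zero>\<^bsub>deg Z' (Suc q)\<^esub> \<and> bicomplex_vert Z p (Suc q) y = x"
begin

text \<open>Column 0 is the Hochschild complex, so exactness of the columns already covers
  \<open>HH\<close>.\<close>

lemma vert_0: "bicomplex_vert Z'' 0 = hoch_b Z''"
  by (intro ext) (simp add: bicomplex_vert_def)

lemma HH_iso: "lspace (HH Z n) \<and> lin_iso (HH Z n) (HH Z' n)"
  unfolding HH_def vert_0[symmetric]
  by (rule homology_lin_iso[where f = F])
    (rule src.lspace_deg tgt.lspace_deg src.lmap_vert tgt.lmap_vert vert_vert lmap_F F_vert F_onto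
      kernel_exact; assumption)+

lemma tot_diff_tot_diff:
  assumes x: "x \<in> carrier (tot Z (Suc (Suc n)))"
  shows "tot_diff Z (Suc n) (tot_diff Z (Suc (Suc n)) x) = \<zero>\<^bsub>tot Z n\<^esub>"
proof
  fix q
  show "tot_diff Z (Suc n) (tot_diff Z (Suc (Suc n)) x) q = \<zero>\<^bsub>tot Z n\<^esub> q"
  proof (cases "q \<le> n")
    case True
    interpret lspace "deg Z q" by (rule src.lspace_deg)
    have xc: "x q \<in> carrier (deg Z q)" "x (Suc q) \<in> carrier (deg Z (Suc q))"
      "x (Suc (Suc q)) \<in> carrier (deg Z (Suc (Suc q)))"
      using True by (auto intro: src.tot_carrier_apply[OF x])
    define p where "p = n - q"
    have p: "Suc n - q = Suc p" "Suc (Suc n) - q = Suc (Suc p)" "Suc n - Suc q = p"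
      "Suc (Suc n) - Suc q = Suc p"
      using True by (auto simp: p_def)
    have le: "q \<le> Suc n" "Suc q \<le> Suc n" using True by auto
    note cl = lmap_closed[OF src.lmap_vert] lmap_closed[OF src.lmap_hor]
    have "tot_diff Z (Suc n) (tot_diff Z (Suc (Suc n)) x) q =
      bicomplex_vert Z p (Suc q) (bicomplex_vert Z p (Suc (Suc q)) (x (Suc (Suc q)))
         \<oplus>\<^bsub>deg Z (Suc q)\<^esub> bicomplex_hor Z (Suc p) (Suc q) (x (Suc q))) \<oplus>\<^bsub>deg Z q\<^esub>
      bicomplex_hor Z (Suc p) q (bicomplex_vert Z (Suc p) (Suc q) (x (Suc q))
         \<oplus>\<^bsub>deg Z q\<^esub> bicomplex_hor Z (Suc (Suc p)) q (x q))"
      unfolding src.tot_diff_apply[OF True] src.tot_diff_apply[OF le(1)] src.tot_diff_apply[OF le(2)]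
        p p_def[symmetric] ..
    also have "\<dots> = (\<zero>\<^bsub>deg Z q\<^esub> \<oplus>\<^bsub>deg Z q\<^esub> bicomplex_vert Z p (Suc q) (bicomplex_hor Z (Suc p) (Suc q) (x (Suc q))))
       \<oplus>\<^bsub>deg Z q\<^esub> (bicomplex_hor Z (Suc p) q (bicomplex_vert Z (Suc p) (Suc q) (x (Suc q))) \<oplus>\<^bsub>deg Z q\<^esub> \<zero>\<^bsub>deg Z q\<^esub>)"
      unfolding lmap_add[OF src.lmap_vert cl(1)[OF xc(3)] cl(2)[OF xc(2)]]
        lmap_add[OF src.lmap_hor cl(1)[OF xc(2)] cl(2)[OF xc(1)]] vert_vert[OF xc(3)]
        hor_hor[OF xc(1) zero_less_Suc] ..
    also have "\<dots> = \<zero>\<^bsub>deg Z q\<^esub>"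
      using vert_hor[OF xc(2), of p] cl(1)[OF cl(2)[OF xc(2)]] cl(2)[OF cl(1)[OF xc(2)]] by simp
    finally show ?thesis
      using True by (simp add: src.zero_tot)
  qed (simp add: src.zero_tot tot_diff_def)
qed

lemma F_tot_onto:
  assumes y: "y \<in> carrier (tot Z' n)"
  shows "\<exists>x\<in>carrier (tot Z n). F_tot n x = y"
proof -
  have "\<forall>q\<in>{..n}. \<exists>a. a \<in> carrier (deg Z q) \<and> F q a = y q"
    using F_onto tgt.tot_carrier_apply[OF y] by blast
  then obtain x where x: "\<And>q. q \<le> n \<Longrightarrow> x q \<in> carrier (deg Z q) \<and> F q (x q) = y q"
    by (metis atMost_iff)
  have "restrict x {..n} \<in> carrier (tot Z n)"
    using x by (auto simp: src.carrier_tot)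
  moreover have "F_tot n (restrict x {..n}) = y"
    using x y by (intro ext) (auto simp: F_tot_def tgt.carrier_tot PiE_iff extensional_def)
  ultimately show ?thesis by blast
qed

text \<open>The kernel bicomplex lies in the first quadrant and has exact columns, so its total
  complex is exact. A preimage is built from row 0 upwards: once \<open>y 0, ..., y m\<close> are
  known, row \<open>m\<close> of the equation prescribes the vertical differential of
  \<open>y (Suc m)\<close> in column \<open>n - m\<close>.\<close>

lemma tot_kernel_exact:
  assumes x: "x \<in> carrier (tot Z n)" and Fx: "F_tot n x = \<zero>\<^bsub>tot Z' n\<^esub>"
    and dx: "n = 0 \<or> tot_diff Z n x = \<zero>\<^bsub>tot Z (n - 1)\<^esub>"
  shows "\<exists>y\<in>carrier (tot Z (Suc n)). F_tot (Suc n) y = \<zero>\<^bsub>tot Z' (Suc n)\<^esub> \<and> tot_diff Z (Suc n) y = x"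
proof -
  have Fx': "F q (x q) = \<zero>\<^bsub>deg Z' q\<^esub>" if "q \<le> n" for q
    using fun_cong[OF Fx, of q] that by (simp add: F_tot_def tgt.zero_tot)
  note cl = lmap_closed[OF src.lmap_vert] lmap_closed[OF src.lmap_hor]
  have "\<exists>y. (\<forall>q\<le>m. y q \<in> carrier (deg Z q) \<and> F q (y q) = \<zero>\<^bsub>deg Z' q\<^esub>) \<and>
      (\<forall>q<m. bicomplex_vert Z (n - q) (Suc q) (y (Suc q)) \<oplus>\<^bsub>deg Z q\<^esub> bicomplex_hor Z (Suc n - q) q (y q) = x q)"
    if "m \<le> Suc n" for m
    using that
  proof (induction m)
    case 0
    interpret lspace "deg Z 0" by (rule src.lspace_deg)
    \<comment> \<open>No equation determines \<open>y 0\<close>, so zero is a legitimate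
      start.\<close>
    show ?case
      using lmap_zero[OF lmap_F src.lspace_deg tgt.lspace_deg, of 0]
      by (intro exI[of _ "\<lambda>_. \<zero>\<^bsub>deg Z 0\<^esub>"]) auto
  next
    case (Suc m)
    then obtain y where y: "\<And>q. q \<le> m \<Longrightarrow> y q \<in> carrier (deg Z q)"
      "\<And>q. q \<le> m \<Longrightarrow> F q (y q) = \<zero>\<^bsub>deg Z' q\<^esub>"
      "\<And>q. q < m \<Longrightarrow> bicomplex_vert Z (n - q) (Suc q) (y (Suc q)) \<oplus>\<^bsub>deg Z q\<^esub>
         bicomplex_hor Z (Suc n - q) q (y q) = x q"
      by auto
    have m: "m \<le> n" using Suc.prems by simp
    interpret lspace "deg Z m" by (rule src.lspace_deg)
    interpret B: lspace "deg Z' m" by (rule tgt.lspace_deg)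
    have xm: "x m \<in> carrier (deg Z m)" using src.tot_carrier_apply[OF x m] .
    have ym: "y m \<in> carrier (deg Z m)" using y(1) by simp
    let ?h = "bicomplex_hor Z (Suc n - m) m (y m)"
    have h: "?h \<in> carrier (deg Z m)" by (rule cl(2)[OF ym])
    have "F m ?h = \<zero>\<^bsub>deg Z' m\<^esub>"
      unfolding F_hor[OF ym] y(2)[OF order_refl]
      by (rule lmap_zero[OF tgt.lmap_hor tgt.lspace_deg tgt.lspace_deg])
    then have Fz: "F m (x m \<ominus>\<^bsub>deg Z m\<^esub> ?h) = \<zero>\<^bsub>deg Z' m\<^esub>"
      unfolding lmap_minus[OF lmap_F src.lspace_deg tgt.lspace_deg xm h] Fx'[OF m]
      by (simp add: a_minus_def B.r_neg)
    \<comment> \<open>The right-hand side must be a vertical cycle. Row \<open>j = m - 1\<close> of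
      \<open>dx\<close> says that \<open>?a\<close> and the horizontal image of \<open>x j\<close>
      add up to 0. Inserting the equation solved in row \<open>j\<close> turns that image into
      \<open>?c\<close>, since two horizontal maps compose to 0. Anticommutativity gives
      \<open>?b + ?c = 0\<close>, hence \<open>?a = ?b\<close>.\<close>
    have "bicomplex_vert Z (n - m) m (x m \<ominus>\<^bsub>deg Z m\<^esub> ?h) = \<zero>\<^bsub>deg Z (m - 1)\<^esub>" if m0: "m \<noteq> 0"
    proof -
      obtain j where j: "m = Suc j" using m0 by (cases m) auto
      define p where "p = n - m"
      have p: "n - j = Suc p" "Suc n - m = Suc p" "Suc n - j = Suc (Suc p)" "n - 1 - j = p"
        "n - m = p" using j m by (auto simp: p_def)
      have n: "n = Suc (n - 1)" "j \<le> n - 1" using j m by auto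
      interpret J: lspace "deg Z j" by (rule src.lspace_deg)
      have yj: "y j \<in> carrier (deg Z j)" and xj: "x j \<in> carrier (deg Z j)"
        using y(1) j m src.tot_carrier_apply[OF x] by auto
      have ym': "y m \<in> carrier (deg Z (Suc j))" and xm': "x m \<in> carrier (deg Z (Suc j))"
        and h': "?h \<in> carrier (deg Z (Suc j))"
        using ym xm h j by auto
      let ?a = "bicomplex_vert Z p m (x m)" and ?b = "bicomplex_vert Z p m ?h"
        and ?c = "bicomplex_hor Z (Suc p) j (bicomplex_vert Z (Suc p) m (y m))"
      have ca: "?a \<in> carrier (deg Z j)" "?b \<in> carrier (deg Z j)" "?c \<in> carrier (deg Z j)"
        unfolding j using cl(1)[OF xm'] cl(1)[OF h'] cl(2)[OF cl(1)[OF ym']] j by auto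
      have bc: "?b \<oplus>\<^bsub>deg Z j\<^esub> ?c = \<zero>\<^bsub>deg Z j\<^esub>"
        using vert_hor[OF ym', of p] unfolding p(2) j(1)[symmetric] .
      have "?c = bicomplex_hor Z (Suc p) j (x j)"
      proof -
        have "bicomplex_hor Z (Suc p) j (x j) = bicomplex_hor Z (Suc p) j
            (bicomplex_vert Z (Suc p) m (y m) \<oplus>\<^bsub>deg Z j\<^esub> bicomplex_hor Z (Suc (Suc p)) j (y j))"
          using y(3)[of j] j p by simp
        also have "\<dots> = ?c \<oplus>\<^bsub>deg Z j\<^esub> \<zero>\<^bsub>deg Z j\<^esub>"
          unfolding j lmap_add[OF src.lmap_hor cl(1)[OF ym'[unfolded j]] cl(2)[OF yj]]
            hor_hor[OF yj zero_less_Suc] ..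
        also have "\<dots> = ?c" using ca by simp
        finally show ?thesis by simp
      qed
      moreover have "?a \<oplus>\<^bsub>deg Z j\<^esub> bicomplex_hor Z (Suc p) j (x j) = \<zero>\<^bsub>deg Z j\<^esub>"
      proof -
        have "tot_diff Z n x j = \<zero>\<^bsub>deg Z j\<^esub>"
          using dx n by (simp add: src.zero_tot)
        moreover have "tot_diff Z n x j = ?a \<oplus>\<^bsub>deg Z j\<^esub> bicomplex_hor Z (Suc p) j (x j)"
          using n(2) p j by (simp add: tot_diff_def)
        ultimately show ?thesis by simp
      qed
      ultimately have ac: "?a \<oplus>\<^bsub>deg Z j\<^esub> ?c = \<zero>\<^bsub>deg Z j\<^esub>" by simp
      have "?a = ?b"
        using J.minus_equality[OF ac ca(3) ca(1)] J.minus_equality[OF bc ca(3) ca(2)] by simp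
      then have "?a \<ominus>\<^bsub>deg Z j\<^esub> ?b = \<zero>\<^bsub>deg Z j\<^esub>"
        using ca by (simp add: a_minus_def J.r_neg)
      moreover have "bicomplex_vert Z p (Suc j) (x m \<ominus>\<^bsub>deg Z (Suc j)\<^esub> ?h) = 
          bicomplex_vert Z p (Suc j) (x m) \<ominus>\<^bsub>deg Z j\<^esub> bicomplex_vert Z p (Suc j) ?h"
        by (rule lmap_minus[OF src.lmap_vert src.lspace_deg src.lspace_deg xm' h'])
      ultimately show ?thesis
        using j p by simp
    qed
    then have z: "m = 0 \<or> bicomplex_vert Z (n - m) m (x m \<ominus>\<^bsub>deg Z m\<^esub> ?h) = \<zero>\<^bsub>deg Z (m - 1)\<^esub>"
      by metis
    obtain w where w: "w \<in> carrier (deg Z (Suc m))" "F (Suc m) w = \<zero>\<^bsub>deg Z' (Suc m)\<^esub>"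
      "bicomplex_vert Z (n - m) (Suc m) w = x m \<ominus>\<^bsub>deg Z m\<^esub> ?h"
      using kernel_exact[OF minus_closed[OF xm h] Fz z] by blast
    have "bicomplex_vert Z (n - m) (Suc m) w \<oplus>\<^bsub>deg Z m\<^esub> ?h = x m"
      unfolding w(3) using xm h by (simp add: a_minus_def a_assoc l_neg)
    then show ?case
      using y w by (intro exI[of _ "y(Suc m := w)"]) (auto simp: less_Suc_eq le_Suc_eq)
  qed
  from this[of "Suc n"] obtain y where y: "\<And>q. q \<le> Suc n \<Longrightarrow> y q \<in> carrier (deg Z q)"
      "\<And>q. q \<le> Suc n \<Longrightarrow> F q (y q) = \<zero>\<^bsub>deg Z' q\<^esub>"
      "\<And>q. q \<le> n \<Longrightarrow> bicomplex_vert Z (n - q) (Suc q) (y (Suc q)) \<oplus>\<^bsub>deg Z q\<^esub>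
         bicomplex_hor Z (Suc n - q) q (y q) = x q"
    by (auto simp: less_Suc_eq_le)
  let ?y = "restrict y {..Suc n}"
  have "?y \<in> carrier (tot Z (Suc n))"
    using y(1) by (auto simp: src.carrier_tot)
  moreover have "F_tot (Suc n) ?y = \<zero>\<^bsub>tot Z' (Suc n)\<^esub>"
    using y(2) by (intro ext) (simp add: F_tot_def tgt.zero_tot)
  moreover have "tot_diff Z (Suc n) ?y = x"
  proof
    fix q
    show "tot_diff Z (Suc n) ?y q = x q"
      using y(3)[of q] x by (cases "q \<le> n")
        (auto simp: src.tot_diff_apply tot_diff_def src.carrier_tot PiE_iff extensional_def)
  qed
  ultimately show ?thesis by blast
qed

lemma HC_iso: "lspace (HC Z n) \<and> lin_iso (HC Z n) (HC Z' n)"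
  unfolding HC_def
  by (rule homology_lin_iso[where f = F_tot])
    (rule src.lspace_tot tgt.lspace_tot src.lmap_tot_diff tgt.lmap_tot_diff tot_diff_tot_diff
      lmap_F_tot F_tot_diff F_tot_onto tot_kernel_exact; assumption)+

end

section \<open>Linear extension\<close>

lemma lookup_fscale [simp]: "Poly_Mapping.lookup (fscale c t) a = c * Poly_Mapping.lookup t a"
  by (simp add: fscale_def Poly_Mapping.map.rep_eq when_def)

text \<open>\<open>'a \<Rightarrow>\<^sub>0 'm\<close> with vectors as coefficients stands for a
  direct sum of copies of \<open>'m\<close> indexed by \<open>'a\<close>; scalars act on the
  coefficients through \<open>sc\<close>.\<close>

definition pscale :: "('k \<Rightarrow> 'm \<Rightarrow> 'm::zero) \<Rightarrow> 'k \<Rightarrow> ('a \<Rightarrow>\<^sub>0 'm) \<Rightarrow> ('a \<Rightarrow>\<^sub>0 'm)"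
  where "pscale sc c = Poly_Mapping.map (sc c)"

lemma vector_space_scale_zero: "vector_space sc \<Longrightarrow> sc c 0 = 0"
  using module.scale_zero_right vector_space_def by (metis module_def vector_space.vector_space_assms(1) add_cancel_right_left)

lemma lookup_pscale: "vector_space sc \<Longrightarrow>
    Poly_Mapping.lookup (pscale sc c t) a = sc c (Poly_Mapping.lookup t a)"
  by (simp add: pscale_def Poly_Mapping.map.rep_eq when_def vector_space_scale_zero)

lemma vector_space_pscale: "vector_space sc \<Longrightarrow> vector_space (pscale sc)"
  by (unfold_locales; rule poly_mapping_eqI)
    (simp_all add: lookup_pscale lookup_add vector_space.vector_space_assms)

interpretation fs: vector_space fscale
  by (unfold_locales; rule poly_mapping_eqI) (simp_all add: lookup_add algebra_simps)

lemma fscale_single [simp]: "fscale c (Poly_Mapping.single a d) = Poly_Mapping.single a (c * d)"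
  by (rule poly_mapping_eqI) (simp add: lookup_single when_def)

lemma keys_fscale: "Poly_Mapping.keys (fscale c t) \<subseteq> Poly_Mapping.keys t"
  by (auto simp: in_keys_iff)

lemma keys_pscale: "vector_space sc \<Longrightarrow> Poly_Mapping.keys (pscale sc c t) \<subseteq> Poly_Mapping.keys t"
  by (auto simp: in_keys_iff lookup_pscale vector_space_scale_zero)

lemma pscale_single: "vector_space sc \<Longrightarrow>
    pscale sc c (Poly_Mapping.single a m) = Poly_Mapping.single a (sc c m)"
  by (rule poly_mapping_eqI) (simp add: lookup_pscale lookup_single when_def vector_space_scale_zero)

lemma lin_ext_superset:
  assumes "vector_space sc" "finite S" "Poly_Mapping.keys t \<subseteq> S"
  shows "lin_ext sc f t = (\<Sum>a\<in>S. sc (Poly_Mapping.lookup t a) (f a))"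
proof -
  interpret vector_space sc by fact
  show ?thesis
    unfolding lin_ext_def using assms
    by (intro sum.mono_neutral_left) (auto simp: in_keys_iff)
qed

lemma lin_ext_zero [simp]: "lin_ext sc f 0 = 0"
  by (simp add: lin_ext_def)

lemma lin_ext_single [simp]:
  assumes "vector_space sc"
  shows "lin_ext sc f (Poly_Mapping.single a c) = sc c (f a)"
proof -
  interpret vector_space sc by fact
  show ?thesis
    by (simp add: lin_ext_superset[OF assms, of "{a}"])
qed

lemma lin_ext_single1 [simp]:
  assumes "vector_space sc"
  shows "lin_ext sc f (single1 a) = f a"
proof -
  interpret vector_space sc by fact
  show ?thesis by (simp add: assms)
qed

lemma lin_ext_add:
  assumes "vector_space sc"
  shows "lin_ext sc f (t + u) = lin_ext sc f t + lin_ext sc f u"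
proof -
  interpret vector_space sc by fact
  let ?S = "Poly_Mapping.keys t \<union> Poly_Mapping.keys u"
  have "Poly_Mapping.keys (t + u) \<subseteq> ?S" by (rule keys_add)
  then show ?thesis
    by (simp add: lin_ext_superset[OF assms, of ?S] lookup_add scale_left_distrib sum.distrib)
qed

lemma lin_ext_scale:
  assumes "vector_space sc"
  shows "lin_ext sc f (fscale c t) = sc c (lin_ext sc f t)"
proof -
  interpret vector_space sc by fact
  show ?thesis
    using keys_fscale[of c t]
    by (simp add: lin_ext_superset[OF assms, of "Poly_Mapping.keys t"] scale_sum_right)
qed

lemma lin_ext_minus:
  assumes "vector_space sc"
  shows "lin_ext sc f (- t) = - lin_ext sc f t"
proof -
  have "lin_ext sc f (- t) + lin_ext sc f t = 0"
    unfolding lin_ext_add[OF assms, symmetric] by simp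
  then show ?thesis by (simp add: eq_neg_iff_add_eq_0)
qed

lemma lin_ext_diff:
  assumes "vector_space sc"
  shows "lin_ext sc f (t - u) = lin_ext sc f t - lin_ext sc f u"
  using lin_ext_add[OF assms, of f t "- u"] lin_ext_minus[OF assms, of f u] by simp

lemma lin_ext_sum:
  assumes "vector_space sc"
  shows "lin_ext sc f (sum t I) = (\<Sum>i\<in>I. lin_ext sc f (t i))"
  by (induction I rule: infinite_finite_induct) (simp_all add: lin_ext_add[OF assms])

lemma lin_ext_cong:
  "(\<And>a. a \<in> Poly_Mapping.keys t \<Longrightarrow> f a = g a) \<Longrightarrow> lin_ext sc f t = lin_ext sc g t"
  by (simp add: lin_ext_def)

lemma lin_ext_fun_add:
  assumes "vector_space sc"
  shows "lin_ext sc (\<lambda>a. f a + g a) t = lin_ext sc f t + lin_ext sc g t"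
proof -
  interpret vector_space sc by fact
  show ?thesis by (simp add: lin_ext_def scale_right_distrib sum.distrib)
qed

lemma lin_ext_fun_scale:
  assumes "vector_space sc"
  shows "lin_ext sc (\<lambda>a. sc c (f a)) t = sc c (lin_ext sc f t)"
proof -
  interpret vector_space sc by fact
  show ?thesis by (simp add: lin_ext_def scale_sum_right mult.commute)
qed

lemma lin_ext_fun_diff:
  assumes "vector_space sc"
  shows "lin_ext sc (\<lambda>a. f a - g a) t = lin_ext sc f t - lin_ext sc g t"
proof -
  interpret vector_space sc by fact
  show ?thesis by (simp add: lin_ext_def scale_right_diff_distrib sum_subtractf)
qed

lemma lin_ext_fun_zero:
  assumes "vector_space sc"
  shows "lin_ext sc (\<lambda>a. 0) t = 0"
proof -
  interpret vector_space sc by fact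
  show ?thesis by (simp add: lin_ext_def)
qed

text \<open>\<open>L\<close> is only required to be linear on \<open>S\<close>: module actions are
  controlled on \<open>mcar\<close> and \<open>galg\<close>, not on the whole type. Hence the
  condition on the values of \<open>f\<close>.\<close>

lemma additive_lin_ext:
  assumes "\<And>x y. x \<in> S \<Longrightarrow> y \<in> S \<Longrightarrow> L (x + y) = L x + L y"
    and "\<And>c x. x \<in> S \<Longrightarrow> L (sc c x) = sc' c (L x)"
    and "module.subspace sc S" and "vector_space sc" and "vector_space sc'"
    and f: "\<And>a. a \<in> Poly_Mapping.keys t \<Longrightarrow> f a \<in> S"
  shows "L (lin_ext sc f t) = lin_ext sc' (\<lambda>a. L (f a)) t"
proof -
  interpret vector_space sc by fact
  interpret B: vector_space sc' by fact
  have L0: "L 0 = 0"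
    using assms(2)[of 0 0] subspace_0[OF assms(3)] by simp
  have "L (\<Sum>a\<in>I. sc (c a) (f a)) = (\<Sum>a\<in>I. sc' (c a) (L (f a)))" if "finite I" "\<And>a. a \<in> I \<Longrightarrow> f a \<in> S"
    for I c
    using that
  proof (induction I rule: finite_induct)
    case (insert a I)
    have "(\<Sum>a\<in>I. sc (c a) (f a)) \<in> S" "sc (c a) (f a) \<in> S"
      using insert.prems by (auto intro!: subspace_sum subspace_scale assms(3))
    then show ?case
      using insert by (simp add: assms(1,2))
  qed (simp add: L0)
  then show ?thesis
    using f by (simp add: lin_ext_def)
qed

lemma lin_ext_comp:
  assumes "vector_space sc"
  shows "lin_ext sc f (lin_ext fscale g t) = lin_ext sc (\<lambda>a. lin_ext sc f (g a)) t"
  by (rule additive_lin_ext[where S = UNIV])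
    (simp_all add: assms lin_ext_add lin_ext_scale fs.vector_space_axioms)

lemma lin_ext_subspace:
  assumes "vector_space sc" "module.subspace sc S" "\<And>a. a \<in> Poly_Mapping.keys t \<Longrightarrow> f a \<in> S"
  shows "lin_ext sc f t \<in> S"
proof -
  interpret vector_space sc by fact
  show ?thesis
    unfolding lin_ext_def using assms(2,3) by (intro subspace_sum subspace_scale)
qed

abbreviation ext :: "('a \<Rightarrow> ('b \<Rightarrow>\<^sub>0 'k::field)) \<Rightarrow> ('a \<Rightarrow>\<^sub>0 'k) \<Rightarrow> ('b \<Rightarrow>\<^sub>0 'k)"
  where "ext \<equiv> lin_ext fscale"

lemmas vs_fs [simp] = fs.vector_space_axioms
lemmas ext_simps = lin_ext_add[OF vs_fs] lin_ext_diff[OF vs_fs] lin_ext_scale[OF vs_fs]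
  lin_ext_comp[OF vs_fs] lin_ext_minus[OF vs_fs]

lemma ext_single1: "ext single1 t = t"
proof (rule poly_mapping_eqI)
  fix a
  have "Poly_Mapping.lookup (ext single1 t) a =
      (\<Sum>b\<in>Poly_Mapping.keys t. if a = b then Poly_Mapping.lookup t b else 0)"
    unfolding lin_ext_def lookup_sum by (rule sum.cong) (auto simp: lookup_single when_def)
  then show "Poly_Mapping.lookup (ext single1 t) a = Poly_Mapping.lookup t a"
    by (simp add: in_keys_iff sum.delta)
qed

lemma keys_in_subspace: "module.subspace fscale {t. Poly_Mapping.keys t \<subseteq> S}"
  unfolding fs.subspace_def by (auto simp: in_keys_iff lookup_add subset_iff) (metis add_0)

lemma keys_ext:
  assumes "\<And>a. a \<in> Poly_Mapping.keys t \<Longrightarrow> Poly_Mapping.keys (f a) \<subseteq> S"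
  shows "Poly_Mapping.keys (ext f t) \<subseteq> S"
  using lin_ext_subspace[OF vs_fs keys_in_subspace, of t f S] assms by simp

text \<open>The counterpart of \<open>lin_ext\<close> for vector coefficients, with one function for
  each index. Only nonzero coefficients occur in the sum, so its laws need
  \<open>f a 0 = 0\<close>.\<close>

definition psum :: "('a \<Rightarrow> 'm \<Rightarrow> 'v::ab_group_add) \<Rightarrow> ('a \<Rightarrow>\<^sub>0 'm::ab_group_add) \<Rightarrow> 'v"
  where "psum f t = (\<Sum>a\<in>Poly_Mapping.keys t. f a (Poly_Mapping.lookup t a))"

lemma psum_superset:
  assumes "\<And>a. a \<in> S \<Longrightarrow> f a 0 = 0" "finite S" "Poly_Mapping.keys t \<subseteq> S"
  shows "psum f t = (\<Sum>a\<in>S. f a (Poly_Mapping.lookup t a))"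
  unfolding psum_def using assms by (intro sum.mono_neutral_left) (auto simp: in_keys_iff)

lemma psum_zero [simp]: "psum f 0 = 0"
  by (simp add: psum_def)

lemma psum_single: "f a 0 = 0 \<Longrightarrow> psum f (Poly_Mapping.single a m) = f a m"
  using psum_superset[where f = f and S = "{a}" and t = "Poly_Mapping.single a m"] by simp

lemma psum_add:
  assumes f: "\<And>a. a \<in> Poly_Mapping.keys t \<union> Poly_Mapping.keys u \<Longrightarrow> f a 0 = 0"
    and "\<And>a. a \<in> Poly_Mapping.keys t \<union> Poly_Mapping.keys u \<Longrightarrow>
      f a (Poly_Mapping.lookup t a + Poly_Mapping.lookup u a)
      = f a (Poly_Mapping.lookup t a) + f a (Poly_Mapping.lookup u a)"
  shows "psum f (t + u) = psum f t + psum f u"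
proof -
  let ?S = "Poly_Mapping.keys t \<union> Poly_Mapping.keys u"
  have "Poly_Mapping.keys (t + u) \<subseteq> ?S" by (rule keys_add)
  then have "psum f (t + u) = (\<Sum>a\<in>?S. f a (Poly_Mapping.lookup t a) + f a (Poly_Mapping.lookup u a))"
    using psum_superset[where f = f and S = ?S, OF f] assms(2)
    by (simp add: lookup_add)
  also have "\<dots> = psum f t + psum f u"
    using psum_superset[where f = f and S = ?S, OF f] by (simp add: sum.distrib)
  finally show ?thesis .
qed

lemma psum_cong:
  "(\<And>a. a \<in> Poly_Mapping.keys t \<Longrightarrow> f a (Poly_Mapping.lookup t a) = g a (Poly_Mapping.lookup t a))
    \<Longrightarrow> psum f t = psum g t"
  by (simp add: psum_def)

lemma psum_single_self: "psum Poly_Mapping.single t = t"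
proof (rule poly_mapping_eqI)
  fix a
  have "Poly_Mapping.lookup (psum Poly_Mapping.single t) a =
      (\<Sum>b\<in>Poly_Mapping.keys t. if a = b then Poly_Mapping.lookup t b else 0)"
    unfolding psum_def lookup_sum by (rule sum.cong) (auto simp: lookup_single when_def)
  then show "Poly_Mapping.lookup (psum Poly_Mapping.single t) a = Poly_Mapping.lookup t a"
    by (simp add: in_keys_iff sum.delta)
qed

section \<open>Operators on linear combinations of lists\<close>

abbreviation cons :: "'a \<Rightarrow> ('a list \<Rightarrow>\<^sub>0 'k::field) \<Rightarrow> ('a list \<Rightarrow>\<^sub>0 'k)"
  where "cons a \<equiv> ext (\<lambda>xs. single1 (a # xs))"

abbreviation snoc :: "'a \<Rightarrow> ('a list \<Rightarrow>\<^sub>0 'k::field) \<Rightarrow> ('a list \<Rightarrow>\<^sub>0 'k)"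
  where "snoc a \<equiv> ext (\<lambda>xs. single1 (xs @ [a]))"

abbreviation lmaps :: "('a \<Rightarrow> 'b) \<Rightarrow> ('a list \<Rightarrow>\<^sub>0 'k::field) \<Rightarrow> ('b list \<Rightarrow>\<^sub>0 'k)"
  where "lmaps f \<equiv> ext (\<lambda>xs. single1 (map f xs))"

definition dropnth :: "nat \<Rightarrow> 'a list \<Rightarrow> 'a list"
  where "dropnth k xs = take k xs @ drop (Suc k) xs"

text \<open>The simplicial boundary, an alternating sum of deletions, in a recursion on the head
  that fits inductions on lists. On a one-element list it is the augmentation to the empty
  list.\<close>

fun bdry :: "'a list \<Rightarrow> ('a list \<Rightarrow>\<^sub>0 'k::field)"
  where "bdry [] = 0"
  | "bdry (a # xs) = single1 xs - cons a (bdry xs)"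

definition bdry' :: "'a list \<Rightarrow> ('a list \<Rightarrow>\<^sub>0 'k::field)"
  where "bdry' xs = snoc (last xs) (bdry (butlast xs))"

text \<open>The prism operator between the identity and the map induced by \<open>f\<close>.\<close>

fun htpy :: "('a \<Rightarrow> 'a) \<Rightarrow> 'a list \<Rightarrow> ('a list \<Rightarrow>\<^sub>0 'k::field)"
  where "htpy f [] = 0"
  | "htpy f (a # xs) = single1 (a # map f (a # xs)) - cons a (htpy f xs)"

lemma bdry_sum: "(bdry xs :: 'a list \<Rightarrow>\<^sub>0 'k::field) = (\<Sum>k<length xs. fscale ((-1) ^ k) (single1 (dropnth k xs)))"
proof (induction xs)
  case (Cons a xs)
  have "(cons a (bdry xs) :: 'a list \<Rightarrow>\<^sub>0 'k) =
      (\<Sum>k<length xs. fscale ((-1) ^ k) (single1 (dropnth (Suc k) (a # xs))))"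
    unfolding Cons lin_ext_sum[OF vs_fs] by (simp add: dropnth_def)
  then show ?case
    by (simp add: sum.lessThan_Suc_shift dropnth_def sum_negf single_uminus del: sum.lessThan_Suc)
qed simp

lemma bdry'_sum: "(bdry' xs :: 'a list \<Rightarrow>\<^sub>0 'k::field) = (\<Sum>k<length xs - 1. fscale ((-1) ^ k) (single1 (dropnth k xs)))"
proof (cases xs rule: rev_cases)
  case (snoc ys a)
  show ?thesis
    unfolding snoc bdry'_def bdry_sum lin_ext_sum[OF vs_fs]
    by (simp add: dropnth_def)
qed (simp add: bdry'_def)

lemma keys_bdry: "Poly_Mapping.keys (bdry xs :: 'a list \<Rightarrow>\<^sub>0 'k::field) \<subseteq> (\<lambda>k. dropnth k xs) ` {..<length xs}"
proof -
  have "Poly_Mapping.keys (bdry xs :: 'a list \<Rightarrow>\<^sub>0 'k) \<subseteq>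
    (\<Union>k\<in>{..<length xs}. Poly_Mapping.keys (fscale ((-1) ^ k) (single1 (dropnth k xs)) :: 'a list \<Rightarrow>\<^sub>0 'k))"
    unfolding bdry_sum by (rule keys_sum)
  then show ?thesis by auto
qed

lemma bdry_cons: "ext bdry (cons a t) = t - cons a (ext bdry t)"
  by (simp add: ext_simps lin_ext_fun_diff ext_single1)

lemma bdry_bdry: "ext bdry (bdry xs) = 0"
proof (induction xs)
  case (Cons a xs)
  then show ?case by (simp add: ext_simps(2) bdry_cons)
qed simp

lemma bdry'_snoc: "ext bdry' (snoc a t) = snoc a (ext bdry t)"
  by (simp add: ext_simps bdry'_def)

lemma bdry'_bdry': "ext bdry' (bdry' xs) = 0"
  unfolding bdry'_def[of xs] bdry'_snoc bdry_bdry by simp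

lemma cons_snoc: "cons a (snoc b t) = snoc b (cons a t)"
  by (simp add: ext_simps)

lemma bdry_append1:
  "bdry (xs @ [a]) = snoc a (bdry xs) + fscale ((-1) ^ length xs) (single1 xs)"
  by (induction xs) (simp_all add: ext_simps cons_snoc single_uminus)

lemma bdry_map: "bdry (map f xs) = lmaps f (bdry xs)"
  by (induction xs) (simp_all add: ext_simps)

lemma bdry'_map: "xs \<noteq> [] \<Longrightarrow> bdry' (map f xs) = lmaps f (bdry' xs)"
  by (simp add: bdry'_def map_butlast[symmetric] bdry_map last_map ext_simps)

text \<open>Copying the last entry to the front is an extra degeneracy for \<open>b'\<close>:
  deleting the copy returns \<open>xs\<close>, and since \<open>b'\<close> never deletes the last
  entry, the other deletions commute with copying up to sign.\<close>

lemma degen_last_homotopy: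
  assumes "xs \<noteq> []"
  shows "bdry' (last xs # xs) = single1 xs - ext (\<lambda>ys. single1 (last ys # ys)) (bdry' xs)"
proof -
  obtain ys a where xs: "xs = ys @ [a]" using assms by (cases xs rule: rev_cases) auto
  show ?thesis
    unfolding xs bdry'_def by (simp add: ext_simps)
qed

lemma htpy_cons: "ext (htpy f) (cons a t) = cons a (lmaps f (cons a t)) - cons a (ext (htpy f) t)"
  by (simp add: ext_simps lin_ext_fun_diff)

text \<open>The prism formula \<open>b h = f - 1 - h b\<close>. Both \<open>htpy\<close> and
  \<open>bdry\<close> peel off the head, so induction on the list works: \<open>a # map f xs\<close>
  cancels between \<open>D\<close> and \<open>A\<close>, and the term with \<open>f\<close> applied
  to \<open>cons a (bdry xs)\<close> is the one that occurs in \<open>C\<close>.\<close>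

lemma htpy_homotopy:
  "(ext bdry (htpy f xs) :: 'a list \<Rightarrow>\<^sub>0 'k::field) = single1 (map f xs) - single1 xs - ext (htpy f) (bdry xs)"
proof (induction xs)
  case (Cons a xs)
  have A: "(cons a (ext bdry (htpy f xs)) :: 'a list \<Rightarrow>\<^sub>0 'k) =
      cons a (single1 (map f xs)) - cons a (single1 xs) - cons a (ext (htpy f) (bdry xs))"
    unfolding Cons by (simp add: ext_simps)
  have B: "(ext bdry (htpy f (a # xs)) :: 'a list \<Rightarrow>\<^sub>0 'k) = single1 (map f (a # xs)) - cons a (bdry (map f (a # xs)))
      - htpy f xs + cons a (ext bdry (htpy f xs))"
    by (simp add: ext_simps(2) bdry_cons)
  have C: "(ext (htpy f) (bdry (a # xs)) :: 'a list \<Rightarrow>\<^sub>0 'k) = htpy f xs - cons a (lmaps f (cons a (bdry xs)))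
      + cons a (ext (htpy f) (bdry xs))"
    by (simp add: ext_simps(2) htpy_cons)
  have D: "(cons a (bdry (map f (a # xs))) :: 'a list \<Rightarrow>\<^sub>0 'k) = single1 (a # map f xs) - cons a (lmaps f (cons a (bdry xs)))"
    by (simp add: bdry_map ext_simps)
  show ?case
    unfolding B C D A by simp
qed simp

text \<open>Commutation is needed on the entries alone. With a right translation as \<open>g\<close>
  it makes the prism equivariant; with \<open>g = f\<close> it makes the prism commute with the map
  induced by \<open>f\<close>.\<close>

lemma htpy_map:
  assumes "\<And>a. a \<in> set xs \<Longrightarrow> f (g a) = g (f a)"
  shows "htpy f (map g xs) = lmaps g (htpy f xs)"
  using assms
proof (induction xs)
  case (Cons a xs)
  then have "map f (map g xs) = map g (map f xs)" "f (g a) = g (f a)" by simp_all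
  then show ?case
    using Cons by (simp add: ext_simps del: map_map)
qed simp

lemma keys_htpy:
  assumes "\<And>a. a \<in> X \<Longrightarrow> f a \<in> X" "set xs \<subseteq> X"
  shows "Poly_Mapping.keys (htpy f xs :: 'a list \<Rightarrow>\<^sub>0 'k::field) \<subseteq> {ys. length ys = Suc (length xs) \<and> set ys \<subseteq> X}"
  using assms(2)
proof (induction xs)
  case (Cons a xs)
  have "Poly_Mapping.keys (cons a (htpy f xs) :: 'a list \<Rightarrow>\<^sub>0 'k) \<subseteq> {ys. length ys = Suc (Suc (length xs)) \<and> set ys \<subseteq> X}"
    by (rule keys_ext) (use Cons in auto)
  moreover have "Poly_Mapping.keys (single1 (a # map f (a # xs)) :: 'a list \<Rightarrow>\<^sub>0 'k)
      \<subseteq> {ys. length ys = Suc (Suc (length xs)) \<and> set ys \<subseteq> X}"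
    using Cons.prems assms(1) by auto
  ultimately show ?case
    unfolding htpy.simps length_Cons by (intro order.trans[OF keys_diff] Un_least)
qed simp

section \<open>Subspaces as records\<close>

text \<open>Record structure on a subspace of a type that already has an addition:
  \<open>finsum\<close> over it becomes an ordinary \<open>sum\<close>, so later computations take
  place in the type.\<close>

definition typed_space :: "('k \<Rightarrow> 'v \<Rightarrow> 'v::ab_group_add) \<Rightarrow> 'v set \<Rightarrow> ('k, 'v) module"
  where "typed_space sc S =
    \<lparr>carrier = S, mult = undefined, one = undefined, zero = 0, add = (+), smult = sc\<rparr>"

lemma typed_space_simps [simp]:
  "carrier (typed_space sc S) = S" "\<zero>\<^bsub>typed_space sc S\<^esub> = 0"
  "x \<oplus>\<^bsub>typed_space sc S\<^esub> y = x + y" "c \<odot>\<^bsub>typed_space sc S\<^esub> x = sc c x"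
  by (simp_all add: typed_space_def)

lemma free_space_typed: "free_space S = typed_space fscale {t. Poly_Mapping.keys t \<subseteq> S}"
  by (simp add: free_space_def typed_space_def)

lemma lspace_typed:
  assumes "vector_space sc" "module.subspace sc S"
  shows "lspace (typed_space sc S)"
proof -
  interpret vector_space sc by fact
  show ?thesis
    by (rule lspaceI) (use assms(2) in \<open>auto simp: subspace_def scale_right_distrib scale_left_distrib\<close>)
qed

lemma finsum_typed:
  assumes "vector_space sc" "module.subspace sc S" "finite I" "\<And>i. i \<in> I \<Longrightarrow> f i \<in> S"
  shows "(\<Oplus>\<^bsub>typed_space sc S\<^esub>i\<in>I. f i) = sum f I"
proof -
  interpret lspace "typed_space sc S" by (rule lspace_typed[OF assms(1,2)])
  show ?thesis
    using assms(3,4)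
  proof (induction I rule: finite_induct)
    case (insert i I)
    then have "f \<in> I \<rightarrow> carrier (typed_space sc S)" "f i \<in> carrier (typed_space sc S)" by auto
    then show ?case using insert by simp
  qed simp
qed

text \<open>Scalars are left out: maps are compared on classes \<open>nu gs m\<close> with arbitrary
  \<open>m\<close>, or on homogeneous vectors, and these families span additively.\<close>

definition additive_on :: "'v set \<Rightarrow> ('v::ab_group_add \<Rightarrow> 'w::ab_group_add) \<Rightarrow> bool"
  where "additive_on S f \<longleftrightarrow> (\<forall>x\<in>S. \<forall>y\<in>S. f (x + y) = f x + f y)"

lemma additive_on_zero: "\<lbrakk>additive_on S f; 0 \<in> S\<rbrakk> \<Longrightarrow> f 0 = 0"
  unfolding additive_on_def by (metis add_cancel_right_right)

lemma additive_on_sum: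
  assumes f: "additive_on S f" and vs: "vector_space sc" and S: "module.subspace sc S"
    and "\<And>i. i \<in> I \<Longrightarrow> x i \<in> S"
  shows "f (sum x I) = (\<Sum>i\<in>I. f (x i))"
proof -
  interpret vector_space sc by fact
  show ?thesis
    using assms(4)
  proof (induction I rule: infinite_finite_induct)
    case (insert i I)
    have "sum x I \<in> S" using insert.prems by (intro subspace_sum[OF S]) auto
    then show ?case using insert f by (simp add: additive_on_def)
  qed (simp_all add: additive_on_zero[OF f subspace_0[OF S]])
qed

lemma additive_on_minus:
  assumes f: "additive_on S f" and vs: "vector_space sc" and S: "module.subspace sc S" and x: "x \<in> S"
  shows "f (- x) = - f x"
proof -
  interpret vector_space sc by fact
  have "f (- x) + f x = f (- x + x)"
    using f x subspace_neg[OF S x] unfolding additive_on_def by metis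
  then show ?thesis
    using additive_on_zero[OF f subspace_0[OF S]] by (simp add: eq_neg_iff_add_eq_0)
qed

section \<open>A model of the cyclic module\<close>

text \<open>
  The group \<open>H\<close> acts from the right on \<open>X\<close>, freely because of the equivariant retraction \<open>r\<close>, and from
  the left on \<open>W\<close>. Every \<open>H\<close>-orbit of lists contains exactly one list whose head is sent to \<open>e\<close> by \<open>r\<close>,
  so that these lists index the coinvariants of \<open>X\<^bsup>n+1\<^esup> \<times> W\<close>; \<open>nu gs m\<close> is the class of \<open>gs \<otimes> m\<close>.
\<close>

locale orbit_model =
  fixes mul :: "'g \<Rightarrow> 'g \<Rightarrow> 'g" and iv :: "'g \<Rightarrow> 'g" and e :: 'g and H X :: "'g set"
    and r :: "'g \<Rightarrow> 'g" and act :: "'g \<Rightarrow> 'm \<Rightarrow> 'm::ab_group_add" and W :: "'m set"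
    and sc :: "'k::field \<Rightarrow> 'm \<Rightarrow> 'm" and l :: 'g
  assumes vs: "vector_space sc" and W: "module.subspace sc W"
    and H_X: "H \<subseteq> X" and e_H: "e \<in> H"
    and mul_H: "\<lbrakk>z \<in> H; w \<in> H\<rbrakk> \<Longrightarrow> mul z w \<in> H"
    and mul_X: "\<lbrakk>x \<in> X; z \<in> H\<rbrakk> \<Longrightarrow> mul x z \<in> X"
    and mul_assoc: "\<lbrakk>x \<in> X; z \<in> H; w \<in> H\<rbrakk> \<Longrightarrow> mul (mul x z) w = mul x (mul z w)"
    and mul_e: "x \<in> X \<Longrightarrow> mul x e = x"
    and e_mul: "z \<in> H \<Longrightarrow> mul e z = z"
    and iv_H: "z \<in> H \<Longrightarrow> iv z \<in> H"
    and mul_iv: "z \<in> H \<Longrightarrow> mul z (iv z) = e"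
    and iv_mul: "z \<in> H \<Longrightarrow> mul (iv z) z = e"
    and r_H: "x \<in> X \<Longrightarrow> r x \<in> H"
    and r_mul: "\<lbrakk>x \<in> X; z \<in> H\<rbrakk> \<Longrightarrow> r (mul x z) = mul (r x) z"
    and r_id: "z \<in> H \<Longrightarrow> r z = z"
    and act_W: "\<lbrakk>z \<in> H; m \<in> W\<rbrakk> \<Longrightarrow> act z m \<in> W"
    and act_add: "\<lbrakk>z \<in> H; m \<in> W; m' \<in> W\<rbrakk> \<Longrightarrow> act z (m + m') = act z m + act z m'"
    and act_scale: "\<lbrakk>z \<in> H; m \<in> W\<rbrakk> \<Longrightarrow> act z (sc c m) = sc c (act z m)"
    and act_e: "m \<in> W \<Longrightarrow> act e m = m"
    and act_mul: "\<lbrakk>z \<in> H; w \<in> H; m \<in> W\<rbrakk> \<Longrightarrow> act (mul z w) m = act z (act w m)"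
    and l_H: "l \<in> H" and l_comm: "z \<in> H \<Longrightarrow> mul z l = mul l z"
    and act_l: "m \<in> W \<Longrightarrow> act l m = m"
begin

interpretation V: vector_space sc by (rule vs)

lemma vsp: "vector_space (pscale sc)"
  by (rule vector_space_pscale[OF vs])

interpretation P: vector_space "pscale sc :: 'k \<Rightarrow> ('g list \<Rightarrow>\<^sub>0 'm) \<Rightarrow> _" by (rule vsp)

definition lists_of :: "nat \<Rightarrow> 'g list set"
  where "lists_of n = {gs. length gs = n \<and> set gs \<subseteq> X}"

definition shift :: "'g \<Rightarrow> 'g list \<Rightarrow> 'g list"
  where "shift z gs = map (\<lambda>g. mul g z) gs"

definition nrm :: "'g list \<Rightarrow> 'g list"
  where "nrm gs = shift (iv (r (hd gs))) gs"

text \<open>\<open>gs\<close> is \<open>nrm gs\<close> translated by \<open>z = r (hd gs)\<close>,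
  so the class of \<open>gs \<otimes> m\<close> equals that of
  \<open>nrm gs \<otimes> z m\<close>.\<close>

definition nu :: "'g list \<Rightarrow> 'm \<Rightarrow> ('g list \<Rightarrow>\<^sub>0 'm)"
  where "nu gs m = Poly_Mapping.single (nrm gs) (act (r (hd gs)) m)"

definition em :: "('g list \<Rightarrow>\<^sub>0 'k) \<Rightarrow> 'm \<Rightarrow> ('g list \<Rightarrow>\<^sub>0 'm)"
  where "em t m = lin_ext (pscale sc) (\<lambda>gs. nu gs m) t"

text \<open>An operator on lists is evaluated only on the normal lists in the support, and
  \<open>em\<close> brings the result back to normal form. For equivariant \<open>p\<close> this is
  the induced operator on coinvariants, see \<open>op_nu\<close>.\<close>

definition op :: "('g list \<Rightarrow> ('g list \<Rightarrow>\<^sub>0 'k)) \<Rightarrow> ('g list \<Rightarrow>\<^sub>0 'm) \<Rightarrow> ('g list \<Rightarrow>\<^sub>0 'm)"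
  where "op p = psum (\<lambda>gs m. em (p gs) m)"

definition coinv :: "nat \<Rightarrow> ('g list \<Rightarrow>\<^sub>0 'm) set"
  where "coinv n = {\<phi>. \<forall>gs. Poly_Mapping.lookup \<phi> gs \<in> W \<and>
    (Poly_Mapping.lookup \<phi> gs \<noteq> 0 \<longrightarrow> gs \<in> lists_of (Suc n) \<and> r (hd gs) = e)}"

definition natural :: "nat \<Rightarrow> nat \<Rightarrow> ('g list \<Rightarrow> ('g list \<Rightarrow>\<^sub>0 'k)) \<Rightarrow> bool"
  where "natural n k p \<longleftrightarrow> (\<forall>gs\<in>lists_of (Suc n). Poly_Mapping.keys (p gs) \<subseteq> lists_of (Suc k) \<and>
    (\<forall>z\<in>H. p (shift z gs) = ext (\<lambda>gs. single1 (shift z gs)) (p gs)))"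

lemma W0: "0 \<in> W" and W_add: "\<lbrakk>m \<in> W; m' \<in> W\<rbrakk> \<Longrightarrow> m + m' \<in> W" and W_scale: "m \<in> W \<Longrightarrow> sc c m \<in> W"
  using W by (auto simp: V.subspace_def)

lemma hd_X: "gs \<in> lists_of (Suc n) \<Longrightarrow> hd gs \<in> X"
  by (cases gs) (auto simp: lists_of_def)

lemma lists_of_nonempty: "gs \<in> lists_of (Suc n) \<Longrightarrow> gs \<noteq> []"
  by (auto simp: lists_of_def)

lemma shift_lists_of: "\<lbrakk>gs \<in> lists_of n; z \<in> H\<rbrakk> \<Longrightarrow> shift z gs \<in> lists_of n"
  by (auto simp: lists_of_def shift_def mul_X)

lemma shift_shift: "\<lbrakk>gs \<in> lists_of n; z \<in> H; w \<in> H\<rbrakk> \<Longrightarrow> shift w (shift z gs) = shift (mul z w) gs"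
  by (auto simp: lists_of_def shift_def mul_assoc subset_iff)

lemma shift_e: "gs \<in> lists_of n \<Longrightarrow> shift e gs = gs"
  unfolding lists_of_def shift_def by (auto intro!: map_idI simp: mul_e)

lemma hd_shift: "gs \<noteq> [] \<Longrightarrow> hd (shift z gs) = mul (hd gs) z"
  by (cases gs) (auto simp: shift_def)

lemma iv_shift: "\<lbrakk>a \<in> H; z \<in> H\<rbrakk> \<Longrightarrow> mul z (iv (mul a z)) = iv a"
proof -
  assume a: "a \<in> H" and z: "z \<in> H"
  have X: "\<And>z. z \<in> H \<Longrightarrow> z \<in> X" using H_X by auto
  let ?u = "mul z (iv (mul a z))"
  have u: "?u \<in> H" using a z by (simp add: mul_H iv_H)
  have "mul a ?u = e"
    using a z by (simp add: mul_assoc[symmetric] X mul_H iv_H mul_iv)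
  then have "mul (iv a) (mul a ?u) = iv a"
    using a by (simp add: mul_e X iv_H)
  moreover have "mul (iv a) (mul a ?u) = ?u"
    using a u by (simp add: mul_assoc[symmetric] X iv_H iv_mul e_mul)
  ultimately show ?thesis by simp
qed

lemma iv_e: "iv e = e"
  using mul_iv[OF e_H] e_mul[OF iv_H[OF e_H]] by simp

lemma nrm_shift:
  assumes gs: "gs \<in> lists_of (Suc n)" and z: "z \<in> H"
  shows "nrm (shift z gs) = nrm gs"
proof -
  note h = hd_X[OF gs]
  have "nrm (shift z gs) = shift (mul z (iv (mul (r (hd gs)) z))) gs"
    unfolding nrm_def hd_shift[OF lists_of_nonempty[OF gs]] r_mul[OF h z]
    by (rule shift_shift[OF gs z]) (simp add: mul_H iv_H r_H h z)
  then show ?thesis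
    by (simp add: nrm_def iv_shift r_H h z)
qed

text \<open>The relation that defines coinvariants. Translation by \<open>z\<close> keeps the normal
  list and multiplies \<open>r (hd gs)\<close> by \<open>z\<close>.\<close>

lemma nu_shift:
  assumes gs: "gs \<in> lists_of (Suc n)" and z: "z \<in> H" and m: "m \<in> W"
  shows "nu (shift z gs) m = nu gs (act z m)"
  unfolding nu_def nrm_shift[OF gs z] hd_shift[OF lists_of_nonempty[OF gs]]
  by (simp add: r_mul hd_X[OF gs] z act_mul r_H m)

lemma nrm_normal:
  assumes gs: "gs \<in> lists_of (Suc n)"
  shows "nrm gs \<in> lists_of (Suc n)" "r (hd (nrm gs)) = e"
proof -
  note h = hd_X[OF gs]
  show "nrm gs \<in> lists_of (Suc n)"
    unfolding nrm_def by (rule shift_lists_of[OF gs iv_H[OF r_H[OF h]]])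
  show "r (hd (nrm gs)) = e"
    unfolding nrm_def hd_shift[OF lists_of_nonempty[OF gs]]
    by (simp add: r_mul h iv_H r_H mul_iv)
qed

lemma nrm_unshift:
  assumes gs: "gs \<in> lists_of (Suc n)"
  shows "shift (r (hd gs)) (nrm gs) = gs"
  unfolding nrm_def
  by (simp add: shift_shift[OF gs] iv_H r_H hd_X[OF gs] iv_mul shift_e[OF gs])

lemma coinv_subspace: "module.subspace (pscale sc) (coinv n)"
  unfolding P.subspace_def coinv_def
  by (auto simp: lookup_add lookup_pscale[OF vs] W0 W_add W_scale) (metis add_0)+

lemma nu_coinv: "\<lbrakk>gs \<in> lists_of (Suc n); m \<in> W\<rbrakk> \<Longrightarrow> nu gs m \<in> coinv n"
  using nrm_normal[of gs n]
  by (auto simp: coinv_def nu_def lookup_single when_def W0 act_W r_H hd_X)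

lemma nu_normal: "\<lbrakk>gs \<in> lists_of (Suc n); m \<in> W; r (hd gs) = e\<rbrakk> \<Longrightarrow> nu gs m = Poly_Mapping.single gs m"
  by (simp add: nu_def nrm_def iv_e shift_e act_e)

lemma nu_add: "\<lbrakk>gs \<in> lists_of (Suc n); m \<in> W; m' \<in> W\<rbrakk> \<Longrightarrow> nu gs (m + m') = nu gs m + nu gs m'"
  by (simp add: nu_def act_add r_H hd_X single_add)

lemma nu_scale: "\<lbrakk>gs \<in> lists_of (Suc n); m \<in> W\<rbrakk> \<Longrightarrow> nu gs (sc c m) = pscale sc c (nu gs m)"
  by (simp add: nu_def act_scale r_H hd_X pscale_single[OF vs])

lemma coinv_keys: "\<lbrakk>\<phi> \<in> coinv n; gs \<in> Poly_Mapping.keys \<phi>\<rbrakk> \<Longrightarrow> gs \<in> lists_of (Suc n) \<and> r (hd gs) = e"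
  by (auto simp: coinv_def in_keys_iff)

lemma coinv_lookup: "\<phi> \<in> coinv n \<Longrightarrow> Poly_Mapping.lookup \<phi> gs \<in> W"
  by (auto simp: coinv_def)

lemma coinv_expand:
  assumes "\<phi> \<in> coinv n"
  shows "\<phi> = (\<Sum>gs\<in>Poly_Mapping.keys \<phi>. nu gs (Poly_Mapping.lookup \<phi> gs))"
proof -
  have "\<phi> = psum Poly_Mapping.single \<phi>" by (simp add: psum_single_self)
  also have "\<dots> = psum nu \<phi>"
    by (intro psum_cong nu_normal[where n = n, symmetric])
      (use coinv_keys[OF assms] coinv_lookup[OF assms] in auto)
  finally show ?thesis by (simp add: psum_def)
qed

text \<open>Elements of \<open>coinv n\<close> are sums of classes \<open>nu gs m\<close>. The lists
  in \<open>eq\<close> need not be normal, so normalization stays out of later computations.\<close>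

lemma coinv_eqI:
  fixes F G :: "('g list \<Rightarrow>\<^sub>0 'm) \<Rightarrow> 'w::ab_group_add"
  assumes F: "additive_on (coinv n) F" and G: "additive_on (coinv n) G" and \<phi>: "\<phi> \<in> coinv n"
    and eq: "\<And>gs m. \<lbrakk>gs \<in> lists_of (Suc n); m \<in> W\<rbrakk> \<Longrightarrow> F (nu gs m) = G (nu gs m)"
  shows "F \<phi> = G \<phi>"
proof -
  have *: "nu gs (Poly_Mapping.lookup \<phi> gs) \<in> coinv n" if "gs \<in> Poly_Mapping.keys \<phi>" for gs
    using coinv_keys[OF \<phi> that] coinv_lookup[OF \<phi>] by (intro nu_coinv) auto
  have "K \<phi> = (\<Sum>gs\<in>Poly_Mapping.keys \<phi>. K (nu gs (Poly_Mapping.lookup \<phi> gs)))"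
    if K: "additive_on (coinv n) K" for K :: "_ \<Rightarrow> 'w"
  proof -
    have "K \<phi> = K (\<Sum>gs\<in>Poly_Mapping.keys \<phi>. nu gs (Poly_Mapping.lookup \<phi> gs))"
      by (rule arg_cong[OF coinv_expand[OF \<phi>]])
    also have "\<dots> = (\<Sum>gs\<in>Poly_Mapping.keys \<phi>. K (nu gs (Poly_Mapping.lookup \<phi> gs)))"
      by (rule additive_on_sum[OF K vsp coinv_subspace]) (rule *)
    finally show ?thesis .
  qed
  note KF = this[OF F] and KG = this[OF G]
  show ?thesis
    unfolding KF KG
    by (intro sum.cong refl eq) (use coinv_keys[OF \<phi>] coinv_lookup[OF \<phi>] in auto)
qed

lemma em_coinv:
  assumes "Poly_Mapping.keys t \<subseteq> lists_of (Suc n)" "m \<in> W"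
  shows "em t m \<in> coinv n"
  unfolding em_def by (rule lin_ext_subspace[OF vsp coinv_subspace]) (use assms nu_coinv in auto)

lemma em_add_right:
  assumes "Poly_Mapping.keys t \<subseteq> lists_of (Suc n)" "m \<in> W" "m' \<in> W"
  shows "em t (m + m') = em t m + em t m'"
proof -
  have "em t (m + m') = lin_ext (pscale sc) (\<lambda>gs. nu gs m + nu gs m') t"
    unfolding em_def by (rule lin_ext_cong) (use assms nu_add in blast)
  then show ?thesis by (simp add: em_def lin_ext_fun_add[OF vsp])
qed

lemma em_scale_right:
  assumes "Poly_Mapping.keys t \<subseteq> lists_of (Suc n)" "m \<in> W"
  shows "em t (sc c m) = pscale sc c (em t m)"
proof -
  have "em t (sc c m) = lin_ext (pscale sc) (\<lambda>gs. pscale sc c (nu gs m)) t"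
    unfolding em_def by (rule lin_ext_cong) (use assms nu_scale in blast)
  then show ?thesis by (simp add: em_def lin_ext_fun_scale[OF vsp])
qed

lemma em_zero_right:
  assumes "Poly_Mapping.keys t \<subseteq> lists_of (Suc n)"
  shows "em t 0 = 0"
  using em_scale_right[OF assms W0, of 0] by simp

lemma em_single1: "em (single1 gs) m = nu gs m"
  by (simp add: em_def vsp)

lemma em_shift:
  assumes "Poly_Mapping.keys t \<subseteq> lists_of (Suc n)" "m \<in> W" "z \<in> H"
  shows "em (ext (\<lambda>gs. single1 (shift z gs)) t) m = em t (act z m)"
  unfolding em_def lin_ext_comp[OF vsp]
  by (rule lin_ext_cong) (use assms nu_shift in \<open>auto simp: vsp\<close>)

lemma natural_keys: "\<lbrakk>natural n k p; gs \<in> lists_of (Suc n)\<rbrakk> \<Longrightarrow> Poly_Mapping.keys (p gs) \<subseteq> lists_of (Suc k)"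
  by (auto simp: natural_def)

text \<open>By equivariance the factor \<open>z = r (hd gs)\<close> moves from the vector back into
  the list, which undoes the normalization.\<close>

lemma op_nu:
  assumes p: "natural n k p" and gs: "gs \<in> lists_of (Suc n)" and m: "m \<in> W"
  shows "op p (nu gs m) = em (p gs) m"
proof -
  have a: "nrm gs \<in> lists_of (Suc n)" and z: "r (hd gs) \<in> H"
    using nrm_normal[OF gs] r_H hd_X[OF gs] by auto
  have "op p (nu gs m) = em (p (nrm gs)) (act (r (hd gs)) m)"
    unfolding op_def nu_def by (rule psum_single) (rule em_zero_right[OF natural_keys[OF p a]])
  also have "\<dots> = em (ext (\<lambda>gs'. single1 (shift (r (hd gs)) gs')) (p (nrm gs))) m"
    by (rule em_shift[symmetric, OF natural_keys[OF p a] m z])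
  also have "\<dots> = em (p (shift (r (hd gs)) (nrm gs))) m"
    using p a z by (simp add: natural_def)
  finally show ?thesis by (simp add: nrm_unshift[OF gs])
qed

lemma op_additive:
  assumes p: "natural n k p"
  shows "additive_on (coinv n) (op p)"
  unfolding additive_on_def op_def
proof (intro ballI psum_add)
  fix \<phi> \<psi> gs assume \<phi>: "\<phi> \<in> coinv n" "\<psi> \<in> coinv n"
    and "gs \<in> Poly_Mapping.keys \<phi> \<union> Poly_Mapping.keys \<psi>"
  then have gs: "gs \<in> lists_of (Suc n)"
    using coinv_keys by blast
  show "em (p gs) 0 = 0"
    by (rule em_zero_right[OF natural_keys[OF p gs]])
  show "em (p gs) (Poly_Mapping.lookup \<phi> gs + Poly_Mapping.lookup \<psi> gs) =
      em (p gs) (Poly_Mapping.lookup \<phi> gs) + em (p gs) (Poly_Mapping.lookup \<psi> gs)"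
    by (rule em_add_right[OF natural_keys[OF p gs]]) (use \<phi> coinv_lookup in auto)
qed

lemma op_coinv:
  assumes p: "natural n k p" and \<phi>: "\<phi> \<in> coinv n"
  shows "op p \<phi> \<in> coinv k"
  unfolding op_def psum_def
  by (intro P.subspace_sum[OF coinv_subspace] em_coinv natural_keys[OF p])
    (use coinv_keys[OF \<phi>] coinv_lookup[OF \<phi>] in auto)

lemma op_scale:
  assumes p: "natural n k p" and \<phi>: "\<phi> \<in> coinv n"
  shows "op p (pscale sc c \<phi>) = pscale sc c (op p \<phi>)"
proof -
  have "em (p gs) 0 = 0" if "gs \<in> Poly_Mapping.keys \<phi>" for gs
    using coinv_keys[OF \<phi> that] by (intro em_zero_right[OF natural_keys[OF p]]) auto
  then have "op p (pscale sc c \<phi>) = (\<Sum>gs\<in>Poly_Mapping.keys \<phi>. em (p gs) (sc c (Poly_Mapping.lookup \<phi> gs)))"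
    unfolding op_def
    by (subst psum_superset[where S = "Poly_Mapping.keys \<phi>"])
      (auto simp: lookup_pscale[OF vs] intro: set_mp[OF keys_pscale[OF vs]])
  also have "\<dots> = (\<Sum>gs\<in>Poly_Mapping.keys \<phi>. pscale sc c (em (p gs) (Poly_Mapping.lookup \<phi> gs)))"
    by (intro sum.cong refl em_scale_right[OF natural_keys[OF p]])
      (use coinv_keys[OF \<phi>] coinv_lookup[OF \<phi>] in auto)
  finally show ?thesis
    by (simp add: op_def psum_def P.scale_sum_right)
qed

lemma op_em:
  assumes p: "natural n k p" and t: "Poly_Mapping.keys t \<subseteq> lists_of (Suc n)" and m: "m \<in> W"
  shows "op p (em t m) = em (ext p t) m"
proof -
  have "op p (em t m) = lin_ext (pscale sc) (\<lambda>gs. op p (nu gs m)) t"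
    unfolding em_def
    by (rule additive_lin_ext[where S = "coinv n", OF _ _ coinv_subspace vsp vsp])
      (use op_additive[OF p] op_scale[OF p] t nu_coinv[OF _ m] in \<open>auto simp: additive_on_def\<close>)
  also have "\<dots> = lin_ext (pscale sc) (\<lambda>gs. em (p gs) m) t"
    by (rule lin_ext_cong) (use op_nu[OF p _ m] t in auto)
  finally show ?thesis by (simp add: em_def lin_ext_comp[OF vsp])
qed

lemma natural_comp:
  assumes p: "natural n k p" and q: "natural k j q"
  shows "natural n j (\<lambda>gs. ext q (p gs))"
  unfolding natural_def
proof (intro ballI conjI)
  fix gs assume gs: "gs \<in> lists_of (Suc n)"
  note pk = natural_keys[OF p gs]
  show "Poly_Mapping.keys (ext q (p gs)) \<subseteq> lists_of (Suc j)"
    by (rule keys_ext) (use pk natural_keys[OF q] in auto)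
  fix z assume z: "z \<in> H"
  have "ext q (p (shift z gs)) = ext (\<lambda>gs'. q (shift z gs')) (p gs)"
    using p gs z by (simp add: natural_def ext_simps)
  also have "\<dots> = ext (\<lambda>gs'. ext (\<lambda>gs. single1 (shift z gs)) (q gs')) (p gs)"
    by (rule lin_ext_cong) (use q z pk in \<open>auto simp: natural_def\<close>)
  finally show "ext q (p (shift z gs)) = ext (\<lambda>gs. single1 (shift z gs)) (ext q (p gs))"
    by (simp add: ext_simps)
qed

text \<open>Functoriality. It turns identities between operators on coinvariants into identities of
  formal sums of lists.\<close>

lemma op_comp:
  assumes p: "natural n k p" and q: "natural k j q" and \<phi>: "\<phi> \<in> coinv n"
  shows "op q (op p \<phi>) = op (\<lambda>gs. ext q (p gs)) \<phi>"
proof (rule coinv_eqI[OF _ op_additive[OF natural_comp[OF p q]] \<phi>])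
  show "additive_on (coinv n) (\<lambda>\<phi>. op q (op p \<phi>))"
    using op_additive[OF p] op_additive[OF q] op_coinv[OF p] by (auto simp: additive_on_def)
  show "op q (op p (nu gs m)) = op (\<lambda>gs. ext q (p gs)) (nu gs m)"
    if gs: "gs \<in> lists_of (Suc n)" and m: "m \<in> W" for gs m
    unfolding op_nu[OF p gs m] op_nu[OF natural_comp[OF p q] gs m]
    by (rule op_em[OF q natural_keys[OF p gs] m])
qed

lemma op_cong:
  assumes \<phi>: "\<phi> \<in> coinv n" and pq: "\<And>gs. gs \<in> lists_of (Suc n) \<Longrightarrow> p gs = q gs"
  shows "op p \<phi> = op q \<phi>"
  unfolding op_def by (rule psum_cong) (simp add: pq coinv_keys[OF \<phi>])

lemma op_fun_add: "op (\<lambda>gs. p gs + q gs) \<phi> = op p \<phi> + op q \<phi>"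
  by (simp add: op_def psum_def em_def lin_ext_add[OF vsp] sum.distrib)

lemma op_fun_diff: "op (\<lambda>gs. p gs - q gs) \<phi> = op p \<phi> - op q \<phi>"
  by (simp add: op_def psum_def em_def lin_ext_diff[OF vsp] sum_subtractf)

lemma op_fun_scale: "op (\<lambda>gs. fscale c (p gs)) \<phi> = pscale sc c (op p \<phi>)"
  by (simp add: op_def psum_def em_def lin_ext_scale[OF vsp] P.scale_sum_right)

lemma op_fun_zero: "op (\<lambda>gs. 0) \<phi> = 0"
  by (simp add: op_def psum_def em_def)

lemma op_fun_sum: "op (\<lambda>gs. \<Sum>i\<in>I. p i gs) \<phi> = (\<Sum>i\<in>I. op (p i) \<phi>)"
  by (induction I rule: infinite_finite_induct) (simp_all add: op_fun_zero op_fun_add)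

lemma op_single1:
  assumes "\<phi> \<in> coinv n"
  shows "op single1 \<phi> = \<phi>"
proof -
  have "op single1 \<phi> = (\<Sum>gs\<in>Poly_Mapping.keys \<phi>. nu gs (Poly_Mapping.lookup \<phi> gs))"
    by (simp add: op_def psum_def em_single1)
  then show ?thesis using coinv_expand[OF assms] by simp
qed

lemma natural_scale:
  assumes "natural n k p"
  shows "natural n k (\<lambda>gs. fscale c (p gs))"
  unfolding natural_def
proof (intro ballI conjI)
  fix gs z assume gs: "gs \<in> lists_of (Suc n)"
  show "Poly_Mapping.keys (fscale c (p gs)) \<subseteq> lists_of (Suc k)"
    by (rule order_trans[OF keys_fscale natural_keys[OF assms gs]])
  assume "z \<in> H"
  then show "fscale c (p (shift z gs)) = ext (\<lambda>gs. single1 (shift z gs)) (fscale c (p gs))"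
    using assms gs by (simp add: natural_def ext_simps)
qed

lemma natural_list_fun:
  assumes "\<And>gs. gs \<in> lists_of (Suc n) \<Longrightarrow> q gs \<in> lists_of (Suc k)"
    and "\<And>gs z. \<lbrakk>gs \<in> lists_of (Suc n); z \<in> H\<rbrakk> \<Longrightarrow> q (shift z gs) = shift z (q gs)"
  shows "natural n k (\<lambda>gs. single1 (q gs))"
  using assms by (auto simp: natural_def)

end

section \<open>The quasi-isomorphism between models\<close>

context orbit_model
begin

interpretation V: vector_space sc by (rule vs)
interpretation P: vector_space "pscale sc :: 'k \<Rightarrow> ('g list \<Rightarrow>\<^sub>0 'm) \<Rightarrow> _" by (rule vsp)

definition rot :: "'g list \<Rightarrow> 'g list"
  where "rot gs = mul (last gs) l # butlast gs"

text \<open>Degeneracies are not specified, since homology does not depend on them.\<close>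

definition model :: "('k, 'g list \<Rightarrow>\<^sub>0 'm) cyclic_module"
  where "model =
    \<lparr>deg = (\<lambda>n. typed_space (pscale sc) (coinv n)),
     face = (\<lambda>n k. op (\<lambda>gs. single1 (dropnth k gs))),
     degen = (\<lambda>n k. undefined),
     cyc = (\<lambda>n. op (\<lambda>gs. single1 (rot gs)))\<rparr>"

lemma length_dropnth: "k < length xs \<Longrightarrow> length (dropnth k xs) = length xs - 1"
  by (simp add: dropnth_def)

lemma set_dropnth: "set (dropnth k xs) \<subseteq> set xs"
  unfolding dropnth_def using set_take_subset set_drop_subset by fastforce

lemma dropnth_lists_of: "\<lbrakk>k \<le> Suc n; gs \<in> lists_of (Suc (Suc n))\<rbrakk> \<Longrightarrow> dropnth k gs \<in> lists_of (Suc n)"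
  using set_dropnth[of k gs] by (auto simp: lists_of_def length_dropnth)

lemma dropnth_map: "dropnth k (map f xs) = map f (dropnth k xs)"
  by (simp add: dropnth_def take_map drop_map)

lemma natural_dropnth: "k \<le> Suc n \<Longrightarrow> natural (Suc n) n (\<lambda>gs. single1 (dropnth k gs))"
  by (rule natural_list_fun) (simp_all add: dropnth_lists_of shift_def dropnth_map)

lemma rot_lists_of: "gs \<in> lists_of (Suc n) \<Longrightarrow> rot gs \<in> lists_of (Suc n)"
  by (cases gs rule: rev_cases) (auto simp: lists_of_def rot_def mul_X l_H)

text \<open>This is where \<open>l\<close> must commute with \<open>H\<close>:
  \<open>(x z) l = (x l) z\<close> for the entry that moves to the front.\<close>

lemma rot_shift: "\<lbrakk>gs \<in> lists_of (Suc n); z \<in> H\<rbrakk> \<Longrightarrow> rot (shift z gs) = shift z (rot gs)"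
  by (cases gs rule: rev_cases)
    (auto simp: lists_of_def rot_def shift_def mul_assoc l_H l_comm map_butlast)

lemma natural_rot: "natural n n (\<lambda>gs. single1 (rot gs))"
  by (rule natural_list_fun) (simp_all add: rot_lists_of rot_shift)

lemma keys_bdry_lists_of:
  "gs \<in> lists_of (Suc (Suc n)) \<Longrightarrow> Poly_Mapping.keys (bdry gs :: 'g list \<Rightarrow>\<^sub>0 'k) \<subseteq> lists_of (Suc n)"
proof -
  assume gs: "gs \<in> lists_of (Suc (Suc n))"
  have "(\<lambda>k. dropnth k gs) ` {..<length gs} \<subseteq> lists_of (Suc n)"
    using gs by (intro image_subsetI dropnth_lists_of[OF _ gs]) (auto simp: lists_of_def)
  then show ?thesis
    using keys_bdry[of gs, where 'k = 'k] by blast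
qed

lemma natural_bdry: "natural (Suc n) n bdry"
  by (simp add: natural_def keys_bdry_lists_of) (simp add: shift_def[abs_def] bdry_map)

lemma natural_bdry': "natural (Suc n) n bdry'"
  unfolding natural_def
proof (intro ballI conjI)
  fix gs z assume gs: "gs \<in> lists_of (Suc (Suc n))"
  obtain xs a where xs: "gs = xs @ [a]" "a \<in> X" "set xs \<subseteq> X" "length xs = Suc n"
    using gs by (cases gs rule: rev_cases) (auto simp: lists_of_def)
  have "dropnth k xs @ [a] \<in> lists_of (Suc n)" if "k < Suc n" for k
    using xs that set_dropnth[of k xs] by (auto simp: lists_of_def length_dropnth)
  then show "Poly_Mapping.keys (bdry' gs :: 'g list \<Rightarrow>\<^sub>0 'k) \<subseteq> lists_of (Suc n)"
    unfolding bdry'_def xs(1) using keys_bdry[of xs, where 'k = 'k] xs(4)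
    by (intro keys_ext) auto
  show "bdry' (shift z gs) = ext (\<lambda>gs. single1 (shift z gs)) (bdry' gs)"
    unfolding shift_def[abs_def] by (rule bdry'_map[OF lists_of_nonempty[OF gs]])
qed

lemma linear_cyclic_model: "linear_cyclic model"
proof (rule linear_cyclic.intro, goal_cases)
  case (1 n)
  show ?case
    by (simp add: model_def lspace_typed vsp coinv_subspace)
next
  case (2 k n)
  note k = 2
  show ?case
    by (rule lmapI) (use op_coinv[OF natural_dropnth[OF k]] op_scale[OF natural_dropnth[OF k]]
        op_additive[OF natural_dropnth[OF k]] in \<open>auto simp: model_def additive_on_def\<close>)
next
  case (3 n)
  show ?case
    by (rule lmapI) (use op_coinv[OF natural_rot] op_scale[OF natural_rot]
        op_additive[OF natural_rot] in \<open>auto simp: model_def additive_on_def\<close>)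
qed

lemma op_signed_sum:
  assumes I: "finite I" "I \<subseteq> {..Suc n}" and \<phi>: "\<phi> \<in> coinv (Suc n)"
  shows "(\<Oplus>\<^bsub>deg model n\<^esub>k\<in>I. (-1) ^ k \<odot>\<^bsub>deg model n\<^esub> face model (Suc n) k \<phi>) =
    op (\<lambda>gs. \<Sum>k\<in>I. fscale ((-1) ^ k) (single1 (dropnth k gs))) \<phi>"
proof -
  have "pscale sc ((-1) ^ k) (op (\<lambda>gs. single1 (dropnth k gs)) \<phi>) \<in> coinv n" if "k \<in> I" for k
    using that I by (intro P.subspace_scale[OF coinv_subspace] op_coinv[OF natural_dropnth \<phi>]) auto
  then show ?thesis
    by (simp add: model_def finsum_typed[OF vsp coinv_subspace I(1)] op_fun_sum op_fun_scale
        del: fscale_single)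
qed

lemma hoch_b_model:
  assumes \<phi>: "\<phi> \<in> coinv (Suc n)"
  shows "hoch_b model (Suc n) \<phi> = op bdry \<phi>"
proof -
  have "hoch_b model (Suc n) \<phi> = op (\<lambda>gs. \<Sum>k\<le>Suc n. fscale ((-1) ^ k) (single1 (dropnth k gs))) \<phi>"
    unfolding hoch_b_def diff_Suc_1 by (rule op_signed_sum[OF _ _ \<phi>]) auto
  also have "\<dots> = op bdry \<phi>"
    by (rule op_cong[OF \<phi>]) (simp add: bdry_sum lists_of_def lessThan_Suc_atMost del: fscale_single)
  finally show ?thesis .
qed

lemma hoch_b'_model:
  assumes \<phi>: "\<phi> \<in> coinv (Suc n)"
  shows "hoch_b' model (Suc n) \<phi> = op bdry' \<phi>"
proof -
  have "hoch_b' model (Suc n) \<phi> = op (\<lambda>gs. \<Sum>k<Suc n. fscale ((-1) ^ k) (single1 (dropnth k gs))) \<phi>"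
    unfolding hoch_b'_def diff_Suc_1 by (rule op_signed_sum[OF _ _ \<phi>]) auto
  also have "\<dots> = op bdry' \<phi>"
    by (rule op_cong[OF \<phi>]) (simp add: bdry'_sum lists_of_def del: fscale_single sum.lessThan_Suc)
  finally show ?thesis .
qed

section \<open>The signed cyclic operator and the norm on the model\<close>

abbreviation top :: "nat \<Rightarrow> ('g list \<Rightarrow>\<^sub>0 'm) \<Rightarrow> ('g list \<Rightarrow>\<^sub>0 'm)"
  where "top n \<equiv> cyc_t model n"

lemma cyc_t_model: "top n \<phi> = op (\<lambda>gs. fscale ((-1) ^ n) (single1 (rot gs))) \<phi>"
  unfolding op_fun_scale by (simp add: cyc_t_def model_def)

lemma natural_t: "natural n n (\<lambda>gs. fscale ((-1) ^ n) (single1 (rot gs)))"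
  by (rule natural_scale[OF natural_rot])

lemma top_coinv: "\<phi> \<in> coinv n \<Longrightarrow> top n \<phi> \<in> coinv n"
  unfolding cyc_t_model by (rule op_coinv[OF natural_t])

lemma top_additive: "additive_on (coinv n) (top n)"
  unfolding cyc_t_model by (rule op_additive[OF natural_t])

lemma top_funpow_coinv: "\<phi> \<in> coinv n \<Longrightarrow> (top n ^^ i) \<phi> \<in> coinv n"
  by (induction i) (simp_all add: top_coinv)

lemma cyc_N_model: "\<phi> \<in> coinv n \<Longrightarrow> cyc_N model n \<phi> = (\<Sum>i\<le>n. (top n ^^ i) \<phi>)"
  using finsum_typed[OF vsp coinv_subspace finite_atMost top_funpow_coinv]
  by (simp add: cyc_N_def model_def)

lemma rot_funpow_append: "(rot ^^ length ys) (xs @ ys) = map (\<lambda>g. mul g l) ys @ xs"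
proof (induction ys arbitrary: xs rule: rev_induct)
  case (snoc a ys)
  have "(rot ^^ length (ys @ [a])) (xs @ ys @ [a]) = (rot ^^ length ys) (rot ((xs @ ys) @ [a]))"
    by (simp add: funpow_swap1)
  also have "\<dots> = (rot ^^ length ys) ((mul a l # xs) @ ys)"
    by (simp add: rot_def butlast_append)
  finally show ?case
    unfolding snoc by (simp add: map_butlast)
qed simp

text \<open>Formula and naturality go through one induction, because composing with a further
  \<open>t\<close> requires naturality of the power reached so far.\<close>

lemma top_funpow_op:
  assumes \<phi>: "\<phi> \<in> coinv n"
  shows "(top n ^^ i) \<phi> = op (\<lambda>gs. fscale (((-1) ^ n) ^ i) (single1 ((rot ^^ i) gs))) \<phi> \<and>
    natural n n (\<lambda>gs. fscale (((-1) ^ n) ^ i) (single1 ((rot ^^ i) gs)))"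
proof (induction i)
  case 0
  have "natural n n single1"
    using natural_list_fun[of n "\<lambda>gs. gs" n] by simp
  then show ?case using op_single1[OF \<phi>] by simp
next
  case (Suc i)
  then have e: "(top n ^^ i) \<phi> = op (\<lambda>gs. fscale (((-1) ^ n) ^ i) (single1 ((rot ^^ i) gs))) \<phi>"
    and nat: "natural n n (\<lambda>gs. fscale (((-1) ^ n) ^ i) (single1 ((rot ^^ i) gs)))" by auto
  have eq: "(\<lambda>gs. ext (\<lambda>gs. fscale ((-1) ^ n) (single1 (rot gs))) (fscale (((-1) ^ n) ^ i) (single1 ((rot ^^ i) gs))))
    = (\<lambda>gs. fscale (((-1) ^ n) ^ Suc i) (single1 ((rot ^^ Suc i) gs)) :: 'g list \<Rightarrow>\<^sub>0 'k)"
    by (simp add: mult.commute)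
  have "(top n ^^ Suc i) \<phi> = top n (op (\<lambda>gs. fscale (((-1) ^ n) ^ i) (single1 ((rot ^^ i) gs))) \<phi>)"
    by (simp only: funpow.simps comp_apply e)
  then show ?case
    using natural_comp[OF nat natural_t] unfolding cyc_t_model op_comp[OF nat natural_t \<phi>] eq by blast
qed

text \<open>\<open>n + 1\<close> rotations multiply every entry by \<open>l\<close>. On coinvariants
  this translation moves to the vector, where \<open>l\<close> acts as the identity by
  \<open>act_l\<close>; the sign is trivial because \<open>n (n + 1)\<close> is even.\<close>

lemma top_period:
  assumes \<phi>: "\<phi> \<in> coinv n"
  shows "(top n ^^ Suc n) \<phi> = \<phi>"
proof (rule coinv_eqI[OF _ _ \<phi>])
  show "additive_on (coinv n) (\<lambda>\<phi>. (top n ^^ Suc n) \<phi>)"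
  proof -
    have "additive_on (coinv n) (\<lambda>\<phi>. (top n ^^ i) \<phi>)" for i
      using top_additive top_funpow_coinv by (induction i) (auto simp: additive_on_def)
    then show ?thesis .
  qed
  show "additive_on (coinv n) (\<lambda>\<phi>. \<phi>)"
    by (simp add: additive_on_def)
  fix gs m assume gs: "gs \<in> lists_of (Suc n)" and m: "m \<in> W"
  note nc = nu_coinv[OF gs m]
  have s: "((-1 :: 'k) ^ n) ^ Suc n = 1"
    unfolding power_mult[symmetric] by (rule neg_one_even_power) simp
  have "(rot ^^ Suc n) gs = shift l gs"
    using rot_funpow_append[of gs "[]"] gs by (simp add: lists_of_def shift_def)
  then have "(top n ^^ Suc n) (nu gs m) = nu (shift l gs) m"
    using op_nu[OF conjunct2[OF top_funpow_op[OF nc, of "Suc n"]] gs m] top_funpow_op[OF nc, of "Suc n"]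
    unfolding s fs.scale_one by (simp add: em_single1 del: funpow.simps)
  then show "(top n ^^ Suc n) (nu gs m) = nu gs m"
    by (simp only: nu_shift[OF gs l_H m] act_l[OF m])
qed

lemma cyc_N_coinv: "\<phi> \<in> coinv n \<Longrightarrow> cyc_N model n \<phi> \<in> coinv n"
  unfolding cyc_N_model by (intro P.subspace_sum[OF coinv_subspace] top_funpow_coinv)

lemma cyc_N_additive: "additive_on (coinv n) (cyc_N model n)"
proof -
  have "additive_on (coinv n) (\<lambda>\<phi>. (top n ^^ i) \<phi>)" for i
    using top_additive top_funpow_coinv by (induction i) (auto simp: additive_on_def)
  then show ?thesis
    unfolding additive_on_def
    by (auto simp: cyc_N_model P.subspace_add[OF coinv_subspace] sum.distrib)
qed

lemma sum_top_Suc: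
  assumes \<phi>: "\<phi> \<in> coinv n"
  shows "(\<Sum>i\<le>n. (top n ^^ Suc i) \<phi>) = cyc_N model n \<phi>"
proof -
  have "(\<Sum>i\<le>n. (top n ^^ Suc i) \<phi>) + \<phi> = (\<Sum>i\<le>Suc n. (top n ^^ i) \<phi>)"
    by (subst sum.atMost_Suc_shift) (simp add: add.commute)
  also have "\<dots> = cyc_N model n \<phi> + \<phi>"
    by (simp add: cyc_N_model[OF \<phi>] top_period[OF \<phi>] del: funpow.simps)
  finally show ?thesis by simp
qed

lemma top_cyc_N:
  assumes \<phi>: "\<phi> \<in> coinv n"
  shows "top n (cyc_N model n \<phi>) = cyc_N model n \<phi>"
  using additive_on_sum[OF top_additive vsp coinv_subspace top_funpow_coinv[OF \<phi>], where I = "{..n}"]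
    sum_top_Suc[OF \<phi>]
  by (simp add: cyc_N_model[OF \<phi>])

lemma cyc_N_top:
  assumes \<phi>: "\<phi> \<in> coinv n"
  shows "cyc_N model n (top n \<phi>) = cyc_N model n \<phi>"
  using sum_top_Suc[OF \<phi>] by (simp add: cyc_N_model[OF top_coinv[OF \<phi>]] funpow_swap1)

lemma cyc_N_top_funpow: "\<phi> \<in> coinv n \<Longrightarrow> cyc_N model n ((top n ^^ i) \<phi>) = cyc_N model n \<phi>"
  by (induction i) (simp_all add: cyc_N_top top_funpow_coinv)

abbreviation fop :: "nat \<Rightarrow> ('g list \<Rightarrow>\<^sub>0 'm) \<Rightarrow> ('g list \<Rightarrow>\<^sub>0 'm)"
  where "fop k \<equiv> op (\<lambda>gs. single1 (dropnth k gs))"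

text \<open>The entry at position \<open>k\<close> stands at \<open>k + 1\<close> after rotation,
  and for \<open>k \<le> n\<close> it is not the one that moves to the front. The sign comes from
  the two degrees in which \<open>t\<close> is taken.\<close>

lemma fop_top:
  assumes \<phi>: "\<phi> \<in> coinv (Suc n)" and k: "k \<le> n"
  shows "fop (Suc k) (top (Suc n) \<phi>) = - top n (fop k \<phi>)"
proof -
  have "dropnth (Suc k) (rot gs) = rot (dropnth k gs)" if mem: "gs \<in> lists_of (Suc (Suc n))" for gs
  proof -
    obtain xs a where gs: "gs = xs @ [a]" "length xs = Suc n"
      using mem by (cases gs rule: rev_cases) (auto simp: lists_of_def)
    then show ?thesis
      using k by (simp add: rot_def dropnth_def butlast_append)
  qed
  then have "op (\<lambda>gs. ext (\<lambda>gs. single1 (dropnth (Suc k) gs)) (fscale ((-1) ^ Suc n) (single1 (rot gs)))) \<phi> =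
      op (\<lambda>gs. fscale (-1) (ext (\<lambda>gs. fscale ((-1) ^ n) (single1 (rot gs))) (single1 (dropnth k gs)))) \<phi>"
    by (intro op_cong[OF \<phi>]) simp
  then show ?thesis
    using k unfolding cyc_t_model op_fun_scale[of "-1"]
    by (simp add: op_comp[OF natural_t natural_dropnth \<phi>] op_comp[OF natural_dropnth natural_t \<phi>]
        del: fscale_single power_Suc)
qed

text \<open>The identity \<open>b (1 - t) = (1 - t) b'\<close>. Deleting the new head of a rotated
  list leaves the list without its last entry, which is also the last face in \<open>b\<close>; with
  their signs these two terms cancel.\<close>

lemma bdry_top:
  assumes \<phi>: "\<phi> \<in> coinv (Suc n)"
  shows "op bdry \<phi> - op bdry (top (Suc n) \<phi>) = op bdry' \<phi> - top n (op bdry' \<phi>)"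
proof -
  have "bdry gs - ext bdry (fscale ((-1) ^ Suc n) (single1 (rot gs))) =
      bdry' gs - ext (\<lambda>gs. fscale ((-1) ^ n) (single1 (rot gs))) (bdry' gs)"
    if mem: "gs \<in> lists_of (Suc (Suc n))" for gs
  proof -
    obtain xs a where gs: "gs = xs @ [a]" "length xs = Suc n"
      using mem by (cases gs rule: rev_cases) (auto simp: lists_of_def)
    have s: "Poly_Mapping.single xs c - Poly_Mapping.single xs c = 0" for c :: 'k by simp
    have A: "ext (\<lambda>gs. fscale ((-1) ^ n) (single1 (rot gs))) (bdry' gs) =
        fscale ((-1) ^ n) (cons (mul a l) (bdry xs))"
      unfolding gs bdry'_def by (simp add: ext_simps rot_def lin_ext_fun_scale[OF vs_fs] flip: lin_ext_fun_scale[OF vs_fs])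
    have B: "bdry gs = bdry' gs + fscale ((-1) ^ Suc n) (single1 xs)"
      unfolding gs(1) bdry_append1 bdry'_def by (simp add: gs(2))
    have C: "ext bdry (fscale ((-1) ^ Suc n) (single1 (rot gs))) =
        fscale ((-1) ^ Suc n) (single1 xs - cons (mul a l) (bdry xs))"
      unfolding gs by (simp add: ext_simps rot_def del: fscale_single)
    show ?thesis
      unfolding A C by (subst B) (simp add: fs.scale_right_diff_distrib del: fscale_single)
  qed
  then have "op (\<lambda>gs. bdry gs - ext bdry (fscale ((-1) ^ Suc n) (single1 (rot gs)))) \<phi> =
      op (\<lambda>gs. bdry' gs - ext (\<lambda>gs. fscale ((-1) ^ n) (single1 (rot gs))) (bdry' gs)) \<phi>"
    by (rule op_cong[OF \<phi>])
  then show ?thesis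
    unfolding op_fun_diff cyc_t_model
      op_comp[OF natural_t natural_bdry \<phi>] op_comp[OF natural_bdry' natural_t \<phi>] .
qed

end

section \<open>The identities of the bicomplex for the model\<close>

context orbit_model
begin

interpretation V: vector_space sc by (rule vs)
interpretation P: vector_space "pscale sc :: 'k \<Rightarrow> ('g list \<Rightarrow>\<^sub>0 'm) \<Rightarrow> _" by (rule vsp)

lemma bdry_bdry_op: "\<phi> \<in> coinv (Suc (Suc n)) \<Longrightarrow> op bdry (op bdry \<phi>) = 0"
  by (simp add: op_comp[OF natural_bdry natural_bdry] bdry_bdry op_fun_zero)

lemma bdry'_bdry'_op: "\<phi> \<in> coinv (Suc (Suc n)) \<Longrightarrow> op bdry' (op bdry' \<phi>) = 0"
  by (simp add: op_comp[OF natural_bdry' natural_bdry'] bdry'_bdry' op_fun_zero)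

lemma bdry_fop:
  assumes \<phi>: "\<phi> \<in> coinv (Suc n)"
  shows "op bdry \<phi> = (\<Sum>k\<le>Suc n. pscale sc ((-1) ^ k) (fop k \<phi>))"
    and "op bdry' \<phi> = (\<Sum>k\<le>n. pscale sc ((-1) ^ k) (fop k \<phi>))"
proof -
  have "op bdry \<phi> = op (\<lambda>gs. \<Sum>k\<le>Suc n. fscale ((-1) ^ k) (single1 (dropnth k gs))) \<phi>"
    by (rule op_cong[OF \<phi>]) (simp add: bdry_sum lists_of_def lessThan_Suc_atMost del: fscale_single)
  then show "op bdry \<phi> = (\<Sum>k\<le>Suc n. pscale sc ((-1) ^ k) (fop k \<phi>))"
    by (simp only: op_fun_sum op_fun_scale)
  have "op bdry' \<phi> = op (\<lambda>gs. \<Sum>k\<le>n. fscale ((-1) ^ k) (single1 (dropnth k gs))) \<phi>"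
    by (rule op_cong[OF \<phi>])
      (simp add: bdry'_sum lists_of_def lessThan_Suc_atMost del: fscale_single sum.lessThan_Suc)
  then show "op bdry' \<phi> = (\<Sum>k\<le>n. pscale sc ((-1) ^ k) (fop k \<phi>))"
    by (simp only: op_fun_sum op_fun_scale)
qed

lemma top_scale: "\<phi> \<in> coinv n \<Longrightarrow> top n (pscale sc c \<phi>) = pscale sc c (top n \<phi>)"
  unfolding cyc_t_model by (rule op_scale[OF natural_t])

lemma op_zero: "op p 0 = 0"
  by (simp add: op_def)

text \<open>Iterating \<open>d_(k+1) t = - t d_k\<close> expresses every face through
  \<open>d_0\<close>, with the sign absorbed into the powers of \<open>t\<close>.\<close>

lemma fop_top_funpow:
  assumes \<phi>: "\<phi> \<in> coinv (Suc n)" and k: "k \<le> Suc n"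
  shows "pscale sc ((-1) ^ k) (fop k ((top (Suc n) ^^ k) \<phi>)) = (top n ^^ k) (fop 0 \<phi>)"
  using k
proof (induction k)
  case (Suc k)
  have c: "(top (Suc n) ^^ k) \<phi> \<in> coinv (Suc n)" by (rule top_funpow_coinv[OF \<phi>])
  have "fop (Suc k) ((top (Suc n) ^^ Suc k) \<phi>) = - top n (fop k ((top (Suc n) ^^ k) \<phi>))"
    using fop_top[OF c, of k] Suc.prems by simp
  moreover have "fop k ((top (Suc n) ^^ k) \<phi>) \<in> coinv n"
    using Suc.prems by (intro op_coinv[OF natural_dropnth c]) simp
  ultimately have "pscale sc ((-1) ^ Suc k) (fop (Suc k) ((top (Suc n) ^^ Suc k) \<phi>)) =
      top n (pscale sc ((-1) ^ k) (fop k ((top (Suc n) ^^ k) \<phi>)))"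
    by (simp add: top_scale)
  then show ?case using Suc by simp
qed (simp add: V.scale_one)

text \<open>Both sides equal \<open>N d\<^sub>0 N\<close>, because \<open>(-1)\<^sup>k d\<^sub>k = t\<^sup>k d\<^sub>0 t\<^bsup>-k\<^esup>\<close> and \<open>N\<close> absorbs powers of \<open>t\<close>.\<close>

lemma bdry_cyc_N:
  assumes \<phi>: "\<phi> \<in> coinv (Suc n)"
  shows "op bdry' (cyc_N model (Suc n) \<phi>) = cyc_N model n (op bdry \<phi>)"
proof -
  let ?N = "cyc_N model (Suc n) \<phi>"
  have N: "?N \<in> coinv (Suc n)" by (rule cyc_N_coinv[OF \<phi>])
  have tN: "(top (Suc n) ^^ k) ?N = ?N" for k
    by (induction k) (simp_all add: top_cyc_N[OF \<phi>])
  have d0: "fop 0 \<psi> \<in> coinv n" if "\<psi> \<in> coinv (Suc n)" for \<psi>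
    by (rule op_coinv[OF natural_dropnth that]) simp
  have "op bdry' ?N = (\<Sum>k\<le>n. (top n ^^ k) (fop 0 ?N))"
    unfolding bdry_fop(2)[OF N] using fop_top_funpow[OF N] by (intro sum.cong) (auto simp: tN)
  also have "\<dots> = cyc_N model n (fop 0 ?N)"
    by (simp add: cyc_N_model[OF d0[OF N]])
  finally have 1: "op bdry' ?N = cyc_N model n (fop 0 ?N)" .
  \<comment> \<open>In degree \<open>n + 1\<close> the power \<open>n + 2\<close> of
    \<open>t\<close> is the identity, so \<open>?c k\<close> is \<open>\<phi>\<close> moved by the
    \<open>-k\<close>-th power of \<open>t\<close>.\<close>
  let ?c = "\<lambda>k. (top (Suc n) ^^ (Suc (Suc n) - k)) \<phi>"
  have c: "?c k \<in> coinv (Suc n)" for k by (rule top_funpow_coinv[OF \<phi>])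
  have "cyc_N model n (op bdry \<phi>) = (\<Sum>k\<le>Suc n. cyc_N model n (pscale sc ((-1) ^ k) (fop k \<phi>)))"
    unfolding bdry_fop(1)[OF \<phi>]
    by (rule additive_on_sum[OF cyc_N_additive vsp coinv_subspace])
      (auto intro!: P.subspace_scale[OF coinv_subspace] op_coinv[OF natural_dropnth \<phi>])
  also have "\<dots> = (\<Sum>k\<le>Suc n. cyc_N model n (fop 0 (?c k)))"
  proof (rule sum.cong[OF refl])
    fix k assume "k \<in> {..Suc n}"
    then have k: "k \<le> Suc n" by simp
    have "(top (Suc n) ^^ k) (?c k) = (top (Suc n) ^^ (k + (Suc (Suc n) - k))) \<phi>"
      by (simp only: funpow_add comp_apply)
    also have "\<dots> = \<phi>"
      using k top_period[OF \<phi>] by (simp del: funpow.simps)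
    finally have "pscale sc ((-1) ^ k) (fop k \<phi>) = (top n ^^ k) (fop 0 (?c k))"
      using fop_top_funpow[OF c k, of k] by simp
    then show "cyc_N model n (pscale sc ((-1) ^ k) (fop k \<phi>)) = cyc_N model n (fop 0 (?c k))"
      by (simp add: cyc_N_top_funpow[OF d0[OF c]])
  qed
  also have "\<dots> = cyc_N model n (\<Sum>k\<le>Suc n. fop 0 (?c k))"
    by (rule additive_on_sum[OF cyc_N_additive vsp coinv_subspace, symmetric]) (rule d0[OF c])
  also have "(\<Sum>k\<le>Suc n. fop 0 (?c k)) = fop 0 (\<Sum>k\<le>Suc n. ?c k)"
    by (rule additive_on_sum[OF op_additive[OF natural_dropnth[of 0 n]] vsp coinv_subspace, symmetric])
      (simp_all only: zero_le c)
  \<comment> \<open>For \<open>k = 0, ..., n + 1\<close> the exponents \<open>n + 2 - k\<close> run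
    through \<open>n + 2, ..., 1\<close>; reversing the order gives the sum in
    \<open>sum_top_Suc\<close>.\<close>
  also have "(\<Sum>k\<le>Suc n. ?c k) = (\<Sum>k<Suc (Suc n). (top (Suc n) ^^ Suc (Suc (Suc n) - Suc k)) \<phi>)"
    unfolding lessThan_Suc_atMost by (intro sum.cong refl) (simp add: Suc_diff_le del: funpow.simps)
  also have "\<dots> = (\<Sum>k<Suc (Suc n). (top (Suc n) ^^ Suc k) \<phi>)"
    by (rule sum.nat_diff_reindex)
  also have "\<dots> = ?N"
    unfolding lessThan_Suc_atMost by (rule sum_top_Suc[OF \<phi>])
  finally show ?thesis using 1 by simp
qed

lemma vert_model:
  assumes \<phi>: "\<phi> \<in> coinv (Suc q)"
  shows "bicomplex_vert model p (Suc q) \<phi> = (if even p then op bdry \<phi> else - op bdry' \<phi>)"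
  by (simp add: bicomplex_vert_def hoch_b_model[OF \<phi>] hoch_b'_model[OF \<phi>]) (simp add: model_def)

lemma hor_model: "bicomplex_hor model p q \<phi> = (if odd p then \<phi> - top q \<phi> else cyc_N model q \<phi>)"
proof -
  have "deg model q = typed_space (pscale sc) (coinv q)" by (simp add: model_def)
  then show ?thesis by (simp add: bicomplex_hor_def)
qed

lemma deg_model [simp]: "deg model n = typed_space (pscale sc) (coinv n)"
  by (simp add: model_def)

lemma op_uminus: "\<lbrakk>natural n k p; \<phi> \<in> coinv n\<rbrakk> \<Longrightarrow> op p (- \<phi>) = - op p \<phi>"
  by (rule additive_on_minus[OF op_additive vsp coinv_subspace])

lemma coinv_diff: "\<lbrakk>\<phi> \<in> coinv n; \<psi> \<in> coinv n\<rbrakk> \<Longrightarrow> \<phi> - \<psi> \<in> coinv n"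
  by (rule P.subspace_diff[OF coinv_subspace])

lemma coinv_uminus: "\<phi> \<in> coinv n \<Longrightarrow> - \<phi> \<in> coinv n"
  by (rule P.subspace_neg[OF coinv_subspace])

lemma additive_on_coinv_diff:
  assumes "additive_on (coinv n) f" "\<phi> \<in> coinv n" "\<psi> \<in> coinv n"
  shows "f (\<phi> - \<psi>) = f \<phi> - f \<psi>"
proof -
  have "f (\<phi> + - \<psi>) = f \<phi> + f (- \<psi>)"
    using assms coinv_uminus unfolding additive_on_def by blast
  then show ?thesis
    using additive_on_minus[OF assms(1) vsp coinv_subspace assms(3)] by simp
qed

lemma vert_vert_model:
  assumes \<phi>: "\<phi> \<in> coinv (Suc (Suc q))"
  shows "bicomplex_vert model p (Suc q) (bicomplex_vert model p (Suc (Suc q)) \<phi>) = 0"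
proof -
  have b: "op bdry \<phi> \<in> coinv (Suc q)" "op bdry' \<phi> \<in> coinv (Suc q)"
    using op_coinv[OF natural_bdry \<phi>] op_coinv[OF natural_bdry' \<phi>] by auto
  then show ?thesis
    using \<phi> by (simp add: vert_model coinv_uminus bdry_bdry_op bdry'_bdry'_op op_uminus[OF natural_bdry'])
qed

lemma hor_hor_model:
  assumes \<phi>: "\<phi> \<in> coinv q" and p: "p > 0"
  shows "bicomplex_hor model p q (bicomplex_hor model (Suc p) q \<phi>) = 0"
  using additive_on_coinv_diff[OF cyc_N_additive \<phi> top_coinv[OF \<phi>]]
  by (simp add: hor_model top_cyc_N[OF \<phi>] cyc_N_top[OF \<phi>])

lemma vert_hor_model:
  assumes \<phi>: "\<phi> \<in> coinv (Suc q)"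
  shows "bicomplex_vert model p (Suc q) (bicomplex_hor model (Suc p) (Suc q) \<phi>) +
    bicomplex_hor model (Suc p) q (bicomplex_vert model (Suc p) (Suc q) \<phi>) = 0"
proof (cases "even p")
  case True
  have "top q (- op bdry' \<phi>) = - top q (op bdry' \<phi>)"
    by (rule additive_on_minus[OF top_additive vsp coinv_subspace op_coinv[OF natural_bdry' \<phi>]])
  then show ?thesis
    using True bdry_top[OF \<phi>] additive_on_coinv_diff[OF op_additive[OF natural_bdry] \<phi> top_coinv[OF \<phi>]]
    by (simp add: vert_model[OF \<phi>] vert_model[OF coinv_diff[OF \<phi> top_coinv[OF \<phi>]]] hor_model)
next
  case False
  then show ?thesis
    by (simp add: vert_model[OF \<phi>] vert_model[OF cyc_N_coinv[OF \<phi>]] hor_model bdry_cyc_N[OF \<phi>])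
qed

text \<open>On \<open>H\<close> the retraction is the identity, so the same \<open>r\<close> serves
  for \<open>X = H\<close>. Since \<open>nu\<close>, \<open>em\<close> and \<open>op\<close> do not
  mention \<open>X\<close>, both models share them.\<close>

lemma orbit_model_H: "orbit_model mul iv e H H r act W sc l"
proof -
  have X: "\<And>z. z \<in> H \<Longrightarrow> z \<in> X" using H_X by auto
  show ?thesis
    by unfold_locales
      (auto simp: W X vs e_H mul_H mul_assoc mul_e e_mul iv_H mul_iv iv_mul r_id act_W
        act_add act_scale act_e act_mul l_H l_comm act_l V.vector_space_assms)
qed

section \<open>The retraction on coinvariants and the exactness of its kernel\<close>

lemma map_r_lists_of: "gs \<in> lists_of n \<Longrightarrow> map r gs \<in> lists_of n"
  using H_X r_H by (auto simp: lists_of_def)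

lemma map_r_shift: "\<lbrakk>gs \<in> lists_of n; z \<in> H\<rbrakk> \<Longrightarrow> map r (shift z gs) = shift z (map r gs)"
  by (auto simp: lists_of_def shift_def r_mul)

abbreviation rop :: "('g list \<Rightarrow>\<^sub>0 'm) \<Rightarrow> ('g list \<Rightarrow>\<^sub>0 'm)"
  where "rop \<equiv> op (\<lambda>gs. single1 (map r gs))"

lemma natural_r: "natural n n (\<lambda>gs. single1 (map r gs))"
  by (rule natural_list_fun) (simp_all add: map_r_lists_of map_r_shift)

lemma natural_htpy: "natural n (Suc n) (htpy r)"
  unfolding natural_def
proof (intro ballI conjI)
  fix gs z assume gs: "gs \<in> lists_of (Suc n)"
  then show "Poly_Mapping.keys (htpy r gs :: 'g list \<Rightarrow>\<^sub>0 'k) \<subseteq> lists_of (Suc (Suc n))"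
    using keys_htpy[of X r gs, where 'k = 'k] r_H H_X by (auto simp: lists_of_def)
  assume "z \<in> H"
  then show "htpy r (shift z gs) = ext (\<lambda>gs. single1 (shift z gs)) (htpy r gs)"
    unfolding shift_def using gs by (intro htpy_map) (auto simp: lists_of_def r_mul)
qed

lemma natural_degen_last: "natural n (Suc n) (\<lambda>gs. single1 (last gs # gs))"
proof (rule natural_list_fun)
  fix gs z assume gs: "gs \<in> lists_of (Suc n)"
  then have "last gs \<in> X"
    using last_in_set[OF lists_of_nonempty[OF gs]] by (auto simp: lists_of_def)
  then show "last gs # gs \<in> lists_of (Suc (Suc n))"
    using gs by (simp add: lists_of_def)
  show "last (shift z gs) # shift z gs = shift z (last gs # gs)"
    using lists_of_nonempty[OF gs] by (simp add: shift_def last_map)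
qed

lemma rop_fop: "\<lbrakk>k \<le> Suc n; \<phi> \<in> coinv (Suc n)\<rbrakk> \<Longrightarrow> rop (fop k \<phi>) = fop k (rop \<phi>)"
  by (simp add: op_comp[OF natural_dropnth natural_r] op_comp[OF natural_r natural_dropnth] dropnth_map)

lemma rop_rot:
  assumes \<phi>: "\<phi> \<in> coinv n"
  shows "rop (op (\<lambda>gs. single1 (rot gs)) \<phi>) = op (\<lambda>gs. single1 (rot gs)) (rop \<phi>)"
proof -
  have "map r (rot gs) = rot (map r gs)" if gs: "gs \<in> lists_of (Suc n)" for gs
  proof -
    obtain xs a where "gs = xs @ [a]" using gs lists_of_nonempty by (cases gs rule: rev_cases) auto
    then show ?thesis using gs by (simp add: rot_def lists_of_def r_mul l_H)
  qed
  then show ?thesis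
    by (simp add: op_comp[OF natural_rot natural_r \<phi>] op_comp[OF natural_r natural_rot \<phi>])
      (rule op_cong[OF \<phi>], simp)
qed

text \<open>On the kernel of \<open>rop\<close> the prism formula reads
  \<open>b h = - 1 - h b\<close>, so a cycle \<open>\<phi>\<close> is the boundary of
  \<open>- h \<phi>\<close>. The prism preserves the kernel because it commutes with
  \<open>rop\<close>.\<close>

lemma kernel_exact_bdry:
  assumes \<phi>: "\<phi> \<in> coinv q" and k: "rop \<phi> = 0" and b: "q = 0 \<or> op bdry \<phi> = 0"
  shows "\<exists>\<psi>\<in>coinv (Suc q). rop \<psi> = 0 \<and> op bdry \<psi> = \<phi>"
proof -
  let ?h = "op (htpy r) \<phi>"
  have h: "?h \<in> coinv (Suc q)" by (rule op_coinv[OF natural_htpy \<phi>])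
  have "rop ?h = op (\<lambda>gs. htpy r (map r gs)) \<phi>"
    unfolding op_comp[OF natural_htpy natural_r \<phi>]
    by (intro op_cong[OF \<phi>] htpy_map[symmetric]) simp
  also have "\<dots> = op (htpy r) (rop \<phi>)"
    by (simp add: op_comp[OF natural_r natural_htpy \<phi>])
  finally have 1: "rop ?h = 0"
    by (simp add: k op_zero)
  have "op bdry ?h = op (\<lambda>gs. single1 (map r gs) - single1 gs - ext (htpy r) (bdry gs)) \<phi>"
    unfolding op_comp[OF natural_htpy natural_bdry \<phi>] htpy_homotopy ..
  also have "\<dots> = - \<phi> - op (\<lambda>gs. ext (htpy r) (bdry gs)) \<phi>"
    by (simp add: op_fun_diff k op_single1[OF \<phi>])
  also have "op (\<lambda>gs. ext (htpy r) (bdry gs)) \<phi> = 0"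
  proof (cases q)
    case 0
    \<comment> \<open>A one-element list is sent by \<open>bdry\<close> to the empty list, on which
      \<open>htpy\<close> vanishes. So no cycle condition is required in degree 0.\<close>
    have "ext (htpy r) (bdry gs) = (0 :: 'g list \<Rightarrow>\<^sub>0 'k)" if "gs \<in> lists_of (Suc 0)" for gs
      using that by (cases gs) (auto simp: lists_of_def)
    then have "op (\<lambda>gs. ext (htpy r) (bdry gs)) \<phi> = op (\<lambda>gs. 0) \<phi>"
      using \<phi> 0 by (intro op_cong) auto
    then show ?thesis by (simp add: op_fun_zero)
  next
    case (Suc n)
    then show ?thesis
      using b \<phi> op_comp[OF natural_bdry natural_htpy, of \<phi> n] by (simp add: op_zero)
  qed
  finally have "op bdry (- ?h) = \<phi>"
    by (simp add: op_uminus[OF natural_bdry h])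
  moreover have "rop (- ?h) = 0"
    by (simp add: op_uminus[OF natural_r h] 1)
  ultimately show ?thesis
    using coinv_uminus[OF h] by blast
qed

text \<open>The extra degeneracy contracts the whole \<open>b'\<close> complex and commutes with
  \<open>rop\<close>, so it also contracts the kernel. In degree 0 the operator \<open>bdry'\<close>
  is zero.\<close>

lemma kernel_exact_bdry':
  assumes \<phi>: "\<phi> \<in> coinv q" and k: "rop \<phi> = 0" and b: "q = 0 \<or> op bdry' \<phi> = 0"
  shows "\<exists>\<psi>\<in>coinv (Suc q). rop \<psi> = 0 \<and> op bdry' \<psi> = \<phi>"
proof -
  let ?s = "\<lambda>gs. single1 (last gs # gs) :: 'g list \<Rightarrow>\<^sub>0 'k"
  have s: "op ?s \<phi> \<in> coinv (Suc q)" by (rule op_coinv[OF natural_degen_last \<phi>])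
  have "rop (op ?s \<phi>) = op ?s (rop \<phi>)"
    unfolding op_comp[OF natural_degen_last natural_r \<phi>] op_comp[OF natural_r natural_degen_last \<phi>]
    by (rule op_cong[OF \<phi>]) (simp add: last_map[OF lists_of_nonempty])
  then have 1: "rop (op ?s \<phi>) = 0"
    by (simp add: k op_zero)
  have "op bdry' (op ?s \<phi>) = op (\<lambda>gs. single1 gs - ext ?s (bdry' gs)) \<phi>"
    unfolding op_comp[OF natural_degen_last natural_bdry' \<phi>]
    by (rule op_cong[OF \<phi>]) (simp add: degen_last_homotopy lists_of_nonempty)
  also have "\<dots> = \<phi> - op (\<lambda>gs. ext ?s (bdry' gs)) \<phi>"
    by (simp add: op_fun_diff op_single1[OF \<phi>])
  also have "op (\<lambda>gs. ext ?s (bdry' gs)) \<phi> = 0"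
  proof (cases q)
    case 0
    have "ext ?s (bdry' gs) = (0 :: 'g list \<Rightarrow>\<^sub>0 'k)" if "gs \<in> lists_of (Suc 0)" for gs
      using that by (cases gs) (auto simp: lists_of_def bdry'_def)
    then have "op (\<lambda>gs. ext ?s (bdry' gs)) \<phi> = op (\<lambda>gs. 0) \<phi>"
      using \<phi> 0 by (intro op_cong) auto
    then show ?thesis by (simp add: op_fun_zero)
  next
    case (Suc n)
    then show ?thesis
      using b \<phi> op_comp[OF natural_bdry' natural_degen_last, of \<phi> n] by (simp add: op_zero)
  qed
  finally have "op bdry' (op ?s \<phi>) = \<phi>" by simp
  then show ?thesis using s 1 by blast
qed

text \<open>Coinvariants for \<open>H\<close> are functions supported on lists in \<open>H\<close>,
  hence contained in those for \<open>X\<close>, and \<open>rop\<close> fixes them. The inclusion is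
  therefore a section of \<open>rop\<close>, which yields surjectivity.\<close>

lemma rop_H:
  assumes HM: "orbit_model mul iv e H H r act W sc l"
  shows "\<phi> \<in> coinv n \<Longrightarrow> rop \<phi> \<in> orbit_model.coinv e H r W n"
    and "\<phi> \<in> orbit_model.coinv e H r W n \<Longrightarrow> \<phi> \<in> coinv n \<and> rop \<phi> = \<phi>"
proof -
  interpret HM: orbit_model mul iv e H H r act W sc l by (rule HM)
  assume \<phi>: "\<phi> \<in> coinv n"
  have "em (single1 (map r gs)) (Poly_Mapping.lookup \<phi> gs) \<in> HM.coinv n" if "gs \<in> Poly_Mapping.keys \<phi>" for gs
    using coinv_keys[OF \<phi> that] coinv_lookup[OF \<phi>] r_H
    by (intro HM.em_coinv) (auto simp: HM.lists_of_def lists_of_def)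
  then show "rop \<phi> \<in> HM.coinv n"
    unfolding op_def psum_def by (intro P.subspace_sum[OF HM.coinv_subspace])
next
  interpret HM: orbit_model mul iv e H H r act W sc l by (rule HM)
  assume \<phi>: "\<phi> \<in> HM.coinv n"
  have "HM.lists_of (Suc n) \<subseteq> lists_of (Suc n)"
    using H_X by (auto simp: HM.lists_of_def lists_of_def)
  then have \<phi>': "\<phi> \<in> coinv n"
    using \<phi> by (auto simp: HM.coinv_def coinv_def)
  have "rop \<phi> = op single1 \<phi>"
  proof (rule HM.op_cong[OF \<phi>])
    fix gs assume "gs \<in> HM.lists_of (Suc n)"
    then have "map r gs = gs"
      by (intro map_idI r_id) (auto simp: HM.lists_of_def)
    then show "single1 (map r gs) = (single1 gs :: 'g list \<Rightarrow>\<^sub>0 'k)" by simp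
  qed
  then show "\<phi> \<in> coinv n \<and> rop \<phi> = \<phi>"
    using \<phi>' by (simp add: op_single1)
qed

theorem model_quasi_iso:
  "cyclic_quasi_iso model (orbit_model.model mul iv e H r act W sc l) (\<lambda>n. rop)"
proof -
  interpret HM: orbit_model mul iv e H H r act W sc l by (rule orbit_model_H)
  note rH = rop_H[OF orbit_model_H]
  have lin: "lmap (deg model n) (deg HM.model n) rop" for n
    by (rule lmapI) (use rH(1) op_additive[OF natural_r] op_scale[OF natural_r] in
        \<open>auto simp: additive_on_def\<close>)
  show ?thesis
  proof (intro cyclic_quasi_iso.intro cyclic_map.intro cyclic_map_axioms.intro
      cyclic_quasi_iso_axioms.intro linear_cyclic_model HM.linear_cyclic_model lin, goal_cases)
    case (1 k n \<phi>)
    then show ?case by (simp add: model_def HM.model_def rop_fop)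
  next
    case (2 \<phi> n)
    then show ?case by (simp add: model_def HM.model_def rop_rot)
  next
    case (3 \<phi> q p)
    then show ?case by (simp add: vert_vert_model)
  next
    case (4 \<phi> q p)
    then show ?case by (simp add: hor_hor_model)
  next
    case (5 \<phi> q p)
    then show ?case by (simp add: vert_hor_model)
  next
    case (6 \<phi> n)
    then show ?case using rH(2)[of \<phi> n] by auto
  next
    case (7 \<phi> q p)
    then have \<phi>: "\<phi> \<in> coinv q" "rop \<phi> = 0" by simp_all
    show ?case
    proof (cases "even p")
      case True
      have "q = 0 \<or> op bdry \<phi> = 0"
        using 7(3) \<phi>(1) True by (cases q) (auto simp: vert_model)
      then show ?thesis
        using kernel_exact_bdry[OF \<phi>] True by (fastforce simp: vert_model)
    next
      case False
      have "q = 0 \<or> op bdry' \<phi> = 0"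
        using 7(3) \<phi>(1) False by (cases q) (auto simp: vert_model)
      then obtain \<psi> where \<psi>: "\<psi> \<in> coinv (Suc q)" "rop \<psi> = 0" "op bdry' \<psi> = \<phi>"
        using kernel_exact_bdry'[OF \<phi>] by blast
      \<comment> \<open>Odd columns carry \<open>- b'\<close>, hence the sign of the
        witness.\<close>
      then show ?thesis
        using False coinv_uminus[OF \<psi>(1)]
        by (intro bexI[of _ "- \<psi>"])
          (simp_all add: vert_model op_uminus[OF natural_bdry' \<psi>(1)] op_uminus[OF natural_r \<psi>(1)])
    qed
  qed
qed

end

section \<open>Expanding tensors into composable arrows\<close>

text \<open>The part of \<open>b\<^sub>0 \<otimes> \<dots> \<otimes> b\<^sub>n\<close> that consists of arrows with source \<open>x\<close>.\<close>

fun expand :: "'g groupoid \<Rightarrow> 'g \<Rightarrow> ('g \<Rightarrow>\<^sub>0 'k::field) list \<Rightarrow> ('g list \<Rightarrow>\<^sub>0 'k)"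
  where "expand G x [] = single1 []"
  | "expand G x (b # bs) = ext (\<lambda>g. if src G g = x then cons g (expand G x bs) else 0) b"

definition face_list :: "'g groupoid \<Rightarrow> nat \<Rightarrow> ('g \<Rightarrow>\<^sub>0 'k::field) list \<Rightarrow> ('g \<Rightarrow>\<^sub>0 'k) list"
  where "face_list G k bs = (let r = gcounit G (bs ! k) in
    if Suc k < length bs
    then take k bs @ gmult G (bs ! Suc k) r # drop (Suc (Suc k)) bs
    else take (k - 1) bs @ [gmult G (bs ! (k - 1)) r])"

lemmas ext_fun_scale = lin_ext_fun_scale[OF vs_fs]

lemma tuple_face_eq: "tuple_face G k (m, bs) = single1 (m, face_list G k bs)"
  by (simp add: tuple_face_def face_list_def Let_def)

lemma expand_update_add:
  "i < length bs \<Longrightarrow> expand G x (bs[i := b + b']) = expand G x (bs[i := b]) + expand G x (bs[i := b'])"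
proof (induction bs arbitrary: i)
  case (Cons a bs)
  show ?case
  proof (cases i)
    case (Suc j)
    have "(\<lambda>g. if src G g = x then cons g (expand G x (bs[j := b + b'])) else 0) =
      (\<lambda>g. (if src G g = x then cons g (expand G x (bs[j := b])) else 0) +
        (if src G g = x then cons g (expand G x (bs[j := b'])) else 0))"
      using Cons Suc by (auto simp: lin_ext_add)
    then show ?thesis
      using Suc by (simp add: lin_ext_fun_add)
  qed (simp add: lin_ext_add)
qed simp

lemma expand_update_scale:
  "i < length bs \<Longrightarrow> expand G x (bs[i := fscale c b]) = fscale c (expand G x (bs[i := b]))"
proof (induction bs arbitrary: i)
  case (Cons a bs)
  show ?case
  proof (cases i)
    case (Suc j)
    have "(\<lambda>g. if src G g = x then cons g (expand G x (bs[j := fscale c b])) else 0) =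
      (\<lambda>g. fscale c (if src G g = x then cons g (expand G x (bs[j := b])) else 0))"
      using Cons Suc by (auto simp: lin_ext_scale)
    then show ?thesis
      using Suc by (simp add: ext_fun_scale)
  qed (simp add: lin_ext_scale)
qed simp

lemma gmult_single1:
  "gmult G b (single1 g) = ext (\<lambda>h. if src G h = tgt G g then single1 (cmp G h g) else 0) b"
  by (simp add: gmult_def)

lemma gmult_add_right: "gmult G b (c + c') = gmult G b c + gmult G b c'"
  by (simp add: gmult_def lin_ext_add lin_ext_fun_add)

lemma gmult_scale_right: "gmult G b (fscale a c) = fscale a (gmult G b c)"
  by (simp add: gmult_def lin_ext_scale ext_fun_scale)

section \<open>Behaviour of the expansion under multiplication, counit and rotation\<close>

context groupoid
begin

text \<open>Objects are orthogonal idempotents, and \<open>g x\<close> is \<open>g\<close> for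
  \<open>x = s(g)\<close> and 0 for every other object; so \<open>r\<close> scales each arrow by its
  coefficient at the source.\<close>

lemma gmult_base:
  assumes b: "b \<in> galg G" and r: "r \<in> gbase G"
  shows "gmult G b r = ext (\<lambda>g. Poly_Mapping.single g (Poly_Mapping.lookup r (src G g))) b"
  unfolding gmult_def
proof (rule lin_ext_cong)
  fix g assume "g \<in> Poly_Mapping.keys b"
  then have g: "g \<in> Arr G" using b by (auto simp: galg_def)
  have "ext (\<lambda>h. if src G g = tgt G h then single1 (cmp G g h) else 0) r =
      (\<Sum>h\<in>Poly_Mapping.keys r. if h = src G g then Poly_Mapping.single g (Poly_Mapping.lookup r h) else 0)"
    unfolding lin_ext_def using r g
    by (intro sum.cong) (auto simp: gbase_def tgt_Obj cmp_src subset_iff)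
  then show "ext (\<lambda>h. if src G g = tgt G h then single1 (cmp G g h) else 0) r =
      Poly_Mapping.single g (Poly_Mapping.lookup r (src G g))"
    by (simp add: sum.delta in_keys_iff)
qed

lemma gmult_closed:
  assumes "b \<in> galg G" "c \<in> galg G"
  shows "gmult G b c \<in> galg G"
proof -
  have "Poly_Mapping.keys (gmult G b c) \<subseteq> Arr G"
    unfolding gmult_def
    by (intro keys_ext) (use assms in \<open>auto simp: galg_def subset_iff intro!: cmp_closed\<close>)
  then show ?thesis by (simp add: galg_def)
qed

lemma gbase_galg: "r \<in> gbase G \<Longrightarrow> r \<in> galg G"
  using Obj_subset by (auto simp: gbase_def galg_def)

lemma gcounit_gbase: "b \<in> galg G \<Longrightarrow> gcounit G b \<in> gbase G"
proof -
  assume "b \<in> galg G"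
  then have "Poly_Mapping.keys (gcounit G b) \<subseteq> Obj G"
    unfolding gcounit_def by (intro keys_ext) (auto simp: galg_def src_closed)
  then show ?thesis by (simp add: gbase_def)
qed

lemma single_galg: "g \<in> Arr G \<Longrightarrow> Poly_Mapping.single g c \<in> galg G"
  by (simp add: galg_def)

lemma galg_subspace: "module.subspace fscale (galg G)"
  using keys_in_subspace by (simp add: galg_def)

lemma keys_expand:
  assumes "set bs \<subseteq> galg G"
  shows "Poly_Mapping.keys (expand G x bs :: 'g list \<Rightarrow>\<^sub>0 'k::field) \<subseteq>
    {gs. length gs = length bs \<and> set gs \<subseteq> {g \<in> Arr G. src G g = x}}"
  using assms
proof (induction bs)
  case (Cons b bs)
  have "Poly_Mapping.keys (if src G g = x then cons g (expand G x bs) else 0 :: 'g list \<Rightarrow>\<^sub>0 'k) \<subseteq>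
      {gs. length gs = length (b # bs) \<and> set gs \<subseteq> {g \<in> Arr G. src G g = x}}"
    if "g \<in> Poly_Mapping.keys b" for g
  proof -
    have g: "g \<in> Arr G" using that Cons.prems by (auto simp: galg_def)
    have "Poly_Mapping.keys (cons g (expand G x bs) :: 'g list \<Rightarrow>\<^sub>0 'k) \<subseteq>
      {gs. length gs = length (b # bs) \<and> set gs \<subseteq> {g \<in> Arr G. src G g = x}}" if "src G g = x"
      by (rule keys_ext) (use Cons g that in auto)
    then show ?thesis by simp
  qed
  then show ?case
    unfolding expand.simps by (rule keys_ext)
qed simp

text \<open>The factor depends on the common source \<open>x\<close> only and not on the position
  \<open>i\<close>. This is why expansion respects balancing over \<open>R\<close>.\<close>

lemma expand_update_base:
  assumes r: "r \<in> gbase G" and b: "b \<in> galg G"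
  shows "i < length bs \<Longrightarrow> expand G x (bs[i := gmult G b r]) =
    fscale (Poly_Mapping.lookup r x) (expand G x (bs[i := b]))"
proof (induction bs arbitrary: i)
  case (Cons a bs)
  show ?case
  proof (cases i)
    case 0
    have "(\<lambda>g. ext (\<lambda>g. if src G g = x then cons g (expand G x bs) else 0)
          (Poly_Mapping.single g (Poly_Mapping.lookup r (src G g)))) =
        (\<lambda>g. fscale (Poly_Mapping.lookup r x) (if src G g = x then cons g (expand G x bs) else 0))"
      by auto
    then show ?thesis
      using 0 by (simp add: gmult_base[OF b r] lin_ext_comp ext_fun_scale[symmetric])
  next
    case (Suc j)
    have "(\<lambda>g. if src G g = x then cons g (expand G x (bs[j := gmult G b r])) else 0) =
      (\<lambda>g. fscale (Poly_Mapping.lookup r x) (if src G g = x then cons g (expand G x (bs[j := b])) else 0))"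
      using Cons Suc by (auto simp: lin_ext_scale)
    then show ?thesis
      using Suc by (simp add: ext_fun_scale)
  qed
qed simp

text \<open>Right multiplication by \<open>g\<close> kills all arrows except those starting at
  \<open>t(g)\<close>, and gives these the source \<open>s(g)\<close>. So one part is carried to one
  part; \<open>expand_act_other\<close> states that nothing arrives elsewhere.\<close>

lemma expand_act:
  assumes g: "g \<in> Arr G" and "set bs \<subseteq> galg G"
  shows "expand G (src G g) (map (\<lambda>b. gmult G b (single1 g)) bs) =
    lmaps (\<lambda>h. cmp G h g) (expand G (tgt G g) bs)"
  using assms(2)
proof (induction bs)
  case (Cons b bs)
  show ?case
    unfolding list.map expand.simps gmult_single1[of G b] ext_simps
  proof (rule lin_ext_cong)
    fix h assume "h \<in> Poly_Mapping.keys b"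
    then have h: "h \<in> Arr G" using Cons.prems by (auto simp: galg_def)
    show "ext (\<lambda>h. if src G h = src G g then cons h (expand G (src G g) (map (\<lambda>b. gmult G b (single1 g)) bs)) else 0)
        (if src G h = tgt G g then single1 (cmp G h g) else 0) =
      lmaps (\<lambda>h. cmp G h g) (if src G h = tgt G g then cons h (expand G (tgt G g) bs) else 0)"
      using Cons h g by (simp add: src_cmp ext_simps)
  qed
qed simp

lemma expand_act_other:
  assumes g: "g \<in> Arr G" and "set bs \<subseteq> galg G" and "x \<noteq> src G g" and "bs \<noteq> []"
  shows "expand G x (map (\<lambda>b. gmult G b (single1 g)) bs) = (0 :: 'g list \<Rightarrow>\<^sub>0 'k::field)"
proof -
  obtain b bs' where bs: "bs = b # bs'" using assms(4) by (cases bs) auto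
  have "ext (\<lambda>h. ext (\<lambda>h. if src G h = x then cons h (expand G x (map (\<lambda>b. gmult G b (single1 g)) bs')) else 0)
        (if src G h = tgt G g then single1 (cmp G h g) else 0)) b =
      ext (\<lambda>h. 0 :: 'g list \<Rightarrow>\<^sub>0 'k) b"
    by (rule lin_ext_cong) (use assms bs in \<open>auto simp: galg_def src_cmp\<close>)
  then show ?thesis
    by (simp add: bs gmult_single1[of G b] ext_simps lin_ext_fun_zero)
qed

lemma expand_map_single1:
  "\<forall>g\<in>set gs. src G g = x \<Longrightarrow> expand G x (map single1 gs) = (single1 gs :: 'g list \<Rightarrow>\<^sub>0 'k::field)"
  by (induction gs) simp_all

lemma lookup_gcounit:
  "ext (\<lambda>g. if src G g = x then t else 0) b = fscale (Poly_Mapping.lookup (gcounit G b) x) t"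
proof -
  have "fscale (Poly_Mapping.lookup (gcounit G b) x) t =
      (\<Sum>g\<in>Poly_Mapping.keys b. fscale (Poly_Mapping.lookup b g * (1 when src G g = x)) t)"
    unfolding gcounit_def lin_ext_def lookup_sum by (simp add: fs.scale_sum_left lookup_single mult_when)
  also have "\<dots> = ext (\<lambda>g. if src G g = x then t else 0) b"
    unfolding lin_ext_def by (rule sum.cong) (auto simp: when_def)
  finally show ?thesis by simp
qed

lemma face_list_0: "face_list G 0 (b # b' # bs) = gmult G b' (gcounit G b) # bs"
  by (simp add: face_list_def)

lemma face_list_1: "face_list G (Suc 0) [b, b'] = [gmult G b (gcounit G b')]"
  by (simp add: face_list_def)

lemma face_list_Suc: "length bs \<ge> 2 \<Longrightarrow> k < length bs \<Longrightarrow> face_list G (Suc k) (b # bs) = b # face_list G k bs"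
  by (cases k) (auto simp: face_list_def Let_def)

lemma face_list_closed:
  assumes "set bs \<subseteq> galg G" "k < length bs" "length bs \<ge> 2"
  shows "set (face_list G k bs) \<subseteq> galg G" and "length (face_list G k bs) = length bs - 1"
proof -
  have m: "gmult G (bs ! i) (gcounit G (bs ! k)) \<in> galg G" if "i < length bs" for i
    using that assms by (intro gmult_closed gbase_galg[OF gcounit_gbase]) auto
  have sub: "set (take j bs) \<subseteq> galg G" "set (drop j bs) \<subseteq> galg G" for j
    using assms(1) set_take_subset[of j bs] set_drop_subset[of j bs] by auto
  show "set (face_list G k bs) \<subseteq> galg G"
    using m[of "Suc k"] m[of "k - 1"] sub assms(2) by (simp add: face_list_def Let_def)
  show "length (face_list G k bs) = length bs - 1"
    using assms(2,3) by (auto simp: face_list_def Let_def)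
qed

text \<open>Summing out the entry \<open>b_k\<close> in the part of source \<open>x\<close> leaves
  the coefficient of \<open>\<epsilon>(b_k)\<close> at \<open>x\<close>, by
  \<open>lookup_gcounit\<close>. The neighbour that absorbs \<open>\<epsilon>(b_k)\<close>
  contributes the same scalar, whether it is the next one or the previous one.\<close>

lemma expand_face:
  assumes "set bs \<subseteq> galg G" "k < length bs" "length bs \<ge> 2"
  shows "(expand G x (face_list G k bs) :: 'g list \<Rightarrow>\<^sub>0 'k::field) =
    ext (\<lambda>gs. single1 (dropnth k gs)) (expand G x bs)"
  using assms
proof (induction bs arbitrary: k)
  case (Cons b bs)
  let ?drop = "\<lambda>k. ext (\<lambda>gs. single1 (dropnth k gs)) :: ('a list \<Rightarrow>\<^sub>0 'k) \<Rightarrow> _"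
  have drop_cons: "?drop 0 (cons g t) = t" "?drop (Suc k) (cons g t) = cons g (?drop k t)" for g t k
    by (simp_all add: ext_simps dropnth_def ext_single1)
  obtain b' bs' where bs: "bs = b' # bs'" using Cons.prems by (cases bs) auto
  have b: "b \<in> galg G" "b' \<in> galg G" using Cons.prems bs by auto
  consider "k = 0" | "bs' = []" "k = Suc 0" | j where "k = Suc j" "bs' \<noteq> []"
    using Cons.prems bs by (cases k; cases bs') auto
  then show ?case
  proof cases
    case 1
    have "?drop 0 (expand G x (b # bs)) = ext (\<lambda>g. if src G g = x then expand G x bs else 0) b"
      unfolding expand.simps(2)[of G x b] ext_simps(4)[of _ _ b]
      by (simp only: if_distrib[of "?drop 0"] drop_cons lin_ext_zero)
    also have "\<dots> = expand G x (gmult G b' (gcounit G b) # bs')"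
      using expand_update_base[OF gcounit_gbase[OF b(1)] b(2), of 0 bs x] bs
      by (simp add: lookup_gcounit)
    finally show ?thesis using 1 bs by (simp add: face_list_0)
  next
    case 2
    have d: "?drop 0 (expand G x [b']) = fscale (Poly_Mapping.lookup (gcounit G b') x) (single1 [])"
      unfolding lookup_gcounit[symmetric] expand.simps ext_simps(4)[of _ _ b']
      by (rule lin_ext_cong) (simp add: dropnth_def)
    have "?drop (Suc 0) (expand G x (b # bs)) =
        ext (\<lambda>g. if src G g = x then cons g (?drop 0 (expand G x [b'])) else 0) b"
      unfolding bs 2 expand.simps(2)[of G x b] ext_simps(4)[of _ _ b]
      by (simp only: if_distrib[of "?drop (Suc 0)"] drop_cons lin_ext_zero)
    also have "\<dots> = ext (\<lambda>g. fscale (Poly_Mapping.lookup (gcounit G b') x) (if src G g = x then single1 [g] else 0)) b"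
      unfolding d by (rule lin_ext_cong) simp
    also have "\<dots> = expand G x [gmult G b (gcounit G b')]"
      using expand_update_base[OF gcounit_gbase[OF b(2)] b(1), of 0 "[b]" x]
      by (simp add: ext_fun_scale cong: if_cong)
    finally show ?thesis using 2 bs by (simp add: face_list_1)
  next
    case 3
    have le: "2 \<le> length bs" "j < length bs" "set bs \<subseteq> galg G" using Cons.prems 3 bs by (auto simp: Suc_le_eq)
    have "?drop (Suc j) (expand G x (b # bs)) =
        ext (\<lambda>g. if src G g = x then cons g (?drop j (expand G x bs)) else 0) b"
      unfolding expand.simps(2)[of G x b] ext_simps(4)[of _ _ b]
      by (simp only: if_distrib[of "?drop (Suc j)"] drop_cons lin_ext_zero)
    then show ?thesis
      using Cons.IH[OF le(3,2,1)] 3 by (simp add: face_list_Suc[OF le(1,2)] cong: if_cong)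
  qed
qed simp

text \<open>The recursion of \<open>expand\<close> from the other end, obtained by exchanging two
  sums; it is needed because the cyclic operator acts on the last factor.\<close>

lemma expand_snoc:
  "(expand G x (bs @ [b]) :: 'g list \<Rightarrow>\<^sub>0 'k::field) =
    ext (\<lambda>g. if src G g = x then snoc g (expand G x bs) else 0) b"
proof (induction bs)
  case (Cons a bs)
  have "(expand G x ((a # bs) @ [b]) :: 'g list \<Rightarrow>\<^sub>0 'k) =
      ext (\<lambda>g. ext (\<lambda>h. if src G g = x then if src G h = x then cons g (snoc h (expand G x bs)) else 0 else 0) b) a"
    unfolding append_Cons expand.simps Cons
    by (rule lin_ext_cong) (auto simp: ext_simps(4) lin_ext_fun_zero intro!: lin_ext_cong)
  also have "\<dots> = ext (\<lambda>h. ext (\<lambda>g. if src G g = x then if src G h = x then cons g (snoc h (expand G x bs)) else 0 else 0) a) b"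
    unfolding lin_ext_def fs.scale_sum_right by (subst sum.swap) (simp add: mult.commute)
  also have "\<dots> = ext (\<lambda>g. if src G g = x then snoc g (expand G x (a # bs)) else 0) b"
  proof (rule lin_ext_cong)
    fix h
    show "(ext (\<lambda>g. if src G g = x then if src G h = x then cons g (snoc h (expand G x bs)) else 0 else 0) a
        :: 'g list \<Rightarrow>\<^sub>0 'k) = (if src G h = x then snoc h (expand G x (a # bs)) else 0)"
    proof (cases "src G h = x")
      case True
      then show ?thesis
        unfolding expand.simps if_P[OF True] ext_simps(4)[of _ _ a]
        by (intro lin_ext_cong) (simp add: cons_snoc)
    next
      case False
      then show ?thesis
        by (simp only: if_False if_cancel lin_ext_fun_zero[OF vs_fs])
    qed
  qed
  finally show ?case .
qed (simp cong: if_cong)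

text \<open>As \<open>h\<close> is a loop, multiplying by it keeps the source, so the moved entry
  stays in the same part as the others.\<close>

lemma expand_cyc:
  assumes h: "h \<in> Arr G" "src G h = tgt G h" and bs: "set bs \<subseteq> galg G" "bs \<noteq> []"
  shows "(expand G (src G h) (gmult G (last bs) (single1 h) # butlast bs) :: 'g list \<Rightarrow>\<^sub>0 'k::field) =
    ext (\<lambda>gs. single1 (cmp G (last gs) h # butlast gs)) (expand G (src G h) bs)"
proof -
  obtain cs b where cs: "bs = cs @ [b]" using bs by (cases bs rule: rev_cases) auto
  let ?E = "expand G (src G h) cs :: 'g list \<Rightarrow>\<^sub>0 'k"
  have "expand G (src G h) (gmult G b (single1 h) # cs) =
      ext (\<lambda>g. if src G g = src G h then cons (cmp G g h) ?E else 0) b"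
    unfolding expand.simps gmult_single1 ext_simps(4)
    by (rule lin_ext_cong) (use bs cs h in \<open>auto simp: galg_def src_cmp\<close>)
  also have "\<dots> = ext (\<lambda>gs. single1 (cmp G (last gs) h # butlast gs)) (expand G (src G h) (cs @ [b]))"
    unfolding expand_snoc ext_simps(4)
    by (rule lin_ext_cong) (simp add: ext_simps)
  finally show ?thesis by (simp add: cs)
qed

lemma expand_mult_other:
  assumes a: "a \<in> galg G" and h: "h \<in> Arr G" "src G h \<noteq> x"
  shows "expand G x (gmult G a (single1 h) # bs) = (0 :: 'g list \<Rightarrow>\<^sub>0 'k::field)"
proof -
  have "ext (\<lambda>g. ext (\<lambda>g. if src G g = x then cons g (expand G x bs) else 0)
      (if src G g = tgt G h then single1 (cmp G g h) else 0)) a = ext (\<lambda>g. 0 :: 'g list \<Rightarrow>\<^sub>0 'k) a"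
    by (rule lin_ext_cong) (use a h in \<open>auto simp: galg_def src_cmp\<close>)
  then show ?thesis
    by (simp add: gmult_single1 ext_simps(4) lin_ext_fun_zero)
qed

lemma src_Arr: "g \<in> Arr G \<Longrightarrow> src G g \<in> Arr G"
  using src_closed Obj_subset by blast

end

section \<open>The cyclic module of a module graded by an adjoint orbit\<close>

text \<open>
  A criterion for \<open>R\<close> to be the kernel of \<open>A\<close>: this holds if \<open>F\<close> is spanned by elements that are congruent
  modulo \<open>R\<close> to the normal form read off from their image under \<open>A\<close>, that is, by elements of \<open>reduced\<close>.
\<close>

locale formal_sums =
  fixes sc :: "'k::field \<Rightarrow> 'm \<Rightarrow> 'm::ab_group_add" and S :: "'m set" and L :: "'x set" and i :: "'x \<Rightarrow> 'y"
    and R F :: "('m \<times> 'y \<Rightarrow>\<^sub>0 'k) set" and A :: "('m \<times> 'y \<Rightarrow>\<^sub>0 'k) \<Rightarrow> ('x \<Rightarrow>\<^sub>0 'm)"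
  assumes vs: "vector_space sc" and S: "module.subspace sc S"
    and R: "module.subspace fscale R" and F: "module.subspace fscale F" and R_F: "R \<subseteq> F"
    and R_add: "\<lbrakk>x \<in> L; m \<in> S; m' \<in> S\<rbrakk>
      \<Longrightarrow> single1 (m + m', i x) - single1 (m, i x) - single1 (m', i x) \<in> R"
    and R_scale: "\<lbrakk>x \<in> L; m \<in> S\<rbrakk> \<Longrightarrow> single1 (sc a m, i x) - fscale a (single1 (m, i x)) \<in> R"
    and A_add: "A (t + u) = A t + A u" and A_scale: "A (fscale a t) = pscale sc a (A t)"
    and A_R: "t \<in> R \<Longrightarrow> A t = 0"
    and A_F: "t \<in> F \<Longrightarrow> Poly_Mapping.keys (A t) \<subseteq> L \<and> (\<forall>x. Poly_Mapping.lookup (A t) x \<in> S)"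
begin

interpretation V: vector_space sc by (rule vs)

text \<open>A candidate inverse of \<open>A\<close> on normal forms. It is not additive, since the
  pairs formed with \<open>m + m'\<close>, \<open>m\<close> and \<open>m'\<close> are unrelated
  generators; linearity holds modulo \<open>R\<close>.\<close>

definition unexpand :: "('x \<Rightarrow>\<^sub>0 'm) \<Rightarrow> ('m \<times> 'y \<Rightarrow>\<^sub>0 'k)"
  where "unexpand = psum (\<lambda>x m. single1 (m, i x))"

definition reduced :: "('m \<times> 'y \<Rightarrow>\<^sub>0 'k) set"
  where "reduced = {t \<in> F. t - unexpand (A t) \<in> R}"

lemma single1_zero_R: "x \<in> L \<Longrightarrow> single1 (0, i x) \<in> R"
  using R_scale[of x 0 0] V.subspace_0[OF S] by simp

text \<open>Combinations with different supports become comparable after padding to a common finite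
  set; a padding term is a generator with vector 0 and lies in \<open>R\<close>.\<close>

lemma unexpand_superset:
  assumes "finite K" "Poly_Mapping.keys \<phi> \<subseteq> K" "K \<subseteq> L"
  shows "(\<Sum>x\<in>K. single1 (Poly_Mapping.lookup \<phi> x, i x)) - unexpand \<phi> \<in> R"
proof -
  let ?f = "\<lambda>x. single1 (Poly_Mapping.lookup \<phi> x, i x) :: 'm \<times> 'y \<Rightarrow>\<^sub>0 'k"
  have "sum ?f K - unexpand \<phi> = sum ?f (K - Poly_Mapping.keys \<phi>)"
    unfolding unexpand_def psum_def using sum.subset_diff[OF assms(2,1), of ?f] by simp
  also have "\<dots> \<in> R"
    by (rule fs.subspace_sum[OF R]) (use assms(3) single1_zero_R in \<open>auto simp: in_keys_iff\<close>)
  finally show ?thesis .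
qed

lemma unexpand_single: "\<lbrakk>x \<in> L; m \<in> S\<rbrakk> \<Longrightarrow> single1 (m, i x) - unexpand (Poly_Mapping.single x m) \<in> R"
  using unexpand_superset[of "{x}" "Poly_Mapping.single x m"] by simp

lemma unexpand_add:
  assumes \<phi>: "Poly_Mapping.keys \<phi> \<subseteq> L" "\<And>x. Poly_Mapping.lookup \<phi> x \<in> S"
    and \<psi>: "Poly_Mapping.keys \<psi> \<subseteq> L" "\<And>x. Poly_Mapping.lookup \<psi> x \<in> S"
  shows "unexpand (\<phi> + \<psi>) - unexpand \<phi> - unexpand \<psi> \<in> R"
proof -
  let ?K = "Poly_Mapping.keys \<phi> \<union> Poly_Mapping.keys \<psi>"
  let ?k = "\<lambda>\<phi>. \<Sum>x\<in>?K. single1 (Poly_Mapping.lookup \<phi> x, i x) :: 'm \<times> 'y \<Rightarrow>\<^sub>0 'k"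
  have A: "?k (\<phi> + \<psi>) - ?k \<phi> - ?k \<psi> \<in> R"
    unfolding sum_subtractf[symmetric] lookup_add
    by (intro fs.subspace_sum[OF R] R_add) (use \<phi> \<psi> in auto)
  have B: "?k (\<phi> + \<psi>) - unexpand (\<phi> + \<psi>) \<in> R" "?k \<phi> - unexpand \<phi> \<in> R" "?k \<psi> - unexpand \<psi> \<in> R"
    using \<phi> \<psi> keys_add[of \<phi> \<psi>] by (auto intro!: unexpand_superset)
  show ?thesis
    using fs.subspace_add[OF R fs.subspace_add[OF R fs.subspace_diff[OF R A B(1)] B(2)] B(3)]
    by (simp add: algebra_simps)
qed

lemma unexpand_scale:
  assumes \<phi>: "Poly_Mapping.keys \<phi> \<subseteq> L" "\<And>x. Poly_Mapping.lookup \<phi> x \<in> S"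
  shows "unexpand (pscale sc a \<phi>) - fscale a (unexpand \<phi>) \<in> R"
proof -
  let ?k = "\<lambda>\<psi>. \<Sum>x\<in>Poly_Mapping.keys \<phi>. single1 (Poly_Mapping.lookup \<psi> x, i x) :: 'm \<times> 'y \<Rightarrow>\<^sub>0 'k"
  have A: "?k (pscale sc a \<phi>) - fscale a (?k \<phi>) \<in> R"
    unfolding fs.scale_sum_right sum_subtractf[symmetric] lookup_pscale[OF vs]
    by (intro fs.subspace_sum[OF R] R_scale) (use \<phi> in auto)
  have B: "?k (pscale sc a \<phi>) - unexpand (pscale sc a \<phi>) \<in> R"
    by (rule unexpand_superset[OF finite_keys keys_pscale[OF vs] \<phi>(1)])
  have "?k \<phi> = unexpand \<phi>" by (simp add: unexpand_def psum_def)
  then show ?thesis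
    using fs.subspace_diff[OF R A B] by simp
qed

text \<open>Modulo \<open>R\<close> the map \<open>unexpand\<close> is linear. Thus a set of reduced
  elements that spans \<open>F\<close> shows that all of \<open>F\<close> is reduced.\<close>

lemma reduced_subspace: "module.subspace fscale reduced"
  unfolding fs.subspace_def
proof (intro conjI ballI allI)
  show "0 \<in> reduced"
    using fs.subspace_0[OF R] fs.subspace_0[OF F] by (simp add: reduced_def A_R unexpand_def)
  fix t assume t: "t \<in> reduced"
  then have tF: "t \<in> F" and tr: "t - unexpand (A t) \<in> R" by (simp_all add: reduced_def)
  {
    fix u assume "u \<in> reduced"
    then have uF: "u \<in> F" and ur: "u - unexpand (A u) \<in> R" by (simp_all add: reduced_def)
    have "(t - unexpand (A t)) + (u - unexpand (A u))
        - (unexpand (A t + A u) - unexpand (A t) - unexpand (A u)) \<in> R"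
      by (intro fs.subspace_diff[OF R fs.subspace_add[OF R tr ur]] unexpand_add)
        (use A_F[OF tF] A_F[OF uF] in auto)
    then show "t + u \<in> reduced"
      using fs.subspace_add[OF F tF uF] by (simp add: reduced_def A_add algebra_simps)
  }
  fix a
  have "fscale a (t - unexpand (A t)) - (unexpand (pscale sc a (A t)) - fscale a (unexpand (A t))) \<in> R"
    by (intro fs.subspace_diff[OF R fs.subspace_scale[OF R tr]] unexpand_scale) (use A_F[OF tF] in auto)
  then show "fscale a t \<in> reduced"
    using fs.subspace_scale[OF F tF, of a] by (simp add: reduced_def A_scale fs.scale_right_diff_distrib)
qed

lemma R_reduced: "R \<subseteq> reduced"
  using R_F by (auto simp: reduced_def A_R unexpand_def)

lemma reduced_mod: "\<lbrakk>t - u \<in> R; u \<in> reduced\<rbrakk> \<Longrightarrow> t \<in> reduced"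
  using fs.subspace_add[OF reduced_subspace, of "t - u" u] R_reduced by auto

lemma reduced_mod': "\<lbrakk>t - u \<in> R; t \<in> reduced\<rbrakk> \<Longrightarrow> u \<in> reduced"
  using fs.subspace_diff[OF reduced_subspace, of t "t - u"] R_reduced by auto

end

lemma psum_pscale:
  assumes vs: "vector_space sc" and vs': "vector_space sc'"
    and "\<And>a. a \<in> Poly_Mapping.keys t \<Longrightarrow> f a 0 = 0"
    and "\<And>a. a \<in> Poly_Mapping.keys t \<Longrightarrow>
      f a (sc c (Poly_Mapping.lookup t a)) = sc' c (f a (Poly_Mapping.lookup t a))"
  shows "psum f (pscale sc c t) = sc' c (psum f t)"
proof -
  interpret vector_space sc' by fact
  have "psum f (pscale sc c t) = (\<Sum>a\<in>Poly_Mapping.keys t. f a (sc c (Poly_Mapping.lookup t a)))"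
    using psum_superset[where f = f, OF assms(3) finite_keys keys_pscale[OF vs]]
    by (simp add: lookup_pscale[OF vs])
  then show ?thesis
    by (simp add: assms(4) psum_def scale_sum_right)
qed

text \<open>\<open>N \<otimes>\<^sub>R B\<close> is the direct sum of the spaces \<open>N \<cdot> s(g)\<close> over all arrows \<open>g\<close>.\<close>

definition coact_parts ::
    "'g groupoid \<Rightarrow> ('k::field, 'g, 'm::ab_group_add) ayd_data \<Rightarrow> ('k, 'g, 'm) tuples \<Rightarrow> ('g \<Rightarrow>\<^sub>0 'm)"
  where "coact_parts G N = lin_ext (pscale (mscale N)) (\<lambda>(m, bs). lin_ext (pscale (mscale N))
    (\<lambda>g. Poly_Mapping.single g (lact N (single1 (src G g)) m)) (hd bs))"

text \<open>Only the action of single arrows is assumed, which is common ground for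
  \<open>M\<close>, its orbit module and its loop module.\<close>

locale arrow_module = groupoid G
  for G :: "'g groupoid" +
  fixes N :: "('k::field, 'g, 'm::ab_group_add) ayd_data"
  assumes vsN: "vector_space (mscale N)" and mcar_sub: "module.subspace (mscale N) (mcar N)"
    and act_closed: "\<lbrakk>g \<in> Arr G; m \<in> mcar N\<rbrakk> \<Longrightarrow> lact N (single1 g) m \<in> mcar N"
    and act_add: "\<lbrakk>g \<in> Arr G; m \<in> mcar N; m' \<in> mcar N\<rbrakk>
      \<Longrightarrow> lact N (single1 g) (m + m') = lact N (single1 g) m + lact N (single1 g) m'"
    and act_scale: "\<lbrakk>g \<in> Arr G; m \<in> mcar N\<rbrakk>
      \<Longrightarrow> lact N (single1 g) (mscale N a m) = mscale N a (lact N (single1 g) m)"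
begin

interpretation V: vector_space "mscale N" by (rule vsN)

abbreviation arr_act :: "'g \<Rightarrow> 'm \<Rightarrow> 'm" where "arr_act g \<equiv> lact N (single1 g)"

lemma mcar_closed: "\<lbrakk>m \<in> mcar N; m' \<in> mcar N\<rbrakk> \<Longrightarrow> m + m' \<in> mcar N" "m \<in> mcar N \<Longrightarrow> mscale N a m \<in> mcar N"
  using mcar_sub by (auto simp: V.subspace_def)

lemma tuplesD: "(m, bs) \<in> tuples G N n \<Longrightarrow> m \<in> mcar N \<and> length bs = n \<and> set bs \<subseteq> galg G"
  by (simp add: tuples_def)

lemma tuples_update: "\<lbrakk>(m, bs) \<in> tuples G N n; b \<in> galg G\<rbrakk> \<Longrightarrow> (m, bs[i := b]) \<in> tuples G N n"
  using set_update_subset_insert[of bs i b] by (auto simp: tuples_def)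

lemma galg_closed: "\<lbrakk>b \<in> galg G; b' \<in> galg G\<rbrakk> \<Longrightarrow> b + b' \<in> galg G" "b \<in> galg G \<Longrightarrow> fscale a b \<in> galg G"
  for b :: "'g \<Rightarrow>\<^sub>0 'k"
  using galg_subspace by (auto simp: fs.subspace_def)

lemma tuples_1:
  assumes "p \<in> tuples G N 1"
  obtains m b where "p = (m, [b])" "m \<in> mcar N" "b \<in> galg G"
  using assms by (cases p; cases "snd p") (auto simp: tuples_def)

definition arrow_parts :: "('g \<Rightarrow>\<^sub>0 'm) set"
  where "arrow_parts = {\<phi>. Poly_Mapping.keys \<phi> \<subseteq> Arr G \<and> (\<forall>g. Poly_Mapping.lookup \<phi> g \<in> mcar N)}"

lemma vsp1: "vector_space (pscale (mscale N))"
  by (rule vector_space_pscale[OF vsN])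

interpretation Q: vector_space "pscale (mscale N) :: 'k \<Rightarrow> ('g \<Rightarrow>\<^sub>0 'm) \<Rightarrow> _" by (rule vsp1)

lemma arrow_parts_subspace: "module.subspace (pscale (mscale N)) arrow_parts"
  unfolding Q.subspace_def arrow_parts_def
proof (intro conjI ballI allI)
  let ?S = "{\<phi>. Poly_Mapping.keys \<phi> \<subseteq> Arr G \<and> (\<forall>g. Poly_Mapping.lookup \<phi> g \<in> mcar N)}"
  fix \<phi> \<psi> x assume \<phi>: "\<phi> \<in> ?S"
  show "pscale (mscale N) x \<phi> \<in> ?S"
    using \<phi> mcar_closed keys_pscale[OF vsN, of x \<phi>] by (auto simp: lookup_pscale[OF vsN])
  assume "\<psi> \<in> ?S"
  then show "\<phi> + \<psi> \<in> ?S"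
    using \<phi> mcar_closed keys_add[of \<phi> \<psi>] by (auto simp: lookup_add)
qed (use V.subspace_0[OF mcar_sub] in simp)

lemma single_arrow_parts: "\<lbrakk>g \<in> Arr G; m \<in> mcar N\<rbrakk> \<Longrightarrow> Poly_Mapping.single g m \<in> arrow_parts"
  using V.subspace_0[OF mcar_sub] by (auto simp: arrow_parts_def lookup_single when_def)

lemma galg_keys: "\<lbrakk>b \<in> galg G; g \<in> Poly_Mapping.keys b\<rbrakk> \<Longrightarrow> g \<in> Arr G"
  by (auto simp: galg_def)

lemma coact_parts_single1: "coact_parts G N (single1 (m, [b])) =
    lin_ext (pscale (mscale N)) (\<lambda>g. Poly_Mapping.single g (arr_act (src G g) m)) b"
  by (simp add: coact_parts_def vsp1)

lemma coact_parts_add: "coact_parts G N (t + u) = coact_parts G N t + coact_parts G N u"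
  and coact_parts_scale: "coact_parts G N (fscale a t) = pscale (mscale N) a (coact_parts G N t)"
  and coact_parts_diff: "coact_parts G N (t - u) = coact_parts G N t - coact_parts G N u"
  by (simp_all add: coact_parts_def lin_ext_add[OF vsp1] lin_ext_scale[OF vsp1] lin_ext_diff[OF vsp1])

text \<open>The hypothesis on \<open>F\<close> says that the term for \<open>m0 \<otimes> b\<close>
  sees \<open>m0\<close> only through \<open>s(g) m0\<close> for the arrows \<open>g\<close> of
  \<open>b\<close>. Such an expression factors through \<open>coact_parts\<close>, so it does not
  depend on the representative \<open>t\<close> of a tensor.\<close>

lemma psum_coact_parts:
  fixes z :: "'g \<Rightarrow> 'm \<Rightarrow> 'w::ab_group_add"
  assumes vs': "vector_space sc'"
    and add: "\<And>g x y. \<lbrakk>g \<in> Arr G; x \<in> mcar N; y \<in> mcar N\<rbrakk> \<Longrightarrow> z g (x + y) = z g x + z g y"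
    and scale: "\<And>g x a. \<lbrakk>g \<in> Arr G; x \<in> mcar N\<rbrakk> \<Longrightarrow> z g (mscale N a x) = sc' a (z g x)"
    and t: "Poly_Mapping.keys t \<subseteq> tuples G N 1"
    and F: "\<And>m b. \<lbrakk>m \<in> mcar N; b \<in> galg G\<rbrakk> \<Longrightarrow> F (m, [b]) = lin_ext sc' (\<lambda>g. z g (arr_act (src G g) m)) b"
  shows "lin_ext sc' F t = psum z (coact_parts G N t)"
    and "coact_parts G N t \<in> arrow_parts"
proof -
  have z0: "z g 0 = 0" if "g \<in> Arr G" for g
    using add[OF that, of 0 0] V.subspace_0[OF mcar_sub] by simp
  have zadd: "psum z (\<phi> + \<psi>) = psum z \<phi> + psum z \<psi>" if "\<phi> \<in> arrow_parts" "\<psi> \<in> arrow_parts" for \<phi> \<psi>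
    by (rule psum_add) (use that z0 add in \<open>auto simp: arrow_parts_def\<close>)
  have zscale: "psum z (pscale (mscale N) x \<phi>) = sc' x (psum z \<phi>)" if "\<phi> \<in> arrow_parts" for x \<phi>
    by (rule psum_pscale[OF vsN vs']) (use that z0 scale in \<open>auto simp: arrow_parts_def\<close>)
  let ?th = "\<lambda>(m, bs). lin_ext (pscale (mscale N)) (\<lambda>g. Poly_Mapping.single g (arr_act (src G g) m)) (hd bs)"
  have pw: "F p = psum z (?th p)" and th: "?th p \<in> arrow_parts" if p: "p \<in> Poly_Mapping.keys t" for p
  proof -
    obtain m b where p': "p = (m, [b])" "m \<in> mcar N" "b \<in> galg G"
      using tuples_1 p t by blast
    have s: "Poly_Mapping.single g (arr_act (src G g) m) \<in> arrow_parts" if "g \<in> Poly_Mapping.keys b" for g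
      using galg_keys[OF p'(3) that] p'(2) by (intro single_arrow_parts act_closed src_Arr)
    show "?th p \<in> arrow_parts"
      unfolding p'(1) prod.case list.sel by (rule lin_ext_subspace[OF vsp1 arrow_parts_subspace s])
    have "F p = lin_ext sc' (\<lambda>g. psum z (Poly_Mapping.single g (arr_act (src G g) m))) b"
      unfolding p'(1) F[OF p'(2,3)]
      by (rule lin_ext_cong) (use galg_keys[OF p'(3)] z0 in \<open>simp add: psum_single\<close>)
    also have "\<dots> = psum z (?th p)"
      unfolding p'(1) prod.case list.sel
      by (rule additive_lin_ext[symmetric, OF zadd zscale arrow_parts_subspace vsp1 vs' s])
    finally show "F p = psum z (?th p)" .
  qed
  have "lin_ext sc' F t = lin_ext sc' (\<lambda>p. psum z (?th p)) t"
    by (rule lin_ext_cong) (rule pw)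
  also have "\<dots> = psum z (coact_parts G N t)"
    unfolding coact_parts_def
    by (rule additive_lin_ext[symmetric, OF zadd zscale arrow_parts_subspace vsp1 vs' th])
  finally show "lin_ext sc' F t = psum z (coact_parts G N t)" .
  show "coact_parts G N t \<in> arrow_parts"
    unfolding coact_parts_def by (rule lin_ext_subspace[OF vsp1 arrow_parts_subspace th])
qed

end

text \<open>The inverse is a parameter rather than \<open>ginv G\<close>, so that the centralizer
  can be used with the inverse of the ambient groupoid.\<close>

locale groupoid_inv = groupoid G
  for G :: "'g groupoid" +
  fixes iv :: "'g \<Rightarrow> 'g"
  assumes iv_closed: "g \<in> Arr G \<Longrightarrow> iv g \<in> Arr G"
    and src_iv: "g \<in> Arr G \<Longrightarrow> src G (iv g) = tgt G g"
    and tgt_iv: "g \<in> Arr G \<Longrightarrow> tgt G (iv g) = src G g"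
    and iv_left: "g \<in> Arr G \<Longrightarrow> cmp G (iv g) g = src G g"
    and iv_right: "g \<in> Arr G \<Longrightarrow> cmp G g (iv g) = tgt G g"
begin

abbreviation adj :: "'g \<Rightarrow> 'g \<Rightarrow> 'g" where "adj g h \<equiv> cmp G (cmp G g h) (iv g)"

lemmas grpd = cmp_closed src_cmp tgt_cmp iv_closed src_iv tgt_iv

lemma iv_cancel: "\<lbrakk>g \<in> Arr G; h \<in> Arr G; tgt G h = src G g\<rbrakk> \<Longrightarrow> cmp G (iv g) (cmp G g h) = h"
  by (simp add: cmp_assoc[symmetric] grpd iv_left) (metis tgt_cmp_id)

lemma iv_cancel': "\<lbrakk>g \<in> Arr G; h \<in> Arr G; tgt G h = tgt G g\<rbrakk> \<Longrightarrow> cmp G g (cmp G (iv g) h) = h"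
  by (simp add: cmp_assoc[symmetric] grpd iv_right) (metis tgt_cmp_id)

lemma iv_unique: "\<lbrakk>g \<in> Arr G; h \<in> Arr G; src G h = tgt G g; cmp G h g = src G g\<rbrakk> \<Longrightarrow> h = iv g"
proof -
  assume a: "g \<in> Arr G" "h \<in> Arr G" "src G h = tgt G g" "cmp G h g = src G g"
  have "h = cmp G h (cmp G g (iv g))"
    using a cmp_src[of h] by (simp add: iv_right)
  also have "\<dots> = cmp G (src G g) (iv g)"
    using a by (simp add: cmp_assoc[symmetric] grpd)
  also have "\<dots> = iv g"
    using tgt_cmp_id[of "iv g"] a by (simp add: grpd)
  finally show ?thesis .
qed

lemma iv_cmp: "\<lbrakk>g \<in> Arr G; h \<in> Arr G; src G g = tgt G h\<rbrakk> \<Longrightarrow> iv (cmp G g h) = cmp G (iv h) (iv g)"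
  by (rule iv_unique[symmetric]) (simp_all add: grpd cmp_assoc iv_cancel iv_left)

lemma src_src: "g \<in> Arr G \<Longrightarrow> src G (src G g) = src G g" and tgt_src: "g \<in> Arr G \<Longrightarrow> tgt G (src G g) = src G g"
  using src_closed src_Obj tgt_Obj by auto

lemma iv_src: "g \<in> Arr G \<Longrightarrow> iv (src G g) = src G g"
  using cmp_src[of "src G g"] by (intro iv_unique[symmetric]) (simp_all add: src_Arr src_src tgt_src)

lemma adj_Arr:
  assumes "g \<in> Arr G" "h \<in> Arr G" "src G g = src G h" "tgt G h = src G h"
  shows "adj g h \<in> Arr G" "src G (adj g h) = tgt G g" "tgt G (adj g h) = tgt G g"
  using assms by (simp_all add: grpd)

lemma adj_cmp:
  assumes "g \<in> Arr G" "h \<in> Arr G" "k \<in> Arr G" "src G g = tgt G h" "src G h = src G k" "tgt G k = src G k"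
  shows "adj (cmp G g h) k = adj g (adj h k)"
  using assms by (simp add: grpd cmp_assoc iv_cmp)

lemma adj_src: "\<lbrakk>k \<in> Arr G; tgt G k = src G k\<rbrakk> \<Longrightarrow> adj (src G k) k = k"
  using tgt_cmp_id[of k] cmp_src[of k] by (simp add: iv_src)

lemma adj_iv:
  assumes "g \<in> Arr G" "k \<in> Arr G" "src G g = src G k" "tgt G k = src G k"
  shows "adj (iv g) (adj g k) = k"
  using adj_cmp[of "iv g" g k] adj_src[of k] assms by (simp add: iv_left grpd)

lemma adj_swap:
  assumes "g \<in> Arr G" "k \<in> Arr G" "src G g = src G k" "tgt G k = src G k"
  shows "cmp G (adj g k) g = cmp G g k"
  using assms cmp_src[of k] by (simp add: grpd cmp_assoc iv_left)

end

text \<open>\<open>gr m\<close> is the family of components of \<open>m\<close>, and \<open>c l'\<close> is an arrow that conjugates \<open>l\<close> into \<open>l'\<close>.\<close>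

locale orbit_graded = arrow_module G N + groupoid_inv G iv
  for G :: "'g groupoid" and N :: "('k::field, 'g, 'm::ab_group_add) ayd_data" and iv +
  fixes l :: 'g and c :: "'g \<Rightarrow> 'g"
    and orb :: "'g set" and gr :: "'m \<Rightarrow> ('g \<Rightarrow>\<^sub>0 'm)"
  assumes act_cmp: "\<lbrakk>g \<in> Arr G; h \<in> Arr G; src G g = tgt G h; m \<in> mcar N\<rbrakk>
      \<Longrightarrow> lact N (single1 (cmp G g h)) m = lact N (single1 g) (lact N (single1 h) m)"
    and act_zero: "\<lbrakk>g \<in> Arr G; h \<in> Arr G; src G g \<noteq> tgt G h; m \<in> mcar N\<rbrakk>
      \<Longrightarrow> lact N (single1 g) (lact N (single1 h) m) = 0"
    and l_Arr: "l \<in> Arr G" and l_loop: "tgt G l = src G l"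
    and orb_l: "l \<in> orb"
    and orb_adj: "\<lbrakk>l' \<in> orb; g \<in> Arr G; src G g = src G l'\<rbrakk> \<Longrightarrow> cmp G (cmp G g l') (iv g) \<in> orb"
    and c_Arr: "l' \<in> orb \<Longrightarrow> c l' \<in> Arr G" and src_c: "l' \<in> orb \<Longrightarrow> src G (c l') = src G l"
    and c_adj: "l' \<in> orb \<Longrightarrow> cmp G (cmp G (c l') l) (iv (c l')) = l'"
    and c_l: "c l = src G l"
    and gr_add: "\<lbrakk>m \<in> mcar N; m' \<in> mcar N\<rbrakk> \<Longrightarrow> gr (m + m') = gr m + gr m'"
    and gr_scale: "m \<in> mcar N \<Longrightarrow> gr (mscale N a m) = pscale (mscale N) a (gr m)"
    and gr_keys: "m \<in> mcar N \<Longrightarrow> Poly_Mapping.keys (gr m) \<subseteq> orb"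
    and gr_lookup: "\<lbrakk>m \<in> mcar N; l' \<in> orb\<rbrakk> \<Longrightarrow> Poly_Mapping.lookup (gr m) l' \<in> mcar N \<and>
      gr (Poly_Mapping.lookup (gr m) l') = Poly_Mapping.single l' (Poly_Mapping.lookup (gr m) l') \<and>
      lact N (single1 (src G l')) (Poly_Mapping.lookup (gr m) l') = Poly_Mapping.lookup (gr m) l'"
    and gr_sum: "m \<in> mcar N \<Longrightarrow> psum (\<lambda>_ x. x) (gr m) = m"
    and gr_act: "\<lbrakk>m \<in> mcar N; gr m = Poly_Mapping.single l' m; l' \<in> orb; g \<in> Arr G; src G g = src G l'\<rbrakk>
      \<Longrightarrow> gr (lact N (single1 g) m) =
        Poly_Mapping.single (cmp G (cmp G g l') (iv g)) (lact N (single1 g) m)"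
    and coact_rep: "m \<in> mcar N \<Longrightarrow>
      Poly_Mapping.keys (SOME t. t \<in> coact N m) \<subseteq> tuples G N 1 \<and>
      coact_parts G N (SOME t. t \<in> coact N m) = gr m"
    and act_l: "\<lbrakk>m \<in> mcar N; gr m = Poly_Mapping.single l m\<rbrakk> \<Longrightarrow> lact N (single1 l) m = m"
begin

interpretation V: vector_space "mscale N" by (rule vsN)

lemma orb_loop: "l' \<in> orb \<Longrightarrow> l' \<in> Arr G" "l' \<in> orb \<Longrightarrow> src G l' = tgt G (c l')"
    "l' \<in> orb \<Longrightarrow> tgt G l' = tgt G (c l')"
  using adj_Arr[of "c l'" l] c_Arr[of l'] src_c[of l'] c_adj[of l'] l_Arr l_loop by auto

definition H :: "'g set" where "H = {z \<in> Arr G. src G z = src G l \<and> adj z l = l}"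
definition X :: "'g set" where "X = {g \<in> Arr G. src G g = src G l}"
definition r :: "'g \<Rightarrow> 'g" where "r g = cmp G (iv (c (adj g l))) g"
definition part :: "'g \<Rightarrow> 'm set" where "part l' = {m \<in> mcar N. gr m = Poly_Mapping.single l' m}"

lemma H_Arr: "z \<in> H \<Longrightarrow> z \<in> Arr G" "z \<in> H \<Longrightarrow> src G z = src G l" "z \<in> H \<Longrightarrow> adj z l = l"
  by (auto simp: H_def)

lemma H_tgt: "z \<in> H \<Longrightarrow> tgt G z = src G l"
  using adj_Arr(3)[of z l] H_Arr[of z] l_Arr l_loop by simp

lemma X_Arr: "g \<in> X \<Longrightarrow> g \<in> Arr G" "g \<in> X \<Longrightarrow> src G g = src G l"
  by (auto simp: X_def)

lemma adj_X: "g \<in> X \<Longrightarrow> adj g l \<in> orb"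
  using orb_adj[OF orb_l] by (auto simp: X_def)

lemma gr_0: "gr 0 = 0"
  using gr_add[of 0 0] V.subspace_0[OF mcar_sub] by simp

lemma part_mcar: "m \<in> part l' \<Longrightarrow> m \<in> mcar N"
  by (simp add: part_def)

lemma part_subspace: "module.subspace (mscale N) (part l')"
  unfolding V.subspace_def part_def using mcar_sub
  by (auto simp: V.subspace_def gr_0 gr_add gr_scale single_add pscale_single[OF vsN])

lemma part_src: "\<lbrakk>m \<in> part l'; l' \<in> orb\<rbrakk> \<Longrightarrow> arr_act (src G l') m = m"
  using gr_lookup[of m l'] by (simp add: part_def)

lemma lookup_part: "\<lbrakk>m \<in> mcar N; l' \<in> orb\<rbrakk> \<Longrightarrow> Poly_Mapping.lookup (gr m) l' \<in> part l'"
  using gr_lookup[of m l'] by (simp add: part_def)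

lemma act_part: "\<lbrakk>m \<in> part l'; l' \<in> orb; g \<in> Arr G; src G g = src G l'\<rbrakk> \<Longrightarrow> arr_act g m \<in> part (adj g l')"
  using gr_act by (simp add: part_def act_closed)

lemma adj_iv_c: "l' \<in> orb \<Longrightarrow> adj (iv (c l')) l' = l"
  using adj_iv[of "c l'" l] c_adj[of l'] c_Arr src_c l_Arr l_loop by simp

lemma iv_c_part:
  assumes "m \<in> part l'" "l' \<in> orb"
  shows "arr_act (iv (c l')) m \<in> part l"
  using act_part[OF assms, of "iv (c l')"] adj_iv_c[OF assms(2)] c_Arr[OF assms(2)] orb_loop[OF assms(2)]
  by (simp add: grpd)

text \<open>Both \<open>g\<close> and \<open>c (adj g l)\<close> conjugate \<open>l\<close> to
  \<open>adj g l\<close>, so the quotient of the two centralizes \<open>l\<close>.\<close>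

lemma r_in_H:
  assumes g: "g \<in> X"
  shows "r g \<in> H"
proof -
  let ?l = "adj g l"
  note o = adj_X[OF g]
  have t: "tgt G (c ?l) = tgt G g"
    using orb_loop(3)[OF o] adj_Arr(3)[of g l] X_Arr[OF g] l_Arr l_loop by simp
  have "adj (r g) l = adj (iv (c ?l)) ?l"
    unfolding r_def using X_Arr[OF g] l_Arr l_loop c_Arr[OF o] t by (intro adj_cmp) (simp_all add: grpd)
  then show ?thesis
    using adj_iv_c[OF o] X_Arr[OF g] c_Arr[OF o] t by (simp add: H_def r_def grpd)
qed

text \<open>Since \<open>z\<close> centralizes \<open>l\<close>, the arrows \<open>g z\<close> and
  \<open>g\<close> conjugate \<open>l\<close> to the same loop and hence select the same value of
  \<open>c\<close>. This makes \<open>r\<close> equivariant.\<close>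

lemma adj_H: "\<lbrakk>g \<in> X; z \<in> H\<rbrakk> \<Longrightarrow> adj (cmp G g z) l = adj g l"
  using adj_cmp[of g z l] H_Arr[of z] H_tgt[of z] X_Arr[of g] l_Arr l_loop by simp

sublocale M: orbit_model "cmp G" iv "src G l" H X r arr_act "part l" "mscale N" l
proof (rule orbit_model.intro)
  show "vector_space (mscale N)" by (rule vsN)
  show "module.subspace (mscale N) (part l)" by (rule part_subspace)
  show "H \<subseteq> X" by (auto simp: H_def X_def)
  show e: "src G l \<in> H"
    using adj_src[OF l_Arr l_loop] by (simp add: H_def src_Arr src_src l_Arr)
  show "cmp G z w \<in> H" if "z \<in> H" "w \<in> H" for z w
    using adj_cmp[of z w l] H_Arr[OF that(1)] H_Arr[OF that(2)] H_tgt[OF that(2)] l_Arr l_loop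
    unfolding H_def by (simp add: grpd)
  show "cmp G x z \<in> X" if "x \<in> X" "z \<in> H" for x z
    using X_Arr[OF that(1)] H_Arr[OF that(2)] H_tgt[OF that(2)] by (simp add: X_def grpd)
  show "cmp G (cmp G x z) w = cmp G x (cmp G z w)" if "x \<in> X" "z \<in> H" "w \<in> H" for x z w
    using X_Arr[OF that(1)] H_Arr[OF that(2)] H_Arr[OF that(3)] H_tgt[OF that(2)] H_tgt[OF that(3)]
    by (intro cmp_assoc) simp_all
  show "cmp G x (src G l) = x" if "x \<in> X" for x
    using that cmp_src[of x] by (simp add: X_def)
  show "cmp G (src G l) z = z" if "z \<in> H" for z
    using that tgt_cmp_id[of z] H_tgt[of z] H_Arr[of z] by simp
  show "iv z \<in> H" if "z \<in> H" for z
    using adj_iv[of z l] H_Arr[OF that] H_tgt[OF that] l_Arr l_loop unfolding H_def by (simp add: grpd)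
  show "cmp G z (iv z) = src G l" "cmp G (iv z) z = src G l" if "z \<in> H" for z
    using that iv_left[of z] iv_right[of z] H_tgt[of z] H_Arr[of z] by simp_all
  show "r x \<in> H" if "x \<in> X" for x
    by (rule r_in_H[OF that])
  show "r (cmp G x z) = cmp G (r x) z" if "x \<in> X" "z \<in> H" for x z
  proof -
    note o = adj_X[OF that(1)]
    have "tgt G (c (adj x l)) = tgt G x"
      using orb_loop(3)[OF o] adj_Arr(3)[of x l] X_Arr[OF that(1)] l_Arr l_loop by simp
    then show ?thesis
      unfolding r_def adj_H[OF that] using X_Arr[OF that(1)] H_Arr[OF that(2)] H_tgt[OF that(2)] c_Arr[OF o]
      by (simp add: cmp_assoc grpd)
  qed
  show "r z = z" if "z \<in> H" for z
    using that tgt_cmp_id[of z] H_tgt[of z] H_Arr[of z] by (simp add: r_def c_l iv_src l_Arr)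
  show "arr_act z m \<in> part l" if "z \<in> H" "m \<in> part l" for z m
    using that act_part[OF that(2) orb_l, of z] H_Arr[of z] by simp
  show "arr_act z (m + m') = arr_act z m + arr_act z m'" if "z \<in> H" "m \<in> part l" "m' \<in> part l" for z m m'
    using that by (intro act_add H_Arr part_mcar) auto
  show "arr_act z (mscale N a m) = mscale N a (arr_act z m)" if "z \<in> H" "m \<in> part l" for z m a
    using that by (intro act_scale H_Arr part_mcar) auto
  show "arr_act (src G l) m = m" if "m \<in> part l" for m
    by (rule part_src[OF that orb_l])
  show "arr_act (cmp G z w) m = arr_act z (arr_act w m)" if "z \<in> H" "w \<in> H" "m \<in> part l" for z w m
    using H_Arr[OF that(1)] H_Arr[OF that(2)] H_tgt[OF that(2)] part_mcar[OF that(3)]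
    by (intro act_cmp) simp_all
  show "l \<in> H"
    using cmp_src[of l] by (simp add: H_def l_Arr l_loop cmp_assoc grpd iv_right)
  show "cmp G z l = cmp G l z" if "z \<in> H" for z
    using adj_swap[of z l] H_Arr[OF that] l_Arr l_loop by simp
  show "arr_act l m = m" if "m \<in> part l" for m
    using that act_l by (simp add: part_def)
qed

text \<open>For \<open>m\<close> in degree \<open>l'\<close> and \<open>c = c l'\<close>, the tensor \<open>(b\<^sub>0 \<otimes> \<dots> \<otimes> b\<^sub>n) \<otimes>\<^sub>B m\<close> is
  \<open>(b\<^sub>0c \<otimes> \<dots> \<otimes> b\<^sub>nc) \<otimes>\<^sub>B c\<^sup>-\<^sup>1m\<close>.\<close>

definition hom :: "'g \<Rightarrow> ('g \<Rightarrow>\<^sub>0 'k) list \<Rightarrow> 'm \<Rightarrow> ('g list \<Rightarrow>\<^sub>0 'm)"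
  where "hom l' bs m =
    M.em (lmaps (\<lambda>g. cmp G g (c l')) (expand G (src G l') bs)) (arr_act (iv (c l')) m)"

definition alph :: "'m \<times> ('g \<Rightarrow>\<^sub>0 'k) list \<Rightarrow> ('g list \<Rightarrow>\<^sub>0 'm)"
  where "alph = (\<lambda>(m, bs). psum (\<lambda>l'. hom l' bs) (gr m))"

definition al :: "('k, 'g, 'm) tuples \<Rightarrow> ('g list \<Rightarrow>\<^sub>0 'm)"
  where "al = lin_ext (pscale (mscale N)) alph"

lemma keys_shift_c:
  assumes "l' \<in> orb" "set bs \<subseteq> galg G"
  shows "Poly_Mapping.keys (lmaps (\<lambda>g. cmp G g (c l')) (expand G (src G l') bs) :: 'g list \<Rightarrow>\<^sub>0 'k)
    \<subseteq> M.lists_of (length bs)"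
proof (rule keys_ext)
  fix gs assume "gs \<in> Poly_Mapping.keys (expand G (src G l') bs :: 'g list \<Rightarrow>\<^sub>0 'k)"
  then have "length gs = length bs" "\<And>g. g \<in> set gs \<Longrightarrow> g \<in> Arr G \<and> src G g = src G l'"
    using keys_expand[OF assms(2), of "src G l'"] by auto
  then show "Poly_Mapping.keys (single1 (map (\<lambda>g. cmp G g (c l')) gs) :: 'g list \<Rightarrow>\<^sub>0 'k) \<subseteq> M.lists_of (length bs)"
    using c_Arr[OF assms(1)] src_c[OF assms(1)] orb_loop[OF assms(1)]
    unfolding M.lists_of_def by (auto simp: X_def grpd)
qed

context
  fixes n :: nat and bs :: "('g \<Rightarrow>\<^sub>0 'k) list"
  assumes bs: "length bs = Suc n" "set bs \<subseteq> galg G"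
begin

lemma hom_add:
  assumes "l' \<in> orb" "m \<in> part l'" "m' \<in> part l'"
  shows "hom l' bs (m + m') = hom l' bs m + hom l' bs m'"
proof -
  have "arr_act (iv (c l')) (m + m') = arr_act (iv (c l')) m + arr_act (iv (c l')) m'"
    using assms by (intro act_add iv_closed c_Arr part_mcar) auto
  then show ?thesis
    unfolding hom_def
    using M.em_add_right[OF _ iv_c_part[OF assms(2,1)] iv_c_part[OF assms(3,1)]] keys_shift_c[OF assms(1) bs(2)] bs(1)
    by simp
qed

lemma hom_scale:
  assumes "l' \<in> orb" "m \<in> part l'"
  shows "hom l' bs (mscale N a m) = pscale (mscale N) a (hom l' bs m)"
proof -
  have "arr_act (iv (c l')) (mscale N a m) = mscale N a (arr_act (iv (c l')) m)"
    using assms by (intro act_scale iv_closed c_Arr part_mcar) auto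
  then show ?thesis
    unfolding hom_def
    using M.em_scale_right[OF _ iv_c_part[OF assms(2,1)]] keys_shift_c[OF assms(1) bs(2)] bs(1)
    by simp
qed

lemma hom_coinv: "\<lbrakk>l' \<in> orb; m \<in> part l'\<rbrakk> \<Longrightarrow> hom l' bs m \<in> M.coinv n"
  unfolding hom_def using keys_shift_c[of l' bs] bs by (intro M.em_coinv iv_c_part) auto

lemma part_0: "0 \<in> part l'"
  using V.subspace_0[OF part_subspace] .

lemma hom_0: "l' \<in> orb \<Longrightarrow> hom l' bs 0 = 0"
  using hom_add[OF _ part_0 part_0, of l'] by simp

lemma alph_add:
  assumes "m \<in> mcar N" "m' \<in> mcar N"
  shows "alph (m + m', bs) = alph (m, bs) + alph (m', bs)"
  unfolding alph_def prod.case gr_add[OF assms]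
  by (rule psum_add) (use assms gr_keys hom_0 hom_add lookup_part in blast)+

lemma alph_scale:
  assumes "m \<in> mcar N"
  shows "alph (mscale N a m, bs) = pscale (mscale N) a (alph (m, bs))"
proof -
  interpret P: vector_space "pscale (mscale N) :: 'k \<Rightarrow> ('g list \<Rightarrow>\<^sub>0 'm) \<Rightarrow> _" by (rule M.vsp)
  let ?K = "Poly_Mapping.keys (gr m)"
  have o: "l' \<in> orb" if "l' \<in> ?K" for l' using gr_keys[OF assms] that by auto
  have "psum (\<lambda>l'. hom l' bs) (pscale (mscale N) a (gr m)) =
      (\<Sum>l'\<in>?K. hom l' bs (Poly_Mapping.lookup (pscale (mscale N) a (gr m)) l'))"
    by (rule psum_superset[OF _ finite_keys keys_pscale[OF vsN]]) (rule hom_0[OF o])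
  also have "\<dots> = (\<Sum>l'\<in>?K. pscale (mscale N) a (hom l' bs (Poly_Mapping.lookup (gr m) l')))"
    by (rule sum.cong) (use hom_scale[OF o lookup_part[OF assms o]] in \<open>auto simp: lookup_pscale[OF vsN]\<close>)
  finally show ?thesis
    by (simp add: alph_def gr_scale[OF assms] psum_def P.scale_sum_right)
qed

lemma alph_part: "\<lbrakk>l' \<in> orb; m \<in> part l'\<rbrakk> \<Longrightarrow> alph (m, bs) = hom l' bs m"
  using psum_single[of "\<lambda>l'. hom l' bs" l' m] hom_0 by (simp add: alph_def part_def)

lemma alph_coinv: "m \<in> mcar N \<Longrightarrow> alph (m, bs) \<in> M.coinv n"
proof -
  interpret P: vector_space "pscale (mscale N) :: 'k \<Rightarrow> ('g list \<Rightarrow>\<^sub>0 'm) \<Rightarrow> _" by (rule M.vsp)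
  assume m: "m \<in> mcar N"
  show ?thesis
    unfolding alph_def prod.case psum_def
    by (intro P.subspace_sum[OF M.coinv_subspace] hom_coinv lookup_part m) (use gr_keys[OF m] in auto)
qed

end

lemma alph_cong: "(\<And>x. expand G x bs = expand G x bs') \<Longrightarrow> alph (m, bs) = alph (m, bs')"
  by (simp add: alph_def hom_def[abs_def])

lemma alph_update_add:
  assumes "i < length bs"
  shows "alph (m, bs[i := b + b']) = alph (m, bs[i := b]) + alph (m, bs[i := b'])"
  by (simp add: alph_def psum_def hom_def expand_update_add[OF assms] lin_ext_add M.em_def
      lin_ext_add[OF M.vsp] sum.distrib)

lemma alph_update_scale:
  assumes "i < length bs"
  shows "alph (m, bs[i := fscale a b]) = pscale (mscale N) a (alph (m, bs[i := b]))"
proof -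
  interpret P: vector_space "pscale (mscale N) :: 'k \<Rightarrow> ('g list \<Rightarrow>\<^sub>0 'm) \<Rightarrow> _" by (rule M.vsp)
  show ?thesis
    by (simp add: alph_def psum_def hom_def expand_update_scale[OF assms] lin_ext_scale M.em_def
        lin_ext_scale[OF M.vsp] P.scale_sum_right)
qed

text \<open>By \<open>gr_sum\<close> a vector is the sum of its homogeneous components, so additive
  maps are determined on these.\<close>

lemma parts_eqI:
  fixes F K :: "'m \<Rightarrow> 'w::ab_group_add"
  assumes F: "additive_on (mcar N) F" and K: "additive_on (mcar N) K" and m: "m \<in> mcar N"
    and eq: "\<And>l' m. \<lbrakk>l' \<in> orb; m \<in> part l'\<rbrakk> \<Longrightarrow> F m = K m"
  shows "F m = K m"
proof -
  have o: "l' \<in> orb" if "l' \<in> Poly_Mapping.keys (gr m)" for l' using gr_keys[OF m] that by auto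
  have *: "Poly_Mapping.lookup (gr m) l' \<in> mcar N" if "l' \<in> Poly_Mapping.keys (gr m)" for l'
    using gr_lookup[OF m o[OF that]] by simp
  have "J m = (\<Sum>l'\<in>Poly_Mapping.keys (gr m). J (Poly_Mapping.lookup (gr m) l'))"
    if J: "additive_on (mcar N) J" for J :: "'m \<Rightarrow> 'w"
  proof -
    have "J m = J (\<Sum>l'\<in>Poly_Mapping.keys (gr m). Poly_Mapping.lookup (gr m) l')"
      using gr_sum[OF m] by (simp add: psum_def)
    also have "\<dots> = (\<Sum>l'\<in>Poly_Mapping.keys (gr m). J (Poly_Mapping.lookup (gr m) l'))"
      by (rule additive_on_sum[OF J vsN mcar_sub]) (rule *)
    finally show ?thesis .
  qed
  note JF = this[OF F] and JK = this[OF K]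
  show ?thesis
    unfolding JF JK by (intro sum.cong refl eq[OF o lookup_part[OF m o]])
qed

lemma map_gmult_closed: "\<lbrakk>g \<in> Arr G; set bs \<subseteq> galg G\<rbrakk> \<Longrightarrow> set (map (\<lambda>b. gmult G b (single1 g)) bs) \<subseteq> galg G"
  using single_galg[of g 1] by (auto intro!: gmult_closed)

text \<open>Balancing over \<open>B\<close>, reduced to homogeneous \<open>m\<close> of degree
  \<open>l'\<close>. If \<open>g\<close> does not start at \<open>s(l')\<close>, both sides vanish.
  Otherwise \<open>g (c l')\<close> and \<open>c (adj g l')\<close> conjugate \<open>l\<close> to
  the same loop and differ by an element \<open>z\<close> of \<open>H\<close>, which
  \<open>em_shift\<close> carries over to the vector.\<close>

lemma alph_act:
  assumes bs: "length bs = Suc n" "set bs \<subseteq> galg G" and g: "g \<in> Arr G" and m: "m \<in> mcar N"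
  shows "alph (m, map (\<lambda>b. gmult G b (single1 g)) bs) = alph (arr_act g m, bs)"
proof (rule parts_eqI[OF _ _ m])
  let ?bs = "map (\<lambda>b. gmult G b (single1 g)) bs"
  have bs': "length ?bs = Suc n" "set ?bs \<subseteq> galg G"
    using map_gmult_closed[OF g bs(2)] bs by auto
  show "additive_on (mcar N) (\<lambda>m. alph (m, ?bs))"
    using alph_add[OF bs'] by (simp add: additive_on_def)
  show "additive_on (mcar N) (\<lambda>m. alph (arr_act g m, bs))"
    using alph_add[OF bs] act_add[OF g] act_closed[OF g] by (simp add: additive_on_def)
  fix l' m assume o: "l' \<in> orb" and m: "m \<in> part l'"
  show "alph (m, ?bs) = alph (arr_act g m, bs)"
  proof (cases "src G g = src G l'")
    case False
    have "arr_act g m = arr_act g (arr_act (src G l') m)"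
      by (simp add: part_src[OF m o])
    also have "\<dots> = 0"
      using False g part_mcar[OF m]
      by (intro act_zero) (simp_all add: src_Arr tgt_src orb_loop(1)[OF o])
    finally have "alph (arr_act g m, bs) = 0"
      by (simp add: alph_def gr_0)
    moreover have "expand G (src G l') ?bs = (0 :: 'g list \<Rightarrow>\<^sub>0 'k)"
      using False bs by (intro expand_act_other[OF g bs(2)]) auto
    then have "hom l' ?bs m = 0"
      by (simp add: hom_def M.em_def)
    ultimately show ?thesis
      by (simp add: alph_part[OF bs' o m])
  next
    case True
    let ?l = "adj g l'"
    note lo = orb_loop[OF o] and cA = c_Arr[OF o] and sc = src_c[OF o]
    have o': "?l \<in> orb" using orb_adj[OF o g True] .
    note lo' = orb_loop[OF o'] and cA' = c_Arr[OF o'] and sc' = src_c[OF o']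
    have sl: "src G ?l = tgt G g" "tgt G (c ?l) = tgt G g"
      using adj_Arr[OF g lo(1) True] lo lo'(3) by auto
    have tl: "src G g = tgt G (c l')" using True lo by simp
    define z where "z = cmp G (iv (c ?l)) (cmp G g (c l'))"
    have z: "z \<in> H"
    proof -
      have "adj z l = adj (iv (c ?l)) (adj (cmp G g (c l')) l)"
        unfolding z_def using g cA cA' sl tl sc l_Arr l_loop by (intro adj_cmp) (simp_all add: grpd)
      also have "adj (cmp G g (c l')) l = adj g (adj (c l') l)"
        using g cA tl sc l_Arr l_loop by (intro adj_cmp) simp_all
      also have "\<dots> = ?l" by (simp add: c_adj[OF o])
      finally show ?thesis
        using adj_iv_c[OF o'] g cA cA' sl tl sc by (simp add: H_def z_def grpd)
    qed
    have m1: "arr_act (iv (c l')) m \<in> part l" by (rule iv_c_part[OF m o])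
    let ?E = "expand G (tgt G g) bs :: 'g list \<Rightarrow>\<^sub>0 'k"
    have "hom l' ?bs m = M.em (lmaps (\<lambda>h. cmp G h (c l')) (lmaps (\<lambda>h. cmp G h g) ?E)) (arr_act (iv (c l')) m)"
      using expand_act[OF g bs(2)] True by (simp add: hom_def)
    also have "lmaps (\<lambda>h. cmp G h (c l')) (lmaps (\<lambda>h. cmp G h g) ?E) =
        ext (\<lambda>gs. single1 (M.shift z gs)) (lmaps (\<lambda>h. cmp G h (c ?l)) ?E)"
      unfolding ext_simps(4)
    proof (rule lin_ext_cong)
      fix gs assume "gs \<in> Poly_Mapping.keys ?E"
      then have "\<And>h. h \<in> set gs \<Longrightarrow> h \<in> Arr G \<and> src G h = tgt G g"
        using keys_expand[OF bs(2), of "tgt G g"] by auto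
      then have "cmp G (cmp G h g) (c l') = cmp G (cmp G h (c ?l)) z" if "h \<in> set gs" for h
        using that g cA cA' sl tl by (simp add: z_def cmp_assoc grpd iv_cancel')
      then show "lmaps (\<lambda>h. cmp G h (c l')) (single1 (map (\<lambda>h. cmp G h g) gs)) =
          ext (\<lambda>gs. single1 (M.shift z gs)) (single1 (map (\<lambda>h. cmp G h (c ?l)) gs) :: 'g list \<Rightarrow>\<^sub>0 'k)"
        by (simp add: M.shift_def comp_def cong: map_cong)
    qed
    also have "M.em \<dots> (arr_act (iv (c l')) m) =
        M.em (lmaps (\<lambda>h. cmp G h (c ?l)) ?E) (arr_act z (arr_act (iv (c l')) m))"
      using M.em_shift[OF _ m1 z] keys_shift_c[OF o' bs(2)] sl bs(1) by simp
    also have "arr_act z (arr_act (iv (c l')) m) = arr_act (cmp G z (iv (c l'))) m"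
      using z cA H_Arr[OF z] sc part_mcar[OF m] by (simp add: act_cmp grpd)
    also have "cmp G z (iv (c l')) = cmp G (iv (c ?l)) g"
      unfolding z_def using g cA cA' sl tl cmp_src[OF g] by (simp add: cmp_assoc grpd iv_right)
    also have "arr_act (cmp G (iv (c ?l)) g) m = arr_act (iv (c ?l)) (arr_act g m)"
      using g cA' sl part_mcar[OF m] by (intro act_cmp) (simp_all add: grpd)
    finally have "hom l' ?bs m = hom ?l bs (arr_act g m)"
      by (simp add: hom_def sl)
    then show ?thesis
      using alph_part[OF bs' o m] alph_part[OF bs o' act_part[OF m o g True]] by simp
  qed
qed

end

lemma typed_minus:
  assumes "vector_space sc" "module.subspace sc S" "x \<in> S" "y \<in> S"
  shows "x \<ominus>\<^bsub>typed_space sc S\<^esub> y = x - y"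
proof -
  interpret vector_space sc by fact
  interpret L: lspace "typed_space sc S" by (rule lspace_typed[OF assms(1,2)])
  show ?thesis
    using L.smult_minus_one[of y] assms(4) by (simp add: a_minus_def flip: L.smult_minus_one)
qed

section \<open>The kernel of \<open>al\<close> is the space of relations\<close>

context orbit_graded
begin

interpretation V: vector_space "mscale N" by (rule vsN)
interpretation P: vector_space "pscale (mscale N) :: 'k \<Rightarrow> ('g list \<Rightarrow>\<^sub>0 'm) \<Rightarrow> _" by (rule M.vsp)

abbreviation free :: "nat \<Rightarrow> ('k, 'g, 'm) tuples set"
  where "free n \<equiv> {t. Poly_Mapping.keys t \<subseteq> tuples G N n}"

abbreviation rel :: "nat \<Rightarrow> ('k, 'g, 'm) tuples set"
  where "rel \<equiv> Z_rel G N"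

lemma free_subspace: "fs.subspace (free n)"
  by (rule keys_in_subspace)

lemma rel_subspace: "fs.subspace (rel n)"
  by (simp add: Z_rel_def)

lemma al_add: "al (t + u) = al t + al u" and al_diff: "al (t - u) = al t - al u"
  and al_scale: "al (fscale a t) = pscale (mscale N) a (al t)" and al_single1: "al (single1 p) = alph p"
  and al_ext: "al (ext f t) = lin_ext (pscale (mscale N)) (\<lambda>p. al (f p)) t"
  by (simp_all add: al_def lin_ext_add[OF M.vsp] lin_ext_diff[OF M.vsp] lin_ext_scale[OF M.vsp] M.vsp
      lin_ext_comp[OF M.vsp])

lemma single1_free: "p \<in> tuples G N n \<Longrightarrow> single1 p \<in> free n"
  by simp

lemma nth_galg: "\<lbrakk>(m, bs) \<in> tuples G N n; i < n\<rbrakk> \<Longrightarrow> bs ! i \<in> galg G"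
  by (auto simp: tuples_def)

lemma rel_free: "rel n \<subseteq> free (Suc n)"
  unfolding Z_rel_def
proof (intro fs.span_minimal free_subspace Un_least)
  note sub = fs.subspace_diff[OF free_subspace] fs.subspace_scale[OF free_subspace]
  show "multilinear_rel G N (Suc n) \<subseteq> free (Suc n)"
    unfolding multilinear_rel_def
    by (intro Un_least subsetI; elim CollectE exE conjE; hypsubst; intro sub single1_free tuples_update galg_closed)
      (auto simp: tuples_def mcar_closed)
  show "balanced_rel G N (Suc n) \<subseteq> free (Suc n)"
    unfolding balanced_rel_def
    by (intro subsetI; elim CollectE exE conjE; hypsubst;
        intro sub single1_free tuples_update gmult_closed) (auto intro: nth_galg gbase_galg)
  show "{single1 (m, map (\<lambda>b. gmult G b (single1 g)) bs) - single1 (arr_act g m, bs) | m bs g.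
      (m, bs) \<in> tuples G N (Suc n) \<and> g \<in> Arr G} \<subseteq> free (Suc n)"
  proof (intro subsetI, elim CollectE exE conjE, hypsubst)
    fix m bs g assume t: "(m, bs) \<in> tuples G N (Suc n)" and g: "g \<in> Arr G"
    show "single1 (m, map (\<lambda>b. gmult G b (single1 g)) bs) - single1 (arr_act g m, bs) \<in> free (Suc n)"
      using tuplesD[OF t] map_gmult_closed[OF g, of bs] act_closed[OF g, of m]
      by (intro sub single1_free) (simp_all add: tuples_def)
  qed
qed

lemma rel_multilinear: "multilinear_rel G N (Suc n) \<subseteq> rel n"
  unfolding Z_rel_def
  by (rule order_trans[OF _ fs.span_superset], rule le_supI1, rule le_supI1, rule order_refl)

lemma rel_act:
  assumes "(m, bs) \<in> tuples G N (Suc n)" "g \<in> Arr G"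
  shows "single1 (m, map (\<lambda>b. gmult G b (single1 g)) bs) - single1 (arr_act g m, bs) \<in> rel n"
  unfolding Z_rel_def
  by (rule fs.span_base, rule UnI2, rule CollectI, intro exI conjI, rule refl, (rule assms)+)

lemma rel_add:
  assumes "(m, bs) \<in> tuples G N (Suc n)" "m' \<in> mcar N"
  shows "single1 (m + m', bs) - single1 (m, bs) - single1 (m', bs) \<in> rel n"
  by (rule subsetD[OF rel_multilinear], unfold multilinear_rel_def, rule UnI1, rule UnI1, rule UnI1,
      rule CollectI, intro exI conjI, rule refl, (rule assms)+)

lemma rel_scale:
  assumes "(m, bs) \<in> tuples G N (Suc n)"
  shows "single1 (mscale N a m, bs) - fscale a (single1 (m, bs)) \<in> rel n"
  by (rule subsetD[OF rel_multilinear], unfold multilinear_rel_def, rule UnI1, rule UnI1, rule UnI2,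
      rule CollectI, intro exI conjI, rule refl, rule assms)

lemma rel_update_add:
  assumes "(m, bs) \<in> tuples G N (Suc n)" "i < Suc n" "b \<in> galg G" "b' \<in> galg G"
  shows "single1 (m, bs[i := b + b']) - single1 (m, bs[i := b]) - single1 (m, bs[i := b']) \<in> rel n"
  by (rule subsetD[OF rel_multilinear], unfold multilinear_rel_def, rule UnI1, rule UnI2,
      rule CollectI, intro exI conjI, rule refl, (rule assms)+)

lemma rel_update_scale:
  assumes "(m, bs) \<in> tuples G N (Suc n)" "i < Suc n" "b \<in> galg G"
  shows "single1 (m, bs[i := fscale a b]) - fscale a (single1 (m, bs[i := b])) \<in> rel n"
  by (rule subsetD[OF rel_multilinear], unfold multilinear_rel_def, rule UnI2,
      rule CollectI, intro exI conjI, rule refl, (rule assms)+)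

text \<open>Each kind of relation has its counterpart: linearity of \<open>alph\<close>, the scaling
  \<open>expand_update_base\<close> that is independent of the position for balancing over
  \<open>R\<close>, and \<open>alph_act\<close> for balancing over \<open>B\<close>.\<close>

lemma al_rel:
  assumes "t \<in> rel n"
  shows "al t = 0"
proof -
  have "rel n \<subseteq> {t. al t = 0}"
    unfolding Z_rel_def
  proof (intro fs.span_minimal Un_least)
    show "fs.subspace {t. al t = 0}"
      by (auto simp: fs.subspace_def al_add al_scale) (simp add: al_def)
    show "multilinear_rel G N (Suc n) \<subseteq> {t. al t = 0}"
      unfolding multilinear_rel_def
      by (intro Un_least subsetI; elim CollectE exE conjE; hypsubst;
          drule tuplesD; elim conjE; intro CollectI)
        (simp_all only: al_diff al_scale al_single1 alph_add alph_scale alph_update_add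
          alph_update_scale, simp_all)
    show "balanced_rel G N (Suc n) \<subseteq> {t. al t = 0}"
      unfolding balanced_rel_def
    proof (intro subsetI, elim CollectE exE conjE, hypsubst, intro CollectI)
      fix m bs i and q :: "'g \<Rightarrow>\<^sub>0 'k"
      assume t: "(m, bs) \<in> tuples G N (Suc n)" and i: "Suc i < Suc n" and q: "q \<in> gbase G"
      have "alph (m, bs[i := gmult G (bs ! i) q]) = alph (m, bs[Suc i := gmult G (bs ! Suc i) q])"
        using tuplesD[OF t] i by (intro alph_cong) (simp add: expand_update_base[OF q nth_galg[OF t]])
      then show "al (single1 (m, bs[i := gmult G (bs ! i) q]) - single1 (m, bs[Suc i := gmult G (bs ! Suc i) q])) = 0"
        by (simp add: al_diff al_single1)
    qed
    show "{single1 (m, map (\<lambda>b. gmult G b (single1 g)) bs) - single1 (arr_act g m, bs) | m bs g.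
        (m, bs) \<in> tuples G N (Suc n) \<and> g \<in> Arr G} \<subseteq> {t. al t = 0}"
      using alph_act by (auto simp: al_diff al_single1 tuples_def)
  qed
  then show ?thesis using assms by blast
qed

lemma al_coinv: "t \<in> free (Suc n) \<Longrightarrow> al t \<in> M.coinv n"
  unfolding al_def
  by (rule lin_ext_subspace[OF M.vsp M.coinv_subspace]) (auto simp: tuples_def intro!: alph_coinv)

lemma list_tuples:
  assumes "gs \<in> M.lists_of (Suc n)" "m \<in> mcar N"
  shows "(m, map single1 gs) \<in> tuples G N (Suc n)"
  using assms single_galg[where c = "1::'k"] X_Arr by (auto simp: tuples_def M.lists_of_def)

lemma formal_sums_rel: "formal_sums (mscale N) (part l) (M.lists_of (Suc n)) (map single1) (rel n) (free (Suc n)) al"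
proof (rule formal_sums.intro)
  fix gs m m' a assume gs: "gs \<in> M.lists_of (Suc n)" and m: "m \<in> part l"
  note t = list_tuples[OF gs part_mcar[OF m]]
  show "single1 (mscale N a m, map single1 gs) - fscale a (single1 (m, map single1 gs)) \<in> rel n"
    by (rule rel_scale[OF t])
  assume "m' \<in> part l"
  then show "single1 (m + m', map single1 gs) - single1 (m, map single1 gs) - single1 (m', map single1 gs) \<in> rel n"
    by (intro rel_add[OF t] part_mcar)
next
  fix t assume "t \<in> free (Suc n)"
  from al_coinv[OF this] show "Poly_Mapping.keys (al t) \<subseteq> M.lists_of (Suc n) \<and>
      (\<forall>gs. Poly_Mapping.lookup (al t) gs \<in> part l)"
    using M.coinv_keys M.coinv_lookup by blast
qed (simp_all only: vsN part_subspace rel_subspace free_subspace rel_free al_add al_scale al_rel)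

abbreviation unexpand :: "('g list \<Rightarrow>\<^sub>0 'm) \<Rightarrow> ('k, 'g, 'm) tuples"
  where "unexpand \<equiv> formal_sums.unexpand (map single1)"

abbreviation reduced :: "nat \<Rightarrow> ('k, 'g, 'm) tuples set"
  where "reduced n \<equiv> formal_sums.reduced (map single1) (rel n) (free (Suc n)) al"

lemmas unexpand_def = formal_sums.unexpand_def[OF formal_sums_rel]
lemmas reduced_def = formal_sums.reduced_def[OF formal_sums_rel]
lemmas reduced_subspace = formal_sums.reduced_subspace[OF formal_sums_rel]
lemmas rel_reduced = formal_sums.R_reduced[OF formal_sums_rel]
lemmas reduced_mod = formal_sums.reduced_mod[OF formal_sums_rel]
lemmas reduced_mod' = formal_sums.reduced_mod'[OF formal_sums_rel]

lemma rel_zero: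
  assumes "length bs = Suc n" "set bs \<subseteq> galg G"
  shows "single1 (0, bs) \<in> rel n"
  using rel_scale[of 0 bs n 0] assms V.subspace_0[OF mcar_sub] by (simp add: tuples_def)

lemma map_gmult_single1:
  assumes "z \<in> Arr G" "\<And>g. g \<in> set gs \<Longrightarrow> src G g = tgt G z"
  shows "map (\<lambda>b. gmult G b (single1 z)) (map single1 gs) = map single1 (map (\<lambda>g. cmp G g z) gs)"
  using assms(2) by (simp add: gmult_single1)

text \<open>\<open>c l\<close> is the identity at \<open>s(l)\<close>, so the translation in
  \<open>hom\<close> has no effect.\<close>

lemma alph_normal:
  assumes gs: "gs \<in> M.lists_of (Suc n)" and m: "m \<in> part l"
  shows "alph (m, map single1 gs) = M.nu gs m"
proof -
  have g: "g \<in> Arr G" "src G g = src G l" if "g \<in> set gs" for g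
    using gs X_Arr that by (auto simp: M.lists_of_def)
  have "alph (m, map single1 gs) = hom l (map single1 gs) m"
    by (rule alph_part[OF _ _ orb_l m, of _ n])
      (use gs g single_galg[where c = "1::'k"] in \<open>auto simp: M.lists_of_def\<close>)
  also have "\<dots> = M.nu gs m"
  proof -
    have "expand G (src G l) (map single1 gs) = (single1 gs :: 'g list \<Rightarrow>\<^sub>0 'k)"
      by (rule expand_map_single1) (simp add: g)
    moreover have "map (\<lambda>g. cmp G g (src G l)) gs = gs"
      by (rule map_idI) (use g cmp_src in metis)
    ultimately show ?thesis
      using part_src[OF m orb_l] by (simp add: hom_def c_l iv_src[OF l_Arr] M.em_single1)
  qed
  finally show ?thesis .
qed

text \<open>Base case of the reduction. A list in \<open>X\<close> is its normal list translated by
  \<open>z = r (hd gs)\<close>, and the relation over \<open>B\<close> for the arrow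
  \<open>z\<close> moves \<open>z\<close> to the vector, in agreement with
  \<open>nu\<close>.\<close>

lemma reduced_normal:
  assumes gs: "gs \<in> M.lists_of (Suc n)" and m: "m \<in> part l"
  shows "single1 (m, map single1 gs) \<in> reduced n"
proof -
  let ?z = "r (hd gs)"
  let ?t = "single1 (arr_act ?z m, map single1 (M.nrm gs)) :: ('k, 'g, 'm) tuples"
  have z: "?z \<in> H" by (rule r_in_H[OF M.hd_X[OF gs]])
  have ns: "M.nrm gs \<in> M.lists_of (Suc n)" by (rule M.nrm_normal[OF gs])
  have zm: "arr_act ?z m \<in> mcar N" by (rule part_mcar[OF M.act_W[OF z m]])
  have eq: "map (\<lambda>b. gmult G b (single1 ?z)) (map single1 (M.nrm gs)) = map single1 (M.shift ?z (M.nrm gs))"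
    unfolding M.shift_def using ns H_tgt[OF z] H_Arr[OF z] X_Arr
    by (intro map_gmult_single1) (auto simp: M.lists_of_def)
  have 1: "single1 (m, map single1 gs) - ?t \<in> rel n"
    using rel_act[OF list_tuples[OF ns part_mcar[OF m]] H_Arr(1)[OF z]]
    unfolding eq M.nrm_unshift[OF gs] .
  have 2: "?t - unexpand (M.nu gs m) \<in> rel n"
    unfolding M.nu_def by (rule formal_sums.unexpand_single[OF formal_sums_rel ns M.act_W[OF z m]])
  have "single1 (m, map single1 gs) - unexpand (M.nu gs m) \<in> rel n"
    using fs.subspace_add[OF rel_subspace 1 2] by simp
  then show ?thesis
    using list_tuples[OF gs part_mcar[OF m]] by (simp add: reduced_def al_single1 alph_normal[OF gs m])
qed

text \<open>Writing \<open>m = c (c^-1 m)\<close> for the arrow \<open>c = c l'\<close> and reading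
  the relation over \<open>B\<close> backwards moves a vector of degree \<open>l'\<close> into
  degree \<open>l\<close>.\<close>

lemma reduced_part_list:
  assumes o: "l' \<in> orb" and m: "m \<in> part l'"
    and gs: "length gs = Suc n" "\<And>g. g \<in> set gs \<Longrightarrow> g \<in> Arr G \<and> src G g = src G l'"
  shows "single1 (m, map single1 gs) \<in> reduced n"
proof -
  let ?c = "c l'" and ?m = "arr_act (iv (c l')) m"
  note cA = c_Arr[OF o] and lo = orb_loop[OF o]
  have "arr_act ?c ?m = arr_act (cmp G ?c (iv ?c)) m"
    using cA part_mcar[OF m] by (intro act_cmp[symmetric]) (simp_all add: grpd)
  also have "\<dots> = m"
    using part_src[OF m o] lo by (simp add: iv_right[OF cA])
  finally have cm: "arr_act ?c ?m = m" .
  have p: "?m \<in> part l" by (rule iv_c_part[OF m o])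
  have t: "(?m, map single1 gs) \<in> tuples G N (Suc n)"
    using gs part_mcar[OF p] single_galg[where c = "1::'k"] by (auto simp: tuples_def)
  have eq: "map (\<lambda>b. gmult G b (single1 ?c)) (map single1 gs) = map single1 (map (\<lambda>g. cmp G g ?c) gs)"
    using gs(2) lo by (intro map_gmult_single1 cA) simp
  have "single1 (?m, map single1 (map (\<lambda>g. cmp G g ?c) gs)) - single1 (m, map single1 gs) \<in> rel n"
    using rel_act[OF t cA] unfolding eq cm .
  moreover have "single1 (?m, map single1 (map (\<lambda>g. cmp G g ?c) gs)) \<in> reduced n"
    by (rule reduced_normal[OF _ p], unfold M.lists_of_def)
      (use gs cA src_c[OF o] lo in \<open>auto simp: X_def grpd\<close>)
  ultimately show ?thesis by (rule reduced_mod')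
qed

text \<open>Entries are broken into arrows one position at a time; for one position the multilinear
  relations make the good entries a subspace.\<close>

lemma reduced_position:
  assumes t: "(m, bs) \<in> tuples G N (Suc n)" and i: "i < Suc n"
  shows "fs.subspace {b \<in> galg G. single1 (m, bs[i := b]) \<in> reduced n}"
  unfolding fs.subspace_def
proof (intro conjI ballI allI)
  have sc: "single1 (m, bs[i := fscale a b]) \<in> reduced n"
    if "b \<in> galg G" "fscale a (single1 (m, bs[i := b])) \<in> reduced n" for a b
    using reduced_mod[OF rel_update_scale[OF t i that(1)] that(2)] .
  have g0: "(0 :: 'g \<Rightarrow>\<^sub>0 'k) \<in> galg G"
    using fs.subspace_0[OF galg_subspace] .
  show "0 \<in> {b \<in> galg G. single1 (m, bs[i := b]) \<in> reduced n}"
    using sc[of 0 0] g0 fs.subspace_0[OF reduced_subspace] by simp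
  fix b assume b: "b \<in> {b \<in> galg G. single1 (m, bs[i := b]) \<in> reduced n}"
  show "fscale a b \<in> {b \<in> galg G. single1 (m, bs[i := b]) \<in> reduced n}" for a
    using b sc[of b a] fs.subspace_scale[OF reduced_subspace, of "single1 (m, bs[i := b])" n a] galg_closed
    by (simp del: fscale_single)
  fix b' assume b': "b' \<in> {b \<in> galg G. single1 (m, bs[i := b]) \<in> reduced n}"
  have "single1 (m, bs[i := b + b']) - (single1 (m, bs[i := b]) + single1 (m, bs[i := b'])) \<in> rel n"
    using rel_update_add[OF t i, of b b'] b b' by (simp add: diff_diff_eq)
  then have "single1 (m, bs[i := b + b']) \<in> reduced n"
    by (rule reduced_mod) (use b b' in \<open>auto intro!: fs.subspace_add[OF reduced_subspace]\<close>)
  then show "b + b' \<in> {b \<in> galg G. single1 (m, bs[i := b]) \<in> reduced n}"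
    using b b' galg_closed by simp
qed

text \<open>The entries in \<open>pre\<close> are already single arrows. Multiplication by the
  identity at \<open>s(l')\<close> discards all arrows with another source, so the recursion ends in
  lists covered by \<open>reduced_part_list\<close>.\<close>

lemma reduced_part_mult:
  assumes o: "l' \<in> orb" and m: "m \<in> part l'"
    and "set bs \<subseteq> galg G" "length pre + length bs = Suc n"
    and "\<And>g. g \<in> set pre \<Longrightarrow> g \<in> Arr G \<and> src G g = src G l'"
  shows "single1 (m, map single1 pre @ map (\<lambda>b. gmult G b (single1 (src G l'))) bs) \<in> reduced n"
  using assms(3-5)
proof (induction bs arbitrary: pre)
  case Nil
  then show ?case using reduced_part_list[OF o m, of pre n] by simp
next
  case (Cons b bs)
  let ?x = "src G l'"
  let ?rest = "map (\<lambda>b. gmult G b (single1 ?x)) bs"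
  \<comment> \<open>The 0 is a placeholder: updating position \<open>length pre\<close> inserts the
    entry under consideration, as \<open>u\<close> records.\<close>
  let ?bs = "map single1 pre @ 0 # ?rest"
  have x: "?x \<in> Arr G" "tgt G ?x = ?x" using orb_loop(1)[OF o] by (simp_all add: src_Arr tgt_src)
  have z0: "(0 :: 'g \<Rightarrow>\<^sub>0 'k) \<in> galg G"
    using fs.subspace_0[OF galg_subspace] .
  have t: "(m, ?bs) \<in> tuples G N (Suc n)"
    using Cons.prems part_mcar[OF m] map_gmult_closed[OF x(1), of bs] single_galg[where c = "1::'k"] z0
    by (auto simp: tuples_def)
  let ?S = "{b \<in> galg G. single1 (m, ?bs[length pre := b]) \<in> reduced n}"
  have u: "?bs[length pre := b] = map single1 pre @ b # ?rest" for b
    using list_update_length[of "map single1 pre" 0 ?rest b] by simp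
  have S: "fs.subspace ?S"
    using Cons.prems by (intro reduced_position[OF t]) simp
  have "gmult G b (single1 ?x) \<in> ?S"
    unfolding gmult_single1[of G b]
  proof (rule lin_ext_subspace[OF vs_fs S])
    fix g assume "g \<in> Poly_Mapping.keys b"
    then have g: "g \<in> Arr G" using Cons.prems by (auto simp: galg_def)
    show "(if src G g = tgt G ?x then single1 (cmp G g ?x) else 0) \<in> ?S"
    proof (cases "src G g = ?x")
      case True
      have "single1 (m, map single1 (pre @ [g]) @ ?rest) \<in> reduced n"
        by (rule Cons.IH) (use Cons.prems g True in auto)
      then show ?thesis
        using True x g cmp_src[OF g] single_galg[OF g, of 1] by (simp add: u)
    next
      case False
      then show ?thesis
        using fs.subspace_0[OF S] x by simp
    qed
  qed
  then show ?case by (simp add: u)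
qed

text \<open>For homogeneous \<open>m\<close> of degree \<open>l'\<close> the identity at
  \<open>s(l')\<close> fixes \<open>m\<close>, so the relation over \<open>B\<close> inserts this
  identity into every entry and \<open>reduced_part_mult\<close> applies. A general vector is the
  sum of its components.\<close>

lemma free_reduced:
  assumes t: "t \<in> free (Suc n)"
  shows "t \<in> reduced n"
proof -
  have part: "single1 (m, bs) \<in> reduced n"
    if o: "l' \<in> orb" and m: "m \<in> part l'" and bs: "length bs = Suc n" "set bs \<subseteq> galg G" for l' m bs
  proof (rule reduced_mod')
    show "single1 (m, map (\<lambda>b. gmult G b (single1 (src G l'))) bs) - single1 (m, bs) \<in> rel n"
      using rel_act[of m bs n "src G l'"] bs part_mcar[OF m] orb_loop(1)[OF o] part_src[OF m o]
      by (simp add: tuples_def src_Arr)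
    show "single1 (m, map (\<lambda>b. gmult G b (single1 (src G l'))) bs) \<in> reduced n"
      using reduced_part_mult[OF o m, of bs "[]"] bs by simp
  qed
  have "single1 p \<in> reduced n" if p: "p \<in> tuples G N (Suc n)" for p
  proof -
    obtain m bs where p': "p = (m, bs)" by (cases p)
    then have m: "m \<in> mcar N" and bs: "length bs = Suc n" "set bs \<subseteq> galg G"
      using p by (auto simp: tuples_def)
    let ?S = "{m \<in> mcar N. single1 (m, bs) \<in> reduced n}"
    have S: "V.subspace ?S"
      unfolding V.subspace_def
    proof (intro conjI ballI allI)
      show "0 \<in> ?S"
        using rel_zero[OF bs] rel_reduced V.subspace_0[OF mcar_sub] by auto
      fix m assume m: "m \<in> ?S"
      then have mt: "(m, bs) \<in> tuples G N (Suc n)" using bs by (simp add: tuples_def)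
      show "mscale N a m \<in> ?S" for a
        using reduced_mod[OF rel_scale[OF mt]] m fs.subspace_scale[OF reduced_subspace] mcar_closed
        by (simp del: fscale_single)
      fix m' assume m': "m' \<in> ?S"
      have "single1 (m + m', bs) - (single1 (m, bs) + single1 (m', bs)) \<in> rel n"
        using rel_add[OF mt, of m'] m' by (simp add: diff_diff_eq)
      then have "single1 (m + m', bs) \<in> reduced n"
        by (rule reduced_mod) (use m m' in \<open>auto intro!: fs.subspace_add[OF reduced_subspace]\<close>)
      then show "m + m' \<in> ?S"
        using m m' mcar_closed by simp
    qed
    have "psum (\<lambda>_ x. x) (gr m) \<in> ?S"
      unfolding psum_def
    proof (rule V.subspace_sum[OF S])
      fix l' assume "l' \<in> Poly_Mapping.keys (gr m)"
      then have o: "l' \<in> orb" using gr_keys[OF m] by auto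
      show "Poly_Mapping.lookup (gr m) l' \<in> ?S"
        using part[OF o lookup_part[OF m o] bs] part_mcar[OF lookup_part[OF m o]] by simp
    qed
    then show ?thesis
      by (simp add: gr_sum[OF m] p')
  qed
  then have "ext single1 t \<in> reduced n"
    using t by (intro lin_ext_subspace[OF vs_fs reduced_subspace]) auto
  then show ?thesis by (simp add: ext_single1)
qed

text \<open>If \<open>al t = 0\<close>, the normal form read off from it is 0, and \<open>t\<close>
  being reduced then says that \<open>t\<close> itself is a relation.\<close>

lemma al_eq_0_iff:
  assumes t: "t \<in> free (Suc n)"
  shows "al t = 0 \<longleftrightarrow> t \<in> rel n"
  using free_reduced[OF t] al_rel by (auto simp: reduced_def unexpand_def)

lemma al_unexpand:
  assumes \<phi>: "\<phi> \<in> M.coinv n"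
  shows "unexpand \<phi> \<in> free (Suc n)" and "al (unexpand \<phi>) = \<phi>"
proof -
  have k: "(Poly_Mapping.lookup \<phi> gs, map single1 gs) \<in> tuples G N (Suc n)"
    "alph (Poly_Mapping.lookup \<phi> gs, map single1 gs) = M.nu gs (Poly_Mapping.lookup \<phi> gs)"
    if "gs \<in> Poly_Mapping.keys \<phi>" for gs
    using M.coinv_keys[OF \<phi> that] M.coinv_lookup[OF \<phi>, of gs]
    by (auto intro!: list_tuples part_mcar alph_normal)
  show "unexpand \<phi> \<in> free (Suc n)"
    unfolding unexpand_def psum_def by (intro fs.subspace_sum[OF free_subspace] single1_free k)
  have "al (unexpand \<phi>) = (\<Sum>gs\<in>Poly_Mapping.keys \<phi>. M.nu gs (Poly_Mapping.lookup \<phi> gs))"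
    unfolding unexpand_def psum_def al_def lin_ext_sum[OF M.vsp]
    by (rule sum.cong) (simp_all add: M.vsp k)
  then show "al (unexpand \<phi>) = \<phi>"
    using M.coinv_expand[OF \<phi>] by simp
qed

end

section \<open>Faces and the cyclic operator under \<open>al\<close>\<close>

context orbit_graded
begin

interpretation V: vector_space "mscale N" by (rule vsN)
interpretation P: vector_space "pscale (mscale N) :: 'k \<Rightarrow> ('g list \<Rightarrow>\<^sub>0 'm) \<Rightarrow> _" by (rule M.vsp)

lemma alph_face:
  assumes t: "(m, bs) \<in> tuples G N (Suc (Suc n))" and k: "k \<le> Suc n"
  shows "alph (m, face_list G k bs) = M.fop k (alph (m, bs))"
proof -
  have m: "m \<in> mcar N" and bs: "length bs = Suc (Suc n)" "set bs \<subseteq> galg G"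
    using tuplesD[OF t] by auto
  let ?drop = "\<lambda>gs. single1 (dropnth k gs) :: 'g list \<Rightarrow>\<^sub>0 'k"
  have h: "hom l' (face_list G k bs) m' = M.fop k (hom l' bs m')" if o: "l' \<in> orb" and m': "m' \<in> part l'" for l' m'
  proof -
    have "lmaps (\<lambda>g. cmp G g (c l')) (expand G (src G l') (face_list G k bs)) =
        ext ?drop (lmaps (\<lambda>g. cmp G g (c l')) (expand G (src G l') bs))"
      using k bs by (simp add: expand_face[OF bs(2)] ext_simps(4) M.dropnth_map)
    then show ?thesis
      unfolding hom_def using M.op_em[OF M.natural_dropnth[OF k] _ iv_c_part[OF m' o]] keys_shift_c[OF o bs(2)] bs(1)
      by simp
  qed
  have o: "l' \<in> orb" if "l' \<in> Poly_Mapping.keys (gr m)" for l' using gr_keys[OF m] that by auto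
  have "M.fop k (alph (m, bs)) = (\<Sum>l'\<in>Poly_Mapping.keys (gr m). M.fop k (hom l' bs (Poly_Mapping.lookup (gr m) l')))"
    unfolding alph_def prod.case psum_def
    by (rule additive_on_sum[OF M.op_additive[OF M.natural_dropnth[OF k]] M.vsp M.coinv_subspace])
      (intro hom_coinv[OF bs] o lookup_part m)
  then show ?thesis
    by (simp add: alph_def psum_def h[OF o lookup_part[OF m o]])
qed

text \<open>Rotation by \<open>l'\<close> becomes rotation by \<open>l\<close> in the model because
  \<open>l' (c l') = (c l') l\<close>.\<close>

lemma alph_rot:
  assumes t: "(m, bs) \<in> tuples G N (Suc n)"
  shows "(\<Sum>l'\<in>Poly_Mapping.keys (gr m). alph (Poly_Mapping.lookup (gr m) l', gmult G (last bs) (single1 l') # butlast bs))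
    = M.op (\<lambda>gs. single1 (M.rot gs)) (alph (m, bs))"
proof -
  have m: "m \<in> mcar N" and bs: "length bs = Suc n" "set bs \<subseteq> galg G"
    using tuplesD[OF t] by auto
  have ne: "bs \<noteq> []" using bs by auto
  have lb: "last bs \<in> galg G" "set (butlast bs) \<subseteq> galg G"
    using bs(2) last_in_set[OF ne] by (auto dest: in_set_butlastD)
  let ?rot = "\<lambda>gs. single1 (M.rot gs) :: 'g list \<Rightarrow>\<^sub>0 'k"
  have h: "alph (m', gmult G (last bs) (single1 l') # butlast bs) = M.op ?rot (hom l' bs m')"
    if o: "l' \<in> orb" and m': "m' \<in> part l'" for l' m'
  proof -
    note lo = orb_loop[OF o] and cA = c_Arr[OF o]
    let ?E = "expand G (src G l') bs :: 'g list \<Rightarrow>\<^sub>0 'k"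
    have sw: "cmp G l' (c l') = cmp G (c l') l"
      using adj_swap[of "c l'" l] c_adj[OF o] cA src_c[OF o] l_Arr l_loop by simp
    have bs': "length (gmult G (last bs) (single1 l') # butlast bs) = Suc n"
      "set (gmult G (last bs) (single1 l') # butlast bs) \<subseteq> galg G"
      using bs lb gmult_closed[OF lb(1) single_galg[OF lo(1), of 1]] by auto
    have "lmaps (\<lambda>g. cmp G g (c l')) (expand G (src G l') (gmult G (last bs) (single1 l') # butlast bs)) =
        ext ?rot (lmaps (\<lambda>g. cmp G g (c l')) ?E)"
      unfolding expand_cyc[OF lo(1) trans[OF lo(2) lo(3)[symmetric]] bs(2) ne] ext_simps(4)
    proof (rule lin_ext_cong)
      fix gs assume "gs \<in> Poly_Mapping.keys ?E"
      then have gs: "length gs = Suc n" "\<And>g. g \<in> set gs \<Longrightarrow> g \<in> Arr G \<and> src G g = src G l'"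
        using keys_expand[OF bs(2), of "src G l'"] bs(1) by auto
      obtain hs a where hs: "gs = hs @ [a]" using gs(1) by (cases gs rule: rev_cases) auto
      have "cmp G (cmp G a l') (c l') = cmp G (cmp G a (c l')) l"
        using gs(2)[of a] hs lo cA src_c[OF o] l_Arr l_loop sw by (simp add: cmp_assoc)
      then show "lmaps (\<lambda>g. cmp G g (c l')) (single1 (cmp G (last gs) l' # butlast gs)) =
          ext ?rot (single1 (map (\<lambda>g. cmp G g (c l')) gs))"
        by (simp add: hs M.rot_def map_butlast[symmetric])
    qed
    then show ?thesis
      unfolding alph_part[OF bs' o m'] hom_def
      using M.op_em[OF M.natural_rot[of n] _ iv_c_part[OF m' o]] keys_shift_c[OF o bs(2)] bs(1) by simp
  qed
  have o: "l' \<in> orb" if "l' \<in> Poly_Mapping.keys (gr m)" for l' using gr_keys[OF m] that by auto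
  have "M.op ?rot (alph (m, bs)) = (\<Sum>l'\<in>Poly_Mapping.keys (gr m). M.op ?rot (hom l' bs (Poly_Mapping.lookup (gr m) l')))"
    unfolding alph_def prod.case psum_def
    by (rule additive_on_sum[OF M.op_additive[OF M.natural_rot[of n]] M.vsp M.coinv_subspace])
      (intro hom_coinv[OF bs] o lookup_part m)
  then show ?thesis
    by (simp add: h[OF o lookup_part[OF m o]])
qed

text \<open>All arrows in the first entry have source \<open>s(h)\<close>, so balancing with the
  identity at \<open>s(h)\<close> leaves the expansion unchanged and replaces \<open>m\<close> by
  \<open>s(h) m\<close>. This is the form required by \<open>psum_coact_parts\<close>.\<close>

lemma alph_src:
  assumes h: "h \<in> Arr G" and m: "m \<in> mcar N" and a: "a \<in> galg G" and bs: "set bs \<subseteq> galg G"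
  shows "alph (m, gmult G a (single1 h) # bs) = alph (arr_act (src G h) m, gmult G a (single1 h) # bs)"
proof -
  let ?bs = "gmult G a (single1 h) # bs"
  have c: "length ?bs = Suc (length bs)" "set ?bs \<subseteq> galg G"
    using bs gmult_closed[OF a single_galg[OF h, of 1]] by auto
  have "expand G x (map (\<lambda>b. gmult G b (single1 (src G h))) ?bs) = (expand G x ?bs :: 'g list \<Rightarrow>\<^sub>0 'k)" for x
  proof (cases "x = src G h")
    case True
    have "expand G x (map (\<lambda>b. gmult G b (single1 (src G h))) ?bs) =
        lmaps (\<lambda>g. cmp G g x) (expand G x ?bs :: 'g list \<Rightarrow>\<^sub>0 'k)"
      using expand_act[OF src_Arr[OF h] c(2)] by (simp only: True src_src[OF h] tgt_src[OF h])
    also have "\<dots> = ext single1 (expand G x ?bs)"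
    proof (rule lin_ext_cong)
      fix gs assume "gs \<in> Poly_Mapping.keys (expand G x ?bs :: 'g list \<Rightarrow>\<^sub>0 'k)"
      then have "\<And>g. g \<in> set gs \<Longrightarrow> g \<in> Arr G \<and> src G g = x"
        using keys_expand[OF c(2), of x] by auto
      then have "map (\<lambda>g. cmp G g x) gs = gs"
        using cmp_src by (intro map_idI) metis
      then show "single1 (map (\<lambda>g. cmp G g x) gs) = (single1 gs :: 'g list \<Rightarrow>\<^sub>0 'k)" by simp
    qed
    finally show ?thesis by (simp only: ext_single1)
  next
    case False
    then show ?thesis
      using expand_act_other[OF src_Arr[OF h] c(2), of x] expand_mult_other[OF a h, of x bs] src_src[OF h]
      by simp
  qed
  then have "alph (m, ?bs) = alph (m, map (\<lambda>b. gmult G b (single1 (src G h))) ?bs)"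
    by (intro alph_cong) simp
  also have "\<dots> = alph (arr_act (src G h) m, ?bs)"
    by (rule alph_act[OF c src_Arr[OF h] m])
  finally show ?thesis .
qed

text \<open>After applying \<open>al\<close>, the Sweedler sum in the cyclic operator depends on the
  coaction only through \<open>coact_parts\<close>, hence on the grading. The chosen representative
  drops out, and \<open>alph_rot\<close> evaluates what remains.\<close>

lemma al_cyc:
  assumes t: "(m, bs) \<in> tuples G N (Suc n)"
  shows "al (tuple_cyc G N (m, bs)) = M.op (\<lambda>gs. single1 (M.rot gs)) (alph (m, bs))"
    and "tuple_cyc G N (m, bs) \<in> free (Suc n)"
proof -
  have m: "m \<in> mcar N" and bs: "length bs = Suc n" "set bs \<subseteq> galg G"
    using tuplesD[OF t] by auto
  have ne: "bs \<noteq> []" using bs by auto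
  let ?a = "last bs" and ?rest = "butlast bs"
  have a: "?a \<in> galg G" and rest: "set ?rest \<subseteq> galg G"
    using bs(2) last_in_set[OF ne] by (auto dest: in_set_butlastD)
  let ?t = "SOME t. t \<in> coact N m"
  have tk: "Poly_Mapping.keys ?t \<subseteq> tuples G N 1" and tg: "coact_parts G N ?t = gr m"
    using coact_rep[OF m] by auto
  let ?f = "\<lambda>(m0, b0). single1 (m0, gmult G ?a (hd b0) # ?rest) :: ('k, 'g, 'm) tuples"
  let ?z = "\<lambda>h m'. alph (m', gmult G ?a (single1 h) # ?rest)"
  have cyc: "tuple_cyc G N (m, bs) = ext ?f ?t"
    by (simp add: tuple_cyc_def sweedler_def)
  have closed: "length (gmult G ?a b # ?rest) = Suc n \<and> set (gmult G ?a b # ?rest) \<subseteq> galg G" if "b \<in> galg G" for b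
    using gmult_closed[OF a that] rest bs by simp
  have hdg: "hd b0 \<in> galg G \<and> m0 \<in> mcar N" if "(m0, b0) \<in> tuples G N 1" for m0 b0
    using that by (cases b0) (auto simp: tuples_def)
  show "tuple_cyc G N (m, bs) \<in> free (Suc n)"
    unfolding cyc
  proof (rule lin_ext_subspace[OF vs_fs free_subspace])
    fix p assume p: "p \<in> Poly_Mapping.keys ?t"
    obtain m0 b0 where p': "p = (m0, b0)" by (cases p)
    have "(m0, b0) \<in> tuples G N 1" using p tk unfolding p' by blast
    then show "?f p \<in> free (Suc n)"
      using hdg[of m0 b0] closed[of "hd b0"] unfolding p' prod.case
      by (intro single1_free) (simp add: tuples_def)
  qed
  have zc: "length (gmult G ?a (single1 h) # ?rest) = Suc n" "set (gmult G ?a (single1 h) # ?rest) \<subseteq> galg G"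
    if "h \<in> Arr G" for h
    using closed[OF single_galg[OF that, of 1]] by auto
  \<comment> \<open>Linearity in \<open>b\<close> reduces to single arrows, where
    \<open>alph_src\<close> inserts the projection to the source.\<close>
  have pw: "al (?f (m0, [b])) = lin_ext (pscale (mscale N)) (\<lambda>h. ?z h (arr_act (src G h) m0)) b"
    if m0: "m0 \<in> mcar N" and b: "b \<in> galg G" for m0 b
  proof -
    have "al (?f (m0, [b])) = alph (m0, gmult G ?a (ext single1 b) # ?rest)"
      by (simp add: al_single1 ext_single1)
    also have "\<dots> = lin_ext (pscale (mscale N)) (\<lambda>h. alph (m0, gmult G ?a (single1 h) # ?rest)) b"
    proof (rule additive_lin_ext[where S = UNIV and sc = fscale and L = "\<lambda>b. alph (m0, gmult G ?a b # ?rest)"])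
      show "alph (m0, gmult G ?a (x + y) # ?rest) =
          alph (m0, gmult G ?a x # ?rest) + alph (m0, gmult G ?a y # ?rest)" for x y
        using alph_update_add[of 0 "0 # ?rest" m0 "gmult G ?a x" "gmult G ?a y"] by (simp add: gmult_add_right)
      show "alph (m0, gmult G ?a (fscale d x) # ?rest) = pscale (mscale N) d (alph (m0, gmult G ?a x # ?rest))" for d x
        using alph_update_scale[of 0 "0 # ?rest" m0 d "gmult G ?a x"] by (simp add: gmult_scale_right)
    qed (simp_all add: M.vsp)
    also have "\<dots> = lin_ext (pscale (mscale N)) (\<lambda>h. ?z h (arr_act (src G h) m0)) b"
      by (rule lin_ext_cong) (rule alph_src[OF galg_keys[OF b] m0 a rest])
    finally show ?thesis .
  qed
  have "al (tuple_cyc G N (m, bs)) = lin_ext (pscale (mscale N)) (\<lambda>p. al (?f p)) ?t"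
    unfolding cyc al_ext ..
  also have "\<dots> = psum ?z (coact_parts G N ?t)"
    by (rule psum_coact_parts(1)[OF M.vsp alph_add[OF zc] alph_scale[OF zc] tk pw])
  also have "coact_parts G N ?t = gr m" by (rule tg)
  finally show "al (tuple_cyc G N (m, bs)) = M.op (\<lambda>gs. single1 (M.rot gs)) (alph (m, bs))"
    using alph_rot[OF t] by (simp add: psum_def)
qed

section \<open>Passage to the quotient spaces\<close>

abbreviation cls :: "nat \<Rightarrow> ('k, 'g, 'm) tuples \<Rightarrow> ('k, 'g, 'm) tuples set"
  where "cls n t \<equiv> rel n +>\<^bsub>free_space (tuples G N (Suc n))\<^esub> t"

lemma quotient_rel: "quotient (free_space (tuples G N (Suc n))) (rel n)"
proof -
  have "lspace (free_space (tuples G N (Suc n)) :: ('k, ('k, 'g, 'm) tuples) module)"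
    unfolding free_space_typed by (rule lspace_typed[OF vs_fs free_subspace])
  moreover have "lsub (free_space (tuples G N (Suc n))) (rel n)"
    using rel_subspace[of n] rel_free[of n] by (auto simp: lsub_def free_space_typed fs.subspace_def)
  ultimately show ?thesis
    by (intro quotient.intro quotient_axioms.intro)
qed

lemma carrier_Z_deg: "carrier (Z_deg G N n) = cls n ` free (Suc n)"
  using quotient.quotient_carrier[OF quotient_rel, of n] by (simp add: Z_deg_def free_space_typed)

lemma lspace_Z_deg: "lspace (Z_deg G N n)"
  unfolding Z_deg_def by (rule quotient.lspace_quotient[OF quotient_rel])

lemma cls_eq_iff:
  assumes "t \<in> free (Suc n)" "u \<in> free (Suc n)"
  shows "cls n t = cls n u \<longleftrightarrow> t - u \<in> rel n"
  using quotient.cls_eq_iff[OF quotient_rel, of u n t] typed_minus[OF vs_fs free_subspace, of t "Suc n" u] assms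
  by (simp add: free_space_typed)

lemma in_cls_iff:
  assumes "t \<in> free (Suc n)"
  shows "u \<in> cls n t \<longleftrightarrow> u \<in> free (Suc n) \<and> u - t \<in> rel n"
proof -
  have "u \<in> free (Suc n)" if "u \<in> cls n t"
    using quotient.cls_carrier[OF quotient_rel, of t n u] that assms by (simp add: free_space_typed)
  then show ?thesis
    using quotient.in_cls_iff[OF quotient_rel, of t n u] typed_minus[OF vs_fs free_subspace, of u "Suc n" t] assms
    by (auto simp: free_space_typed)
qed

lemma cls_add:
  assumes "t \<in> free (Suc n)" "u \<in> free (Suc n)"
  shows "cls n t \<oplus>\<^bsub>Z_deg G N n\<^esub> cls n u = cls n (t + u)"
  using quotient.cls_add[OF quotient_rel, of t n u] assms by (simp add: Z_deg_def free_space_typed)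

lemma cls_smult:
  assumes "t \<in> free (Suc n)"
  shows "a \<odot>\<^bsub>Z_deg G N n\<^esub> cls n t = cls n (fscale a t)"
  using quotient.cls_smult[OF quotient_rel, of t n a] assms by (simp add: Z_deg_def free_space_typed)

text \<open>Any representative gives the same value, because \<open>al\<close> vanishes on
  relations.\<close>

definition zmap :: "nat \<Rightarrow> ('k, 'g, 'm) tuples set \<Rightarrow> ('g list \<Rightarrow>\<^sub>0 'm)"
  where "zmap n C = al (SOME t. t \<in> C)"

lemma zmap_cls:
  assumes t: "t \<in> free (Suc n)"
  shows "zmap n (cls n t) = al t"
proof -
  have "t \<in> cls n t"
    using t fs.subspace_0[OF rel_subspace] by (simp only: in_cls_iff[OF t]) simp
  then have "(SOME u. u \<in> cls n t) \<in> cls n t" by (rule someI)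
  then have "al ((SOME u. u \<in> cls n t) - t) = 0"
    using al_rel by (simp only: in_cls_iff[OF t]) blast
  then show ?thesis
    by (simp add: zmap_def al_diff)
qed

lemma zmap_bij: "bij_betw (zmap n) (carrier (Z_deg G N n)) (M.coinv n)"
proof (rule bij_betw_imageI)
  show "inj_on (zmap n) (carrier (Z_deg G N n))"
    unfolding carrier_Z_deg
  proof (rule inj_onI, elim imageE)
    fix C D t u assume C: "C = cls n t" "t \<in> free (Suc n)" and D: "D = cls n u" "u \<in> free (Suc n)"
      and eq: "zmap n C = zmap n D"
    have "al (t - u) = 0"
      using eq by (simp add: C(1) D(1) zmap_cls[OF C(2)] zmap_cls[OF D(2)] al_diff)
    then show "C = D"
      unfolding C(1) D(1) cls_eq_iff[OF C(2) D(2)]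
      using al_eq_0_iff[OF fs.subspace_diff[OF free_subspace C(2) D(2)]] by simp
  qed
  show "zmap n ` carrier (Z_deg G N n) = M.coinv n"
    unfolding carrier_Z_deg image_image
  proof (intro equalityI subsetI)
    fix \<phi> assume "\<phi> \<in> (\<lambda>t. zmap n (cls n t)) ` free (Suc n)"
    then show "\<phi> \<in> M.coinv n"
      using al_coinv by (elim imageE) (simp only: zmap_cls)
  next
    fix \<phi> assume "\<phi> \<in> M.coinv n"
    then show "\<phi> \<in> (\<lambda>t. zmap n (cls n t)) ` free (Suc n)"
      by (intro image_eqI[where x = "unexpand \<phi>"]) (simp_all only: zmap_cls al_unexpand)
  qed
qed

lemma lmap_zmap: "lmap (Z_deg G N n) (deg M.model n) (zmap n)"
proof (rule lmapI; unfold carrier_Z_deg; elim imageE; hypsubst)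
  fix t assume t: "t \<in> free (Suc n)"
  show "zmap n (cls n t) \<in> carrier (deg M.model n)"
    using al_coinv[OF t] by (simp add: zmap_cls[OF t])
  show "zmap n (a \<odot>\<^bsub>Z_deg G N n\<^esub> cls n t) = a \<odot>\<^bsub>deg M.model n\<^esub> zmap n (cls n t)" for a
    unfolding cls_smult[OF t] zmap_cls[OF t] zmap_cls[OF fs.subspace_scale[OF free_subspace t]]
    by (simp add: al_scale)
  fix u assume u: "u \<in> free (Suc n)"
  show "zmap n (cls n t \<oplus>\<^bsub>Z_deg G N n\<^esub> cls n u) = zmap n (cls n t) \<oplus>\<^bsub>deg M.model n\<^esub> zmap n (cls n u)"
    unfolding cls_add[OF t u] zmap_cls[OF t] zmap_cls[OF u] zmap_cls[OF fs.subspace_add[OF free_subspace t u]]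
    by (simp add: al_add)
qed

text \<open>No relation is checked for \<open>f\<close> itself. If \<open>u - t\<close> is a
  relation, then by \<open>af\<close> the images of \<open>u\<close> and \<open>t\<close> have the
  same value under \<open>al\<close>, and since the kernel of \<open>al\<close> is exactly the space
  of relations, they are congruent.\<close>

lemma Z_map_props:
  assumes f: "\<And>p. p \<in> tuples G N (Suc n) \<Longrightarrow> f p \<in> free (Suc k)"
    and af: "\<And>p. p \<in> tuples G N (Suc n) \<Longrightarrow> al (f p) = F (alph p)"
    and F: "additive_on (M.coinv n) F" "\<And>a \<phi>. \<phi> \<in> M.coinv n \<Longrightarrow> F (pscale (mscale N) a \<phi>) = pscale (mscale N) a (F \<phi>)"
  shows "lmap (Z_deg G N n) (Z_deg G N k) (Z_map G N k f)"
    and "C \<in> carrier (Z_deg G N n) \<Longrightarrow> zmap k (Z_map G N k f C) = F (zmap n C)"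
proof -
  have ef: "ext f t \<in> free (Suc k)" if "t \<in> free (Suc n)" for t
    by (rule lin_ext_subspace[OF vs_fs free_subspace]) (use that f in auto)
  have ael: "al (ext f t) = F (al t)" if t: "t \<in> free (Suc n)" for t
  proof -
    have "al (ext f t) = lin_ext (pscale (mscale N)) (\<lambda>p. F (alph p)) t"
      unfolding al_ext by (rule lin_ext_cong, rule af) (use t in auto)
    also have "\<dots> = F (al t)"
      unfolding al_def
    proof (rule additive_lin_ext[where S = "M.coinv n", symmetric, OF _ F(2) M.coinv_subspace M.vsp M.vsp])
      show "alph p \<in> M.coinv n" if "p \<in> Poly_Mapping.keys t" for p
        using al_coinv[of "single1 p" n] that t by (auto simp: al_single1)
    qed (use F(1) in \<open>auto simp: additive_on_def\<close>)
    finally show ?thesis .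
  qed
  have Z: "Z_map G N k f (cls n t) = cls k (ext f t)" if t: "t \<in> free (Suc n)" for t
  proof -
    have "cls k (ext f u) = cls k (ext f t)" if u: "u \<in> cls n t" for u
    proof -
      have u': "u \<in> free (Suc n)" "u - t \<in> rel n" using u unfolding in_cls_iff[OF t] by auto
      have "al u = al t" using al_rel[OF u'(2)] by (simp add: al_diff)
      then have "al (ext f u - ext f t) = 0"
        by (simp add: al_diff ael[OF u'(1)] ael[OF t])
      then show ?thesis
        unfolding cls_eq_iff[OF ef[OF u'(1)] ef[OF t]]
        using al_eq_0_iff[OF fs.subspace_diff[OF free_subspace ef[OF u'(1)] ef[OF t]]] by simp
    qed
    moreover have "t \<in> cls n t"
      using t fs.subspace_0[OF rel_subspace] by (simp only: in_cls_iff[OF t]) simp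
    ultimately show ?thesis
      unfolding Z_map_def by blast
  qed
  show "lmap (Z_deg G N n) (Z_deg G N k) (Z_map G N k f)"
  proof (rule lmapI; unfold carrier_Z_deg; elim imageE; hypsubst)
    fix t assume t: "t \<in> free (Suc n)"
    show "Z_map G N k f (cls n t) \<in> cls k ` free (Suc k)"
      unfolding Z[OF t] by (rule imageI[OF ef[OF t]])
    show "Z_map G N k f (a \<odot>\<^bsub>Z_deg G N n\<^esub> cls n t) = a \<odot>\<^bsub>Z_deg G N k\<^esub> Z_map G N k f (cls n t)" for a
      unfolding cls_smult[OF t] Z[OF t] cls_smult[OF ef[OF t]] Z[OF fs.subspace_scale[OF free_subspace t]]
        lin_ext_scale[OF vs_fs] ..
    fix u assume u: "u \<in> free (Suc n)"
    show "Z_map G N k f (cls n t \<oplus>\<^bsub>Z_deg G N n\<^esub> cls n u) =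
        Z_map G N k f (cls n t) \<oplus>\<^bsub>Z_deg G N k\<^esub> Z_map G N k f (cls n u)"
      unfolding cls_add[OF t u] Z[OF t] Z[OF u] cls_add[OF ef[OF t] ef[OF u]]
        Z[OF fs.subspace_add[OF free_subspace t u]] lin_ext_add[OF vs_fs] ..
  qed
  assume "C \<in> carrier (Z_deg G N n)"
  then obtain t where t: "C = cls n t" "t \<in> free (Suc n)" unfolding carrier_Z_deg by blast
  show "zmap k (Z_map G N k f C) = F (zmap n C)"
    unfolding t(1) Z[OF t(2)] zmap_cls[OF t(2)] zmap_cls[OF ef[OF t(2)]] by (rule ael[OF t(2)])
qed

lemma Z_face:
  assumes k: "k \<le> Suc n"
  shows "lmap (Z_deg G N (Suc n)) (Z_deg G N n) (Z_map G N n (tuple_face G k))"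
    and "C \<in> carrier (Z_deg G N (Suc n)) \<Longrightarrow>
      zmap n (Z_map G N n (tuple_face G k) C) = M.fop k (zmap (Suc n) C)"
proof -
  have 1: "tuple_face G k p \<in> free (Suc n)" and 2: "al (tuple_face G k p) = M.fop k (alph p)"
    if p: "p \<in> tuples G N (Suc (Suc n))" for p
  proof -
    obtain m bs where p': "p = (m, bs)" by (cases p)
    note t = p[unfolded p']
    show "tuple_face G k p \<in> free (Suc n)"
      using face_list_closed[of bs k] tuplesD[OF t] k by (simp add: p' tuple_face_eq tuples_def)
    show "al (tuple_face G k p) = M.fop k (alph p)"
      by (simp add: p' tuple_face_eq al_single1 alph_face[OF t k])
  qed
  note nat = M.natural_dropnth[OF k]
  note props = Z_map_props[OF 1 2 M.op_additive[OF nat] M.op_scale[OF nat]]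
  show "lmap (Z_deg G N (Suc n)) (Z_deg G N n) (Z_map G N n (tuple_face G k))"
    by (rule props(1))
  show "C \<in> carrier (Z_deg G N (Suc n)) \<Longrightarrow>
      zmap n (Z_map G N n (tuple_face G k) C) = M.fop k (zmap (Suc n) C)"
    by (rule props(2))
qed

lemma Z_cyc:
  shows "lmap (Z_deg G N n) (Z_deg G N n) (Z_map G N n (tuple_cyc G N))"
    and "C \<in> carrier (Z_deg G N n) \<Longrightarrow>
      zmap n (Z_map G N n (tuple_cyc G N) C) = M.op (\<lambda>gs. single1 (M.rot gs)) (zmap n C)"
proof -
  have 1: "tuple_cyc G N p \<in> free (Suc n)" and 2: "al (tuple_cyc G N p) = M.op (\<lambda>gs. single1 (M.rot gs)) (alph p)"
    if p: "p \<in> tuples G N (Suc n)" for p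
    using al_cyc p by (cases p, simp)+
  note props = Z_map_props[OF 1 2 M.op_additive[OF M.natural_rot[of n]] M.op_scale[OF M.natural_rot[of n]]]
  show "lmap (Z_deg G N n) (Z_deg G N n) (Z_map G N n (tuple_cyc G N))"
    by (rule props(1))
  show "C \<in> carrier (Z_deg G N n) \<Longrightarrow>
      zmap n (Z_map G N n (tuple_cyc G N) C) = M.op (\<lambda>gs. single1 (M.rot gs)) (zmap n C)"
    by (rule props(2))
qed

theorem cyclic_map_zmap: "cyclic_map (Z_module G N) M.model zmap"
proof (intro cyclic_map.intro cyclic_map_axioms.intro M.linear_cyclic_model)
  show "linear_cyclic (Z_module G N)"
    by (rule linear_cyclic.intro) (simp_all add: Z_module_def lspace_Z_deg Z_face(1) Z_cyc(1))
qed (simp_all add: Z_module_def lmap_zmap[simplified] Z_face(2) Z_cyc(2), simp_all add: M.model_def)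

end

section \<open>Inverting isomorphisms of cyclic modules\<close>

lemma (in cyclic_map) cyclic_map_inverse:
  assumes bij: "\<And>n. bij_betw (F n) (carrier (deg Z n)) (carrier (deg Z' n))"
  shows "cyclic_map Z' Z (\<lambda>n. inv_into (carrier (deg Z n)) (F n))"
proof -
  let ?I = "\<lambda>n. inv_into (carrier (deg Z n)) (F n)"
  have I: "?I n y \<in> carrier (deg Z n)" "F n (?I n y) = y" if "y \<in> carrier (deg Z' n)" for n y
    using bij[of n] that by (auto simp: bij_betw_def inv_into_into f_inv_into_f)
  have L: "?I n (F n x) = x" if "x \<in> carrier (deg Z n)" for n x
    using bij[of n] that by (auto simp: bij_betw_def)
  show ?thesis
  proof (intro cyclic_map.intro cyclic_map_axioms.intro)
    show "linear_cyclic Z'" "linear_cyclic Z" by unfold_locales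
    show "lmap (deg Z' n) (deg Z n) (?I n)" for n
      by (rule lmap_inv_into[OF lmap_F bij src.lspace_deg])
    fix n
    {
      fix k y assume k: "k \<le> Suc n" and y: "y \<in> carrier (deg Z' (Suc n))"
      have "?I n (face Z' (Suc n) k (F (Suc n) (?I (Suc n) y))) = face Z (Suc n) k (?I (Suc n) y)"
        unfolding F_face[OF k I(1)[OF y], symmetric] by (rule L[OF lmap_closed[OF src.lmap_face[OF k] I(1)[OF y]]])
      then show "?I n (face Z' (Suc n) k y) = face Z (Suc n) k (?I (Suc n) y)"
        by (simp only: I(2)[OF y])
    }
    fix y assume y: "y \<in> carrier (deg Z' n)"
    have "?I n (cyc Z' n (F n (?I n y))) = cyc Z n (?I n y)"
      unfolding F_cyc[OF I(1)[OF y], symmetric] by (rule L[OF lmap_closed[OF src.lmap_cyc I(1)[OF y]]])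
    then show "?I n (cyc Z' n y) = cyc Z n (?I n y)"
      by (simp only: I(2)[OF y])
  qed
qed

text \<open>The identities of the bicomplex are available for \<open>Z'\<close> only, here the
  model. The isomorphism is therefore inverted and used as a quasi-isomorphism with source
  \<open>Z'\<close> and zero kernel.\<close>

lemma cyclic_iso_homology:
  assumes Q: "cyclic_quasi_iso Z' Z'' F'" and F: "cyclic_map Z Z' F"
    and bij: "\<And>n. bij_betw (F n) (carrier (deg Z n)) (carrier (deg Z' n))"
  shows "lspace (HH Z' n) \<and> lin_iso (HH Z' n) (HH Z n)" "lspace (HC Z' n) \<and> lin_iso (HC Z' n) (HC Z n)"
proof -
  interpret Q: cyclic_quasi_iso Z' Z'' F' by (rule Q)
  interpret F: cyclic_map Z Z' F by (rule F)
  let ?I = "\<lambda>n. inv_into (carrier (deg Z n)) (F n)"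
  interpret I: cyclic_map Z' Z ?I by (rule F.cyclic_map_inverse[OF bij])
  interpret I: cyclic_quasi_iso Z' Z ?I
  proof (intro cyclic_quasi_iso.intro cyclic_quasi_iso_axioms.intro, goal_cases)
    case 1
    show ?case by unfold_locales
  next
    case (5 x n)
    then show ?case
      using bij[of n] F.lmap_F[of n] by (intro bexI[of _ "F n x"]) (auto simp: bij_betw_def lmap_def)
  next
    case (6 y q p)
    have "y = F q (?I q y)"
      using bij[of q] 6(1) by (simp add: bij_betw_def f_inv_into_f)
    also have "\<dots> = \<zero>\<^bsub>deg Z' q\<^esub>"
      unfolding 6(2) by (rule lmap_zero[OF F.lmap_F F.src.lspace_deg Q.src.lspace_deg])
    finally have y: "y = \<zero>\<^bsub>deg Z' q\<^esub>" .
    interpret L: lspace "deg Z' (Suc q)" by (rule Q.src.lspace_deg)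
    show ?case
      using lmap_zero[OF I.lmap_F Q.src.lspace_deg F.src.lspace_deg, of "Suc q"]
        lmap_zero[OF Q.src.lmap_vert Q.src.lspace_deg Q.src.lspace_deg, of p q] y
      by (intro bexI[of _ "\<zero>\<^bsub>deg Z' (Suc q)\<^esub>"]) simp_all
  qed (rule Q.vert_vert Q.hor_hor Q.vert_hor; assumption)+
  show "lspace (HH Z' n) \<and> lin_iso (HH Z' n) (HH Z n)" "lspace (HC Z' n) \<and> lin_iso (HC Z' n) (HC Z n)"
    by (rule I.HH_iso I.HC_iso)+
qed

section \<open>Detecting tensors over the base\<close>

locale arrow_comodule = arrow_module G N
  for G :: "'g groupoid" and N :: "('k::field, 'g, 'm::ab_group_add) ayd_data" +
  assumes ract_mcar: "\<lbrakk>m \<in> mcar N; q \<in> gbase G\<rbrakk> \<Longrightarrow> ract N m q \<in> mcar N"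
    and act_ract: "\<lbrakk>x \<in> Obj G; m \<in> mcar N; q \<in> gbase G\<rbrakk>
      \<Longrightarrow> lact N (single1 x) (ract N m q) = mscale N (Poly_Mapping.lookup q x) (lact N (single1 x) m)"
    and ract_act: "\<lbrakk>x \<in> Obj G; m \<in> mcar N\<rbrakk> \<Longrightarrow> ract N m (single1 x) = lact N (single1 x) m"
begin

interpretation V: vector_space "mscale N" by (rule vsN)
interpretation Q: vector_space "pscale (mscale N) :: 'k \<Rightarrow> ('g \<Rightarrow>\<^sub>0 'm) \<Rightarrow> _" by (rule vsp1)

abbreviation free1 :: "('k, 'g, 'm) tuples set"
  where "free1 \<equiv> {t. Poly_Mapping.keys t \<subseteq> tuples G N 1}"

lemma free1_subspace: "fs.subspace free1"
  by (rule keys_in_subspace)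

lemma pair_tuple: "(m, [b]) \<in> tuples G N 1 \<longleftrightarrow> m \<in> mcar N \<and> b \<in> galg G"
    "(m, [b]) \<in> tuples G N (Suc 0) \<longleftrightarrow> m \<in> mcar N \<and> b \<in> galg G"
  by (auto simp: tuples_def)

lemma coact_parts_single1_add:
  assumes "m \<in> mcar N" "m' \<in> mcar N" "b \<in> galg G"
  shows "coact_parts G N (single1 (m + m', [b])) = coact_parts G N (single1 (m, [b])) + coact_parts G N (single1 (m', [b]))"
  unfolding coact_parts_single1 lin_ext_fun_add[OF vsp1, symmetric]
  by (rule lin_ext_cong) (use assms galg_keys[OF assms(3)] in \<open>simp add: act_add src_Arr single_add\<close>)

lemma coact_parts_single1_scale:
  assumes "m \<in> mcar N" "b \<in> galg G"
  shows "coact_parts G N (single1 (mscale N a m, [b])) = pscale (mscale N) a (coact_parts G N (single1 (m, [b])))"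
  unfolding coact_parts_single1 lin_ext_fun_scale[OF vsp1, symmetric]
  by (rule lin_ext_cong) (use assms galg_keys[OF assms(2)] in \<open>simp add: act_scale src_Arr pscale_single[OF vsN]\<close>)

lemma coact_parts_ract:
  assumes m: "m \<in> mcar N" and b: "b \<in> galg G" and q: "q \<in> gbase G"
  shows "coact_parts G N (single1 (m, [gmult G b q])) =
      lin_ext (pscale (mscale N)) (\<lambda>g. Poly_Mapping.single g (mscale N (Poly_Mapping.lookup q (src G g)) (arr_act (src G g) m))) b"
    and "coact_parts G N (single1 (ract N m q, [b])) = coact_parts G N (single1 (m, [gmult G b q]))"
proof -
  show 1: "coact_parts G N (single1 (m, [gmult G b q])) =
      lin_ext (pscale (mscale N)) (\<lambda>g. Poly_Mapping.single g (mscale N (Poly_Mapping.lookup q (src G g)) (arr_act (src G g) m))) b"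
    by (simp add: coact_parts_single1 gmult_base[OF b q] lin_ext_comp[OF vsp1] vsp1 pscale_single[OF vsN])
  show "coact_parts G N (single1 (ract N m q, [b])) = coact_parts G N (single1 (m, [gmult G b q]))"
    unfolding 1 unfolding coact_parts_single1
    by (rule lin_ext_cong) (simp add: act_ract[OF src_closed[OF galg_keys[OF b]] m q])
qed

text \<open>With one factor \<open>B\<close> there is no balancing between adjacent factors, so
  these five kinds of generators are all.\<close>

lemma tensor_rel_span:
  assumes T: "fs.subspace T"
    and add: "\<And>m m' b. \<lbrakk>m \<in> mcar N; m' \<in> mcar N; b \<in> galg G\<rbrakk>
      \<Longrightarrow> single1 (m + m', [b]) - single1 (m, [b]) - single1 (m', [b]) \<in> T"
    and scale: "\<And>m a b. \<lbrakk>m \<in> mcar N; b \<in> galg G\<rbrakk> \<Longrightarrow> single1 (mscale N a m, [b]) - fscale a (single1 (m, [b])) \<in> T"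
    and add2: "\<And>m b b'. \<lbrakk>m \<in> mcar N; b \<in> galg G; b' \<in> galg G\<rbrakk>
      \<Longrightarrow> single1 (m, [b + b']) - single1 (m, [b]) - single1 (m, [b']) \<in> T"
    and scale2: "\<And>m a b. \<lbrakk>m \<in> mcar N; b \<in> galg G\<rbrakk> \<Longrightarrow> single1 (m, [fscale a b]) - fscale a (single1 (m, [b])) \<in> T"
    and ract: "\<And>m b q. \<lbrakk>m \<in> mcar N; b \<in> galg G; q \<in> gbase G\<rbrakk>
      \<Longrightarrow> single1 (ract N m q, [b]) - single1 (m, [gmult G b q]) \<in> T"
  shows "tensor_rel G N 1 \<subseteq> T"
proof -
  have pair: "\<exists>b. bs = [b] \<and> m \<in> mcar N \<and> b \<in> galg G" if "(m, bs) \<in> tuples G N 1" for m bs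
    using that tuples_1[of "(m, bs)"] by (metis prod.inject)
  show ?thesis
    unfolding tensor_rel_def
  proof (intro fs.span_minimal T Un_least)
    show "multilinear_rel G N 1 \<subseteq> T"
      unfolding multilinear_rel_def
      by (intro Un_least subsetI; elim CollectE exE conjE; hypsubst; drule pair; elim exE conjE; hypsubst)
        (simp_all only: less_one list_update_code add scale add2 scale2)
    show "balanced_rel G N 1 \<subseteq> T"
      by (auto simp: balanced_rel_def)
    show "{single1 (ract N m q, bs) - single1 (m, bs[0 := gmult G (bs ! 0) q]) | m bs q.
        (m, bs) \<in> tuples G N 1 \<and> 0 < (1::nat) \<and> q \<in> gbase G} \<subseteq> T"
      by (intro subsetI; elim CollectE exE conjE; hypsubst; drule pair; elim exE conjE; hypsubst)
        (simp only: list_update_code nth_Cons_0 ract)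
  qed
qed

lemma tensor_rel_free1: "tensor_rel G N 1 \<subseteq> free1"
  by (rule tensor_rel_span[OF free1_subspace]; intro fs.subspace_diff[OF free1_subspace] fs.subspace_scale[OF free1_subspace])
    (simp_all add: pair_tuple mcar_closed galg_closed ract_mcar gmult_closed gbase_galg)

lemma coact_parts_tensor_rel:
  assumes "t \<in> tensor_rel G N 1"
  shows "coact_parts G N t = 0"
proof -
  have "tensor_rel G N 1 \<subseteq> {t. coact_parts G N t = 0}"
  proof (rule tensor_rel_span)
    show "fs.subspace {t. coact_parts G N t = 0}"
      by (auto simp: fs.subspace_def coact_parts_add coact_parts_scale) (simp add: coact_parts_def)
  qed (simp_all add: coact_parts_diff coact_parts_scale coact_parts_single1_add coact_parts_single1_scale
      coact_parts_ract(2) del: fscale_single, simp_all add: coact_parts_single1 lin_ext_add[OF vsp1] lin_ext_scale[OF vsp1])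
  then show ?thesis using assms by blast
qed

lemma tensor_rel_subspace: "fs.subspace (tensor_rel G N 1)"
  by (simp add: tensor_rel_def)

lemma rel1_base:
  assumes "m \<in> mcar N" "b \<in> galg G"
  shows "m' \<in> mcar N \<Longrightarrow> single1 (m + m', [b]) - single1 (m, [b]) - single1 (m', [b]) \<in> tensor_rel G N 1"
    and "single1 (mscale N a m, [b]) - fscale a (single1 (m, [b])) \<in> tensor_rel G N 1"
    and "b' \<in> galg G \<Longrightarrow> single1 (m, [b + b']) - single1 (m, [b]) - single1 (m, [b']) \<in> tensor_rel G N 1"
    and "single1 (m, [fscale a b]) - fscale a (single1 (m, [b])) \<in> tensor_rel G N 1"
    and "q \<in> gbase G \<Longrightarrow> single1 (ract N m q, [b]) - single1 (m, [gmult G b q]) \<in> tensor_rel G N 1"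
proof -
  have t: "(m, [b]) \<in> tuples G N 1" using assms by (simp add: pair_tuple)
  note M = fs.span_base[OF UnI1[OF UnI1]]
  show "single1 (m + m', [b]) - single1 (m, [b]) - single1 (m', [b]) \<in> tensor_rel G N 1" if "m' \<in> mcar N"
    unfolding tensor_rel_def
    by (rule M, unfold multilinear_rel_def, rule UnI1, rule UnI1, rule UnI1, rule CollectI,
        intro exI conjI, rule refl, rule t, rule that)
  show "single1 (mscale N a m, [b]) - fscale a (single1 (m, [b])) \<in> tensor_rel G N 1"
    unfolding tensor_rel_def
    by (rule M, unfold multilinear_rel_def, rule UnI1, rule UnI1, rule UnI2, rule CollectI,
        intro exI conjI, rule refl, rule t)
  show "single1 (m, [b + b']) - single1 (m, [b]) - single1 (m, [b']) \<in> tensor_rel G N 1" if "b' \<in> galg G"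
    unfolding tensor_rel_def
    by (rule M, unfold multilinear_rel_def, rule UnI1, rule UnI2, rule CollectI,
        rule exI[of _ m], rule exI[of _ "[b]"], rule exI[of _ 0], rule exI[of _ b], rule exI[of _ b'])
      (use t that assms in simp)
  show "single1 (m, [fscale a b]) - fscale a (single1 (m, [b])) \<in> tensor_rel G N 1"
    unfolding tensor_rel_def
    by (rule M, unfold multilinear_rel_def, rule UnI2, rule CollectI,
        rule exI[of _ a], rule exI[of _ m], rule exI[of _ "[b]"], rule exI[of _ 0], rule exI[of _ b])
      (use t assms in simp)
  show "single1 (ract N m q, [b]) - single1 (m, [gmult G b q]) \<in> tensor_rel G N 1" if "q \<in> gbase G"
    unfolding tensor_rel_def
    by (rule fs.span_base[OF UnI2], rule CollectI, rule exI[of _ m], rule exI[of _ "[b]"], rule exI[of _ q])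
      (use t that in simp)
qed

lemma formal_sums_tensor:
  "formal_sums (mscale N) (mcar N) (Arr G) (\<lambda>g. [single1 g]) (tensor_rel G N 1) free1 (coact_parts G N)"
proof (rule formal_sums.intro)
  fix t assume "t \<in> free1"
  then have "coact_parts G N t \<in> arrow_parts"
    by (intro psum_coact_parts(2)[where z = "\<lambda>g. Poly_Mapping.single g" and sc' = "pscale (mscale N)"
          and F = "\<lambda>(m, bs). lin_ext (pscale (mscale N)) (\<lambda>g. Poly_Mapping.single g (arr_act (src G g) m)) (hd bs)"])
      (simp_all add: vsp1 single_add pscale_single[OF vsN])
  then show "Poly_Mapping.keys (coact_parts G N t) \<subseteq> Arr G \<and> (\<forall>g. Poly_Mapping.lookup (coact_parts G N t) g \<in> mcar N)"
    by (simp add: arrow_parts_def)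
qed (simp_all only: vsN mcar_sub tensor_rel_subspace free1_subspace tensor_rel_free1 coact_parts_add
    coact_parts_scale coact_parts_tensor_rel rel1_base single_galg)

text \<open>From \<open>g = g s(g)\<close> and balancing one gets
  \<open>m \<otimes> g = s(g) m \<otimes> g\<close>, and this is the normal form recorded by
  \<open>coact_parts\<close>. The second claim supplies a concrete representative of a tensor in
  terms of its parts.\<close>

lemma coact_parts_eq_0_iff:
  assumes t: "t \<in> free1"
  shows "coact_parts G N t = 0 \<longleftrightarrow> t \<in> tensor_rel G N 1"
    and "t - formal_sums.unexpand (\<lambda>g. [single1 g]) (coact_parts G N t) \<in> tensor_rel G N 1"
proof -
  interpret fsum: formal_sums "mscale N" "mcar N" "Arr G" "\<lambda>g. [single1 g]" "tensor_rel G N 1" free1 "coact_parts G N"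
    by (rule formal_sums_tensor)
  note sub = fsum.reduced_subspace
  have arrow: "single1 (m, [single1 g]) \<in> fsum.reduced" if m: "m \<in> mcar N" and g: "g \<in> Arr G" for m g
  proof -
    let ?m = "arr_act (src G g) m"
    have o: "src G g \<in> Obj G" "single1 (src G g) \<in> gbase G"
      using src_closed[OF g] by (simp_all add: gbase_def)
    have "gmult G (single1 g) (single1 (src G g)) = (single1 g :: 'g \<Rightarrow>\<^sub>0 'k)"
      using src_closed[OF g] by (simp add: gmult_single1 tgt_Obj cmp_src[OF g])
    then have 1: "single1 (?m, [single1 g]) - single1 (m, [single1 g]) \<in> tensor_rel G N 1"
      using rel1_base(5)[OF m single_galg[OF g] o(2), of 1] ract_act[OF o(1) m] by simp
    have 2: "single1 (?m, [single1 g]) - fsum.unexpand (Poly_Mapping.single g ?m) \<in> tensor_rel G N 1"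
      by (rule fsum.unexpand_single[OF g act_closed[OF src_Arr[OF g] m]])
    have "single1 (m, [single1 g]) - fsum.unexpand (Poly_Mapping.single g ?m) \<in> tensor_rel G N 1"
      using fs.subspace_diff[OF tensor_rel_subspace 2 1] by simp
    then show ?thesis
      unfolding fsum.reduced_def
      using m single_galg[OF g, of 1] by (simp add: pair_tuple coact_parts_single1 vsp1)
  qed
  have pairs: "single1 (m, [b]) \<in> fsum.reduced" if m: "m \<in> mcar N" and b: "b \<in> galg G" for m b
  proof -
    let ?S = "{b \<in> galg G. single1 (m, [b]) \<in> fsum.reduced}"
    have g0: "(0 :: 'g \<Rightarrow>\<^sub>0 'k) \<in> galg G"
      using fs.subspace_0[OF galg_subspace] .
    have "fs.subspace ?S"
      unfolding fs.subspace_def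
    proof (intro conjI ballI allI)
      show "0 \<in> ?S"
        using fsum.reduced_mod[OF rel1_base(4)[OF m g0, of 0]] fs.subspace_0[OF sub] g0 by simp
      fix x assume x: "x \<in> ?S"
      show "fscale a x \<in> ?S" for a
        using fsum.reduced_mod[OF rel1_base(4)[OF m, of x a]] x fs.subspace_scale[OF sub, of "single1 (m, [x])" a] galg_closed
        by (simp del: fscale_single)
      fix y assume y: "y \<in> ?S"
      have "single1 (m, [x + y]) - (single1 (m, [x]) + single1 (m, [y])) \<in> tensor_rel G N 1"
        using rel1_base(3)[OF m, of x y] x y by (simp add: diff_diff_eq)
      then have "single1 (m, [x + y]) \<in> fsum.reduced"
        by (rule fsum.reduced_mod) (use fs.subspace_add[OF sub] x y in blast)
      then show "x + y \<in> ?S" using x y galg_closed by simp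
    qed
    then have "ext single1 b \<in> ?S"
      by (rule lin_ext_subspace[OF vs_fs]) (use arrow[OF m] galg_keys[OF b] single_galg in auto)
    then show ?thesis by (simp add: ext_single1)
  qed
  have "ext single1 t \<in> fsum.reduced"
  proof (rule lin_ext_subspace[OF vs_fs sub])
    fix p assume "p \<in> Poly_Mapping.keys t"
    then obtain m b where p: "p = (m, [b])" "m \<in> mcar N" "b \<in> galg G"
      using t tuples_1 by blast
    show "single1 p \<in> fsum.reduced" unfolding p(1) by (rule pairs[OF p(2,3)])
  qed
  then have r: "t \<in> fsum.reduced" by (simp add: ext_single1)
  then show "t - fsum.unexpand (coact_parts G N t) \<in> tensor_rel G N 1"
    unfolding fsum.reduced_def by simp
  then show "coact_parts G N t = 0 \<longleftrightarrow> t \<in> tensor_rel G N 1"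
    using coact_parts_tensor_rel by (auto simp: fsum.unexpand_def)
qed

lemma quotient_tensor: "quotient (free_space (tuples G N 1)) (tensor_rel G N 1)"
proof -
  have "lspace (free_space (tuples G N 1) :: ('k, ('k, 'g, 'm) tuples) module)"
    unfolding free_space_typed by (rule lspace_typed[OF vs_fs free1_subspace])
  moreover have "lsub (free_space (tuples G N 1)) (tensor_rel G N 1)"
    using tensor_rel_subspace tensor_rel_free1 by (auto simp: lsub_def free_space_typed fs.subspace_def)
  ultimately show ?thesis
    by (intro quotient.intro quotient_axioms.intro)
qed

text \<open>Equality in \<open>N \<otimes>\<^sub>R B\<close> becomes equality of functions on
  arrows.\<close>

lemma in_tensor_class_iff:
  assumes t: "t \<in> free1"
  shows "u \<in> tensor_class G N 1 t \<longleftrightarrow> u \<in> free1 \<and> coact_parts G N u = coact_parts G N t"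
proof -
  have "u \<in> free1" if "u \<in> tensor_class G N 1 t"
    using quotient.cls_carrier[OF quotient_tensor, of t u] that t by (simp add: free_space_typed tensor_class_def)
  moreover have "u \<in> tensor_class G N 1 t \<longleftrightarrow> u - t \<in> tensor_rel G N 1" if "u \<in> free1"
    using quotient.in_cls_iff[OF quotient_tensor, of t u] typed_minus[OF vs_fs free1_subspace, of u t] t that
    by (simp add: free_space_typed tensor_class_def)
  moreover have "u - t \<in> tensor_rel G N 1 \<longleftrightarrow> coact_parts G N u = coact_parts G N t" if "u \<in> free1"
    using coact_parts_eq_0_iff(1)[OF fs.subspace_diff[OF free1_subspace that t]] by (simp add: coact_parts_diff)
  ultimately show ?thesis by blast
qed

lemma carrier_tensor: "C \<in> carrier (tensor G N 1) \<Longrightarrow> \<exists>t\<in>free1. C = tensor_class G N 1 t"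
  using quotient.quotient_carrier[OF quotient_tensor] by (auto simp: tensor_def tensor_class_def free_space_typed)

lemma tensor_class_add: "\<lbrakk>t \<in> free1; u \<in> free1\<rbrakk> \<Longrightarrow>
    tensor_class G N 1 t \<oplus>\<^bsub>tensor G N 1\<^esub> tensor_class G N 1 u = tensor_class G N 1 (t + u)"
  using quotient.cls_add[OF quotient_tensor, of t u] by (simp add: tensor_def tensor_class_def free_space_typed)

end

section \<open>The orbit module and the loop module\<close>

context groupoid
begin

lemma ginv_unique:
  assumes g: "g \<in> Arr G"
    and h: "h \<in> Arr G" "src G h = tgt G g" "tgt G h = src G g" "cmp G h g = src G g"
    and k: "k \<in> Arr G" "src G k = tgt G g" "tgt G k = src G g" "cmp G g k = tgt G g"
  shows "h = k"
proof -
  have "h = cmp G h (cmp G g k)"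
    using h k cmp_src[of h] by simp
  also have "\<dots> = cmp G (src G g) k"
    using cmp_assoc[of h g k] g h k by simp
  also have "\<dots> = k"
    using k tgt_cmp_id[of k] by simp
  finally show ?thesis .
qed

lemma groupoid_inv_ginv: "groupoid_inv G (ginv G)"
proof -
  have "ginv G g \<in> Arr G \<and> src G (ginv G g) = tgt G g \<and> tgt G (ginv G g) = src G g \<and>
      cmp G (ginv G g) g = src G g \<and> cmp G g (ginv G g) = tgt G g" if g: "g \<in> Arr G" for g
    unfolding ginv_def
  proof (rule theI')
    show "\<exists>!h. h \<in> Arr G \<and> src G h = tgt G g \<and> tgt G h = src G g \<and>
        cmp G h g = src G g \<and> cmp G g h = tgt G g"
      using inverse_ex[OF g] ginv_unique[OF g] by (metis (no_types, lifting))
  qed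
  then show ?thesis
    by unfold_locales simp_all
qed

end

lemma lookup_psum_single:
  assumes "\<And>g. f g 0 = 0"
  shows "Poly_Mapping.lookup (psum (\<lambda>g x. Poly_Mapping.single g (f g x)) \<phi>) g = f g (Poly_Mapping.lookup \<phi> g)"
proof -
  have "Poly_Mapping.lookup (psum (\<lambda>g x. Poly_Mapping.single g (f g x)) \<phi>) g =
      (\<Sum>h\<in>Poly_Mapping.keys \<phi>. if h = g then f h (Poly_Mapping.lookup \<phi> h) else 0)"
    unfolding psum_def lookup_sum by (rule sum.cong) (auto simp: lookup_single when_def)
  then show ?thesis
    by (simp add: sum.delta in_keys_iff assms)
qed

section \<open>The grading of \<open>M\<close> given by its coaction\<close>

locale orbit_setup = stable_anti_yetter_drinfeld G M
  for G :: "'g groupoid" and M :: "('k::field, 'g, 'm::ab_group_add) ayd_data" +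
  fixes l :: 'g
  assumes finite_Obj: "finite (Obj G)" and l: "l \<in> loops G"
begin

interpretation V: vector_space "mscale M" by (rule scale_vector_space)

sublocale groupoid_inv G "ginv G" by (rule groupoid_inv_ginv)

lemma l_Arr: "l \<in> Arr G" and l_loop: "tgt G l = src G l"
  using l by (auto simp: loops_def)

abbreviation mact :: "'g \<Rightarrow> 'm \<Rightarrow> 'm" where "mact g \<equiv> lact M (single1 g)"

lemma lact_0: "m \<in> mcar M \<Longrightarrow> lact M 0 m = 0"
  using lact_scale_left[of 0 m 0] fs.subspace_0[OF galg_subspace] by simp

lemma lact_single: "\<lbrakk>g \<in> Arr G; m \<in> mcar M\<rbrakk> \<Longrightarrow> lact M (Poly_Mapping.single g a) m = mscale M a (mact g m)"
  using lact_scale_left[OF single_galg[of g 1], of m a] by simp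

lemma lact_ext:
  assumes m: "m \<in> mcar M" and "\<And>g. g \<in> Poly_Mapping.keys b \<Longrightarrow> f g \<in> galg G"
  shows "lact M (ext f b) m = lin_ext (mscale M) (\<lambda>g. lact M (f g) m) b"
  by (rule additive_lin_ext[where S = "galg G" and L = "\<lambda>b. lact M b m", OF _ _ galg_subspace vs_fs scale_vector_space])
    (use assms in \<open>auto intro: lact_add_left lact_scale_left\<close>)

lemma mact_cmp:
  assumes "g \<in> Arr G" "h \<in> Arr G" "m \<in> mcar M"
  shows "src G g = tgt G h \<Longrightarrow> mact (cmp G g h) m = mact g (mact h m)"
    and "src G g \<noteq> tgt G h \<Longrightarrow> mact g (mact h m) = 0"
  using lact_mult[OF single_galg[of g 1] single_galg[of h 1], of m] assms
  by (simp_all add: gmult_single1 lact_0)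

sublocale A: arrow_comodule G M
proof (intro arrow_comodule.intro arrow_module.intro arrow_module_axioms.intro arrow_comodule_axioms.intro)
  show "groupoid G" by unfold_locales
  fix x m and q :: "'g \<Rightarrow>\<^sub>0 'k" assume x: "x \<in> Obj G" and m: "m \<in> mcar M" and q: "q \<in> gbase G"
  have xA: "x \<in> Arr G" using x Obj_subset by auto
  have "mact x (lact M q m) = lact M (gmult G (single1 x) q) m"
    by (rule lact_mult[symmetric, OF single_galg[OF xA] gbase_galg[OF q] m])
  also have "\<dots> = mscale M (Poly_Mapping.lookup q x) (mact x m)"
    using x xA m by (simp add: gmult_base[OF single_galg[OF xA] q] src_Obj lact_single[of x m "Poly_Mapping.lookup q x"])
  finally show "mact x (ract M m q) = mscale M (Poly_Mapping.lookup q x) (mact x m)"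
    by (simp add: ract_eq_lact[OF m q])
next
  fix x m assume "x \<in> Obj G" "m \<in> mcar M"
  then show "ract M m (single1 x) = mact x m"
    by (intro ract_eq_lact) (simp_all add: gbase_def)
qed (rule scale_vector_space mcar_subspace lact_closed[OF single_galg] lact_add_right[OF single_galg]
    lact_scale_right[OF single_galg] ract_closed; assumption)+

text \<open>If \<open>\<rho>(m)\<close> is the sum of the \<open>m_g \<otimes> g\<close> with
  \<open>s(g) m_g = m_g\<close>, this is the family of the \<open>m_g\<close>.
  \<open>component_iff\<close> identifies \<open>M_k\<close> with the vectors whose family is
  \<open>m\<close> at \<open>k\<close> and 0 elsewhere.\<close>

definition grade :: "'m \<Rightarrow> ('g \<Rightarrow>\<^sub>0 'm)"
  where "grade m = coact_parts G M (SOME t. t \<in> coact M m)"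

lemma some_coact:
  assumes m: "m \<in> mcar M"
  shows "(SOME t. t \<in> coact M m) \<in> A.free1" and "coact M m = tensor_class G M 1 (SOME t. t \<in> coact M m)"
proof -
  obtain t where t: "t \<in> A.free1" "coact M m = tensor_class G M 1 t"
    using A.carrier_tensor[OF coact_closed[OF m]] by blast
  define s where "s = (SOME t. t \<in> coact M m)"
  have "t \<in> coact M m" unfolding t(2) A.in_tensor_class_iff[OF t(1)] using t(1) by simp
  then have "s \<in> coact M m" unfolding s_def by (rule someI)
  then have s: "s \<in> A.free1" "coact_parts G M s = coact_parts G M t"
    unfolding t(2) A.in_tensor_class_iff[OF t(1)] by blast+
  show "(SOME t. t \<in> coact M m) \<in> A.free1" using s(1) unfolding s_def .
  have "coact M m = tensor_class G M 1 s"
    unfolding t(2) set_eq_iff A.in_tensor_class_iff[OF t(1)] A.in_tensor_class_iff[OF s(1)] s(2) by blast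
  then show "coact M m = tensor_class G M 1 (SOME t. t \<in> coact M m)" unfolding s_def .
qed

lemma in_coact_iff:
  assumes m: "m \<in> mcar M"
  shows "t \<in> coact M m \<longleftrightarrow> t \<in> A.free1 \<and> coact_parts G M t = grade m"
proof -
  let ?s = "SOME t. t \<in> coact M m"
  have "t \<in> coact M m \<longleftrightarrow> t \<in> tensor_class G M 1 ?s"
    using some_coact(2)[OF m] by simp
  then show ?thesis
    unfolding A.in_tensor_class_iff[OF some_coact(1)[OF m]] grade_def .
qed

lemma coact_eq_iff:
  assumes m: "m \<in> mcar M" and t: "t \<in> A.free1"
  shows "coact M m = tensor_class G M 1 t \<longleftrightarrow> grade m = coact_parts G M t"
proof
  assume "coact M m = tensor_class G M 1 t"
  then have "t \<in> coact M m" using A.in_tensor_class_iff[OF t, of t] t by simp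
  then show "grade m = coact_parts G M t" by (simp add: in_coact_iff[OF m])
next
  assume "grade m = coact_parts G M t"
  then show "coact M m = tensor_class G M 1 t"
    unfolding set_eq_iff in_coact_iff[OF m] A.in_tensor_class_iff[OF t] by simp
qed

lemma sweedler_grade:
  fixes z :: "'g \<Rightarrow> 'm \<Rightarrow> 'w::ab_group_add"
  assumes m: "m \<in> mcar M" and vs': "vector_space sc'"
    and add: "\<And>g x y. \<lbrakk>g \<in> Arr G; x \<in> mcar M; y \<in> mcar M\<rbrakk> \<Longrightarrow> z g (x + y) = z g x + z g y"
    and scale: "\<And>g x a. \<lbrakk>g \<in> Arr G; x \<in> mcar M\<rbrakk> \<Longrightarrow> z g (mscale M a x) = sc' a (z g x)"
    and F: "\<And>m b. \<lbrakk>m \<in> mcar M; b \<in> galg G\<rbrakk> \<Longrightarrow> F m b = lin_ext sc' (\<lambda>g. z g (mact (src G g) m)) b"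
  shows "sweedler M sc' F m = psum z (grade m)"
  unfolding sweedler_def grade_def
  by (rule A.psum_coact_parts(1)[where sc' = sc' and z = z, OF vs' add scale]) (use some_coact(1)[OF m] F in auto)

lemma mcar_0: "0 \<in> mcar M"
  by (rule V.subspace_0[OF mcar_subspace])

lemma mact_0: "g \<in> Arr G \<Longrightarrow> mact g 0 = 0"
  using A.act_add[of g 0 0] mcar_0 by simp

lemma mact_src: "\<lbrakk>g \<in> Arr G; m \<in> mcar M\<rbrakk> \<Longrightarrow> mact g (mact (src G g) m) = mact g m"
  using mact_cmp(1)[of g "src G g" m] by (simp add: src_Arr tgt_src cmp_src)

text \<open>\<open>coact_parts\<close> already projects with \<open>s(g)\<close>, and projecting
  twice is projecting once. Applied to the defining formula of \<open>coact_parts\<close>,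
  \<open>psum_coact_parts\<close> turns this into a statement on \<open>grade m\<close>.\<close>

lemma grade_src:
  assumes m: "m \<in> mcar M" and g: "g \<in> Arr G"
  shows "mact (src G g) (Poly_Mapping.lookup (grade m) g) = Poly_Mapping.lookup (grade m) g"
proof -
  \<comment> \<open>The guard makes \<open>?z\<close> send 0 to 0 also off the arrows, where the
    action is not controlled.\<close>
  let ?z = "\<lambda>g x. Poly_Mapping.single g (if g \<in> Arr G then mact (src G g) x else 0)"
  have "grade m = lin_ext (pscale (mscale M))
      (\<lambda>(m, bs). lin_ext (pscale (mscale M)) (\<lambda>g. Poly_Mapping.single g (mact (src G g) m)) (hd bs)) (SOME t. t \<in> coact M m)"
    by (simp add: grade_def coact_parts_def)
  also have "\<dots> = psum ?z (grade m)"
    unfolding grade_def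
  proof (rule A.psum_coact_parts(1)[OF A.vsp1])
    fix m and b :: "'g \<Rightarrow>\<^sub>0 'k" assume "m \<in> mcar M" and b: "b \<in> galg G"
    then show "(\<lambda>(m, bs). lin_ext (pscale (mscale M)) (\<lambda>g. Poly_Mapping.single g (mact (src G g) m)) (hd bs)) (m, [b]) =
        lin_ext (pscale (mscale M)) (\<lambda>g. ?z g (mact (src G g) m)) b"
      unfolding prod.case list.sel
      by (intro lin_ext_cong) (use A.galg_keys[OF b] mact_src[OF src_Arr] in \<open>simp add: src_src\<close>)
  qed (use some_coact(1)[OF m] in \<open>simp_all add: A.act_add A.act_scale src_Arr single_add pscale_single[OF scale_vector_space]\<close>)
  finally have "Poly_Mapping.lookup (grade m) g = Poly_Mapping.lookup (psum ?z (grade m)) g"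
    by (rule arg_cong)
  then show ?thesis
    using g by (subst (asm) lookup_psum_single) (simp_all add: mact_0 src_Arr)
qed

lemma grade_add:
  assumes "m \<in> mcar M" "m' \<in> mcar M"
  shows "grade (m + m') = grade m + grade m'"
proof -
  let ?s = "\<lambda>m. SOME t. t \<in> coact M m"
  have f: "?s m \<in> A.free1" "?s m' \<in> A.free1" using some_coact(1) assms by auto
  have "coact M (m + m') = tensor_class G M 1 (?s m + ?s m')"
    using coact_add[OF assms] A.tensor_class_add[OF f] some_coact(2)[OF assms(1)] some_coact(2)[OF assms(2)] by simp
  then have "grade (m + m') = coact_parts G M (?s m + ?s m')"
    using coact_eq_iff[OF A.mcar_closed(1)[OF assms] fs.subspace_add[OF A.free1_subspace f]] by simp
  then show ?thesis by (simp add: A.coact_parts_add grade_def)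
qed

text \<open>Common pattern of \<open>coact_ract\<close> and \<open>coact_lact\<close>, where a
  coaction is given by a Sweedler expression \<open>f m0 \<otimes> k b\<close>: its parts are
  computed from those of \<open>m\<close> through \<open>z\<close>.\<close>

lemma grade_ext:
  assumes m: "m \<in> mcar M" and m': "m' \<in> mcar M"
    and co: "coact M m' = tensor_class G M 1 (sweedler M fscale (\<lambda>m0 b. single1 (f m0, [k b])) m)"
    and fk: "\<And>m b. \<lbrakk>m \<in> mcar M; b \<in> galg G\<rbrakk> \<Longrightarrow> f m \<in> mcar M \<and> k b \<in> galg G"
    and add: "\<And>g x y. \<lbrakk>g \<in> Arr G; x \<in> mcar M; y \<in> mcar M\<rbrakk> \<Longrightarrow> z g (x + y) = z g x + z g y"
    and scale: "\<And>g x a. \<lbrakk>g \<in> Arr G; x \<in> mcar M\<rbrakk> \<Longrightarrow> z g (mscale M a x) = pscale (mscale M) a (z g x)"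
    and F: "\<And>m b. \<lbrakk>m \<in> mcar M; b \<in> galg G\<rbrakk> \<Longrightarrow> coact_parts G M (single1 (f m, [k b])) =
      lin_ext (pscale (mscale M)) (\<lambda>g. z g (mact (src G g) m)) b"
  shows "grade m' = psum z (grade m)"
proof -
  let ?f = "\<lambda>(m0, bs). single1 (f m0, [k (hd bs)])"
  let ?s = "SOME t. t \<in> coact M m"
  have "ext ?f ?s \<in> A.free1"
  proof (rule lin_ext_subspace[OF vs_fs A.free1_subspace])
    fix p assume "p \<in> Poly_Mapping.keys ?s"
    then obtain m0 b where p: "p = (m0, [b])" "m0 \<in> mcar M" "b \<in> galg G"
      using some_coact(1)[OF m] A.tuples_1 by blast
    then show "?f p \<in> A.free1"
      using fk[OF p(2,3)] by (simp add: A.pair_tuple)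
  qed
  then have "grade m' = coact_parts G M (ext ?f ?s)"
    using co unfolding sweedler_def by (rule iffD1[OF coact_eq_iff[OF m']])
  also have "\<dots> = lin_ext (pscale (mscale M)) (\<lambda>p. coact_parts G M (?f p)) ?s"
    unfolding coact_parts_def lin_ext_comp[OF A.vsp1] ..
  also have "\<dots> = psum z (grade m)"
    unfolding grade_def
    by (rule A.psum_coact_parts(1)[OF A.vsp1 add scale]) (use some_coact(1)[OF m] F in auto)
  finally show ?thesis .
qed

text \<open>Finiteness of the set of objects enters here: it gives the formal sum
  \<open>gunit G\<close> the coefficient 1 at every object.\<close>

lemma gmult_gunit: "b \<in> galg G \<Longrightarrow> gmult G b (gunit G) = b" and gunit_gbase: "gunit G \<in> gbase G"
  for b :: "'g \<Rightarrow>\<^sub>0 'k"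
proof -
  show u: "gunit G \<in> gbase G"
    unfolding gunit_def using keys_sum[of single1 "Obj G"] by (auto simp: gbase_def)
  assume b: "b \<in> galg G"
  have "ext (\<lambda>g. Poly_Mapping.single g (Poly_Mapping.lookup (gunit G) (src G g))) b = ext single1 b"
  proof (rule lin_ext_cong)
    fix g assume "g \<in> Poly_Mapping.keys b"
    then have "src G g \<in> Obj G" using A.galg_keys[OF b] src_closed by blast
    then have "Poly_Mapping.lookup (gunit G) (src G g) = (1 :: 'k)"
      using finite_Obj by (simp add: gunit_def lookup_sum lookup_single when_def)
    then show "Poly_Mapping.single g (Poly_Mapping.lookup (gunit G) (src G g)) = (single1 g :: 'g \<Rightarrow>\<^sub>0 'k)"
      by simp
  qed
  then show "gmult G b (gunit G) = b"
    by (simp add: gmult_base[OF b u] ext_single1)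
qed

text \<open>Compatibility of the coaction with scalars is drawn from its \<open>R\<close>-linearity,
  with \<open>a\<close> times the unit as base element.\<close>

lemma grade_scale:
  assumes m: "m \<in> mcar M"
  shows "grade (mscale M a m) = pscale (mscale M) a (grade m)"
proof -
  let ?q = "fscale a (gunit G) :: 'g \<Rightarrow>\<^sub>0 'k"
  let ?z = "\<lambda>g x. Poly_Mapping.single g (mscale M a x)"
  have q: "?q \<in> gbase G"
    using gunit_gbase keys_fscale[of a "gunit G"] by (auto simp: gbase_def)
  have e: "ract M m ?q = mscale M a m"
    by (simp add: ract_scale_right[OF m gunit_gbase] ract_unit[OF m])
  have "grade (mscale M a m) = psum ?z (grade m)"
  proof (rule grade_ext[OF m A.mcar_closed(2)[OF m] coact_ract[OF m q, unfolded e]])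
    fix m and b :: "'g \<Rightarrow>\<^sub>0 'k" assume m: "m \<in> mcar M" and b: "b \<in> galg G"
    have k: "gmult G b ?q = fscale a b" by (simp add: gmult_scale_right gmult_gunit[OF b])
    show "m \<in> mcar M \<and> gmult G b ?q \<in> galg G"
      using m b A.galg_closed by (simp add: k)
    show "coact_parts G M (single1 (m, [gmult G b ?q])) = lin_ext (pscale (mscale M)) (\<lambda>g. ?z g (mact (src G g) m)) b"
      unfolding k by (simp add: A.coact_parts_single1 lin_ext_scale[OF A.vsp1] lin_ext_fun_scale[OF A.vsp1, symmetric]
          pscale_single[OF scale_vector_space])
  qed (simp_all add: V.scale_right_distrib single_add pscale_single[OF scale_vector_space] mult.commute)
  then show ?thesis
    by (intro poly_mapping_eqI) (simp add: lookup_psum_single lookup_pscale[OF scale_vector_space])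
qed

text \<open>In \<open>h b h^-1\<close> only the loops at \<open>s(h)\<close> survive, and such a
  loop \<open>g\<close> becomes its conjugate \<open>adj h g\<close>; this is the function
  \<open>?z\<close>.\<close>

lemma grade_act:
  assumes h: "h \<in> Arr G" and m: "m \<in> mcar M" and gm: "grade m = Poly_Mapping.single k m"
    and k: "src G k = src G h" "tgt G k = src G h"
  shows "grade (mact h m) = Poly_Mapping.single (adj h k) (mact h m)"
proof -
  let ?z = "\<lambda>g x. if src G g = src G h \<and> tgt G g = src G h then Poly_Mapping.single (adj h g) (mact h x) else 0"
  have "grade (mact h m) = psum ?z (grade m)"
  proof (rule grade_ext[OF m A.act_closed[OF h m] coact_lact[OF h m]])
    fix m and b :: "'g \<Rightarrow>\<^sub>0 'k" assume m: "m \<in> mcar M" and b: "b \<in> galg G"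
    show "mact h m \<in> mcar M \<and> gmult G (gmult G (single1 h) b) (single1 (ginv G h)) \<in> galg G"
      by (intro conjI A.act_closed[OF h m] gmult_closed single_galg h b iv_closed)
    have "gmult G (gmult G (single1 h) b) (single1 (ginv G h)) =
        ext (\<lambda>g. if src G g = src G h \<and> tgt G g = src G h then single1 (adj h g) else 0) b"
      unfolding gmult_single1 gmult_def[of G "single1 h"] lin_ext_single1[OF vs_fs] ext_simps(4)
      by (rule lin_ext_cong) (use A.galg_keys[OF b] h in \<open>auto simp: src_cmp tgt_iv\<close>)
    then have "coact_parts G M (single1 (mact h m, [gmult G (gmult G (single1 h) b) (single1 (ginv G h))])) =
        lin_ext (pscale (mscale M)) (\<lambda>g. lin_ext (pscale (mscale M)) (\<lambda>g. Poly_Mapping.single g (mact (src G g) (mact h m)))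
          (if src G g = src G h \<and> tgt G g = src G h then single1 (adj h g) else 0)) b"
      by (simp add: A.coact_parts_single1 lin_ext_comp[OF A.vsp1])
    also have "\<dots> = lin_ext (pscale (mscale M)) (\<lambda>g. ?z g (mact (src G g) m)) b"
    proof (rule lin_ext_cong)
      fix g assume "g \<in> Poly_Mapping.keys b"
      then have g: "g \<in> Arr G" by (rule A.galg_keys[OF b])
      have t: "tgt G h \<in> Arr G" "src G (tgt G h) = tgt G h" "tgt G (tgt G h) = tgt G h"
        using tgt_closed[OF h] Obj_subset src_Obj tgt_Obj by auto
      have "mact (tgt G h) (mact h m) = mact h m"
        using mact_cmp(1)[OF t(1) h m] t tgt_cmp_id[OF h] by simp
      moreover have "mact h (mact (src G h) m) = mact h m"
        by (rule mact_src[OF h m])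
      ultimately show "lin_ext (pscale (mscale M)) (\<lambda>g. Poly_Mapping.single g (mact (src G g) (mact h m)))
          (if src G g = src G h \<and> tgt G g = src G h then single1 (adj h g) else 0) = ?z g (mact (src G g) m)"
        using adj_Arr[OF h g] by (simp add: A.vsp1 pscale_single[OF scale_vector_space])
    qed
    finally show "coact_parts G M (single1 (mact h m, [gmult G (gmult G (single1 h) b) (single1 (ginv G h))])) =
        lin_ext (pscale (mscale M)) (\<lambda>g. ?z g (mact (src G g) m)) b" .
  qed (use h in \<open>simp_all add: A.act_add A.act_scale single_add pscale_single[OF scale_vector_space] A.vsp1
      vector_space_scale_zero[OF A.vsp1]\<close>)
  also have "\<dots> = Poly_Mapping.single (adj h k) (mact h m)"
    unfolding gm using k mact_0[OF h] by (subst psum_single) simp_all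
  finally show ?thesis .
qed

text \<open>Counitality: \<open>\<epsilon>(g) = s(g)\<close>, and this projection is already part of
  \<open>coact_parts\<close>, so the Sweedler sum is the sum of the components.\<close>

lemma grade_sum:
  assumes m: "m \<in> mcar M"
  shows "psum (\<lambda>_ x. x) (grade m) = m"
proof -
  have "sweedler M (mscale M) (\<lambda>m0 b. ract M m0 (gcounit G b)) m = psum (\<lambda>_ x. x) (grade m)"
  proof (rule sweedler_grade[OF m scale_vector_space])
    fix m and b :: "'g \<Rightarrow>\<^sub>0 'k" assume m: "m \<in> mcar M" and b: "b \<in> galg G"
    have "ract M m (gcounit G b) = lact M (ext (\<lambda>g. single1 (src G g)) b) m"
      unfolding ract_eq_lact[OF m gcounit_gbase[OF b]] unfolding gcounit_def ..
    also have "\<dots> = lin_ext (mscale M) (\<lambda>g. mact (src G g) m) b"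
      by (rule lact_ext[OF m]) (rule single_galg[OF src_Arr[OF A.galg_keys[OF b]]])
    finally show "ract M m (gcounit G b) = lin_ext (mscale M) (\<lambda>g. mact (src G g) m) b" .
  qed simp_all
  then show ?thesis using counital[OF m] by simp
qed

text \<open>For \<open>\<rho>(m) = m \<otimes> k\<close> the stability condition reads
  \<open>k m = m\<close>.\<close>

lemma grade_stable:
  assumes m: "m \<in> mcar M" and gm: "grade m = Poly_Mapping.single k m" and k: "k \<in> Arr G"
  shows "mact k m = m"
proof -
  have "sweedler M (mscale M) (\<lambda>m0 b. lact M b m0) m = psum mact (grade m)"
  proof (rule sweedler_grade[OF m scale_vector_space])
    fix m and b :: "'g \<Rightarrow>\<^sub>0 'k" assume m: "m \<in> mcar M" and b: "b \<in> galg G"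
    have "lact M (ext single1 b) m = lin_ext (mscale M) (\<lambda>g. mact g m) b"
      by (rule lact_ext[OF m]) (rule single_galg[OF A.galg_keys[OF b]])
    also have "\<dots> = lin_ext (mscale M) (\<lambda>g. mact g (mact (src G g) m)) b"
      by (rule lin_ext_cong) (simp add: mact_src[OF A.galg_keys[OF b] m])
    finally show "lact M b m = lin_ext (mscale M) (\<lambda>g. mact g (mact (src G g) m)) b"
      by (simp add: ext_single1)
  qed (simp_all add: A.act_add A.act_scale)
  then show ?thesis
    using stable[OF m] mact_0[OF k] by (simp add: gm psum_single)
qed

text \<open>By \<open>coact_eq_iff\<close> the condition on the coaction says that the only part is
  \<open>s(k) m\<close> at \<open>k\<close>. The two descriptions match because
  \<open>s(k) m = m\<close>, which \<open>grade_src\<close> provides in the converse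
  direction.\<close>

lemma component_iff:
  assumes k: "k \<in> Arr G"
  shows "m \<in> component G M k \<longleftrightarrow> m \<in> mcar M \<and> grade m = Poly_Mapping.single k m"
proof -
  have x: "src G k \<in> Obj G" by (rule src_closed[OF k])
  have f: "single1 (m, [single1 k]) \<in> A.free1" if "m \<in> mcar M" for m
    using that single_galg[OF k, of 1] by (simp add: A.pair_tuple)
  have p: "coact_parts G M (single1 (m, [single1 k])) = Poly_Mapping.single k (mact (src G k) m)" for m
    by (simp add: A.coact_parts_single1 A.vsp1 pscale_single[OF scale_vector_space])
  show ?thesis
  proof
    assume "m \<in> component G M k"
    then have m: "m \<in> mcar M" "coact M m = tensor_class G M 1 (single1 (m, [single1 k]))" "mact (src G k) m = m"
      using A.ract_act[OF x] by (auto simp: component_def)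
    then show "m \<in> mcar M \<and> grade m = Poly_Mapping.single k m"
      using coact_eq_iff[OF m(1) f[OF m(1)]] p by simp
  next
    assume m: "m \<in> mcar M \<and> grade m = Poly_Mapping.single k m"
    then have s: "mact (src G k) m = m"
      using grade_src[OF _ k, of m] by simp
    then show "m \<in> component G M k"
      using m coact_eq_iff[OF _ f, of m] p A.ract_act[OF x] by (simp add: component_def)
  qed
qed

lemma component_subspace:
  assumes k: "k \<in> Arr G"
  shows "V.subspace (component G M k)"
proof -
  have z: "grade 0 = 0"
    using grade_add[OF mcar_0 mcar_0] by simp
  show ?thesis
    unfolding V.subspace_def
    using A.mcar_closed by (auto simp: component_iff[OF k] mcar_0 z grade_add grade_scale single_add pscale_single[OF scale_vector_space])
qed

section \<open>The orbit of \<open>l\<close> and the orbit module\<close>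

abbreviation orb :: "'g set" where "orb \<equiv> adj_orbit G l"

lemma orb_cases:
  assumes "k \<in> orb"
  obtains g where "g \<in> Arr G" "src G g = src G l" "k = adj g l"
  using assms by (auto simp: adj_orbit_def)

lemma orb_Arr:
  assumes "k \<in> orb"
  shows "k \<in> Arr G" "tgt G k = src G k"
  using orb_cases[OF assms] adj_Arr[OF _ l_Arr _ l_loop] by metis+

lemma l_orb: "l \<in> orb"
  using adj_src[OF l_Arr l_loop] src_Arr[OF l_Arr] src_src[OF l_Arr] by (force simp: adj_orbit_def)

lemma adj_orb:
  assumes k: "k \<in> orb" and g: "g \<in> Arr G" "src G g = src G k"
  shows "adj g k \<in> orb"
proof -
  obtain h where h: "h \<in> Arr G" "src G h = src G l" "k = adj h l" by (rule orb_cases[OF k])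
  have "src G g = tgt G h"
    using adj_Arr(2)[OF h(1) l_Arr h(2) l_loop] g h by simp
  then have "adj g k = adj (cmp G g h) l" "cmp G g h \<in> Arr G" "src G (cmp G g h) = src G l"
    using adj_cmp[OF g(1) h(1) l_Arr _ h(2) l_loop] g h by (simp_all add: cmp_closed src_cmp)
  then show ?thesis by (auto simp: adj_orbit_def)
qed

text \<open>The arrow for \<open>l\<close> itself is fixed as the identity. Then
  \<open>r z = z\<close> on the centralizer, so that \<open>r\<close> is a retraction and not merely
  an equivariant map.\<close>

definition conj_arr :: "'g \<Rightarrow> 'g"
  where "conj_arr k = (if k = l then src G l else SOME g. g \<in> Arr G \<and> src G g = src G l \<and> adj g l = k)"

lemma conj_arr: "k \<in> orb \<Longrightarrow> conj_arr k \<in> Arr G \<and> src G (conj_arr k) = src G l \<and> adj (conj_arr k) l = k"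
proof (cases "k = l")
  case True
  then show ?thesis
    using adj_src[OF l_Arr l_loop] src_Arr[OF l_Arr] src_src[OF l_Arr] by (simp add: conj_arr_def)
next
  case False
  assume "k \<in> orb"
  then have "\<exists>g. g \<in> Arr G \<and> src G g = src G l \<and> adj g l = k"
    by (auto elim: orb_cases)
  from someI_ex[OF this] show ?thesis
    using False by (simp add: conj_arr_def)
qed

abbreviation omod :: "('k, 'g, 'm) ayd_data" where "omod \<equiv> orbit_module G M l"

lemma omod_simps:
  "mcar omod = V.span (\<Union>k\<in>orb. component G M k)" "mscale omod = mscale M" "lact omod = lact M"
  "coact omod m = {t \<in> coact M m. Poly_Mapping.keys t \<subseteq> tuples G omod 1}"
  by (simp_all add: orbit_module_def restrict_module_def tuples_def)

lemma component_omod: "k \<in> orb \<Longrightarrow> component G M k \<subseteq> mcar omod"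
  unfolding omod_simps by (rule order_trans[OF _ V.span_superset]) auto

lemma omod_induct:
  assumes "V.subspace T" "\<And>k m. \<lbrakk>k \<in> orb; m \<in> component G M k\<rbrakk> \<Longrightarrow> m \<in> T"
  shows "mcar omod \<subseteq> T"
  unfolding omod_simps using assms by (intro V.span_minimal) auto

lemma omod_mcar: "mcar omod \<subseteq> mcar M"
  by (rule omod_induct[OF mcar_subspace]) (auto simp: component_def)

text \<open>Clear on each \<open>M_k\<close> with \<open>k\<close> in the orbit, where the grading
  has one entry, and inherited by the span since the conditions cut out a subspace.\<close>

lemma omod_grade:
  assumes "m \<in> mcar omod"
  shows "Poly_Mapping.keys (grade m) \<subseteq> orb" "k \<in> orb \<Longrightarrow> Poly_Mapping.lookup (grade m) k \<in> component G M k"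
proof -
  let ?T = "{m \<in> mcar M. Poly_Mapping.keys (grade m) \<subseteq> orb \<and>
    (\<forall>k\<in>orb. Poly_Mapping.lookup (grade m) k \<in> component G M k)}"
  note cs = component_subspace[OF orb_Arr(1)]
  have "mcar omod \<subseteq> ?T"
  proof (rule omod_induct)
    show "V.subspace ?T"
      unfolding V.subspace_def
    proof (intro conjI ballI allI)
      have "grade 0 = 0" using grade_add[OF mcar_0 mcar_0] by simp
      then show "0 \<in> ?T" using V.subspace_0[OF cs] by (simp add: mcar_0)
      fix x a assume x: "x \<in> ?T"
      show "mscale M a x \<in> ?T"
        using x keys_pscale[OF scale_vector_space, of a "grade x"] V.subspace_scale[OF cs]
        by (auto simp: grade_scale A.mcar_closed lookup_pscale[OF scale_vector_space])
      fix y assume y: "y \<in> ?T"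
      show "x + y \<in> ?T"
        using x y keys_add[of "grade x" "grade y"] V.subspace_add[OF cs]
        by (auto simp: grade_add A.mcar_closed lookup_add)
    qed
    fix k m assume k: "k \<in> orb" and m: "m \<in> component G M k"
    then show "m \<in> ?T"
      using V.subspace_0[OF cs] by (auto simp: component_iff[OF orb_Arr(1)[OF k]] lookup_single when_def)
  qed
  then show "Poly_Mapping.keys (grade m) \<subseteq> orb" "k \<in> orb \<Longrightarrow> Poly_Mapping.lookup (grade m) k \<in> component G M k"
    using assms by auto
qed

text \<open>For \<open>m\<close> in \<open>M_k\<close>, an arrow \<open>g\<close> starting at
  \<open>s(k)\<close> leads to the component of \<open>adj g k\<close>, again in the orbit; any
  other arrow annihilates \<open>m\<close>, because \<open>m = s(k) m\<close>.\<close>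

lemma omod_act:
  assumes g: "g \<in> Arr G" and m: "m \<in> mcar omod"
  shows "mact g m \<in> mcar omod"
proof -
  have S: "V.subspace (mcar omod)" by (simp add: omod_simps)
  have "mcar omod \<subseteq> {m \<in> mcar M. mact g m \<in> mcar omod}"
  proof (rule omod_induct)
    show "V.subspace {m \<in> mcar M. mact g m \<in> mcar omod}"
      unfolding V.subspace_def
      using V.subspace_add[OF S] V.subspace_scale[OF S] V.subspace_0[OF S] mact_0[OF g] A.mcar_closed
      by (auto simp: mcar_0 A.act_add[OF g] A.act_scale[OF g])
    fix k m assume k: "k \<in> orb" and m: "m \<in> component G M k"
    note kA = orb_Arr[OF k]
    have mm: "m \<in> mcar M" "grade m = Poly_Mapping.single k m" using m component_iff[OF kA(1)] by auto
    have "mact g m \<in> mcar omod"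
    proof (cases "src G g = src G k")
      case True
      have "grade (mact g m) = Poly_Mapping.single (adj g k) (mact g m)"
        using True kA by (intro grade_act[OF g mm]) simp_all
      then have "mact g m \<in> component G M (adj g k)"
        using component_iff[OF orb_Arr(1)[OF adj_orb[OF k g True]]] A.act_closed[OF g mm(1)] by simp
      then show ?thesis using component_omod[OF adj_orb[OF k g True]] by blast
    next
      case False
      have "mact (src G k) m = m" using grade_src[OF mm(1) kA(1)] by (simp add: mm(2))
      then have "mact g m = 0"
        using mact_cmp(2)[OF g src_Arr[OF kA(1)] mm(1)] False tgt_src[OF kA(1)] by simp
      then show ?thesis using V.subspace_0[OF S] by simp
    qed
    then show "m \<in> {m \<in> mcar M. mact g m \<in> mcar omod}" using mm by simp
  qed
  then show ?thesis using m by blast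
qed

end

context orbit_graded
begin

text \<open>Composite of the isomorphism with the model over \<open>X\<close> and the retraction to
  the model over \<open>H\<close>. Both directions are stated, since the module over the groupoid
  uses one and the module over the centralizer the other.\<close>

lemma homology_model:
  defines "model_H \<equiv> orbit_model.model (cmp G) iv (src G l) H r arr_act (part l) (mscale N) l"
  shows "lin_iso (HH (Z_module G N) n) (HH model_H n)" "lin_iso (HH model_H n) (HH (Z_module G N) n)"
    and "lin_iso (HC (Z_module G N) n) (HC model_H n)" "lin_iso (HC model_H n) (HC (Z_module G N) n)"
proof -
  have "bij_betw (zmap n) (carrier (deg (Z_module G N) n)) (carrier (deg M.model n))" for n
    using zmap_bij[of n] by (simp add: Z_module_def typed_space_def)
  note i = cyclic_iso_homology[OF M.model_quasi_iso cyclic_map_zmap this, of n]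
  note q = cyclic_quasi_iso.HH_iso[OF M.model_quasi_iso, folded model_H_def, of n]
    cyclic_quasi_iso.HC_iso[OF M.model_quasi_iso, folded model_H_def, of n]
  show "lin_iso (HH (Z_module G N) n) (HH model_H n)"
    using i(1) q(1) by (elim conjE) (rule lin_iso_trans[OF lin_iso_sym])
  show "lin_iso (HH model_H n) (HH (Z_module G N) n)"
    using i(1) q(1) by (elim conjE) (rule lin_iso_trans[OF lin_iso_sym])
  show "lin_iso (HC (Z_module G N) n) (HC model_H n)"
    using i(2) q(2) by (elim conjE) (rule lin_iso_trans[OF lin_iso_sym])
  show "lin_iso (HC model_H n) (HC (Z_module G N) n)"
    using i(2) q(2) by (elim conjE) (rule lin_iso_trans[OF lin_iso_sym])
qed

end

context orbit_setup
begin

interpretation V: vector_space "mscale M" by (rule scale_vector_space)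

lemma coact_parts_omod: "coact_parts G omod = coact_parts G M"
  by (simp add: coact_parts_def omod_simps(2,3) fun_eq_iff)

text \<open>The restricted coaction keeps only those representatives of \<open>\<rho>(m)\<close>
  whose vectors lie in the orbit module, so one must be exhibited. It is the normal form
  \<open>?t\<close>, the sum of the \<open>m_k \<otimes> k\<close>, with components in the orbit
  module by \<open>omod_grade\<close>.\<close>

lemma coact_omod:
  assumes m: "m \<in> mcar omod"
  shows "Poly_Mapping.keys (SOME t. t \<in> coact omod m) \<subseteq> tuples G omod 1 \<and>
    coact_parts G omod (SOME t. t \<in> coact omod m) = grade m"
proof -
  interpret fsum: formal_sums "mscale M" "mcar M" "Arr G" "\<lambda>g. [single1 g]" "tensor_rel G M 1" A.free1 "coact_parts G M"
    by (rule A.formal_sums_tensor)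
  have mM: "m \<in> mcar M" using m omod_mcar by blast
  let ?s = "SOME t. t \<in> coact M m" and ?t = "fsum.unexpand (grade m)"
  have "(\<Union>g\<in>Poly_Mapping.keys (grade m). Poly_Mapping.keys
      (single1 (Poly_Mapping.lookup (grade m) g, [single1 g :: 'g \<Rightarrow>\<^sub>0 'k]) :: ('k, 'g, 'm) tuples)) \<subseteq> tuples G omod 1"
  proof (intro UN_least)
    fix g assume "g \<in> Poly_Mapping.keys (grade m)"
    then have g: "g \<in> orb" using omod_grade(1)[OF m] by blast
    then show "Poly_Mapping.keys (single1 (Poly_Mapping.lookup (grade m) g, [single1 g :: 'g \<Rightarrow>\<^sub>0 'k]) :: ('k, 'g, 'm) tuples) \<subseteq> tuples G omod 1"
      using omod_grade(2)[OF m g] component_omod[OF g] single_galg[OF orb_Arr(1)[OF g], of "1::'k"]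
      by (auto simp: tuples_def)
  qed
  then have k: "Poly_Mapping.keys ?t \<subseteq> tuples G omod 1"
    unfolding fsum.unexpand_def psum_def by (rule order_trans[OF keys_sum])
  moreover have "tuples G omod 1 \<subseteq> tuples G M 1"
    using omod_mcar by (auto simp: tuples_def)
  ultimately have f: "?t \<in> A.free1" by auto
  have "?s - ?t \<in> tensor_rel G M 1"
    using A.coact_parts_eq_0_iff(2)[OF some_coact(1)[OF mM]] unfolding grade_def .
  then have "coact_parts G M (?s - ?t) = 0"
    by (rule A.coact_parts_tensor_rel)
  then have "coact_parts G M ?t = grade m"
    by (simp add: A.coact_parts_diff grade_def)
  then have "?t \<in> coact omod m"
    using k f by (simp only: omod_simps(4) in_coact_iff[OF mM] mem_Collect_eq)
  then have "(SOME t. t \<in> coact omod m) \<in> coact omod m"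
    by (rule someI)
  then show ?thesis
    unfolding coact_parts_omod by (simp only: omod_simps(4) in_coact_iff[OF mM] mem_Collect_eq)
qed

lemma omod_mcarD: "m \<in> mcar omod \<Longrightarrow> m \<in> mcar M"
  using omod_mcar by blast

lemma orbit_graded_omod: "orbit_graded G omod (ginv G) l conj_arr orb grade"
proof (intro orbit_graded.intro arrow_module.intro arrow_module_axioms.intro orbit_graded_axioms.intro)
  show "groupoid G" "groupoid_inv G (ginv G)" by unfold_locales
  show "vector_space (mscale omod)" "module.subspace (mscale omod) (mcar omod)"
    by (simp_all add: omod_simps scale_vector_space)
next
  fix m l' assume m: "m \<in> mcar omod" and l': "l' \<in> orb"
  have "Poly_Mapping.lookup (grade m) l' \<in> component G M l'" by (rule omod_grade(2)[OF m l'])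
  then show "Poly_Mapping.lookup (grade m) l' \<in> mcar omod \<and>
      grade (Poly_Mapping.lookup (grade m) l') = Poly_Mapping.single l' (Poly_Mapping.lookup (grade m) l') \<and>
      lact omod (single1 (src G l')) (Poly_Mapping.lookup (grade m) l') = Poly_Mapping.lookup (grade m) l'"
    using component_omod[OF l'] component_iff[OF orb_Arr(1)[OF l']] grade_src[OF omod_mcarD[OF m] orb_Arr(1)[OF l']]
    by (auto simp: omod_simps(3))
next
  fix m l' g
  assume "m \<in> mcar omod" "grade m = Poly_Mapping.single l' m" "l' \<in> orb" "g \<in> Arr G" "src G g = src G l'"
  then show "grade (lact omod (single1 g) m) = Poly_Mapping.single (adj g l') (lact omod (single1 g) m)"
    unfolding omod_simps(3) using orb_Arr[of l'] by (intro grade_act omod_mcarD) simp_all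
qed (simp_all only: omod_simps(2,3) omod_act A.act_add A.act_scale omod_mcarD mact_cmp l_Arr l_loop l_orb
    adj_orb conj_arr not_False_eq_True grade_add grade_scale omod_grade(1) grade_sum coact_omod[unfolded omod_simps(2,3)] grade_stable,
    simp_all add: conj_arr_def)

section \<open>The centralizer and the loop module\<close>

abbreviation cent :: "'g groupoid" where "cent \<equiv> centralizer G l"
abbreviation lmod :: "('k, 'g, 'm) ayd_data" where "lmod \<equiv> loop_module G M l"

lemma cent_simps: "Obj cent = {src G l}" "src cent = src G" "tgt cent = tgt G" "cmp cent = cmp G"
  "Arr cent = {g \<in> Arr G. src G g = src G l \<and> tgt G g = src G l \<and> adj g l = l}"
  by (auto simp: centralizer_def loops_def)

lemma lmod_simps: "mcar lmod = component G M l" "mscale lmod = mscale M" "lact lmod = lact M" "ract lmod = ract M"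
  "coact lmod m = tensor_class cent lmod 1 (single1 (m, [single1 l]))"
  by (simp_all add: loop_module_def tensor_class_def tensor_rel_def multilinear_rel_def balanced_rel_def tuples_def)

lemma src_l_cent: "src G l \<in> Arr cent"
  using src_Arr[OF l_Arr] src_src[OF l_Arr] tgt_src[OF l_Arr] adj_src[OF l_Arr l_loop] by (simp add: cent_simps)

lemma cent_cmp: "\<lbrakk>g \<in> Arr cent; h \<in> Arr cent\<rbrakk> \<Longrightarrow> cmp G g h \<in> Arr cent"
  using adj_cmp[of g h l] l_loop l_Arr by (simp add: cent_simps cmp_closed src_cmp tgt_cmp)

lemma cent_iv: "g \<in> Arr cent \<Longrightarrow> ginv G g \<in> Arr cent"
  using adj_iv[of g l] l_loop l_Arr by (simp add: cent_simps grpd)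

lemma l_cent: "l \<in> Arr cent"
  using l_Arr l_loop cmp_src[OF l_Arr] by (simp add: cent_simps cmp_assoc iv_closed tgt_iv iv_right)

lemma centD: "g \<in> Arr cent \<Longrightarrow> g \<in> Arr G" "g \<in> Arr cent \<Longrightarrow> src G g = src G l" "g \<in> Arr cent \<Longrightarrow> tgt G g = src G l"
    "g \<in> Arr cent \<Longrightarrow> adj g l = l"
  by (simp_all add: cent_simps)

lemma groupoid_cent: "groupoid cent"
proof (rule groupoid.intro, goal_cases)
  case (11 g)
  then show ?case by (simp only: cent_simps centD(1) tgt_cmp_id)
next
  case (12 g)
  then show ?case
    using cent_iv[OF 12] by (intro bexI[of _ "ginv G g"]) (simp_all add: cent_simps grpd iv_left iv_right)
qed (use src_l_cent src_src[OF l_Arr] tgt_src[OF l_Arr] cent_cmp in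
    \<open>simp_all add: cent_simps(1-4) centD src_cmp tgt_cmp cmp_assoc\<close>,
    use cmp_src centD in metis)

lemma groupoid_inv_cent: "groupoid_inv cent (ginv G)"
  by (intro groupoid_inv.intro groupoid_cent groupoid_inv_axioms.intro)
    (simp_all add: cent_iv cent_simps(2-4) centD grpd iv_left iv_right)

lemma component_l: "m \<in> component G M l \<longleftrightarrow> m \<in> mcar M \<and> grade m = Poly_Mapping.single l m"
  by (rule component_iff[OF l_Arr])

lemma component_src: "m \<in> component G M l \<Longrightarrow> mact (src G l) m = m"
  using grade_src[OF _ l_Arr, of m] by (simp add: component_l)

lemma component_act: "\<lbrakk>g \<in> Arr cent; m \<in> component G M l\<rbrakk> \<Longrightarrow> mact g m \<in> component G M l"
  using grade_act[of g m l] l_loop by (simp add: component_l A.act_closed centD)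

lemma component_mcar: "m \<in> component G M l \<Longrightarrow> m \<in> mcar M"
  by (simp add: component_l)

text \<open>The base of the centralizer is spanned by the single object \<open>s(l)\<close>, which
  acts on \<open>M_l\<close> as the identity.\<close>

lemma component_ract:
  assumes m: "m \<in> component G M l" and q: "q \<in> gbase cent"
  shows "ract M m q = mscale M (Poly_Mapping.lookup q (src G l)) m"
proof -
  have k: "Poly_Mapping.keys q \<subseteq> {src G l}" using q by (simp add: gbase_def cent_simps(1))
  have "q = Poly_Mapping.single (src G l) (Poly_Mapping.lookup q (src G l))"
    by (rule poly_mapping_eqI) (use k in \<open>auto simp: lookup_single when_def in_keys_iff\<close>)
  moreover have "q \<in> gbase G"
    using k src_closed[OF l_Arr] by (auto simp: gbase_def)
  then have "ract M m q = lact M q m"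
    by (rule ract_eq_lact[OF component_mcar[OF m]])
  ultimately have "ract M m q = lact M (Poly_Mapping.single (src G l) (Poly_Mapping.lookup q (src G l))) m"
    by (rule back_subst[of "\<lambda>q'. ract M m q = lact M q' m", rotated])
  also have "\<dots> = mscale M (Poly_Mapping.lookup q (src G l)) (mact (src G l) m)"
    by (rule lact_single[OF src_Arr[OF l_Arr] component_mcar[OF m]])
  finally show ?thesis
    unfolding component_src[OF m] .
qed

lemma arrow_comodule_lmod: "arrow_comodule cent lmod"
proof (intro arrow_comodule.intro arrow_module.intro arrow_module_axioms.intro arrow_comodule_axioms.intro groupoid_cent)
  show "vector_space (mscale lmod)" "module.subspace (mscale lmod) (mcar lmod)"
    by (simp_all add: lmod_simps(1,2) scale_vector_space component_subspace[OF l_Arr])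
next
  fix m and q :: "'g \<Rightarrow>\<^sub>0 'k" assume m: "m \<in> mcar lmod" and q: "q \<in> gbase cent"
  note mq = m[unfolded lmod_simps(1)] q
  show "ract lmod m q \<in> mcar lmod"
    unfolding lmod_simps component_ract[OF mq] by (rule V.subspace_scale[OF component_subspace[OF l_Arr] mq(1)])
  show "lact lmod (single1 x) (ract lmod m q) = mscale lmod (Poly_Mapping.lookup q x) (lact lmod (single1 x) m)"
    if "x \<in> Obj cent" for x
  proof -
    have x: "x = src G l" using that by (simp add: cent_simps(1))
    show ?thesis
      unfolding lmod_simps component_ract[OF mq] x
      by (rule A.act_scale[OF src_Arr[OF l_Arr] component_mcar[OF mq(1)]])
  qed
next
  fix x m assume "x \<in> Obj cent" "m \<in> mcar lmod"
  then show "ract lmod m (single1 x) = lact lmod (single1 x) m"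
    unfolding lmod_simps using A.ract_act[OF src_closed[OF l_Arr] component_mcar] by (simp add: cent_simps(1))
qed (simp_all add: lmod_simps(1-3) component_act A.act_add A.act_scale centD component_mcar)

text \<open>By \<open>in_tensor_class_iff\<close> every representative of the class of
  \<open>m \<otimes> l\<close> over the centralizer has the parts of \<open>m \<otimes> l\<close>,
  which are \<open>grade m\<close>. So the grading inherited from \<open>M\<close> is also the one
  belonging to the coaction of the loop module.\<close>

lemma coact_lmod:
  assumes m: "m \<in> component G M l"
  shows "Poly_Mapping.keys (SOME t. t \<in> coact lmod m) \<subseteq> tuples cent lmod 1 \<and>
    coact_parts cent lmod (SOME t. t \<in> coact lmod m) = grade m"
proof -
  interpret C: arrow_comodule cent lmod by (rule arrow_comodule_lmod)
  let ?t = "single1 (m, [single1 l]) :: ('k, 'g, 'm) tuples"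
  have t: "?t \<in> C.free1"
    using m C.single_galg[OF l_cent, of "1::'k"] by (simp add: C.pair_tuple lmod_simps(1))
  have p: "coact_parts cent lmod ?t = grade m"
    using component_src[OF m] m unfolding C.coact_parts_single1
    by (simp add: lin_ext_single1[OF A.vsp1] lmod_simps(2,3) cent_simps(2) component_l)
  have "?t \<in> coact lmod m"
    using t unfolding lmod_simps(5) C.in_tensor_class_iff[OF t] by blast
  then have "(SOME t. t \<in> coact lmod m) \<in> coact lmod m" by (rule someI)
  then show ?thesis
    unfolding lmod_simps(5) C.in_tensor_class_iff[OF t] p by simp
qed

lemma conj_arr_l: "conj_arr l = src G l"
  by (simp add: conj_arr_def)

text \<open>Under its centralizer \<open>l\<close> is conjugate to itself only, so the set of
  degrees is \<open>{l}\<close>. \<open>conj_arr\<close> and \<open>grade\<close> are taken over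
  unchanged, in order to meet the model of the orbit module literally.\<close>

lemma orbit_graded_lmod: "orbit_graded cent lmod (ginv G) l conj_arr {l} grade"
proof (intro orbit_graded.intro groupoid_inv_cent)
  show "arrow_module cent lmod"
    using arrow_comodule_lmod by (rule arrow_comodule.axioms(1))
  show "orbit_graded_axioms cent lmod (ginv G) l conj_arr {l} grade"
  proof (intro orbit_graded_axioms.intro, unfold cent_simps(2-4) lmod_simps(1-3) singleton_iff, goal_cases)
    case (1 g h m)
    then show ?case by (intro mact_cmp(1) centD(1) component_mcar)
  next
    case (2 g h)
    then show ?case using centD(2)[of g] centD(3)[of h] by simp
  next
    case (14 m l')
    then show ?case using component_src[of m] by (simp add: component_l)
  next
    case (16 m l' g)
    then have "grade m = Poly_Mapping.single l m" by simp
    moreover have "src G l = src G g" "tgt G l = src G g" using 16 l_loop by simp_all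
    ultimately show ?case using grade_act[of g m l] 16 by (simp add: centD(1) component_mcar)
  next
    case (17 m)
    then show ?case using coact_lmod[of m] by (simp only: lmod_simps(2,3))
  next
    case (18 m)
    then show ?case by (intro grade_stable[OF component_mcar _ l_Arr])
  next
    case (13 m)
    then show ?case by (simp add: component_l)
  qed (simp_all only: conj_arr_l src_l_cent l_cent l_loop centD(4) component_mcar
      src_src[OF l_Arr] adj_src[OF l_Arr l_loop] grade_add grade_scale grade_sum)
qed

text \<open>The ingredients \<open>H\<close>, \<open>r\<close> and \<open>part l\<close> agree for
  the two instances, so their comparisons meet in one model.\<close>

lemma homology_iso:
  "lin_iso (HH (Z_module G omod) n) (HH (Z_module cent lmod) n)"
  "lin_iso (HC (Z_module G omod) n) (HC (Z_module cent lmod) n)"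
proof -
  note B = orbit_graded_omod and S = orbit_graded_lmod
  note BD = orbit_graded.H_def[OF B] orbit_graded.r_def[OF B] orbit_graded.part_def[OF B]
  note SD = orbit_graded.H_def[OF S] orbit_graded.r_def[OF S] orbit_graded.part_def[OF S]
  \<comment> \<open>The centralizer also requires its arrows to end at \<open>s(l)\<close>, which
    \<open>H_tgt\<close> derives from centralizing \<open>l\<close>.\<close>
  have H: "orbit_graded.H cent (ginv G) l = orbit_graded.H G (ginv G) l"
    using orbit_graded.H_tgt[OF B] by (auto simp: BD(1) SD(1) cent_simps)
  have r: "orbit_graded.r cent (ginv G) l conj_arr = orbit_graded.r G (ginv G) l conj_arr"
    by (rule ext) (simp only: BD(2) SD(2) cent_simps(4))
  have part: "orbit_graded.part omod grade l = component G M l" "orbit_graded.part lmod grade l = component G M l"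
    unfolding BD(3) SD(3) using component_omod[OF l_orb] omod_mcar by (auto simp: component_l lmod_simps(1))
  note hB = orbit_graded.homology_model(1,3)[OF B, of n, unfolded part omod_simps(2,3)]
  note hS = orbit_graded.homology_model(2,4)[OF S, of n, unfolded H r part cent_simps(2-4) lmod_simps(2,3)]
  show "lin_iso (HH (Z_module G omod) n) (HH (Z_module cent lmod) n)"
    by (rule lin_iso_trans[OF hB(1) hS(1)])
  show "lin_iso (HC (Z_module G omod) n) (HC (Z_module cent lmod) n)"
    by (rule lin_iso_trans[OF hB(2) hS(2)])
qed

end

theorem theorem3p9:
  fixes G :: "'g groupoid"
    and M :: "('k::field, 'g, 'm::ab_group_add) ayd_data"
    and l :: 'g
  assumes "groupoid G" and "finite (Obj G)"
    and "stable_anti_yetter_drinfeld G M"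
    and "l \<in> loops G"
  shows "(\<forall>n. lin_iso (HH (Z_module G (orbit_module G M l)) n)
                     (HH (Z_module (centralizer G l) (loop_module G M l)) n)) \<and>
         (\<forall>n. lin_iso (HC (Z_module G (orbit_module G M l)) n)
                     (HC (Z_module (centralizer G l) (loop_module G M l)) n))"
proof -
  interpret orbit_setup G M l
    using assms by (intro orbit_setup.intro orbit_setup_axioms.intro)
  show ?thesis
    by (intro conjI allI homology_iso)
qed

end
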